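(* Let $\alpha\in(0,2)$, let $\Gamma$ be a $\vartheta$-admissible configuration on $\mathbb{R}^d$, $\Lambda\ge1$, and let $k:\mathbb{R}^d\times\mathbb{R}^d\to[0,\infty]$ be a measurable function with $k(x,y)=k(y,x)$ and $$\Lambda^{-1}\big(\mathbf 1_{V^\Gamma[x]}(y)+\mathbf 1_{V^\Gamma[y]}(x)\big)|x-y|^{-d-\alpha}\le k(x,y)\le \Lambda|x-y|^{-d-\alpha}$$ for all $x$ and $y$. Let $\Omega\subset\mathbb{R}^d$ be a bounded Lipschitz domain. Then $H_k(\Omega)=H^{\alpha/2}(\Omega)$. The seminorms $|\cdot|_{H_k(\Omega)}$ and $|\cdot|_{H^{\alpha/2}(\Omega)}$ and the corresponding norms are comparable on $H_k(\Omega)$. Moreover, the subspace $C^\infty(\overline\Omega)$ is dense in $H_k(\Omega)$. In addition, $H_k(\mathbb{R}^d)=H^{\alpha/2}(\mathbb{R}^d)$, and the seminorms $|\cdot|_{H_k(\mathbb{R}^d)}$ and $|\cdot|_{H^{\alpha/2}(\mathbb{R}^d)}$ and the corresponding norms are comparable on $H_k(\mathbb{R}^d)$. The subspace $C_c^\infty(\mathbb{R}^d)$ of smooth functions with compact support is dense in $H_k(\mathbb{R}^d)$.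
   Context: For $v\in\mathbb{S}^{d-1}$ and $\vartheta\in(0,\frac{\pi}{2}]$ the cone with symmetry axis $v$ and apex angle $\vartheta$ is $\widetilde V(v,\vartheta)=\{h\in\mathbb{R}^d : h\neq 0,\ \langle v,h\rangle/|h|>\cos\vartheta\}$ and the double cone is $V(v,\vartheta)=\widetilde V(v,\vartheta)\cup(-\widetilde V(v,\vartheta))$. Let $\mathcal V$ be the set of all double cones. A configuration is a map $\Gamma:\mathbb{R}^d\to\mathcal V$. It is $\vartheta$-bounded if the infimum $\vartheta$ of the apex angles of the double cones in $\Gamma(\mathbb{R}^d)$ is positive, and $\vartheta$-admissible if in addition $\{(x,y)\in\mathbb{R}^d\times\mathbb{R}^d : y-x\in\Gamma(x)\}$ is a Borel set. Put $V^\Gamma[x]=x+\Gamma(x)$. On the diagonal (a null set) use $0^{-d-\alpha}=+\infty$, $0\cdot\infty=0$. For a domain $\Omega\subset\mathbb{R}^d$ (or $\Omega=\mathbb{R}^d$) let $|f|_{H_k(\Omega)}^2=\int_{\Omega\times\Omega}(f(y)-f(x))^2k(x,y)\,d(x,y)$, $H_k(\Omega)=\{f\in L^2(\Omega): |f|_{H_k(\Omega)}<\infty\}$, with norm $\|f\|_{H_k(\Omega)}^2=\|f\|_{L^2(\Omega)}^2+|f|_{H_k(\Omega)}^2$. The space $H^{\alpha/2}(\Omega)$, its seminorm and its norm are defined in the same way with $k(x,y)$ replaced by $|x-y|^{-d-\alpha}$. Two seminorms $p,q$ are comparable on a space if there is $C\ge1$ with $C^{-1}p(f)\le q(f)\le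 Cp(f)$ for all $f$ in the space. $C^\infty(\overline\Omega)$ denotes functions smooth up to the boundary of $\Omega$. *)

theory Defs
  imports "HOL-Analysis.Analysis"
begin

section \<open>Double cones and configurations\<close>

definition cone_at :: "'a::euclidean_space \<Rightarrow> real \<Rightarrow> 'a set" where
  "cone_at v \<theta> = {h. h \<noteq> 0 \<and> (v \<bullet> h) / norm h > cos \<theta>}"

definition double_cone :: "'a::euclidean_space \<Rightarrow> real \<Rightarrow> 'a set" where
  "double_cone v \<theta> = cone_at v \<theta> \<union> uminus ` cone_at v \<theta>"

definition double_cones :: "'a::euclidean_space set set" where
  "double_cones = {double_cone v \<theta> | v \<theta>. norm v = 1 \<and> 0 < \<theta> \<and> \<theta> \<le> pi / 2}"

text \<open>If the dimension is at least 2, the apex angle is determined by the set (see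
  \<open>apex_angle_double_cone\<close> below) and the supremum ranges over a singleton. In dimension 1 every
  double cone is the punctured line, whatever the angle; the supremum then picks \<open>pi / 2\<close>.\<close>
definition apex_angle :: "'a::euclidean_space set \<Rightarrow> real" where
  "apex_angle C = Sup {\<theta>. 0 < \<theta> \<and> \<theta> \<le> pi / 2 \<and> (\<exists>v. norm v = 1 \<and> C = double_cone v \<theta>)}"

definition configuration :: "('a::euclidean_space \<Rightarrow> 'a set) \<Rightarrow> bool" where
  "configuration \<Gamma> \<longleftrightarrow> range \<Gamma> \<subseteq> double_cones"

definition bounded_configuration :: "real \<Rightarrow> ('a::euclidean_space \<Rightarrow> 'a set) \<Rightarrow> bool" where
  "bounded_configuration \<theta> \<Gamma> \<longleftrightarrow>
     configuration \<Gamma> \<and> \<theta> = Inf (apex_angle ` range \<Gamma>) \<and> 0 < \<theta>"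

definition admissible_configuration :: "real \<Rightarrow> ('a::euclidean_space \<Rightarrow> 'a set) \<Rightarrow> bool" where
  "admissible_configuration \<theta> \<Gamma> \<longleftrightarrow>
     bounded_configuration \<theta> \<Gamma> \<and> {(x, y). y - x \<in> \<Gamma> x} \<in> sets borel"

definition shifted_cone :: "('a::euclidean_space \<Rightarrow> 'a set) \<Rightarrow> 'a \<Rightarrow> 'a set" where
  "shifted_cone \<Gamma> x = (\<lambda>h. x + h) ` \<Gamma> x"

lemma mem_double_cone_unit:
  assumes "norm h = 1"
  shows "h \<in> double_cone v \<theta> \<longleftrightarrow> \<bar>v \<bullet> h\<bar> > cos \<theta>"
proof -
  have "h \<in> uminus ` cone_at v \<theta> \<longleftrightarrow> - h \<in> cone_at v \<theta>"
    by (metis (no_types, lifting) add.inverse_inverse image_iff)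
  moreover have "h \<noteq> 0" using assms by auto
  ultimately show ?thesis
    using assms by (auto simp: double_cone_def cone_at_def)
qed

lemma double_cone_subset_imp_angle_le:
  fixes v w :: "'a::euclidean_space"
  assumes dim: "DIM('a) \<ge> 2" and v: "norm v = 1" and w: "norm w = 1"
    and \<theta>: "0 < \<theta>" "\<theta> \<le> pi / 2" and \<phi>: "0 < \<phi>" "\<phi> \<le> pi / 2"
    and sub: "double_cone v \<theta> \<subseteq> double_cone w \<phi>"
  shows "\<theta> \<le> \<phi>"
proof -
  have vv: "v \<bullet> v = 1" using v by (simp add: dot_square_norm)
  obtain w' where w': "norm w' = 1" "v \<bullet> w' \<ge> 0" "\<And>p. \<bar>w' \<bullet> p\<bar> = \<bar>w \<bullet> p\<bar>"
  proof (cases "v \<bullet> w \<ge> 0")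
    case True then show ?thesis using that[of w] w by auto
  next
    case False then show ?thesis using that[of "- w"] w by auto
  qed
  define r where "r = w' - (v \<bullet> w') *\<^sub>R v"
  have vr: "v \<bullet> r = 0" by (simp add: r_def inner_diff_right vv)
  obtain e where e: "norm e = 1" "v \<bullet> e = 0" "r = norm r *\<^sub>R e"
  proof (cases "r = 0")
    case True
    obtain x where "x \<noteq> 0" "orthogonal v x"
      using orthogonal_to_vector_exists[OF dim] by blast
    then show ?thesis
      using that[of "x /\<^sub>R norm x"] True by (simp add: orthogonal_def)
  next
    case False
    then show ?thesis using that[of "r /\<^sub>R norm r"] vr by simp
  qed
  have ee: "e \<bullet> e = 1" using e by (simp add: dot_square_norm)
  have ev: "e \<bullet> v = 0" using e by (simp add: inner_commute)
  have w'_eq: "w' = (v \<bullet> w') *\<^sub>R v + norm r *\<^sub>R e"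
    by (subst e(3)[symmetric]) (simp add: r_def)
  have "w' \<bullet> w' = (v \<bullet> w')\<^sup>2 + (norm r)\<^sup>2"
  proof -
    define a b where "a = v \<bullet> w'" and "b = norm r"
    have "w' = a *\<^sub>R v + b *\<^sub>R e" using w'_eq by (simp only: a_def b_def)
    then have "w' \<bullet> w' = a\<^sup>2 + b\<^sup>2"
      by (simp add: inner_add_left inner_add_right vv ee ev e(2) power2_eq_square)
    then show ?thesis by (simp only: a_def b_def)
  qed
  then have "(v \<bullet> w')\<^sup>2 + (norm r)\<^sup>2 = 1" using w'(1) by (simp add: dot_square_norm)
  then obtain s where s: "0 \<le> s" "s \<le> pi / 2" "v \<bullet> w' = cos s" "norm r = sin s"
    using sincos_total_pi_half[of "v \<bullet> w'" "norm r"] w'(2) by auto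
  have key: "cos \<phi> < \<bar>cos (s + \<tau>)\<bar>" if "\<bar>\<tau>\<bar> < \<theta>" for \<tau>
  proof -
    define p where "p = cos \<tau> *\<^sub>R v - sin \<tau> *\<^sub>R e"
    have "p \<bullet> p = (cos \<tau>)\<^sup>2 + (sin \<tau>)\<^sup>2"
      by (simp add: p_def inner_diff_left inner_diff_right vv ee ev e(2) power2_eq_square)
    then have p: "norm p = 1" by (simp add: norm_eq_sqrt_inner)
    have "v \<bullet> p = cos \<tau>" by (simp add: p_def inner_diff_right vv e(2))
    moreover have "cos \<theta> < cos \<tau>"
      using that \<theta> cos_monotone_0_pi[of "\<bar>\<tau>\<bar>" \<theta>] by auto
    ultimately have "p \<in> double_cone v \<theta>" by (simp add: mem_double_cone_unit[OF p])
    then have "cos \<phi> < \<bar>w' \<bullet> p\<bar>" using sub mem_double_cone_unit[OF p] w'(3) by auto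
    moreover have "w' \<bullet> p = cos (s + \<tau>)"
      by (subst w'_eq)
        (simp add: p_def s cos_add inner_add_left inner_diff_right vv ee ev e(2))
    ultimately show ?thesis by simp
  qed
  have cphi: "cos \<phi> \<ge> 0" using \<phi> by (intro cos_ge_zero) auto
  show ?thesis
  proof (rule ccontr)
    assume "\<not> \<theta> \<le> \<phi>"
    then have lt: "\<phi> < \<theta>" by simp
    show False
    proof (cases "s + \<phi> \<ge> pi / 2")
      case True
      then have "\<bar>pi / 2 - s\<bar> < \<theta>" using s lt by auto
      from key[OF this] show False using cphi by simp
    next
      case False
      from key[of \<phi>] have "cos \<phi> < \<bar>cos (s + \<phi>)\<bar>" using lt \<phi> by auto
      moreover have "cos (s + \<phi>) \<ge> 0" using False s \<phi> by (intro cos_ge_zero) auto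
      moreover have "cos (s + \<phi>) \<le> cos \<phi>"
        using False s \<phi> by (intro cos_monotone_0_pi_le) auto
      ultimately show False by simp
    qed
  qed
qed

lemma apex_angle_double_cone:
  fixes v :: "'a::euclidean_space"
  assumes "DIM('a) \<ge> 2" "norm v = 1" "0 < \<theta>" "\<theta> \<le> pi / 2"
  shows "apex_angle (double_cone v \<theta>) = \<theta>"
proof -
  have "\<phi> = \<theta>"
    if "0 < \<phi>" "\<phi> \<le> pi / 2" "norm w = 1" "double_cone v \<theta> = double_cone w \<phi>" for \<phi> w
    using that assms double_cone_subset_imp_angle_le[of v w \<theta> \<phi>]
      double_cone_subset_imp_angle_le[of w v \<phi> \<theta>] by simp
  then have "{\<phi>. 0 < \<phi> \<and> \<phi> \<le> pi / 2 \<and> (\<exists>w. norm w = 1 \<and> double_cone v \<theta> = double_cone w \<phi>)} = {\<theta>}"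
    using assms by blast
  then show ?thesis by (simp add: apex_angle_def)
qed

section \<open>Function spaces\<close>

text \<open>Elements of the spaces below are represented by functions on the whole space; everything
  depends only on their restriction to \<open>\<Omega>\<close>, up to null sets.\<close>

definition L2_space :: "'a::euclidean_space set \<Rightarrow> ('a \<Rightarrow> real) set" where
  "L2_space \<Omega> = {f. f \<in> borel_measurable (lebesgue_on \<Omega>) \<and>
     (\<integral>\<^sup>+x. ennreal ((f x)\<^sup>2) \<partial>lebesgue_on \<Omega>) < \<infinity>}"

text \<open>The squared seminorm, possibly infinite. The product in \<open>ennreal\<close> satisfies
  \<open>0 * \<infinity> = 0\<close>, which is the convention needed on the diagonal.\<close>
definition Hk_energy :: "'a::euclidean_space set \<Rightarrow> ('a \<Rightarrow> 'a \<Rightarrow> ennreal) \<Rightarrow> ('a \<Rightarrow> real) \<Rightarrow> ennreal" where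
  "Hk_energy \<Omega> k f = (\<integral>\<^sup>+(x, y). ennreal ((f y - f x)\<^sup>2) * k x y \<partial>lebesgue_on (\<Omega> \<times> \<Omega>))"

definition Hk_space :: "'a::euclidean_space set \<Rightarrow> ('a \<Rightarrow> 'a \<Rightarrow> ennreal) \<Rightarrow> ('a \<Rightarrow> real) set" where
  "Hk_space \<Omega> k = {f \<in> L2_space \<Omega>. Hk_energy \<Omega> k f < \<infinity>}"

text \<open>The following two are meaningful for members of \<open>Hk_space \<Omega> k\<close> only, since
  \<open>enn2real \<infinity> = 0\<close>.\<close>
definition Hk_seminorm :: "'a::euclidean_space set \<Rightarrow> ('a \<Rightarrow> 'a \<Rightarrow> ennreal) \<Rightarrow> ('a \<Rightarrow> real) \<Rightarrow> real" where
  "Hk_seminorm \<Omega> k f = sqrt (enn2real (Hk_energy \<Omega> k f))"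

definition Hk_norm :: "'a::euclidean_space set \<Rightarrow> ('a \<Rightarrow> 'a \<Rightarrow> ennreal) \<Rightarrow> ('a \<Rightarrow> real) \<Rightarrow> real" where
  "Hk_norm \<Omega> k f = sqrt (enn2real
     ((\<integral>\<^sup>+x. ennreal ((f x)\<^sup>2) \<partial>lebesgue_on \<Omega>) + Hk_energy \<Omega> k f))"

definition frac_kernel :: "real \<Rightarrow> 'a::euclidean_space \<Rightarrow> 'a \<Rightarrow> ennreal" where
  "frac_kernel \<alpha> x y =
     (if x = y then \<infinity> else ennreal (norm (x - y) powr (- real DIM('a) - \<alpha>)))"

text \<open>\<open>frac_space \<Omega> \<alpha>\<close> is \<open>H\<^bsup>\<alpha>/2\<^esup>(\<Omega>)\<close>.\<close>
abbreviation frac_space :: "'a::euclidean_space set \<Rightarrow> real \<Rightarrow> ('a \<Rightarrow> real) set" where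
  "frac_space \<Omega> \<alpha> \<equiv> Hk_space \<Omega> (frac_kernel \<alpha>)"

abbreviation frac_seminorm :: "'a::euclidean_space set \<Rightarrow> real \<Rightarrow> ('a \<Rightarrow> real) \<Rightarrow> real" where
  "frac_seminorm \<Omega> \<alpha> \<equiv> Hk_seminorm \<Omega> (frac_kernel \<alpha>)"

abbreviation frac_norm :: "'a::euclidean_space set \<Rightarrow> real \<Rightarrow> ('a \<Rightarrow> real) \<Rightarrow> real" where
  "frac_norm \<Omega> \<alpha> \<equiv> Hk_norm \<Omega> (frac_kernel \<alpha>)"

definition comparable_on :: "'b set \<Rightarrow> ('b \<Rightarrow> real) \<Rightarrow> ('b \<Rightarrow> real) \<Rightarrow> bool" where
  "comparable_on S p q \<longleftrightarrow> (\<exists>C\<ge>1. \<forall>f\<in>S. p f / C \<le> q f \<and> q f \<le> C * p f)"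

definition dense_in_Hk ::
  "'a::euclidean_space set \<Rightarrow> ('a \<Rightarrow> 'a \<Rightarrow> ennreal) \<Rightarrow> ('a \<Rightarrow> real) set \<Rightarrow> bool" where
  "dense_in_Hk \<Omega> k D \<longleftrightarrow> D \<subseteq> Hk_space \<Omega> k \<and>
     (\<forall>f\<in>Hk_space \<Omega> k. \<forall>\<epsilon>>0. \<exists>g\<in>D. Hk_norm \<Omega> k (\<lambda>x. f x - g x) < \<epsilon>)"

section \<open>Smooth functions and Lipschitz domains\<close>

primrec iterated_deriv :: "'a list \<Rightarrow> ('a::euclidean_space \<Rightarrow> real) \<Rightarrow> 'a \<Rightarrow> real" where
  "iterated_deriv [] f = f"
| "iterated_deriv (v # vs) f = (\<lambda>x. frechet_derivative (iterated_deriv vs f) (at x) v)"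

definition C_infinity :: "'a::euclidean_space set \<Rightarrow> ('a \<Rightarrow> real) set" where
  "C_infinity \<Omega> = {f. \<forall>vs. \<forall>x\<in>\<Omega>. iterated_deriv vs f differentiable at x}"

text \<open>For open \<open>\<Omega>\<close>: smooth in \<open>\<Omega>\<close>, and all derivatives of all orders (including order 0)
  extend continuously to the closure.\<close>
definition C_infinity_closure :: "'a::euclidean_space set \<Rightarrow> ('a \<Rightarrow> real) set" where
  "C_infinity_closure \<Omega> = {f \<in> C_infinity \<Omega>.
     \<forall>vs. \<exists>g. continuous_on (closure \<Omega>) g \<and> (\<forall>x\<in>\<Omega>. g x = iterated_deriv vs f x)}"

definition C_infinity_compact :: "('a::euclidean_space \<Rightarrow> real) set" where
  "C_infinity_compact = {f \<in> C_infinity UNIV. compact (closure {x. f x \<noteq> 0})}"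

text \<open>Near each boundary point \<open>\<Omega>\<close> is the open epigraph, in some direction \<open>e\<close>, of a Lipschitz
  function \<open>\<phi>\<close> on the hyperplane orthogonal to \<open>e\<close>.\<close>
definition lipschitz_domain :: "'a::euclidean_space set \<Rightarrow> bool" where
  "lipschitz_domain \<Omega> \<longleftrightarrow> open \<Omega> \<and> connected \<Omega> \<and> \<Omega> \<noteq> {} \<and>
     (\<forall>z\<in>frontier \<Omega>. \<exists>e r L \<phi>. norm e = 1 \<and> 0 < r \<and> L-lipschitz_on {y. e \<bullet> y = 0} \<phi> \<and>
        \<Omega> \<inter> ball z r = {x \<in> ball z r. e \<bullet> x > \<phi> (x - (e \<bullet> x) *\<^sub>R e)})"

end

theory Submission
  imports Defs
begin

text \<open>The only geometric input about the cones is thickness: from a point \<open>a\<close> of a ball, the double cone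
  at \<open>a\<close> contains a ball of comparable size that lies in a slightly smaller concentric ball. Hence the
  mean square of \<open>f - c\<close> over a ball is bounded by that over the smaller ball plus the cone energy.
  Iterating until the smaller ball fits into the cone at a second point \<open>z\<close>, and taking \<open>c = f z\<close>,
  bounds the full double integral over a ball; integration over all balls with a weight in the radius
  produces the fractional energy of a ball in terms of the cone energy of a larger ball.

  At a Lipschitz boundary the balls must stay inside the domain. There \<open>f x\<close> is compared with averages
  of \<open>f\<close> over balls around \<open>x + t e\<close>, of radius proportional to \<open>t\<close>, where \<open>e\<close> points into the domain;
  passing from \<open>t\<close> to \<open>(1 - b) t\<close> costs only interior energy, and after integration in \<open>t\<close> the
  remaining term is a contraction that can be absorbed. Connectedness and compactness make these local
  estimates global.

  Smooth functions are dense because, locally, mollifiers supported in the interior cone act within the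
  domain, and a smooth partition of unity glues the pieces together.\<close>

section \<open>Thickness of the cones\<close>

text \<open>The cones depend on the base point only measurably, and
  \<open>y - x \<in> \<Gamma> x\<close> gives no information on the cone at \<open>y\<close>.
  Comparing \<open>f x\<close> with \<open>f y\<close> through a common point of the two cones is
  therefore hopeless in general: thin cones at nearby points may be disjoint. Shrinking balls avoid
  this. Each step uses the cone at one point, wherever it happens to point, and remembers only that
  the radius has dropped by a fixed factor. The number of steps depends on \<open>\<kappa>\<close>
  and \<open>\<tau>\<close> alone, so the constants are the same at all scales; this is what permits
  integration over all balls.

  Absorbing a term at the boundary presupposes that it is finite, which is not known for a function
  of finite cone energy. The interior estimate is therefore used first, to obtain finiteness at
  almost every point; the size of that bound never enters the constants.

  Density is proved in the fractional norm alone. The upper bound on \<open>k\<close> carries it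
  over to \<open>Hk_norm\<close>.\<close>

lemma ball_in_double_cone:
  fixes v w a :: "'a::euclidean_space"
  assumes v: "norm v = 1" and c: "cos \<theta> \<ge> 0" "cos \<theta> < 1" and \<rho>: "\<rho> > 0"
    and a: "a \<in> ball w \<rho>" and t_def: "t = (1 - cos \<theta>) / 4"
  shows "\<exists>b. ball b (t\<^sup>2 / 32 * \<rho>) \<subseteq> {y. y - a \<in> double_cone v \<theta>} \<inter> ball w ((1 - t\<^sup>2 / 16) * \<rho>)"
proof -
  have t: "0 < t" "t \<le> 1/4" using c by (auto simp: t_def)
  define D where "D = w - a"
  have D: "norm D < \<rho>" using a by (simp add: D_def dist_norm)
  \<comment> \<open>The double cone does not distinguish \<open>v\<close> from \<open>- v\<close>,
    so the axis may be chosen to point towards the centre \<open>w\<close>.\<close>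
  obtain v' where v': "norm v' = 1" "v' \<bullet> D \<ge> 0" "double_cone v' \<theta> = double_cone v \<theta>"
  proof (cases "v \<bullet> D \<ge> 0")
    case True then show ?thesis using that v by blast
  next
    case False
    have "uminus ` cone_at (- v) \<theta> = cone_at v \<theta>" for v :: 'a
    proof -
      have "h \<in> uminus ` cone_at (- v) \<theta> \<longleftrightarrow> - h \<in> cone_at (- v) \<theta>" for h
        by (metis (no_types, lifting) add.inverse_inverse image_iff)
      then show ?thesis by (auto simp: cone_at_def)
    qed
    from this[of v] this[of "-v"] have "double_cone (- v) \<theta> = double_cone v \<theta>"
      by (auto simp: double_cone_def)
    then show ?thesis using that[of "- v"] False v by auto
  qed
  define s where "s = t * \<rho> / 8"
  \<comment> \<open>Moving along \<open>v'\<close> alone gains nothing towards the centre when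
    \<open>v'\<close> is orthogonal to \<open>D\<close>. The tilt by a multiple \<open>t\<close> of
    \<open>sgn D\<close> secures \<open>uD\<close>, and \<open>t\<close>, a quarter of
    \<open>1 - cos \<theta>\<close>, is small enough to keep the direction inside the cone with room
    for a ball.\<close>
  define u where "u = v' + t *\<^sub>R sgn D"
  have s: "s > 0" using t \<rho> by (simp add: s_def)
  have sgnD: "norm (sgn D) \<le> 1" by (simp add: norm_sgn)
  have sD: "sgn D \<bullet> D = norm D"
    by (cases "D = 0") (auto simp: sgn_div_norm dot_square_norm power2_eq_square)
  have uD: "u \<bullet> D \<ge> t * norm D" using v' sD by (simp add: u_def inner_add_left)
  have vsgn: "v' \<bullet> sgn D \<ge> 0" using v'(2) by (simp add: sgn_div_norm)
  have nu: "norm u \<le> 1 + t"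
    using norm_triangle_ineq[of v' "t *\<^sub>R sgn D"] v'(1) sgnD t
    by (simp add: u_def) (smt (verit) mult_left_le)
  have vu: "v' \<bullet> u \<ge> 1"
    using v'(1) vsgn t by (simp add: u_def inner_add_right dot_square_norm)
  show ?thesis
  proof (intro exI[of _ "a + s *\<^sub>R u"] subsetI)
    fix y assume "y \<in> ball (a + s *\<^sub>R u) (t\<^sup>2 / 32 * \<rho>)"
    define n where "n = y - (a + s *\<^sub>R u)"
    have n: "norm n < t\<^sup>2 / 32 * \<rho>"
      using \<open>y \<in> _\<close> by (simp add: n_def dist_norm norm_minus_commute)
    have y: "y - a = s *\<^sub>R u + n" by (simp add: n_def)
    have "v' \<bullet> (y - a) = s * (v' \<bullet> u) + v' \<bullet> n" by (simp add: y inner_add_right)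
    moreover have "v' \<bullet> n \<ge> - norm n"
      using Cauchy_Schwarz_ineq2[of v' n] v'(1) by simp
    moreover have "s * (v' \<bullet> u) \<ge> s" using vu s by simp
    ultimately have 1: "v' \<bullet> (y - a) \<ge> s - norm n" by linarith
    have "norm (y - a) \<le> s * norm u + norm n"
      using norm_triangle_ineq[of "s *\<^sub>R u" n] s y by simp
    also have "\<dots> \<le> s * (1 + t) + norm n" using nu s by simp
    finally have 2: "norm (y - a) \<le> s * (1 + t) + norm n" .
    have "cos \<theta> * norm (y - a) \<le> cos \<theta> * (s * (1 + t) + norm n)"
      using 2 c by (simp add: mult_left_mono)
    also have "\<dots> = s * (cos \<theta> + cos \<theta> * t) + cos \<theta> * norm n" by (simp add: algebra_simps)
    also have "\<dots> \<le> s * (cos \<theta> + t) + norm n"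
    proof -
      have "cos \<theta> * t \<le> t" using c t by (simp add: mult_left_le_one_le)
      moreover have "cos \<theta> * norm n \<le> norm n" using c by (simp add: mult_left_le_one_le)
      ultimately show ?thesis using s by (intro add_mono mult_left_mono) auto
    qed
    also have "\<dots> = s - 3 * t * s + norm n" by (simp add: t_def field_simps)
    also have "\<dots> < s - norm n"
    proof -
      have "3 * t * s = 3/8 * (t\<^sup>2 * \<rho>)" by (simp add: s_def power2_eq_square)
      moreover have "t\<^sup>2 * \<rho> > 0" using t \<rho> by simp
      ultimately show ?thesis using n by linarith
    qed
    finally have 3: "cos \<theta> * norm (y - a) < v' \<bullet> (y - a)" using 1 by linarith
    have "y - a \<noteq> 0" using 3 by auto
    with 3 have "y - a \<in> cone_at v' \<theta>" by (simp add: cone_at_def pos_less_divide_eq)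
    then have A: "y - a \<in> double_cone v \<theta>" using v'(3) by (auto simp: double_cone_def)
    have "(norm (D - s *\<^sub>R u))\<^sup>2 = (norm D)\<^sup>2 - 2 * s * (u \<bullet> D) + s\<^sup>2 * (norm u)\<^sup>2"
      by (simp only: power2_norm_eq_inner)
        (simp add: inner_diff_left inner_diff_right inner_commute algebra_simps power2_eq_square)
    also have "\<dots> \<le> (norm D)\<^sup>2 - 2 * s * (t * norm D) + s\<^sup>2 * 2"
    proof -
      have "(norm u)\<^sup>2 \<le> (1 + t)\<^sup>2" using nu by (simp add: power_mono)
      also have "\<dots> \<le> (5/4)\<^sup>2" using t by (intro power_mono) auto
      also have "\<dots> \<le> 2" by (simp add: power2_eq_square)
      finally have "s\<^sup>2 * (norm u)\<^sup>2 \<le> s\<^sup>2 * 2" by (intro mult_left_mono) auto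
      moreover have "2 * s * (t * norm D) \<le> 2 * s * (u \<bullet> D)" using uD s by (intro mult_left_mono) auto
      ultimately show ?thesis by linarith
    qed
    \<comment> \<open>At \<open>norm D = \<rho>\<close> the first-order gain is
      \<open>2 * s * t * \<rho> = t^2 * \<rho>^2 / 4\<close>, the second-order loss
      \<open>t^2 * \<rho>^2 / 32\<close>; the step length \<open>s = t * \<rho> / 8\<close> makes
      the loss an eighth of the gain. \<open>e2\<close> says that \<open>norm D\<close> near
      \<open>\<rho>\<close> is the worst case: for small \<open>norm D\<close> the gain is weak, but
      the point is already deep inside the ball.\<close>
    also have "\<dots> \<le> \<rho>\<^sup>2 * (1 - 3 * t\<^sup>2 / 16)"
    proof -
      have t2: "t\<^sup>2 \<le> 1/16" using power_mono[of t "1/4" 2] t by (simp add: power2_eq_square)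
      have e1: "(norm D)\<^sup>2 - 2 * s * (t * norm D) = norm D * (norm D - t\<^sup>2 * \<rho> / 4)"
        by (simp add: s_def power2_eq_square algebra_simps)
      have e2: "norm D * (norm D - t\<^sup>2 * \<rho> / 4) \<le> \<rho> * (\<rho> - t\<^sup>2 * \<rho> / 4)"
      proof (cases "norm D - t\<^sup>2 * \<rho> / 4 \<ge> 0")
        case True then show ?thesis using D \<rho> by (intro mult_mono) auto
      next
        case False
        then have "norm D * (norm D - t\<^sup>2 * \<rho> / 4) \<le> 0" by (simp add: mult_nonneg_nonpos)
        moreover have "t\<^sup>2 * \<rho> \<le> 1/16 * \<rho>" using t2 \<rho> by (intro mult_right_mono) auto
        then have "\<rho> * (\<rho> - t\<^sup>2 * \<rho> / 4) \<ge> 0" using \<rho> by (intro mult_nonneg_nonneg) auto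
        ultimately show ?thesis by linarith
      qed
      have e3: "s\<^sup>2 * 2 = t\<^sup>2 * \<rho>\<^sup>2 / 32" by (simp add: s_def power2_eq_square)
      have "\<rho> * (\<rho> - t\<^sup>2 * \<rho> / 4) + t\<^sup>2 * \<rho>\<^sup>2 / 32 \<le> \<rho>\<^sup>2 * (1 - 3 * t\<^sup>2 / 16)"
        using \<rho> t by (simp add: power2_eq_square field_simps)
      then show ?thesis using e1 e2 e3 by linarith
    qed
    also have "\<dots> \<le> (\<rho> * (1 - 3 * t\<^sup>2 / 32))\<^sup>2"
      using \<rho> t by (simp add: power2_eq_square algebra_simps)
    finally have "norm (D - s *\<^sub>R u) \<le> \<rho> * (1 - 3 * t\<^sup>2 / 32)"
    proof (rule power2_le_imp_le)
      have "t\<^sup>2 \<le> 1/16" using power_mono[of t "1/4" 2] t by (simp add: power2_eq_square)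
      then show "0 \<le> \<rho> * (1 - 3 * t\<^sup>2 / 32)" using \<rho> by simp
    qed
    moreover have "w - y = (D - s *\<^sub>R u) - n" by (simp add: D_def n_def)
    then have "norm (w - y) \<le> norm (D - s *\<^sub>R u) + norm n" by (metis norm_triangle_ineq4)
    ultimately have "norm (w - y) < \<rho> * (1 - 3 * t\<^sup>2 / 32) + t\<^sup>2 / 32 * \<rho>" using n by linarith
    also have "\<dots> = (1 - t\<^sup>2 / 16) * \<rho>" by (simp add: field_simps)
    finally show "y \<in> {y. y - a \<in> double_cone v \<theta>} \<inter> ball w ((1 - t\<^sup>2 / 16) * \<rho>)"
      using A by (simp add: dist_norm)
  qed
qed

text \<open>The angle \<open>\<theta> / 2\<close> lies strictly below every
  \<open>apex_angle (\<Gamma> x)\<close>, which is a supremum, so some representation of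
  \<open>\<Gamma> x\<close> as a double cone has a larger angle. Halving thus replaces any
  discussion of whether the supremum is attained, and the argument is the same in every
  dimension.\<close>

lemma bounded_configuration_contains_cone:
  fixes \<Gamma> :: "'a::euclidean_space \<Rightarrow> 'a set"
  assumes "bounded_configuration \<theta> \<Gamma>"
  shows "\<exists>v. norm v = 1 \<and> double_cone v (\<theta> / 2) \<subseteq> \<Gamma> x" and "\<theta> \<le> pi / 2"
proof -
  let ?S = "\<lambda>C :: 'a set. {\<theta>. 0 < \<theta> \<and> \<theta> \<le> pi / 2 \<and> (\<exists>v. norm v = 1 \<and> C = double_cone v \<theta>)}"
  have ne: "?S (\<Gamma> x) \<noteq> {}" for x
    using assms by (force simp: bounded_configuration_def configuration_def double_cones_def)
  have bdd: "bdd_above (?S (\<Gamma> x))" for x by (rule bdd_aboveI[of _ "pi/2"]) auto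
  have pos: "0 \<le> apex_angle (\<Gamma> x)" for x
  proof -
    obtain \<phi> where "\<phi> \<in> ?S (\<Gamma> x)" using ne[of x] by blast
    then show ?thesis unfolding apex_angle_def using cSup_upper[OF _ bdd] by fastforce
  qed
  have le: "\<theta> \<le> apex_angle (\<Gamma> x)" for x
    using assms pos unfolding bounded_configuration_def
    by (auto intro!: cInf_lower bdd_belowI[of _ 0])
  have "apex_angle (\<Gamma> x) \<le> pi / 2" for x
    unfolding apex_angle_def by (rule cSup_least[OF ne]) auto
  with le show "\<theta> \<le> pi / 2" by (meson order_trans)
  have "\<theta> / 2 < Sup (?S (\<Gamma> x))"
    using le[of x] assms by (simp add: bounded_configuration_def apex_angle_def)
  then have "\<exists>\<phi>\<in>?S (\<Gamma> x). \<theta> / 2 < \<phi>" by (simp only: less_cSup_iff[OF ne bdd])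
  then obtain \<phi> v where \<phi>: "\<theta> / 2 < \<phi>" "\<phi> \<le> pi / 2" "norm v = 1" "\<Gamma> x = double_cone v \<phi>"
    by blast
  have "cos \<phi> \<le> cos (\<theta> / 2)"
    using \<phi> assms by (intro cos_monotone_0_pi_le) (auto simp: bounded_configuration_def)
  then have "double_cone v (\<theta> / 2) \<subseteq> double_cone v \<phi>"
    by (fastforce simp: double_cone_def cone_at_def)
  then show "\<exists>v. norm v = 1 \<and> double_cone v (\<theta> / 2) \<subseteq> \<Gamma> x" using \<phi> by auto
qed

text \<open>All that the energy estimates know about the configuration. Both constants are relative
  to \<open>\<rho>\<close>, which makes the consequences scale invariant; \<open>a\<close> may lie
  arbitrarily close to the sphere; and the relation is one-sided, since
  \<open>(a, y) \<in> G\<close> says nothing about \<open>(y, a)\<close>.\<close>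

locale thick_relation =
  fixes G :: "('a::euclidean_space \<times> 'a) set" and \<kappa> \<tau> :: real
  assumes G_borel [measurable]: "G \<in> sets borel"
    and \<kappa>: "0 < \<kappa>" and \<tau>: "0 < \<tau>" "\<tau> < 1"
    and thick: "\<And>a w \<rho>. \<rho> > 0 \<Longrightarrow> a \<in> ball w \<rho> \<Longrightarrow>
      \<exists>b. ball b (\<kappa> * \<rho>) \<subseteq> {y. (a, y) \<in> G} \<inter> ball w ((1 - \<tau>) * \<rho>)"

lemma admissible_configuration_thick:
  fixes \<Gamma> :: "'a::euclidean_space \<Rightarrow> 'a set"
  assumes "admissible_configuration \<theta> \<Gamma>"
  shows "\<exists>\<kappa> \<tau>. thick_relation {(x, y). y - x \<in> \<Gamma> x} \<kappa> \<tau>"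
proof -
  have b: "bounded_configuration \<theta> \<Gamma>" using assms by (simp add: admissible_configuration_def)
  define t where "t = (1 - cos (\<theta> / 2)) / 4"
  have \<theta>: "0 < \<theta>" "\<theta> \<le> pi / 2"
    using b bounded_configuration_contains_cone(2)[OF b] by (auto simp: bounded_configuration_def)
  have "cos 0 > cos (\<theta> / 2)" using \<theta> by (intro cos_monotone_0_pi) auto
  moreover have "cos (\<theta> / 2) \<ge> 0" using \<theta> by (intro cos_ge_zero) auto
  ultimately have c: "cos (\<theta> / 2) \<ge> 0" "cos (\<theta> / 2) < 1" by auto
  then have t: "0 < t" "t \<le> 1/4" by (auto simp: t_def)
  have t2: "t\<^sup>2 \<le> 1/16" using power_mono[of t "1/4" 2] t by (simp add: power2_eq_square)
  have "thick_relation {(x, y). y - x \<in> \<Gamma> x} (t\<^sup>2 / 32) (t\<^sup>2 / 16)"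
  proof
    show "{(x, y). y - x \<in> \<Gamma> x} \<in> sets borel"
      using assms by (simp add: admissible_configuration_def)
    show "0 < t\<^sup>2 / 32" "0 < t\<^sup>2 / 16" "t\<^sup>2 / 16 < 1" using t t2 by auto
    fix a w :: 'a and \<rho> :: real assume "\<rho> > 0" "a \<in> ball w \<rho>"
    obtain v where "norm v = 1" "double_cone v (\<theta> / 2) \<subseteq> \<Gamma> a"
      using bounded_configuration_contains_cone(1)[OF b] by blast
    with ball_in_double_cone[OF _ c \<open>\<rho> > 0\<close> \<open>a \<in> ball w \<rho>\<close> t_def, of v]
    show "\<exists>b. ball b (t\<^sup>2 / 32 * \<rho>) \<subseteq> {y. (a, y) \<in> {(x, y). y - x \<in> \<Gamma> x}} \<inter> ball w ((1 - t\<^sup>2 / 16) * \<rho>)"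
      by fastforce
  qed
  then show ?thesis by blast
qed

section \<open>Square deviations on balls\<close>

lemma ennreal_le_divide_mult:
  assumes "ennreal m * A \<le> B" "0 < m"
  shows "A \<le> ennreal (1 / m) * B"
proof -
  have "A = ennreal (1 / m) * (ennreal m * A)"
    using \<open>0 < m\<close> by (simp add: mult.assoc[symmetric] ennreal_mult'[symmetric])
  also have "\<dots> \<le> ennreal (1 / m) * B" by (intro mult_left_mono assms) auto
  finally show ?thesis .
qed

text \<open>The averaging device of the whole development: a triangle inequality valid for all
  intermediate points \<open>y\<close> of \<open>S\<close> is integrated over \<open>S\<close>, and
  the side that is free of \<open>y\<close> picks up the measure.\<close>

lemma nn_integral_ge_const_on:
  assumes "S \<in> sets M" "m \<le> emeasure M S" "\<And>y. y \<in> S \<Longrightarrow> A \<le> B y"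
  shows "m * A \<le> (\<integral>\<^sup>+y\<in>S. B y \<partial>M)"
proof -
  have "m * A \<le> A * emeasure M S" using assms(2) by (simp add: mult.commute mult_left_mono)
  also have "\<dots> = (\<integral>\<^sup>+y. A * indicator S y \<partial>M)" using assms(1) by (simp add: nn_integral_cmult_indicator)
  also have "\<dots> \<le> (\<integral>\<^sup>+y\<in>S. B y \<partial>M)"
    by (intro nn_integral_mono) (use assms(3) in \<open>auto simp: indicator_def\<close>)
  finally show ?thesis .
qed

lemma sum_square_le: "((a::real) + b)\<^sup>2 \<le> 2 * a\<^sup>2 + 2 * b\<^sup>2"
  using sum_squares_bound[of a b] by (simp add: power2_sum)

definition sqd :: "('a \<Rightarrow> real) \<Rightarrow> 'a \<Rightarrow> 'a \<Rightarrow> ennreal" where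
  "sqd f x y = ennreal ((f y - f x)\<^sup>2)"

lemma sqd_sym: "sqd f x y = sqd f y x"
  by (simp add: sqd_def power2_commute)

lemma square_diff_triangle:
  "ennreal ((a - c)\<^sup>2) \<le> 2 * ennreal ((b - a)\<^sup>2) + 2 * ennreal ((b - c)\<^sup>2)"
proof -
  have "(a - c)\<^sup>2 \<le> 2 * (b - a)\<^sup>2 + 2 * (b - c)\<^sup>2"
    using sum_square_le[of "a - b" "b - c"] by (simp add: power2_commute)
  then have "ennreal ((a - c)\<^sup>2) \<le> ennreal (2 * (b - a)\<^sup>2 + 2 * (b - c)\<^sup>2)" by (rule ennreal_leI)
  also have "\<dots> = 2 * ennreal ((b - a)\<^sup>2) + 2 * ennreal ((b - c)\<^sup>2)"
    by (simp add: ennreal_plus ennreal_mult' ennreal_numeral)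
  finally show ?thesis .
qed

lemma sqd_triangle: "sqd f x y \<le> 2 * sqd f x z + 2 * sqd f z y"
  using square_diff_triangle[of "f x" "f y" "f z"] by (simp add: sqd_def power2_commute)

lemma sqd_measurable [measurable]:
  assumes [measurable]: "f \<in> borel_measurable borel" "g \<in> borel_measurable M" "h \<in> borel_measurable M"
  shows "(\<lambda>x. sqd f (g x) (h x)) \<in> borel_measurable M"
  unfolding sqd_def by measurable

definition dint :: "'a::euclidean_space set \<Rightarrow> ('a \<Rightarrow> 'a \<Rightarrow> ennreal) \<Rightarrow> ennreal" where
  "dint S \<Phi> = (\<integral>\<^sup>+x\<in>S. (\<integral>\<^sup>+y\<in>S. \<Phi> x y \<partial>lborel) \<partial>lborel)"

lemma set_nn_integral_mono:
  assumes "\<And>x. x \<in> A \<Longrightarrow> f x \<le> g x" "A \<subseteq> B"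
  shows "(\<integral>\<^sup>+x\<in>A. f x \<partial>M) \<le> (\<integral>\<^sup>+x\<in>B. g x \<partial>M)"
  by (intro nn_integral_mono) (use assms in \<open>auto simp: indicator_def\<close>)

lemma measurable_mem_ball [measurable (raw)]:
  fixes f g :: "'b \<Rightarrow> 'a::euclidean_space"
  assumes [measurable]: "f \<in> borel_measurable M" "g \<in> borel_measurable M" "r \<in> borel_measurable M"
  shows "Measurable.pred M (\<lambda>x. g x \<in> ball (f x) (r x))"
  unfolding mem_ball by measurable

lemma set_nn_integral_linear:
  assumes [measurable]: "f \<in> borel_measurable M" "g \<in> borel_measurable M" "A \<in> sets M"
  shows "(\<integral>\<^sup>+x\<in>A. a * f x + b * g x \<partial>M) =
    a * (\<integral>\<^sup>+x\<in>A. f x \<partial>M) + b * (\<integral>\<^sup>+x\<in>A. g x \<partial>M)"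
  by (simp add: distrib_right nn_integral_add nn_integral_cmult mult.assoc)

lemma set_nn_integral_cmult:
  assumes [measurable]: "f \<in> borel_measurable M" "A \<in> sets M"
  shows "(\<integral>\<^sup>+x\<in>A. a * f x \<partial>M) = a * (\<integral>\<^sup>+x\<in>A. f x \<partial>M)"
  by (simp add: nn_integral_cmult mult.assoc)

lemma set_nn_integral_const:
  assumes [measurable]: "A \<in> sets M"
  shows "(\<integral>\<^sup>+x\<in>A. c \<partial>M) = c * emeasure M A"
  by (simp add: nn_integral_cmult_indicator)

lemma dint_mono:
  assumes "S \<subseteq> T" "\<And>x y. x \<in> S \<Longrightarrow> y \<in> S \<Longrightarrow> \<Phi> x y \<le> \<Psi> x y"
  shows "dint S \<Phi> \<le> dint T \<Psi>"
  unfolding dint_def by (intro set_nn_integral_mono assms)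

context thick_relation
begin

definition Gsq :: "('a \<Rightarrow> real) \<Rightarrow> 'a \<Rightarrow> 'a \<Rightarrow> ennreal" where
  "Gsq f x y = indicator G (x, y) * sqd f x y"

lemma Gsq_measurable [measurable]:
  assumes [measurable]: "f \<in> borel_measurable borel" "g \<in> borel_measurable M" "h \<in> borel_measurable M"
  shows "(\<lambda>x. Gsq f (g x) (h x)) \<in> borel_measurable M"
proof -
  have [measurable]: "(\<lambda>x. (g x, h x)) \<in> M \<rightarrow>\<^sub>M borel" by (rule borel_measurable_Pair) auto
  show ?thesis unfolding Gsq_def by measurable
qed

text \<open>For each \<open>a\<close> in the ball, thickness provides a ball of intermediate points
  \<open>y\<close> related to \<open>a\<close> inside the smaller concentric ball. The difference
  \<open>f a - c\<close> is split at \<open>f y\<close>, averaged over these \<open>y\<close>, and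
  then integrated over \<open>a\<close>. The factor \<open>2 / \<kappa> ^ DIM('a)\<close> is twice
  the ratio of the volumes of the large ball and the ball of intermediate points.\<close>

lemma square_deviation_step:
  assumes [measurable]: "f \<in> borel_measurable borel" and \<rho>: "\<rho> > 0"
  shows "(\<integral>\<^sup>+x\<in>ball w \<rho>. ennreal ((f x - c)\<^sup>2) \<partial>lborel) \<le>
    ennreal (2 / \<kappa> ^ DIM('a)) * (\<integral>\<^sup>+x\<in>ball w ((1 - \<tau>) * \<rho>). ennreal ((f x - c)\<^sup>2) \<partial>lborel) +
    ennreal (2 / (unit_ball_vol DIM('a) * (\<kappa> * \<rho>) ^ DIM('a))) * dint (ball w \<rho>) (Gsq f)"
proof -
  define \<omega> where "\<omega> = unit_ball_vol (real DIM('a))"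
  have \<omega>: "\<omega> > 0" by (simp add: \<omega>_def)
  define m where "m = \<omega> * (\<kappa> * \<rho>) ^ DIM('a)"
  have m: "m > 0" using \<omega> \<kappa> \<rho> by (simp add: m_def)
  let ?I = "\<integral>\<^sup>+x\<in>ball w ((1 - \<tau>) * \<rho>). ennreal ((f x - c)\<^sup>2) \<partial>lborel"
  have pt: "ennreal m * ennreal ((f a - c)\<^sup>2) \<le>
      2 * (\<integral>\<^sup>+y\<in>ball w \<rho>. Gsq f a y \<partial>lborel) + 2 * ?I" if a: "a \<in> ball w \<rho>" for a
  proof -
    obtain b where b: "ball b (\<kappa> * \<rho>) \<subseteq> {y. (a, y) \<in> G} \<inter> ball w ((1 - \<tau>) * \<rho>)"
      using thick[OF \<rho> a] by blast
    have sub: "ball w ((1 - \<tau>) * \<rho>) \<subseteq> ball w \<rho>"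
      using \<rho> \<tau> by (intro subset_ball) (simp add: mult_left_le_one_le)
    have "ennreal m * ennreal ((f a - c)\<^sup>2) \<le>
        (\<integral>\<^sup>+y\<in>ball b (\<kappa> * \<rho>). 2 * Gsq f a y + 2 * ennreal ((f y - c)\<^sup>2) \<partial>lborel)"
    proof (rule nn_integral_ge_const_on)
      show "ennreal m \<le> emeasure lborel (ball b (\<kappa> * \<rho>))"
        using \<kappa> \<rho> by (simp add: emeasure_ball m_def \<omega>_def)
      fix y assume "y \<in> ball b (\<kappa> * \<rho>)"
      then have "(a, y) \<in> G" using b by auto
      then show "ennreal ((f a - c)\<^sup>2) \<le> 2 * Gsq f a y + 2 * ennreal ((f y - c)\<^sup>2)"
        using square_diff_triangle[of "f a" c "f y"] by (simp add: Gsq_def sqd_def)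
    qed simp
    also have "\<dots> = 2 * (\<integral>\<^sup>+y\<in>ball b (\<kappa> * \<rho>). Gsq f a y \<partial>lborel) +
        2 * (\<integral>\<^sup>+y\<in>ball b (\<kappa> * \<rho>). ennreal ((f y - c)\<^sup>2) \<partial>lborel)"
      by (rule set_nn_integral_linear) measurable
    also have "\<dots> \<le> 2 * (\<integral>\<^sup>+y\<in>ball w \<rho>. Gsq f a y \<partial>lborel) + 2 * ?I"
      using b sub by (intro add_mono mult_left_mono set_nn_integral_mono) auto
    finally show ?thesis .
  qed
  have "ennreal m * (\<integral>\<^sup>+x\<in>ball w \<rho>. ennreal ((f x - c)\<^sup>2) \<partial>lborel) =
      (\<integral>\<^sup>+x\<in>ball w \<rho>. ennreal m * ennreal ((f x - c)\<^sup>2) \<partial>lborel)"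
    by (rule set_nn_integral_cmult[symmetric]) measurable
  also have "\<dots> \<le> (\<integral>\<^sup>+x\<in>ball w \<rho>. (2 * (\<integral>\<^sup>+y\<in>ball w \<rho>. Gsq f x y \<partial>lborel) + 2 * ?I) \<partial>lborel)"
    by (intro set_nn_integral_mono pt) auto
  also have "\<dots> = 2 * dint (ball w \<rho>) (Gsq f) + 2 * (\<integral>\<^sup>+x\<in>ball w \<rho>. ?I \<partial>lborel)"
    unfolding dint_def by (rule set_nn_integral_linear) measurable
  also have "(\<integral>\<^sup>+x\<in>ball w \<rho>. ?I \<partial>lborel) = ?I * emeasure lborel (ball w \<rho>)"
    by (rule set_nn_integral_const) measurable
  finally have "(\<integral>\<^sup>+x\<in>ball w \<rho>. ennreal ((f x - c)\<^sup>2) \<partial>lborel) \<le>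
      ennreal (1 / m) * (2 * dint (ball w \<rho>) (Gsq f) + 2 * (?I * emeasure lborel (ball w \<rho>)))"
    using m by (rule ennreal_le_divide_mult)
  also have "\<dots> = ennreal (2 / m) * dint (ball w \<rho>) (Gsq f) +
      ennreal (2 / m) * ennreal (\<omega> * \<rho> ^ DIM('a)) * ?I"
  proof -
    have "ennreal (2 / m) = ennreal (1 / m) * 2"
      using m by (metis ennreal_mult' ennreal_numeral mult.commute mult_1 times_divide_eq_right
          zero_le_numeral)
    then show ?thesis using \<rho> by (simp add: emeasure_ball \<omega>_def[symmetric] distrib_left mult_ac)
  qed
  also have "ennreal (2 / m) * ennreal (\<omega> * \<rho> ^ DIM('a)) = ennreal (2 / \<kappa> ^ DIM('a))"
    using \<omega> \<rho> \<kappa> m by (simp add: ennreal_mult'[symmetric] m_def power_mult_distrib)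
  finally show ?thesis by (simp add: m_def \<omega>_def add.commute)
qed

text \<open>Iterates the step at the radii \<open>(1 - \<tau>) ^ i * \<rho>\<close>. The
  normalisation by \<open>\<rho> ^ DIM('a)\<close> makes both sides scale alike, so the constant
  depends on \<open>n\<close> only; in particular it is uniform in \<open>c\<close>, which later
  becomes a value of \<open>f\<close>.\<close>

lemma square_deviation_shrink:
  "\<exists>C<top. \<forall>f c w \<rho>. f \<in> borel_measurable borel \<longrightarrow> \<rho> > 0 \<longrightarrow>
    (\<integral>\<^sup>+x\<in>ball w \<rho>. ennreal ((f x - c)\<^sup>2) \<partial>lborel) \<le>
    C * ((\<integral>\<^sup>+x\<in>ball w ((1 - \<tau>) ^ n * \<rho>). ennreal ((f x - c)\<^sup>2) \<partial>lborel) +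
      ennreal (1 / \<rho> ^ DIM('a)) * dint (ball w \<rho>) (Gsq f))"
proof (induction n)
  case 0
  show ?case by (intro exI[of _ 1]) auto
next
  case (Suc n)
  then obtain C where C: "C < top" and
    IH: "\<forall>f c w \<rho>. f \<in> borel_measurable borel \<longrightarrow> \<rho> > 0 \<longrightarrow>
    (\<integral>\<^sup>+x\<in>ball w \<rho>. ennreal ((f x - c)\<^sup>2) \<partial>lborel) \<le>
    C * ((\<integral>\<^sup>+x\<in>ball w ((1 - \<tau>) ^ n * \<rho>). ennreal ((f x - c)\<^sup>2) \<partial>lborel) +
      ennreal (1 / \<rho> ^ DIM('a)) * dint (ball w \<rho>) (Gsq f))"
    by blast
  define q where "q = (1 - \<tau>) ^ n"
  have q: "0 < q" "q \<le> 1" using \<tau> by (auto simp: q_def power_le_one)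
  define \<omega> where "\<omega> = unit_ball_vol (real DIM('a))"
  have \<omega>: "\<omega> > 0" by (simp add: \<omega>_def)
  define C1 where "C1 = ennreal (2 / \<kappa> ^ DIM('a))"
  define C2 where "C2 = ennreal (2 / (\<omega> * (\<kappa> * q) ^ DIM('a)))"
  show ?case
  proof (intro exI[of _ "C * (C1 + C2 + 1)"] conjI allI impI)
    show "C * (C1 + C2 + 1) < top"
      using C by (simp add: C1_def C2_def ennreal_mult_less_top)
    fix f :: "'a \<Rightarrow> real" and c w \<rho> assume [measurable]: "f \<in> borel_measurable borel" and \<rho>: "(\<rho>::real) > 0"
    let ?I = "\<lambda>r. \<integral>\<^sup>+x\<in>ball w r. ennreal ((f x - c)\<^sup>2) \<partial>lborel"
    let ?J = "ennreal (1 / \<rho> ^ DIM('a)) * dint (ball w \<rho>) (Gsq f)"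
    have "?I (q * \<rho>) \<le> C1 * ?I ((1 - \<tau>) * (q * \<rho>)) +
        ennreal (2 / (\<omega> * (\<kappa> * (q * \<rho>)) ^ DIM('a))) * dint (ball w (q * \<rho>)) (Gsq f)"
      unfolding C1_def \<omega>_def by (rule square_deviation_step) (use q \<rho> in auto)
    also have "ennreal (2 / (\<omega> * (\<kappa> * (q * \<rho>)) ^ DIM('a))) = C2 * ennreal (1 / \<rho> ^ DIM('a))"
      using \<kappa> q \<rho> \<omega> by (simp add: C2_def ennreal_mult'[symmetric] power_mult_distrib mult_ac)
    also have "C1 * ?I ((1 - \<tau>) * (q * \<rho>)) +
        C2 * ennreal (1 / \<rho> ^ DIM('a)) * dint (ball w (q * \<rho>)) (Gsq f) \<le>
        C1 * ?I ((1 - \<tau>) * (q * \<rho>)) + C2 * ennreal (1 / \<rho> ^ DIM('a)) * dint (ball w \<rho>) (Gsq f)"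
      using q \<rho> by (intro add_left_mono mult_left_mono dint_mono subset_ball) (auto simp: mult_left_le_one_le)
    finally have 1: "?I (q * \<rho>) \<le> C1 * ?I ((1 - \<tau>) ^ Suc n * \<rho>) + C2 * ?J"
      by (simp add: q_def mult.assoc)
    have "?I \<rho> \<le> C * (?I (q * \<rho>) + ?J)" unfolding q_def by (rule IH[rule_format]) (use \<rho> in auto)
    also have "\<dots> \<le> C * ((C1 * ?I ((1 - \<tau>) ^ Suc n * \<rho>) + C2 * ?J) + ?J)"
      by (intro mult_left_mono add_right_mono 1) auto
    also have "\<dots> \<le> C * ((C1 + C2 + 1) * (?I ((1 - \<tau>) ^ Suc n * \<rho>) + ?J))"
    proof -
      have "(C1 + C2 + 1) * (a + b) = (C1 * a + C2 * b + b) + (C1 * b + C2 * a + a)" for a b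
        by (simp only: distrib_left distrib_right mult_1 add_ac)
      then show ?thesis by (intro mult_left_mono) (auto intro: add_increasing2)
    qed
    finally show "?I \<rho> \<le> C * (C1 + C2 + 1) * (?I ((1 - \<tau>) ^ Suc n * \<rho>) + ?J)"
      by (simp add: mult.assoc)
  qed
qed

text \<open>For each \<open>y\<close> the shrinking is run around the centre \<open>b\<close> of a
  ball contained in the cone at \<open>y\<close>, with \<open>c = f y\<close>. It ends inside that
  ball, where all differences \<open>f x - f y\<close> are cone differences. The factor 3 comes from
  \<open>ball p \<rho> \<subseteq> ball b (2 * \<rho>) \<subseteq> ball p (3 *
  \<rho>)\<close>.\<close>

lemma dint_ball_le:
  "\<exists>C<top. \<forall>f p \<rho>. f \<in> borel_measurable borel \<longrightarrow> \<rho> > 0 \<longrightarrow>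
    dint (ball p \<rho>) (sqd f) \<le> C * dint (ball p (3 * \<rho>)) (Gsq f)"
proof -
  \<comment> \<open>The shrinking starts with radius \<open>2 * \<rho>\<close> and must reach a
    radius below \<open>\<kappa> * \<rho>\<close>, hence the threshold
    \<open>\<kappa> / 2\<close>.\<close>
  obtain n where n: "(1 - \<tau>) ^ n < \<kappa> / 2"
    using real_arch_pow_inv[of "\<kappa> / 2" "1 - \<tau>"] \<kappa> \<tau> by auto
  obtain C where C: "C < top" and
    shr: "\<forall>f c w \<rho>. f \<in> borel_measurable borel \<longrightarrow> \<rho> > 0 \<longrightarrow>
    (\<integral>\<^sup>+x\<in>ball w \<rho>. ennreal ((f x - c)\<^sup>2) \<partial>lborel) \<le>
    C * ((\<integral>\<^sup>+x\<in>ball w ((1 - \<tau>) ^ n * \<rho>). ennreal ((f x - c)\<^sup>2) \<partial>lborel) +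
      ennreal (1 / \<rho> ^ DIM('a)) * dint (ball w \<rho>) (Gsq f))"
    using square_deviation_shrink[of n] by blast
  define \<omega> where "\<omega> = unit_ball_vol (real DIM('a))"
  have \<omega>: "\<omega> > 0" by (simp add: \<omega>_def)
  show ?thesis
  proof (intro exI[of _ "C * (1 + ennreal \<omega>)"] conjI allI impI)
    show "C * (1 + ennreal \<omega>) < top" using C by (simp add: ennreal_mult_less_top)
    fix f :: "'a \<Rightarrow> real" and p \<rho> assume [measurable]: "f \<in> borel_measurable borel" and \<rho>: "(\<rho>::real) > 0"
    let ?D = "dint (ball p (3 * \<rho>)) (Gsq f)"
    let ?h = "\<lambda>y. \<integral>\<^sup>+z\<in>ball p (3 * \<rho>). Gsq f y z \<partial>lborel"
    have pt: "(\<integral>\<^sup>+x\<in>ball p \<rho>. sqd f y x \<partial>lborel) \<le> C * (?h y + ennreal (1 / \<rho> ^ DIM('a)) * ?D)"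
      if y: "y \<in> ball p \<rho>" for y
    proof -
      obtain b where b: "ball b (\<kappa> * \<rho>) \<subseteq> {z. (y, z) \<in> G} \<inter> ball p ((1 - \<tau>) * \<rho>)"
        using thick[OF \<rho> y] by blast
      have sub: "ball p ((1 - \<tau>) * \<rho>) \<subseteq> ball p \<rho>"
        using \<rho> \<tau> by (intro subset_ball) (simp add: mult_left_le_one_le)
      have "b \<in> ball b (\<kappa> * \<rho>)" using \<kappa> \<rho> by simp
      then have "b \<in> ball p \<rho>" using b sub by blast
      then have bp: "dist p b < \<rho>" by simp
      have s1: "ball p \<rho> \<subseteq> ball b (2 * \<rho>)"
      proof
        fix x assume "x \<in> ball p \<rho>"
        then show "x \<in> ball b (2 * \<rho>)"
          using bp dist_triangle[of b x p] by (simp add: dist_commute)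
      qed
      have s2: "ball b (2 * \<rho>) \<subseteq> ball p (3 * \<rho>)"
      proof
        fix x assume "x \<in> ball b (2 * \<rho>)"
        then show "x \<in> ball p (3 * \<rho>)" using bp dist_triangle[of p x b] by simp
      qed
      have s4: "ball p \<rho> \<subseteq> ball p (3 * \<rho>)" using \<rho> by (intro subset_ball) simp
      have "(1 - \<tau>) ^ n * (2 * \<rho>) \<le> \<kappa> / 2 * (2 * \<rho>)" using n \<rho> by (intro mult_right_mono) auto
      then have s3: "ball b ((1 - \<tau>) ^ n * (2 * \<rho>)) \<subseteq> ball b (\<kappa> * \<rho>)" by (intro subset_ball) simp
      have "(\<integral>\<^sup>+x\<in>ball p \<rho>. sqd f y x \<partial>lborel) \<le> (\<integral>\<^sup>+x\<in>ball b (2 * \<rho>). ennreal ((f x - f y)\<^sup>2) \<partial>lborel)"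
        using s1 by (intro set_nn_integral_mono) (auto simp: sqd_def)
      also have "\<dots> \<le> C * ((\<integral>\<^sup>+x\<in>ball b ((1 - \<tau>) ^ n * (2 * \<rho>)). ennreal ((f x - f y)\<^sup>2) \<partial>lborel) +
          ennreal (1 / (2 * \<rho>) ^ DIM('a)) * dint (ball b (2 * \<rho>)) (Gsq f))"
        by (rule shr[rule_format]) (use \<rho> in auto)
      also have "\<dots> \<le> C * (?h y + ennreal (1 / \<rho> ^ DIM('a)) * ?D)"
      proof (intro mult_left_mono add_mono mult_mono)
        show "(\<integral>\<^sup>+x\<in>ball b ((1 - \<tau>) ^ n * (2 * \<rho>)). ennreal ((f x - f y)\<^sup>2) \<partial>lborel) \<le> ?h y"
        proof (rule set_nn_integral_mono)
          fix x assume "x \<in> ball b ((1 - \<tau>) ^ n * (2 * \<rho>))"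
          then have "(y, x) \<in> G" using b s3 by blast
          then show "ennreal ((f x - f y)\<^sup>2) \<le> Gsq f y x" by (simp add: Gsq_def sqd_def)
        next
          show "ball b ((1 - \<tau>) ^ n * (2 * \<rho>)) \<subseteq> ball p (3 * \<rho>)"
            using s3 b sub s4 by blast
        qed
        have "\<rho> ^ DIM('a) \<le> (2 * \<rho>) ^ DIM('a)" using \<rho> by (intro power_mono) auto
        then show "ennreal (1 / (2 * \<rho>) ^ DIM('a)) \<le> ennreal (1 / \<rho> ^ DIM('a))"
          using \<rho> by (intro ennreal_leI divide_left_mono) auto
        show "dint (ball b (2 * \<rho>)) (Gsq f) \<le> ?D" by (intro dint_mono s2) auto
      qed auto
      finally show ?thesis .
    qed
    have "dint (ball p \<rho>) (sqd f) \<le> (\<integral>\<^sup>+y\<in>ball p \<rho>. C * (?h y + ennreal (1 / \<rho> ^ DIM('a)) * ?D) \<partial>lborel)"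
      unfolding dint_def[of "ball p \<rho>"] by (intro set_nn_integral_mono pt) auto
    also have "\<dots> = C * (\<integral>\<^sup>+y\<in>ball p \<rho>. ?h y + ennreal (1 / \<rho> ^ DIM('a)) * ?D \<partial>lborel)"
      by (rule set_nn_integral_cmult) measurable
    also have "\<dots> = C * ((\<integral>\<^sup>+y\<in>ball p \<rho>. ?h y \<partial>lborel) +
        ennreal (1 / \<rho> ^ DIM('a)) * ?D * emeasure lborel (ball p \<rho>))"
      using set_nn_integral_linear[of ?h lborel "\<lambda>_. ennreal (1 / \<rho> ^ DIM('a)) * ?D" "ball p \<rho>" 1 1]
      by (simp add: set_nn_integral_const)
    also have "ennreal (1 / \<rho> ^ DIM('a)) * ?D * emeasure lborel (ball p \<rho>) = ennreal \<omega> * ?D"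
    proof -
      have "ennreal (1 / \<rho> ^ DIM('a)) * emeasure lborel (ball p \<rho>) = ennreal \<omega>"
        using \<rho> \<omega> by (simp add: emeasure_ball ennreal_mult'[symmetric] \<omega>_def)
      then show ?thesis by (metis mult.assoc mult.commute)
    qed
    also have "(\<integral>\<^sup>+y\<in>ball p \<rho>. ?h y \<partial>lborel) \<le> ?D"
      unfolding dint_def using \<rho> by (intro set_nn_integral_mono subset_ball) auto
    finally show "dint (ball p \<rho>) (sqd f) \<le> C * (1 + ennreal \<omega>) * ?D"
      by (simp add: distrib_left distrib_right mult.assoc add_right_mono mult_left_mono)
  qed
qed

end

section \<open>Fractional energy of a ball\<close>

lemma nn_integral_lborel_pair:
  fixes f :: "'a::euclidean_space \<times> 'b::euclidean_space \<Rightarrow> ennreal"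
  assumes "f \<in> borel_measurable borel"
  shows "(\<integral>\<^sup>+z. f z \<partial>lborel) = (\<integral>\<^sup>+x. \<integral>\<^sup>+y. f (x, y) \<partial>lborel \<partial>lborel)"
proof -
  have "f \<in> borel_measurable (lborel \<Otimes>\<^sub>M lborel)" using assms by (simp add: lborel_prod)
  from lborel.nn_integral_fst[OF this] show ?thesis by (simp add: lborel_prod)
qed

lemma nn_integral_lborel_swap:
  fixes f :: "'a::euclidean_space \<Rightarrow> 'b::euclidean_space \<Rightarrow> ennreal"
  assumes "case_prod f \<in> borel_measurable (borel \<Otimes>\<^sub>M borel)"
  shows "(\<integral>\<^sup>+x. \<integral>\<^sup>+y. f x y \<partial>lborel \<partial>lborel) = (\<integral>\<^sup>+y. \<integral>\<^sup>+x. f x y \<partial>lborel \<partial>lborel)"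
  by (rule lborel_pair.Fubini'[symmetric]) (use assms in simp)

lemma nn_integral_powr_tail:
  fixes l \<beta> :: real
  assumes "l > 0" "\<beta> > 0"
  shows "(\<integral>\<^sup>+t\<in>{l..}. ennreal (t powr (- \<beta> - 1)) \<partial>lborel) = ennreal (l powr (- \<beta>) / \<beta>)"
proof -
  have "(\<integral>\<^sup>+t\<in>{l..}. ennreal (t powr (- \<beta> - 1)) \<partial>lborel) = ennreal (0 - (- (l powr (- \<beta>) / \<beta>)))"
  proof (rule nn_integral_FTC_atLeast)
    show "DERIV (\<lambda>t. - (t powr (- \<beta>) / \<beta>)) x :> x powr (- \<beta> - 1)" if "l \<le> x" for x
      using that assms by (auto intro!: derivative_eq_intros)
    have "((\<lambda>t. t powr (- \<beta>)) \<longlongrightarrow> 0) at_top"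
      using assms by (intro tendsto_neg_powr filterlim_ident) auto
    from tendsto_minus[OF tendsto_divide[OF this tendsto_const[of \<beta>]]] assms
    show "((\<lambda>t. - (t powr (- \<beta>) / \<beta>)) \<longlongrightarrow> 0) at_top" by simp
  qed auto
  then show ?thesis by simp
qed

lemma frac_kernel_measurable [measurable]:
  fixes g h :: "'b \<Rightarrow> 'a::euclidean_space"
  assumes [measurable]: "g \<in> borel_measurable M" "h \<in> borel_measurable M"
  shows "(\<lambda>x. frac_kernel \<alpha> (g x) (h x)) \<in> borel_measurable M"
  unfolding frac_kernel_def by measurable

lemma frac_kernel_sym: "frac_kernel \<alpha> x y = frac_kernel \<alpha> y x"
  by (simp add: frac_kernel_def norm_minus_commute)

text \<open>Grouping the variables as \<open>(t, x)\<close> and \<open>(a, b)\<close> reduces the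
  exchange of four integrals to a single use of Tonelli. The shift along \<open>e\<close> serves the
  boundary estimate; the interior estimate takes \<open>e = 0\<close>.\<close>

lemma dint_swap:
  fixes \<Phi> :: "'a::euclidean_space \<Rightarrow> 'a \<Rightarrow> ennreal" and W :: "real \<Rightarrow> 'a \<Rightarrow> ennreal"
  assumes [measurable]: "case_prod \<Phi> \<in> borel_measurable (borel \<Otimes>\<^sub>M borel)"
    "case_prod W \<in> borel_measurable (borel \<Otimes>\<^sub>M borel)"
  shows "(\<integral>\<^sup>+t. \<integral>\<^sup>+x. W t x * dint (ball (x + t *\<^sub>R e) (c * t)) \<Phi> \<partial>lborel \<partial>lborel) =
    (\<integral>\<^sup>+a. \<integral>\<^sup>+b. \<Phi> a b * (\<integral>\<^sup>+t. \<integral>\<^sup>+x. W t x * indicator (ball (x + t *\<^sub>R e) (c * t)) a *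
      indicator (ball (x + t *\<^sub>R e) (c * t)) b \<partial>lborel \<partial>lborel) \<partial>lborel \<partial>lborel)"
proof -
  define \<Psi> :: "real \<times> 'a \<Rightarrow> 'a \<times> 'a \<Rightarrow> ennreal" where
    "\<Psi> = (\<lambda>z w. W (fst z) (snd z) * indicator (ball (snd z + fst z *\<^sub>R e) (c * fst z)) (fst w) *
      indicator (ball (snd z + fst z *\<^sub>R e) (c * fst z)) (snd w) * \<Phi> (fst w) (snd w))"
  have [measurable]: "(\<lambda>(z, w). \<Psi> z w) \<in> borel_measurable ((borel \<Otimes>\<^sub>M borel) \<Otimes>\<^sub>M (borel \<Otimes>\<^sub>M borel))"
    unfolding \<Psi>_def by measurable
  have [measurable]: "case_prod \<Psi> \<in> borel_measurable (borel \<Otimes>\<^sub>M borel)"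
    using \<open>(\<lambda>(z, w). \<Psi> z w) \<in> _\<close> by (simp add: borel_prod)
  have "(\<integral>\<^sup>+t. \<integral>\<^sup>+x. W t x * dint (ball (x + t *\<^sub>R e) (c * t)) \<Phi> \<partial>lborel \<partial>lborel) =
      (\<integral>\<^sup>+t. \<integral>\<^sup>+x. \<integral>\<^sup>+a. \<integral>\<^sup>+b. \<Psi> (t, x) (a, b) \<partial>lborel \<partial>lborel \<partial>lborel \<partial>lborel)"
    unfolding dint_def \<Psi>_def
    by (simp add: nn_integral_cmult[symmetric] nn_integral_multc[symmetric] mult_ac)
  also have "\<dots> = (\<integral>\<^sup>+z. \<integral>\<^sup>+w. \<Psi> z w \<partial>lborel \<partial>lborel)"
    by (simp add: nn_integral_lborel_pair)
  also have "\<dots> = (\<integral>\<^sup>+w. \<integral>\<^sup>+z. \<Psi> z w \<partial>lborel \<partial>lborel)"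
    by (rule nn_integral_lborel_swap) measurable
  also have "\<dots> = (\<integral>\<^sup>+a. \<integral>\<^sup>+b. \<integral>\<^sup>+t. \<integral>\<^sup>+x. \<Psi> (t, x) (a, b) \<partial>lborel \<partial>lborel \<partial>lborel \<partial>lborel)"
    by (simp add: nn_integral_lborel_pair)
  also have "\<dots> = (\<integral>\<^sup>+a. \<integral>\<^sup>+b. \<Phi> a b * (\<integral>\<^sup>+t. \<integral>\<^sup>+x. W t x * indicator (ball (x + t *\<^sub>R e) (c * t)) a *
      indicator (ball (x + t *\<^sub>R e) (c * t)) b \<partial>lborel \<partial>lborel) \<partial>lborel \<partial>lborel)"
    unfolding \<Psi>_def by (simp add: nn_integral_cmult[symmetric] mult_ac)
  finally show ?thesis .
qed

text \<open>A pair \<open>a, b\<close> lies in the ball of parameters \<open>t, x\<close> only if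
  \<open>t\<close> is at least \<open>norm (a - b) / (2 * c)\<close>, and then for a set of
  \<open>x\<close> of volume at most that of a ball of radius \<open>c * t\<close>. The weight is
  chosen so that the remaining integral over \<open>t\<close> is a multiple of
  \<open>norm (a - b) powr (- d - \<alpha>)\<close>, where \<open>d\<close> is the
  dimension.\<close>

lemma scale_integral_le:
  fixes \<Phi> :: "'a::euclidean_space \<Rightarrow> 'a \<Rightarrow> ennreal" and e :: 'a and \<alpha> c :: real
  assumes [measurable]: "case_prod \<Phi> \<in> borel_measurable (borel \<Otimes>\<^sub>M borel)"
    and \<alpha>: "0 < \<alpha>" and c: "0 < c"
  defines "C \<equiv> ennreal (unit_ball_vol DIM('a) * c ^ DIM('a) *
    ((1 / (2 * c)) powr (- real DIM('a) - \<alpha>) / (real DIM('a) + \<alpha>)))"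
  shows "(\<integral>\<^sup>+t\<in>{0<..}. ennreal (t powr (- \<alpha> - 1 - 2 * real DIM('a))) *
      (\<integral>\<^sup>+x. dint (ball (x + t *\<^sub>R e) (c * t)) \<Phi> \<partial>lborel) \<partial>lborel) \<le>
    C * (\<integral>\<^sup>+a. \<integral>\<^sup>+b. \<Phi> a b * frac_kernel \<alpha> a b \<partial>lborel \<partial>lborel)"
proof -
  define d where "d = real DIM('a)"
  have d: "d > 0" by (simp add: d_def)
  define \<omega> where "\<omega> = unit_ball_vol d"
  have \<omega>: "\<omega> > 0" using d by (simp add: \<omega>_def)
  define W :: "real \<Rightarrow> 'a \<Rightarrow> ennreal" where "W = (\<lambda>t x. indicator {0<..} t * ennreal (t powr (- \<alpha> - 1 - 2 * d)))"
  have [measurable]: "case_prod W \<in> borel_measurable (borel \<Otimes>\<^sub>M borel)" unfolding W_def by measurable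
  have dm: "(\<lambda>x. dint (ball (x + t *\<^sub>R e) (c * t)) \<Phi>) \<in> borel_measurable borel" for t
    unfolding dint_def by measurable
  have "(\<integral>\<^sup>+t\<in>{0<..}. ennreal (t powr (- \<alpha> - 1 - 2 * real DIM('a))) *
      (\<integral>\<^sup>+x. dint (ball (x + t *\<^sub>R e) (c * t)) \<Phi> \<partial>lborel) \<partial>lborel) =
      (\<integral>\<^sup>+t. \<integral>\<^sup>+x. W t x * dint (ball (x + t *\<^sub>R e) (c * t)) \<Phi> \<partial>lborel \<partial>lborel)"
  proof (rule nn_integral_cong)
    fix t
    have "(\<integral>\<^sup>+x. W t x * dint (ball (x + t *\<^sub>R e) (c * t)) \<Phi> \<partial>lborel) =
        indicator {0<..} t * ennreal (t powr (- \<alpha> - 1 - 2 * d)) * (\<integral>\<^sup>+x. dint (ball (x + t *\<^sub>R e) (c * t)) \<Phi> \<partial>lborel)"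
      unfolding W_def by (rule nn_integral_cmult) (use dm in simp)
    then show "ennreal (t powr (- \<alpha> - 1 - 2 * real DIM('a))) *
      (\<integral>\<^sup>+x. dint (ball (x + t *\<^sub>R e) (c * t)) \<Phi> \<partial>lborel) * indicator {0<..} t =
      (\<integral>\<^sup>+x. W t x * dint (ball (x + t *\<^sub>R e) (c * t)) \<Phi> \<partial>lborel)"
      by (simp add: d_def mult_ac)
  qed
  also have "\<dots> = (\<integral>\<^sup>+a. \<integral>\<^sup>+b. \<Phi> a b * (\<integral>\<^sup>+t. \<integral>\<^sup>+x. W t x * indicator (ball (x + t *\<^sub>R e) (c * t)) a *
      indicator (ball (x + t *\<^sub>R e) (c * t)) b \<partial>lborel \<partial>lborel) \<partial>lborel \<partial>lborel)"
    by (rule dint_swap) measurable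
  also have "\<dots> \<le> (\<integral>\<^sup>+a. \<integral>\<^sup>+b. C * (\<Phi> a b * frac_kernel \<alpha> a b) \<partial>lborel \<partial>lborel)"
  proof (intro nn_integral_mono)
    fix a b :: 'a
    have "(\<integral>\<^sup>+t. \<integral>\<^sup>+x. W t x * indicator (ball (x + t *\<^sub>R e) (c * t)) a *
      indicator (ball (x + t *\<^sub>R e) (c * t)) b \<partial>lborel \<partial>lborel) \<le> C * frac_kernel \<alpha> a b"
    proof (cases "a = b")
      case True
      \<comment> \<open>On the diagonal the kernel is infinite, and the bound is trivial exactly
        because the constant does not vanish: \<open>0 * \<infinity>\<close> would be
        \<open>0\<close>.\<close>
      have "C > 0" using \<omega> c d \<alpha> by (simp add: C_def \<omega>_def d_def ennreal_less_zero_iff)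
      then show ?thesis using True by (simp add: frac_kernel_def ennreal_mult_top)
    next
      case False
      define l where "l = norm (a - b)"
      have l: "l > 0" using False by (simp add: l_def)
      have "(\<integral>\<^sup>+x. W t x * indicator (ball (x + t *\<^sub>R e) (c * t)) a *
          indicator (ball (x + t *\<^sub>R e) (c * t)) b \<partial>lborel) \<le>
          ennreal (\<omega> * c ^ DIM('a)) * (ennreal (t powr (- (d + \<alpha>) - 1)) * indicator {l / (2 * c)..} t)" for t
      proof (cases "l / (2 * c) \<le> t")
        case True
        have t: "t > 0" using True l c by (smt (verit) divide_pos_pos)
        have "(\<integral>\<^sup>+x. W t x * indicator (ball (x + t *\<^sub>R e) (c * t)) a *
          indicator (ball (x + t *\<^sub>R e) (c * t)) b \<partial>lborel) \<le>
          (\<integral>\<^sup>+x. ennreal (t powr (- \<alpha> - 1 - 2 * d)) * indicator (ball (a - t *\<^sub>R e) (c * t)) x \<partial>lborel)"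
          by (intro nn_integral_mono)
            (auto simp: W_def indicator_def dist_norm norm_minus_commute algebra_simps)
        also have "\<dots> = ennreal (t powr (- \<alpha> - 1 - 2 * d)) * ennreal (\<omega> * (c * t) ^ DIM('a))"
          using c t by (simp add: nn_integral_cmult_indicator emeasure_ball \<omega>_def d_def)
        also have "\<dots> = ennreal (\<omega> * c ^ DIM('a)) * ennreal (t powr (- (d + \<alpha>) - 1))"
        proof -
          have "t ^ DIM('a) = t powr d" using t by (simp add: powr_realpow d_def)
          then have "t powr (- \<alpha> - 1 - 2 * d) * t ^ DIM('a) = t powr ((- \<alpha> - 1 - 2 * d) + d)"
            by (simp only: powr_add)
          also have "(- \<alpha> - 1 - 2 * d) + d = - (d + \<alpha>) - 1" by simp
          finally have "t powr (- \<alpha> - 1 - 2 * d) * t ^ DIM('a) = t powr (- (d + \<alpha>) - 1)" .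
          then have e: "t powr (- \<alpha> - 1 - 2 * d) * (\<omega> * (c * t) ^ DIM('a)) =
              \<omega> * c ^ DIM('a) * t powr (- (d + \<alpha>) - 1)"
            by (simp add: power_mult_distrib mult_ac)
          have "ennreal (t powr (- \<alpha> - 1 - 2 * d)) * ennreal (\<omega> * (c * t) ^ DIM('a)) =
              ennreal (t powr (- \<alpha> - 1 - 2 * d) * (\<omega> * (c * t) ^ DIM('a)))"
            by (rule ennreal_mult'[symmetric]) simp
          also have "\<dots> = ennreal (\<omega> * c ^ DIM('a)) * ennreal (t powr (- (d + \<alpha>) - 1))"
            unfolding e using \<omega> c by (intro ennreal_mult') simp
          finally show ?thesis .
        qed
        finally show ?thesis using True by simp
      next
        case False
        have "a \<notin> ball (x + t *\<^sub>R e) (c * t) \<or> b \<notin> ball (x + t *\<^sub>R e) (c * t)" for x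
        proof (rule ccontr)
          assume "\<not> ?thesis"
          then have "dist a b < 2 * (c * t)"
            using dist_triangle[of a b "x + t *\<^sub>R e"] by (simp add: dist_commute)
          then show False using False c by (simp add: l_def dist_norm field_simps)
        qed
        then have z: "W t x * indicator (ball (x + t *\<^sub>R e) (c * t)) a *
          indicator (ball (x + t *\<^sub>R e) (c * t)) b = 0" for x by (auto simp: indicator_def)
        show ?thesis unfolding z by simp
      qed
      then have "(\<integral>\<^sup>+t. \<integral>\<^sup>+x. W t x * indicator (ball (x + t *\<^sub>R e) (c * t)) a *
          indicator (ball (x + t *\<^sub>R e) (c * t)) b \<partial>lborel \<partial>lborel) \<le>
          (\<integral>\<^sup>+t. ennreal (\<omega> * c ^ DIM('a)) * (ennreal (t powr (- (d + \<alpha>) - 1)) * indicator {l / (2 * c)..} t) \<partial>lborel)"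
        by (intro nn_integral_mono) auto
      also have "\<dots> = ennreal (\<omega> * c ^ DIM('a)) *
          (\<integral>\<^sup>+t\<in>{l / (2 * c)..}. ennreal (t powr (- (d + \<alpha>) - 1)) \<partial>lborel)"
        by (rule nn_integral_cmult) measurable
      also have "(\<integral>\<^sup>+t\<in>{l / (2 * c)..}. ennreal (t powr (- (d + \<alpha>) - 1)) \<partial>lborel) =
          ennreal ((l / (2 * c)) powr (- (d + \<alpha>)) / (d + \<alpha>))"
        by (rule nn_integral_powr_tail) (use d \<alpha> l c in auto)
      also have "ennreal (\<omega> * c ^ DIM('a)) * ennreal ((l / (2 * c)) powr (- (d + \<alpha>)) / (d + \<alpha>)) =
          C * frac_kernel \<alpha> a b"
      proof -
        have "(l / (2 * c)) powr (- (d + \<alpha>)) = (1 / (2 * c)) powr (- d - \<alpha>) * l powr (- d - \<alpha>)"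
          using l c powr_mult[of "1 / (2 * c)" l "- d - \<alpha>"] by simp
        then have e: "\<omega> * c ^ DIM('a) * ((l / (2 * c)) powr (- (d + \<alpha>)) / (d + \<alpha>)) =
            \<omega> * c ^ DIM('a) * ((1 / (2 * c)) powr (- d - \<alpha>) / (d + \<alpha>)) * l powr (- d - \<alpha>)"
          by simp
        have "ennreal (\<omega> * c ^ DIM('a)) * ennreal ((l / (2 * c)) powr (- (d + \<alpha>)) / (d + \<alpha>)) =
            ennreal (\<omega> * c ^ DIM('a) * ((l / (2 * c)) powr (- (d + \<alpha>)) / (d + \<alpha>)))"
          using \<omega> c by (intro ennreal_mult'[symmetric]) simp
        also have "\<dots> = C * ennreal (l powr (- d - \<alpha>))"
        proof -
          have "C = ennreal (\<omega> * c ^ DIM('a) * ((1 / (2 * c)) powr (- d - \<alpha>) / (d + \<alpha>)))"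
            by (simp only: C_def \<omega>_def d_def)
          then show ?thesis
            using e \<omega> c d \<alpha> ennreal_mult'[of "\<omega> * c ^ DIM('a) * ((1 / (2 * c)) powr (- d - \<alpha>) / (d + \<alpha>))"
                "l powr (- d - \<alpha>)"] by (simp only: e) auto
        qed
        finally show ?thesis using False by (simp add: frac_kernel_def l_def d_def)
      qed
      finally show ?thesis .
    qed
    then have "\<Phi> a b * (\<integral>\<^sup>+t. \<integral>\<^sup>+x. W t x * indicator (ball (x + t *\<^sub>R e) (c * t)) a *
      indicator (ball (x + t *\<^sub>R e) (c * t)) b \<partial>lborel \<partial>lborel) \<le> \<Phi> a b * (C * frac_kernel \<alpha> a b)"
      by (rule mult_left_mono) simp
    then show "\<Phi> a b * (\<integral>\<^sup>+t. \<integral>\<^sup>+x. W t x * indicator (ball (x + t *\<^sub>R e) (c * t)) a *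
      indicator (ball (x + t *\<^sub>R e) (c * t)) b \<partial>lborel \<partial>lborel) \<le> C * (\<Phi> a b * frac_kernel \<alpha> a b)"
      by (simp add: mult_ac)
  qed
  also have "\<dots> = C * (\<integral>\<^sup>+a. \<integral>\<^sup>+b. \<Phi> a b * frac_kernel \<alpha> a b \<partial>lborel \<partial>lborel)"
    by (simp add: nn_integral_cmult)
  finally show ?thesis .
qed

lemma dint_conv: "dint S \<Phi> = (\<integral>\<^sup>+x. \<integral>\<^sup>+y. \<Phi> x y * (indicator S x * indicator S y) \<partial>lborel \<partial>lborel)"
  unfolding dint_def by (intro nn_integral_cong) (auto simp: indicator_def)

text \<open>The converse of \<open>scale_integral_le\<close>, with localised parameters. With
  \<open>l = norm (x - y)\<close>, the scales \<open>t\<close> in \<open>{2 * l..<4 * l}\<close> and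
  the centres \<open>w\<close> in \<open>ball x l\<close> already produce a multiple of
  \<open>l powr (- d - \<alpha>)\<close>. Since \<open>l < 2 * r\<close>, they satisfy
  \<open>t < 8 * r\<close> and \<open>w \<in> ball p (3 * r)\<close>.\<close>

lemma frac_kernel_le_scale_integral:
  fixes x y p :: "'a::euclidean_space"
  assumes \<alpha>: "0 < \<alpha>" and xy: "x \<noteq> y" and x: "x \<in> ball p r" and y: "y \<in> ball p r"
  defines "C \<equiv> ennreal (1 / (2 * unit_ball_vol DIM('a) * 4 powr (- \<alpha> - 1 - 2 * real DIM('a))))"
  shows "frac_kernel \<alpha> x y \<le> C * (\<integral>\<^sup>+t. \<integral>\<^sup>+w. indicator {0<..<8 * r} t * indicator (ball p (3 * r)) w *
    ennreal (t powr (- \<alpha> - 1 - 2 * real DIM('a))) * indicator (ball w t) x * indicator (ball w t) y \<partial>lborel \<partial>lborel)"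
proof -
  define d where "d = real DIM('a)"
  have d: "d > 0" by (simp add: d_def)
  define \<omega> where "\<omega> = unit_ball_vol d"
  have \<omega>: "\<omega> > 0" using d by (simp add: \<omega>_def)
  define l where "l = norm (x - y)"
  have l: "l > 0" using xy by (simp add: l_def)
  have lr: "l < 2 * r" using x y dist_triangle[of x y p] by (simp add: l_def dist_norm norm_minus_commute)
  define \<gamma> where "\<gamma> = - \<alpha> - 1 - 2 * d"
  have \<gamma>: "\<gamma> < 0" using \<alpha> d by (simp add: \<gamma>_def)
  let ?W = "\<lambda>t w. indicator {0<..<8 * r} t * indicator (ball p (3 * r)) w *
    ennreal (t powr \<gamma>) * indicator (ball w t) x * indicator (ball w t) y"
  have in1: "ennreal ((4 * l) powr \<gamma>) * ennreal (\<omega> * l ^ DIM('a)) \<le> (\<integral>\<^sup>+w. ?W t w \<partial>lborel)"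
    if t: "t \<in> {2 * l..<4 * l}" for t
  proof -
    have "ennreal ((4 * l) powr \<gamma>) * ennreal (\<omega> * l ^ DIM('a)) =
        (\<integral>\<^sup>+w. ennreal ((4 * l) powr \<gamma>) * indicator (ball x l) w \<partial>lborel)"
      using l by (simp add: nn_integral_cmult_indicator emeasure_ball \<omega>_def d_def)
    also have "\<dots> \<le> (\<integral>\<^sup>+w. ?W t w \<partial>lborel)"
    proof (rule nn_integral_mono)
      fix w
      show "ennreal ((4 * l) powr \<gamma>) * indicator (ball x l) w \<le> ?W t w"
      proof (cases "w \<in> ball x l")
        case True
        have "w \<in> ball p (3 * r)" using True x lr dist_triangle[of p w x] by simp
        moreover have "x \<in> ball w t" using True t l by (simp add: dist_commute)
        moreover have "y \<in> ball w t"
          using True t l dist_triangle[of w y x] by (simp add: dist_commute l_def dist_norm)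
        moreover have "(4 * l) powr \<gamma> \<le> t powr \<gamma>" using t l \<gamma> by (intro powr_mono2') auto
        ultimately show ?thesis using t l lr True by (simp add: ennreal_leI)
      qed simp
    qed
    finally show ?thesis .
  qed
  have "ennreal (2 * l) * (ennreal ((4 * l) powr \<gamma>) * ennreal (\<omega> * l ^ DIM('a))) \<le>
      (\<integral>\<^sup>+t\<in>{2 * l..<4 * l}. (\<integral>\<^sup>+w. ?W t w \<partial>lborel) \<partial>lborel)"
    using l by (intro nn_integral_ge_const_on in1) auto
  also have "\<dots> \<le> (\<integral>\<^sup>+t. (\<integral>\<^sup>+w. ?W t w \<partial>lborel) \<partial>lborel)"
    by (intro nn_integral_mono) (auto simp: indicator_def)
  finally have 1: "ennreal (2 * l) * (ennreal ((4 * l) powr \<gamma>) * ennreal (\<omega> * l ^ DIM('a))) \<le>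
      (\<integral>\<^sup>+t. (\<integral>\<^sup>+w. ?W t w \<partial>lborel) \<partial>lborel)" .
  have "l * l powr \<gamma> * l ^ DIM('a) = l powr (1 + \<gamma> + d)"
    using l by (simp add: powr_add powr_realpow d_def)
  also have "1 + \<gamma> + d = - d - \<alpha>" by (simp add: \<gamma>_def)
  finally have "2 * l * ((4 * l) powr \<gamma> * (\<omega> * l ^ DIM('a))) = 2 * \<omega> * 4 powr \<gamma> * l powr (- d - \<alpha>)"
    using l by (simp add: powr_mult mult_ac)
  then have "ennreal (2 * \<omega> * 4 powr \<gamma>) * frac_kernel \<alpha> x y =
      ennreal (2 * l) * (ennreal ((4 * l) powr \<gamma>) * ennreal (\<omega> * l ^ DIM('a)))"
    using xy \<omega> l by (simp add: frac_kernel_def l_def[symmetric] d_def[symmetric] ennreal_mult'[symmetric])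
  with 1 have "ennreal (2 * \<omega> * 4 powr \<gamma>) * frac_kernel \<alpha> x y \<le> (\<integral>\<^sup>+t. (\<integral>\<^sup>+w. ?W t w \<partial>lborel) \<partial>lborel)"
    by simp
  then have "frac_kernel \<alpha> x y \<le> ennreal (1 / (2 * \<omega> * 4 powr \<gamma>)) * (\<integral>\<^sup>+t. (\<integral>\<^sup>+w. ?W t w \<partial>lborel) \<partial>lborel)"
    using \<omega> by (intro ennreal_le_divide_mult) auto
  then show ?thesis by (simp add: C_def \<omega>_def \<gamma>_def d_def)
qed

context thick_relation
begin

text \<open>The kernel is written as an integral over balls, \<open>dint_ball_le\<close> is applied
  to each of them, and the integral is converted back. The factor is \<open>27 = 3 + 3 * 8\<close>:
  centres within \<open>3 * r\<close> of \<open>p\<close>, radii below \<open>8 * r\<close>, and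
  these radii tripled by \<open>dint_ball_le\<close>.\<close>

lemma frac_energy_ball_le:
  assumes \<alpha>: "0 < \<alpha>"
  shows "\<exists>C<top. \<forall>f p r. f \<in> borel_measurable borel \<longrightarrow>
    dint (ball p r) (\<lambda>x y. sqd f x y * frac_kernel \<alpha> x y) \<le>
    C * dint (ball p (27 * r)) (\<lambda>x y. Gsq f x y * frac_kernel \<alpha> x y)"
proof -
  obtain C1 where C1: "C1 < top" and dint_ball: "\<forall>f p \<rho>. f \<in> borel_measurable borel \<longrightarrow> \<rho> > 0 \<longrightarrow>
    dint (ball p \<rho>) (sqd f) \<le> C1 * dint (ball p (3 * \<rho>)) (Gsq f)"
    using dint_ball_le by blast
  define \<gamma> where "\<gamma> = - \<alpha> - 1 - 2 * real DIM('a)"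
  define C2 where "C2 = ennreal (1 / (2 * unit_ball_vol DIM('a) * 4 powr \<gamma>))"
  define C3 where "C3 = ennreal (unit_ball_vol DIM('a) * 3 ^ DIM('a) *
    ((1 / (2 * 3)) powr (- real DIM('a) - \<alpha>) / (real DIM('a) + \<alpha>)))"
  show ?thesis
  proof (intro exI[of _ "C2 * (C1 * C3)"] conjI allI impI)
    show "C2 * (C1 * C3) < top" using C1 by (simp add: C2_def C3_def ennreal_mult_less_top)
    fix f :: "'a \<Rightarrow> real" and p :: 'a and r :: real
    assume [measurable]: "f \<in> borel_measurable borel"
    define W :: "real \<Rightarrow> 'a \<Rightarrow> ennreal" where
      "W = (\<lambda>t w. indicator {0<..<8 * r} t * indicator (ball p (3 * r)) w * ennreal (t powr \<gamma>))"
    have [measurable]: "case_prod W \<in> borel_measurable (borel \<Otimes>\<^sub>M borel)" unfolding W_def by measurable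
    define \<Phi> where "\<Phi> = (\<lambda>x y. Gsq f x y * indicator (ball p (27 * r)) x * indicator (ball p (27 * r)) y)"
    have [measurable]: "case_prod \<Phi> \<in> borel_measurable (borel \<Otimes>\<^sub>M borel)"
      unfolding \<Phi>_def by measurable
    have [measurable]: "case_prod (sqd f) \<in> borel_measurable (borel \<Otimes>\<^sub>M borel)" by measurable
    have dm [measurable]: "(\<lambda>x. dint (ball (g x) (h x)) \<Phi>) \<in> borel_measurable M"
      if [measurable]: "g \<in> borel_measurable M" "h \<in> borel_measurable M" for g h and M :: "'c measure"
      unfolding dint_def by measurable
    have "dint (ball p r) (\<lambda>x y. sqd f x y * frac_kernel \<alpha> x y) \<le>
      (\<integral>\<^sup>+x. \<integral>\<^sup>+y. C2 * (sqd f x y * (\<integral>\<^sup>+t. \<integral>\<^sup>+w. W t w * indicator (ball (w + t *\<^sub>R 0) (1 * t)) x *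
        indicator (ball (w + t *\<^sub>R 0) (1 * t)) y \<partial>lborel \<partial>lborel)) \<partial>lborel \<partial>lborel)"
      unfolding dint_def
    proof (intro nn_integral_mono)
      fix x
      show "(\<integral>\<^sup>+y\<in>ball p r. sqd f x y * frac_kernel \<alpha> x y \<partial>lborel) * indicator (ball p r) x \<le>
        (\<integral>\<^sup>+y. C2 * (sqd f x y * (\<integral>\<^sup>+t. \<integral>\<^sup>+w. W t w * indicator (ball (w + t *\<^sub>R 0) (1 * t)) x *
        indicator (ball (w + t *\<^sub>R 0) (1 * t)) y \<partial>lborel \<partial>lborel)) \<partial>lborel)"
      proof (cases "x \<in> ball p r")
        case True
        have "(\<integral>\<^sup>+y\<in>ball p r. sqd f x y * frac_kernel \<alpha> x y \<partial>lborel) \<le>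
          (\<integral>\<^sup>+y. C2 * (sqd f x y * (\<integral>\<^sup>+t. \<integral>\<^sup>+w. W t w * indicator (ball (w + t *\<^sub>R 0) (1 * t)) x *
          indicator (ball (w + t *\<^sub>R 0) (1 * t)) y \<partial>lborel \<partial>lborel)) \<partial>lborel)"
        proof (rule nn_integral_mono)
          fix y
          show "sqd f x y * frac_kernel \<alpha> x y * indicator (ball p r) y \<le>
            C2 * (sqd f x y * (\<integral>\<^sup>+t. \<integral>\<^sup>+w. W t w * indicator (ball (w + t *\<^sub>R 0) (1 * t)) x *
            indicator (ball (w + t *\<^sub>R 0) (1 * t)) y \<partial>lborel \<partial>lborel))"
          \<comment> \<open>On the diagonal \<open>sqd f x y\<close> is \<open>0\<close>, which
            annihilates the infinite kernel.\<close>
          proof (cases "x = y \<or> y \<notin> ball p r")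
            case False
            then have "frac_kernel \<alpha> x y \<le> C2 * (\<integral>\<^sup>+t. \<integral>\<^sup>+w. W t w * indicator (ball (w + t *\<^sub>R 0) (1 * t)) x *
              indicator (ball (w + t *\<^sub>R 0) (1 * t)) y \<partial>lborel \<partial>lborel)"
              using frac_kernel_le_scale_integral[OF \<alpha>, of x y p r] True
              by (simp add: W_def C2_def \<gamma>_def)
            from mult_left_mono[OF this, of "sqd f x y"] False show ?thesis
              by (simp add: mult.left_commute)
          qed (auto simp: sqd_def)
        qed
        then show ?thesis using True by simp
      qed simp
    qed
    also have "\<dots> = C2 * (\<integral>\<^sup>+t. \<integral>\<^sup>+w. W t w * dint (ball (w + t *\<^sub>R 0) (1 * t)) (sqd f) \<partial>lborel \<partial>lborel)"
      by (subst dint_swap) (auto simp: nn_integral_cmult)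
    also have "\<dots> \<le> C2 * (\<integral>\<^sup>+t. \<integral>\<^sup>+w. C1 * (indicator {0<..} t * (ennreal (t powr \<gamma>) * dint (ball (w + t *\<^sub>R 0) (3 * t)) \<Phi>)) \<partial>lborel \<partial>lborel)"
    proof (intro mult_left_mono nn_integral_mono)
      fix t :: real and w
      show "W t w * dint (ball (w + t *\<^sub>R 0) (1 * t)) (sqd f) \<le>
        C1 * (indicator {0<..} t * (ennreal (t powr \<gamma>) * dint (ball (w + t *\<^sub>R 0) (3 * t)) \<Phi>))"
      proof (cases "t \<in> {0<..<8 * r} \<and> w \<in> ball p (3 * r)")
        case True
        have sub: "ball w (3 * t) \<subseteq> ball p (27 * r)"
        proof
          fix z assume "z \<in> ball w (3 * t)"
          then show "z \<in> ball p (27 * r)" using True dist_triangle[of p z w] by simp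
        qed
        have "dint (ball w t) (sqd f) \<le> C1 * dint (ball w (3 * t)) (Gsq f)"
          using True by (intro dint_ball[rule_format]) auto
        also have "dint (ball w (3 * t)) (Gsq f) \<le> dint (ball w (3 * t)) \<Phi>"
        proof (rule dint_mono)
          fix x y assume "x \<in> ball w (3 * t)" "y \<in> ball w (3 * t)"
          then have "x \<in> ball p (27 * r)" "y \<in> ball p (27 * r)" using sub by blast+
          then show "Gsq f x y \<le> \<Phi> x y" by (simp add: \<Phi>_def)
        qed simp
        finally have "dint (ball w t) (sqd f) \<le> C1 * dint (ball w (3 * t)) \<Phi>"
          by (simp add: mult_left_mono)
        from mult_left_mono[OF this, of "ennreal (t powr \<gamma>)"] True show ?thesis
          by (simp add: W_def mult.left_commute)
      qed (auto simp: W_def)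
    qed auto
    also have "\<dots> = C2 * (C1 * (\<integral>\<^sup>+t\<in>{0<..}. ennreal (t powr \<gamma>) *
        (\<integral>\<^sup>+w. dint (ball (w + t *\<^sub>R 0) (3 * t)) \<Phi> \<partial>lborel) \<partial>lborel))"
      by (simp add: nn_integral_cmult mult_ac)
    also have "\<dots> \<le> C2 * (C1 * (C3 * (\<integral>\<^sup>+a. \<integral>\<^sup>+b. \<Phi> a b * frac_kernel \<alpha> a b \<partial>lborel \<partial>lborel)))"
      unfolding \<gamma>_def C3_def by (intro mult_left_mono scale_integral_le \<alpha>) auto
    also have "(\<integral>\<^sup>+a. \<integral>\<^sup>+b. \<Phi> a b * frac_kernel \<alpha> a b \<partial>lborel \<partial>lborel) =
        dint (ball p (27 * r)) (\<lambda>x y. Gsq f x y * frac_kernel \<alpha> x y)"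
      unfolding dint_conv \<Phi>_def by (simp add: mult_ac)
    finally show "dint (ball p r) (\<lambda>x y. sqd f x y * frac_kernel \<alpha> x y) \<le>
      C2 * (C1 * C3) * dint (ball p (27 * r)) (\<lambda>x y. Gsq f x y * frac_kernel \<alpha> x y)"
      by (simp add: mult.assoc)
  qed
qed

end

section \<open>Energy near the boundary\<close>

text \<open>The factor of the first square can be brought close to 1. With the factor 2 of
  \<open>sum_square_le\<close>, the term to be absorbed at the boundary would be a contraction only
  if \<open>q powr \<alpha> < 1 / 2\<close>.\<close>

lemma square_sum_le_weighted:
  fixes a b \<epsilon> :: real
  assumes "\<epsilon> > 0"
  shows "(a + b)\<^sup>2 \<le> (1 + \<epsilon>) * a\<^sup>2 + (1 + 1 / \<epsilon>) * b\<^sup>2"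
proof -
  have "0 \<le> (\<epsilon> * a - b)\<^sup>2 / \<epsilon>" using assms by simp
  also have "\<dots> = \<epsilon> * a\<^sup>2 - 2 * a * b + b\<^sup>2 / \<epsilon>"
    using assms by (simp add: power2_eq_square field_simps)
  finally show ?thesis by (simp add: power2_sum algebra_simps)
qed

lemma sqd_triangle_weighted:
  assumes "\<epsilon> > 0"
  shows "sqd f x y \<le> ennreal (1 + \<epsilon>) * sqd f x z + ennreal (1 + 1 / \<epsilon>) * sqd f y z"
proof -
  have "(f y - f x)\<^sup>2 \<le> (1 + \<epsilon>) * (f z - f x)\<^sup>2 + (1 + 1 / \<epsilon>) * (f z - f y)\<^sup>2"
    using square_sum_le_weighted[OF assms, of "f z - f x" "f y - f z"] by (simp add: power2_commute)
  then have "sqd f x y \<le> ennreal ((1 + \<epsilon>) * (f z - f x)\<^sup>2 + (1 + 1 / \<epsilon>) * (f z - f y)\<^sup>2)"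
    unfolding sqd_def by (rule ennreal_leI)
  also have "\<dots> = ennreal (1 + \<epsilon>) * sqd f x z + ennreal (1 + 1 / \<epsilon>) * sqd f y z"
    unfolding sqd_def using assms by (subst ennreal_plus) (auto simp: ennreal_mult')
  finally show ?thesis .
qed

text \<open>Up to the volume of the ball this is a mean square deviation from \<open>f x\<close>. As
  \<open>t\<close> varies, the balls sweep out a cone with vertex \<open>x\<close>, axis
  \<open>e\<close> and an opening governed by \<open>b\<close>, which at a Lipschitz boundary stays
  inside the domain.\<close>

definition cone_dev :: "('a::euclidean_space \<Rightarrow> real) \<Rightarrow> 'a \<Rightarrow> real \<Rightarrow> real \<Rightarrow> 'a \<Rightarrow> ennreal" where
  "cone_dev f e b t x = (\<integral>\<^sup>+y\<in>ball (x + t *\<^sub>R e) (b * t). sqd f x y \<partial>lborel)"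

lemma cone_dev_measurable [measurable]:
  assumes [measurable]: "f \<in> borel_measurable borel" "g \<in> borel_measurable M" "h \<in> borel_measurable M"
  shows "(\<lambda>z. cone_dev f e b (g z) (h z)) \<in> borel_measurable M"
  unfolding cone_dev_def by measurable

text \<open>The balls at the scales \<open>t\<close> and \<open>(1 - b) * t\<close> have centres at
  distance \<open>b * t\<close>, so \<open>ball (x + t *\<^sub>R e) (2 * b * t)\<close> contains
  both. Passing from one to the other costs differences between points of that ball, in which
  \<open>x\<close> no longer occurs.\<close>

lemma cone_dev_shrink:
  fixes f :: "'a::euclidean_space \<Rightarrow> real"
  assumes [measurable]: "f \<in> borel_measurable borel" and b: "0 < b" "b < 1" and t: "0 < t" and \<epsilon>: "0 < \<epsilon>"
    and e: "norm e = 1"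
  defines "\<omega> \<equiv> unit_ball_vol (real DIM('a))"
  shows "ennreal (\<omega> * (b * ((1 - b) * t)) ^ DIM('a)) * cone_dev f e b t x \<le>
    ennreal (1 + \<epsilon>) * (ennreal (\<omega> * (b * t) ^ DIM('a)) * cone_dev f e b ((1 - b) * t) x) +
    ennreal (1 + 1 / \<epsilon>) * dint (ball (x + t *\<^sub>R e) (2 * b * t)) (sqd f)"
proof -
  let ?B = "ball (x + t *\<^sub>R e) (b * t)" and ?B' = "ball (x + ((1 - b) * t) *\<^sub>R e) (b * ((1 - b) * t))"
  let ?D = "ball (x + t *\<^sub>R e) (2 * b * t)"
  have s1: "?B \<subseteq> ?D" using b t by (intro subset_ball) simp
  have s2: "?B' \<subseteq> ?D"
  proof
    fix z assume z: "z \<in> ?B'"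
    have "dist (x + t *\<^sub>R e) (x + ((1 - b) * t) *\<^sub>R e) = norm ((b * t) *\<^sub>R e)"
      by (simp add: dist_norm algebra_simps)
    also have "\<dots> = b * t" using e b t by simp
    finally have "dist (x + t *\<^sub>R e) z < b * t + b * ((1 - b) * t)"
      using z dist_triangle[of "x + t *\<^sub>R e" z "x + ((1 - b) * t) *\<^sub>R e"] by simp
    also have "\<dots> \<le> 2 * b * t" using b t by (simp add: mult_left_le_one_le)
    finally show "z \<in> ?D" by simp
  qed
  have pt: "ennreal (\<omega> * (b * ((1 - b) * t)) ^ DIM('a)) * sqd f x y \<le>
      ennreal (1 + \<epsilon>) * cone_dev f e b ((1 - b) * t) x +
      ennreal (1 + 1 / \<epsilon>) * (\<integral>\<^sup>+z\<in>?D. sqd f y z \<partial>lborel)" for y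
  proof -
    have "ennreal (\<omega> * (b * ((1 - b) * t)) ^ DIM('a)) * sqd f x y \<le>
        (\<integral>\<^sup>+z\<in>?B'. ennreal (1 + \<epsilon>) * sqd f x z + ennreal (1 + 1 / \<epsilon>) * sqd f y z \<partial>lborel)"
      using b t \<epsilon> by (intro nn_integral_ge_const_on sqd_triangle_weighted) (auto simp: emeasure_ball \<omega>_def)
    also have "\<dots> = ennreal (1 + \<epsilon>) * (\<integral>\<^sup>+z\<in>?B'. sqd f x z \<partial>lborel) +
        ennreal (1 + 1 / \<epsilon>) * (\<integral>\<^sup>+z\<in>?B'. sqd f y z \<partial>lborel)"
      by (rule set_nn_integral_linear) measurable
    also have "\<dots> \<le> ennreal (1 + \<epsilon>) * cone_dev f e b ((1 - b) * t) x +
        ennreal (1 + 1 / \<epsilon>) * (\<integral>\<^sup>+z\<in>?D. sqd f y z \<partial>lborel)"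
      unfolding cone_dev_def by (intro add_mono mult_left_mono set_nn_integral_mono s2) auto
    finally show ?thesis .
  qed
  have "ennreal (\<omega> * (b * ((1 - b) * t)) ^ DIM('a)) * cone_dev f e b t x =
      (\<integral>\<^sup>+y\<in>?B. ennreal (\<omega> * (b * ((1 - b) * t)) ^ DIM('a)) * sqd f x y \<partial>lborel)"
    unfolding cone_dev_def by (rule set_nn_integral_cmult[symmetric]) measurable
  also have "\<dots> \<le> (\<integral>\<^sup>+y\<in>?B. ennreal (1 + \<epsilon>) * cone_dev f e b ((1 - b) * t) x +
      ennreal (1 + 1 / \<epsilon>) * (\<integral>\<^sup>+z\<in>?D. sqd f y z \<partial>lborel) \<partial>lborel)"
    by (intro set_nn_integral_mono pt) auto
  also have "\<dots> = ennreal (1 + \<epsilon>) * (\<integral>\<^sup>+y\<in>?B. cone_dev f e b ((1 - b) * t) x \<partial>lborel) +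
      ennreal (1 + 1 / \<epsilon>) * (\<integral>\<^sup>+y\<in>?B. (\<integral>\<^sup>+z\<in>?D. sqd f y z \<partial>lborel) \<partial>lborel)"
    by (rule set_nn_integral_linear) measurable
  also have "(\<integral>\<^sup>+y\<in>?B. cone_dev f e b ((1 - b) * t) x \<partial>lborel) =
      ennreal (\<omega> * (b * t) ^ DIM('a)) * cone_dev f e b ((1 - b) * t) x"
    using b t by (subst set_nn_integral_const) (auto simp: emeasure_ball \<omega>_def mult.commute)
  also have "ennreal (1 + \<epsilon>) * (ennreal (\<omega> * (b * t) ^ DIM('a)) * cone_dev f e b ((1 - b) * t) x) +
      ennreal (1 + 1 / \<epsilon>) * (\<integral>\<^sup>+y\<in>?B. (\<integral>\<^sup>+z\<in>?D. sqd f y z \<partial>lborel) \<partial>lborel) \<le>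
    ennreal (1 + \<epsilon>) * (ennreal (\<omega> * (b * t) ^ DIM('a)) * cone_dev f e b ((1 - b) * t) x) +
      ennreal (1 + 1 / \<epsilon>) * dint ?D (sqd f)"
    unfolding dint_def by (intro add_left_mono mult_left_mono set_nn_integral_mono s1) auto
  finally show ?thesis .
qed

text \<open>As \<open>cone_dev\<close> contains a volume of order \<open>t ^ DIM('a)\<close>, the
  weight amounts to integrating the mean square deviation against
  \<open>t powr (- \<alpha> - 1)\<close>. The bound \<open>t0\<close> keeps the cone inside the
  domain.\<close>

definition cone_energy :: "real \<Rightarrow> ('a::euclidean_space \<Rightarrow> real) \<Rightarrow> 'a \<Rightarrow> real \<Rightarrow> real \<Rightarrow> 'a \<Rightarrow> ennreal" where
  "cone_energy \<alpha> f e b t0 x =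
    (\<integral>\<^sup>+t\<in>{0<..t0}. ennreal (t powr (- \<alpha> - 1 - real DIM('a))) * cone_dev f e b t x \<partial>lborel)"

lemma cone_energy_measurable [measurable]:
  fixes f :: "'a::euclidean_space \<Rightarrow> real"
  assumes [measurable]: "f \<in> borel_measurable borel"
  shows "cone_energy \<alpha> f e b t0 \<in> borel_measurable borel"
  unfolding cone_energy_def by measurable

text \<open>Under the substitution of \<open>q * t\<close> the weight contributes
  \<open>q powr (\<alpha> + 1 + d)\<close>, with \<open>d\<close> the dimension, and the measure
  \<open>1 / q\<close>. Only an inequality results, because the new range
  \<open>{0<..q * t0}\<close> is shorter than the old one.\<close>

lemma cone_energy_scaling:
  fixes f :: "'a::euclidean_space \<Rightarrow> real"
  assumes [measurable]: "f \<in> borel_measurable borel" and q: "0 < q" "q < 1"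
  shows "(\<integral>\<^sup>+t\<in>{0<..t0}. ennreal (t powr (- \<alpha> - 1 - real DIM('a))) * cone_dev f e b (q * t) x \<partial>lborel) \<le>
    ennreal (q powr (\<alpha> + real DIM('a))) * cone_energy \<alpha> f e b t0 x"
proof -
  define \<beta> where "\<beta> = - \<alpha> - 1 - real DIM('a)"
  define F where "F s = ennreal (s powr \<beta>) * cone_dev f e b s x * indicator {0<..t0} s" for s
  have [measurable]: "F \<in> borel_measurable borel" unfolding F_def by measurable
  have "(\<integral>\<^sup>+t\<in>{0<..t0}. ennreal (t powr \<beta>) * cone_dev f e b (q * t) x \<partial>lborel) \<le>
      (\<integral>\<^sup>+t. ennreal (q powr (- \<beta>)) * F (0 + q * t) \<partial>lborel)"
  proof (rule nn_integral_mono)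
    fix t
    show "ennreal (t powr \<beta>) * cone_dev f e b (q * t) x * indicator {0<..t0} t \<le>
        ennreal (q powr (- \<beta>)) * F (0 + q * t)"
    proof (cases "t \<in> {0<..t0}")
      case True
      then have qt: "q * t \<in> {0<..t0}" using q by (auto intro: order_trans[OF mult_left_le_one_le])
      have "q powr (- \<beta>) * (q * t) powr \<beta> = t powr \<beta>"
        using q True by (simp add: powr_mult powr_minus field_simps)
      then have "ennreal (q powr (- \<beta>)) * ennreal ((q * t) powr \<beta>) = ennreal (t powr \<beta>)"
        by (simp only: ennreal_mult'[symmetric] powr_ge_zero)
      then show ?thesis using True qt by (simp add: F_def mult.assoc[symmetric])
    qed simp
  qed
  also have "\<dots> = ennreal (q powr (- \<beta>)) * (\<integral>\<^sup>+t. F (0 + q * t) \<partial>lborel)"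
    by (rule nn_integral_cmult) measurable
  also have "(\<integral>\<^sup>+t. F (0 + q * t) \<partial>lborel) = ennreal (1 / q) * (\<integral>\<^sup>+s. F s \<partial>lborel)"
  proof -
    have "(\<integral>\<^sup>+s. F s \<partial>lborel) = ennreal q * (\<integral>\<^sup>+t. F (0 + q * t) \<partial>lborel)"
      using nn_integral_real_affine[of F q 0] q by simp
    then show ?thesis using q by (simp add: mult.assoc[symmetric] ennreal_mult'[symmetric])
  qed
  also have "ennreal (q powr (- \<beta>)) * (ennreal (1 / q) * (\<integral>\<^sup>+s. F s \<partial>lborel)) =
      ennreal (q powr (\<alpha> + real DIM('a))) * (\<integral>\<^sup>+s. F s \<partial>lborel)"
  proof -
    have "q powr (- \<beta>) * (1 / q) = q powr (\<alpha> + real DIM('a) + 1 - 1)"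
      unfolding powr_diff using q by (simp add: \<beta>_def algebra_simps)
    then have "ennreal (q powr (- \<beta>)) * ennreal (1 / q) = ennreal (q powr (\<alpha> + real DIM('a)))"
      by (simp add: ennreal_mult'[symmetric])
    then show ?thesis by (simp add: mult.assoc[symmetric])
  qed
  finally show ?thesis by (simp add: F_def cone_energy_def \<beta>_def)
qed

lemma ennreal_absorb:
  assumes "x \<le> ennreal \<mu> * x + y" "0 \<le> \<mu>" "\<mu> < 1" "x < top"
  shows "x \<le> ennreal (1 / (1 - \<mu>)) * y"
proof (cases y)
  case (real r)
  obtain s where s: "x = ennreal s" "s \<ge> 0" using assms(4) by (cases x) auto
  have "ennreal s \<le> ennreal (\<mu> * s + r)"
    using assms(1,2) s real by (simp add: ennreal_mult' ennreal_plus)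
  then have "s \<le> \<mu> * s + r" using assms(2) s real by (subst (asm) ennreal_le_iff) auto
  then have "s \<le> 1 / (1 - \<mu>) * r" using assms(3) by (simp add: field_simps)
  then show ?thesis using assms(3) s real by (simp add: ennreal_mult'[symmetric] ennreal_leI)
next
  case top
  then show ?thesis using assms(3) by (simp add: ennreal_mult_top)
qed

text \<open>The weight \<open>\<epsilon>\<close> in the triangle inequality is chosen such that the factor \<open>(1 + \<epsilon>) q powr \<alpha>\<close> of the
  term that reproduces the left-hand side equals \<open>q powr (\<alpha> / 2) < 1\<close>. Absorbing this term requires the
  left-hand side to be finite.\<close>
lemma cone_energy_absorb:
  fixes f :: "'a::euclidean_space \<Rightarrow> real"
  assumes f [measurable]: "f \<in> borel_measurable borel" and b: "0 < b" "b < 1" and e: "norm e = 1"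
    and \<alpha>: "0 < \<alpha>" and fin: "cone_energy \<alpha> f e b t0 x < top"
  defines "q \<equiv> 1 - b"
  defines "\<epsilon> \<equiv> q powr (- \<alpha> / 2) - 1"
  defines "M \<equiv> (1 + 1 / \<epsilon>) / (unit_ball_vol (real DIM('a)) * (b * q) ^ DIM('a))"
  shows "cone_energy \<alpha> f e b t0 x \<le> ennreal (1 / (1 - q powr (\<alpha> / 2))) * (ennreal M *
    (\<integral>\<^sup>+t\<in>{0<..t0}. ennreal (t powr (- \<alpha> - 1 - 2 * real DIM('a))) * dint (ball (x + t *\<^sub>R e) (2 * b * t)) (sqd f) \<partial>lborel))"
proof -
  define d where "d = real DIM('a)"
  have d: "d > 0" by (simp add: d_def)
  define \<omega> where "\<omega> = unit_ball_vol d"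
  have \<omega>: "\<omega> > 0" using d by (simp add: \<omega>_def)
  have q: "0 < q" "q < 1" using b by (auto simp: q_def)
  have lam: "q powr (\<alpha> / 2) < 1" using powr_less_mono2[of "\<alpha> / 2" q 1] q \<alpha> by simp
  have "q powr (- \<alpha> / 2) > 1" using lam q by (simp add: powr_minus one_less_inverse)
  then have \<epsilon>: "\<epsilon> > 0" by (simp add: \<epsilon>_def)
  have [measurable]: "case_prod (sqd f) \<in> borel_measurable (borel \<Otimes>\<^sub>M borel)" by measurable
  have M: "M > 0" using \<epsilon> q b by (simp add: M_def add_pos_pos)
  let ?X = "cone_energy \<alpha> f e b t0 x"
  let ?D = "\<lambda>t. dint (ball (x + t *\<^sub>R e) (2 * b * t)) (sqd f)"
  have [measurable]: "?D \<in> borel_measurable borel" unfolding dint_def by measurable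
  have pt: "cone_dev f e b t x \<le> ennreal ((1 + \<epsilon>) * q powr (- d)) * cone_dev f e b (q * t) x +
      ennreal (M * t powr (- d)) * ?D t" if t: "t > 0" for t
  proof -
    define m where "m = \<omega> * (b * (q * t)) ^ DIM('a)"
    have m: "m > 0" using \<omega> b q t by (simp add: m_def)
    have "ennreal m * cone_dev f e b t x \<le>
      ennreal (1 + \<epsilon>) * (ennreal (\<omega> * (b * t) ^ DIM('a)) * cone_dev f e b (q * t) x) +
      ennreal (1 + 1 / \<epsilon>) * ?D t"
      unfolding m_def \<omega>_def q_def d_def by (rule cone_dev_shrink[OF f b t \<epsilon> e])
    from ennreal_le_divide_mult[OF this m]
    have "cone_dev f e b t x \<le> ennreal (1 / m) * (ennreal (1 + \<epsilon>) * (ennreal (\<omega> * (b * t) ^ DIM('a)) * cone_dev f e b (q * t) x)) +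
       ennreal (1 / m) * (ennreal (1 + 1 / \<epsilon>) * ?D t)" by (simp add: distrib_left)
    also have "ennreal (1 / m) * (ennreal (1 + \<epsilon>) * (ennreal (\<omega> * (b * t) ^ DIM('a)) * cone_dev f e b (q * t) x)) =
       ennreal (1 / m * ((1 + \<epsilon>) * (\<omega> * (b * t) ^ DIM('a)))) * cone_dev f e b (q * t) x"
    proof -
      have "0 \<le> 1 / m" "0 \<le> 1 + \<epsilon>" using m \<epsilon> by auto
      then show ?thesis by (simp only: ennreal_mult' mult.assoc)
    qed
    also have "ennreal (1 / m) * (ennreal (1 + 1 / \<epsilon>) * ?D t) = ennreal (1 / m * (1 + 1 / \<epsilon>)) * ?D t"
    proof -
      have "0 \<le> 1 / m" using m by auto
      then show ?thesis by (simp only: ennreal_mult' mult.assoc)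
    qed
    \<comment> \<open>\<open>q powr (- d)\<close> is the ratio of the volumes of the balls at the
      scales \<open>t\<close> and \<open>q * t\<close>. It cancels against the \<open>d\<close> in
      the exponent of \<open>cone_energy_scaling\<close>.\<close>
    also have "1 / m * ((1 + \<epsilon>) * (\<omega> * (b * t) ^ DIM('a))) = (1 + \<epsilon>) * q powr (- d)"
      using \<omega> b q t by (simp add: m_def power_mult_distrib powr_minus powr_realpow d_def divide_simps)
    also have "1 / m * (1 + 1 / \<epsilon>) = M * t powr (- d)"
      using \<omega> b q t by (simp add: m_def M_def \<omega>_def[symmetric] d_def[symmetric] power_mult_distrib
          powr_minus powr_realpow divide_simps) (simp add: d_def powr_realpow)
    finally show ?thesis .
  qed
  have "?X \<le> (\<integral>\<^sup>+t\<in>{0<..t0}. ennreal ((1 + \<epsilon>) * q powr (- d)) * (ennreal (t powr (- \<alpha> - 1 - d)) * cone_dev f e b (q * t) x) +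
     ennreal M * (ennreal (t powr (- \<alpha> - 1 - 2 * d)) * ?D t) \<partial>lborel)"
    unfolding cone_energy_def
  proof (rule set_nn_integral_mono)
    fix t assume t: "t \<in> {0<..t0}"
    have "t powr (- \<alpha> - 1 - d) * (M * t powr (- d)) = M * t powr (- \<alpha> - 1 - 2 * d)"
    proof -
      have "t powr (- \<alpha> - 1 - d) * t powr (- d) = t powr (- \<alpha> - 1 - 2 * d)"
        by (simp add: powr_add[symmetric])
      then show ?thesis by simp
    qed
    then have "ennreal (t powr (- \<alpha> - 1 - d)) * ennreal (M * t powr (- d)) = ennreal M * ennreal (t powr (- \<alpha> - 1 - 2 * d))"
      using M by (simp add: ennreal_mult'[symmetric])
    then have "ennreal (t powr (- \<alpha> - 1 - d)) * (ennreal ((1 + \<epsilon>) * q powr (- d)) * cone_dev f e b (q * t) x +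
      ennreal (M * t powr (- d)) * ?D t) = ennreal ((1 + \<epsilon>) * q powr (- d)) * (ennreal (t powr (- \<alpha> - 1 - d)) * cone_dev f e b (q * t) x) +
     ennreal M * (ennreal (t powr (- \<alpha> - 1 - 2 * d)) * ?D t)"
      by (simp only: distrib_left mult.assoc[symmetric]) (simp only: mult.commute mult.assoc)
    with mult_left_mono[OF pt, of t "ennreal (t powr (- \<alpha> - 1 - d))"] t
    show "ennreal (t powr (- \<alpha> - 1 - real DIM('a))) * cone_dev f e b t x \<le>
      ennreal ((1 + \<epsilon>) * q powr (- d)) * (ennreal (t powr (- \<alpha> - 1 - d)) * cone_dev f e b (q * t) x) +
     ennreal M * (ennreal (t powr (- \<alpha> - 1 - 2 * d)) * ?D t)" by (simp add: d_def)
  qed simp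
  also have "\<dots> = ennreal ((1 + \<epsilon>) * q powr (- d)) * (\<integral>\<^sup>+t\<in>{0<..t0}. ennreal (t powr (- \<alpha> - 1 - d)) * cone_dev f e b (q * t) x \<partial>lborel) +
     ennreal M * (\<integral>\<^sup>+t\<in>{0<..t0}. ennreal (t powr (- \<alpha> - 1 - 2 * d)) * ?D t \<partial>lborel)"
    by (rule set_nn_integral_linear) measurable
  also have "\<dots> \<le> ennreal ((1 + \<epsilon>) * q powr (- d)) * (ennreal (q powr (\<alpha> + d)) * ?X) +
     ennreal M * (\<integral>\<^sup>+t\<in>{0<..t0}. ennreal (t powr (- \<alpha> - 1 - 2 * d)) * ?D t \<partial>lborel)"
    unfolding d_def using q by (intro add_right_mono mult_left_mono cone_energy_scaling) auto
  also have "ennreal ((1 + \<epsilon>) * q powr (- d)) * (ennreal (q powr (\<alpha> + d)) * ?X) = ennreal (q powr (\<alpha> / 2)) * ?X"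
  proof -
    have "(1 + \<epsilon>) * q powr (- d) * q powr (\<alpha> + d) = q powr (- \<alpha> / 2 + - d + (\<alpha> + d))"
      by (simp only: powr_add) (simp add: \<epsilon>_def)
    then have "(1 + \<epsilon>) * q powr (- d) * q powr (\<alpha> + d) = q powr (\<alpha> / 2)" by simp
    then have "ennreal ((1 + \<epsilon>) * q powr (- d)) * ennreal (q powr (\<alpha> + d)) = ennreal (q powr (\<alpha> / 2))"
      using \<epsilon> by (subst ennreal_mult'[symmetric]) auto
    then show ?thesis by (simp add: mult.assoc[symmetric])
  qed
  finally have "?X \<le> ennreal (q powr (\<alpha> / 2)) * ?X +
     ennreal M * (\<integral>\<^sup>+t\<in>{0<..t0}. ennreal (t powr (- \<alpha> - 1 - 2 * d)) * ?D t \<partial>lborel)" .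
  from ennreal_absorb[OF this _ lam fin] show ?thesis by (simp add: d_def)
qed

lemma ennreal_half_double: "ennreal (1 / 2) * (2 * z) = z"
proof -
  have "ennreal (1 / 2) * 2 = ennreal (1 / 2) * ennreal 2" by (simp only: ennreal_numeral)
  also have "\<dots> = ennreal (1 / 2 * 2)" by (rule ennreal_mult'[symmetric]) simp
  also have "\<dots> = 1" by simp
  finally have "ennreal (1 / 2) * 2 = 1" .
  then show ?thesis by (simp only: mult.assoc[symmetric] mult_1)
qed

lemma measurable_mem_greaterThan [measurable (raw)]:
  fixes f g :: "'b \<Rightarrow> real"
  assumes [measurable]: "f \<in> borel_measurable M" "g \<in> borel_measurable M"
  shows "Measurable.pred M (\<lambda>x. g x \<in> {f x<..})"
  unfolding greaterThan_iff by measurable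

lemma set_nn_integral_square_diff_finite:
  fixes f :: "'a::euclidean_space \<Rightarrow> real"
  assumes [measurable]: "f \<in> borel_measurable borel" "S \<in> sets borel"
    and "emeasure lborel S < top" "(\<integral>\<^sup>+y\<in>S. ennreal ((f y)\<^sup>2) \<partial>lborel) < top"
  shows "(\<integral>\<^sup>+y\<in>S. sqd f x y \<partial>lborel) < top"
proof -
  have "(\<integral>\<^sup>+y\<in>S. sqd f x y \<partial>lborel) \<le> (\<integral>\<^sup>+y\<in>S. 2 * ennreal ((f y)\<^sup>2) + 2 * ennreal ((f x)\<^sup>2) \<partial>lborel)"
    using square_diff_triangle[of _ "f x" 0] by (intro set_nn_integral_mono) (auto simp: sqd_def)
  also have "\<dots> = 2 * (\<integral>\<^sup>+y\<in>S. ennreal ((f y)\<^sup>2) \<partial>lborel) + 2 * (\<integral>\<^sup>+y\<in>S. ennreal ((f x)\<^sup>2) \<partial>lborel)"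
    by (rule set_nn_integral_linear) measurable
  also have "\<dots> < top"
    using assms(3,4) by (simp add: set_nn_integral_const ennreal_mult_less_top)
  finally show ?thesis .
qed

text \<open>A purely qualitative statement, with a bound that depends on \<open>x\<close> and
  \<open>\<delta>\<close>. Large scales are controlled by the square integrability of
  \<open>f\<close> on \<open>S\<close>, small ones by the finite fractional energy at the point
  \<open>x\<close>.\<close>

lemma cone_energy_finite:
  fixes f :: "'a::euclidean_space \<Rightarrow> real"
  assumes [measurable]: "f \<in> borel_measurable borel" "S \<in> sets borel"
    and S: "emeasure lborel S < top" "(\<integral>\<^sup>+y\<in>S. ennreal ((f y)\<^sup>2) \<partial>lborel) < top"
    and e: "norm e = 1" and b: "0 < b" "b < 1" and \<alpha>: "0 < \<alpha>" and \<delta>: "0 < \<delta>"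
    and fin: "(\<integral>\<^sup>+y\<in>ball x \<delta>. sqd f x y * frac_kernel \<alpha> x y \<partial>lborel) < top"
    and sub: "\<And>t. t \<in> {0<..t0} \<Longrightarrow> ball (x + t *\<^sub>R e) (b * t) \<subseteq> S"
  shows "cone_energy \<alpha> f e b t0 x < top"
proof -
  define d where "d = real DIM('a)"
  have d: "d > 0" by (simp add: d_def)
  define \<beta> where "\<beta> = - \<alpha> - 1 - d"
  have \<beta>: "\<beta> < 0" using \<alpha> d by (simp add: \<beta>_def)
  \<comment> \<open>A point \<open>y\<close> of the ball at scale \<open>t\<close> satisfies
    \<open>dist x y < 2 * t\<close>. Hence \<open>t < \<eta>\<close> forces
    \<open>y \<in> ball x \<delta>\<close>; read the other way, only scales
    \<open>t > dist x y / 2\<close> contribute for a given \<open>y\<close>, and their weights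
    integrate to a multiple of the kernel.\<close>
  define \<eta> where "\<eta> = \<delta> / 2"
  have \<eta>: "\<eta> > 0" using \<delta> by (simp add: \<eta>_def)
  let ?I = "\<integral>\<^sup>+y\<in>S. sqd f x y \<partial>lborel"
  define C where "C = ennreal ((1 / 2) powr (- d - \<alpha>) / (d + \<alpha>))"
  have "cone_energy \<alpha> f e b t0 x \<le>
      (\<integral>\<^sup>+t. ennreal (t powr \<beta>) * cone_dev f e b t x * indicator {0<..<\<eta>} t +
        ennreal (\<eta> powr \<beta>) * ?I * indicator {\<eta>..t0} t \<partial>lborel)"
    unfolding cone_energy_def
  proof (rule nn_integral_mono)
    fix t
    show "ennreal (t powr (- \<alpha> - 1 - real DIM('a))) * cone_dev f e b t x * indicator {0<..t0} t
      \<le> ennreal (t powr \<beta>) * cone_dev f e b t x * indicator {0<..<\<eta>} t +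
        ennreal (\<eta> powr \<beta>) * ?I * indicator {\<eta>..t0} t"
    proof (cases "t \<in> {\<eta>..t0}")
      case True
      have "cone_dev f e b t x \<le> ?I"
        unfolding cone_dev_def using True \<eta> by (intro set_nn_integral_mono sub) auto
      moreover have "t powr \<beta> \<le> \<eta> powr \<beta>" using True \<eta> \<beta> by (intro powr_mono2') auto
      ultimately have "ennreal (t powr \<beta>) * cone_dev f e b t x \<le> ennreal (\<eta> powr \<beta>) * ?I"
        by (intro mult_mono ennreal_leI) auto
      then show ?thesis using True \<eta> by (simp add: \<beta>_def d_def)
    qed (auto simp: indicator_def \<beta>_def d_def)
  qed
  also have "\<dots> = (\<integral>\<^sup>+t. ennreal (t powr \<beta>) * cone_dev f e b t x * indicator {0<..<\<eta>} t \<partial>lborel) +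
      ennreal (\<eta> powr \<beta>) * ?I * emeasure lborel {\<eta>..t0}"
    by (subst nn_integral_add) (auto simp: nn_integral_cmult_indicator)
  also have "\<dots> < top"
  proof -
    have "(\<integral>\<^sup>+t. ennreal (t powr \<beta>) * cone_dev f e b t x * indicator {0<..<\<eta>} t \<partial>lborel) \<le>
      (\<integral>\<^sup>+t. \<integral>\<^sup>+y. sqd f x y * indicator (ball x \<delta>) y * (ennreal (t powr \<beta>) * indicator {dist x y / 2<..} t) \<partial>lborel \<partial>lborel)"
    proof (rule nn_integral_mono)
      fix t
      show "ennreal (t powr \<beta>) * cone_dev f e b t x * indicator {0<..<\<eta>} t \<le>
        (\<integral>\<^sup>+y. sqd f x y * indicator (ball x \<delta>) y * (ennreal (t powr \<beta>) * indicator {dist x y / 2<..} t) \<partial>lborel)"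
      proof (cases "t \<in> {0<..<\<eta>}")
        case True
        have "ennreal (t powr \<beta>) * cone_dev f e b t x =
          (\<integral>\<^sup>+y\<in>ball (x + t *\<^sub>R e) (b * t). ennreal (t powr \<beta>) * sqd f x y \<partial>lborel)"
          unfolding cone_dev_def by (rule set_nn_integral_cmult[symmetric]) measurable
        also have "\<dots> \<le> (\<integral>\<^sup>+y. sqd f x y * indicator (ball x \<delta>) y * (ennreal (t powr \<beta>) * indicator {dist x y / 2<..} t) \<partial>lborel)"
        proof (rule nn_integral_mono)
          fix y
          show "ennreal (t powr \<beta>) * sqd f x y * indicator (ball (x + t *\<^sub>R e) (b * t)) y \<le>
            sqd f x y * indicator (ball x \<delta>) y * (ennreal (t powr \<beta>) * indicator {dist x y / 2<..} t)"
          proof (cases "y \<in> ball (x + t *\<^sub>R e) (b * t)")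
            case yin: True
            have "dist x (x + t *\<^sub>R e) = t" using e True by (simp add: dist_norm)
            then have "dist x y < t + b * t" using yin dist_triangle[of x y "x + t *\<^sub>R e"] by simp
            also have "\<dots> \<le> 2 * t" using b True by (simp add: mult_left_le_one_le)
            finally have "dist x y < 2 * t" .
            then have "y \<in> ball x \<delta>" "dist x y / 2 < t" using True by (auto simp: \<eta>_def)
            then show ?thesis using yin by (simp add: mult.commute)
          qed simp
        qed
        finally show ?thesis using True by simp
      qed simp
    qed
    also have "\<dots> = (\<integral>\<^sup>+y. \<integral>\<^sup>+t. sqd f x y * indicator (ball x \<delta>) y * (ennreal (t powr \<beta>) * indicator {dist x y / 2<..} t) \<partial>lborel \<partial>lborel)"
      by (rule nn_integral_lborel_swap) measurable
    also have "\<dots> \<le> (\<integral>\<^sup>+y. C * (sqd f x y * frac_kernel \<alpha> x y * indicator (ball x \<delta>) y) \<partial>lborel)"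
    proof (rule nn_integral_mono)
      fix y
      show "(\<integral>\<^sup>+t. sqd f x y * indicator (ball x \<delta>) y * (ennreal (t powr \<beta>) * indicator {dist x y / 2<..} t) \<partial>lborel)
        \<le> C * (sqd f x y * frac_kernel \<alpha> x y * indicator (ball x \<delta>) y)"
      proof (cases "x = y")
        case True then show ?thesis by (simp add: sqd_def)
      next
        case False
        define l where "l = dist x y / 2"
        have l: "l > 0" using False by (simp add: l_def)
        have "(\<integral>\<^sup>+t. sqd f x y * indicator (ball x \<delta>) y * (ennreal (t powr \<beta>) * indicator {dist x y / 2<..} t) \<partial>lborel) =
          sqd f x y * indicator (ball x \<delta>) y * (\<integral>\<^sup>+t. (ennreal (t powr \<beta>) * indicator {dist x y / 2<..} t) \<partial>lborel)"
          by (rule nn_integral_cmult) measurable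
        also have "\<dots> \<le> sqd f x y * indicator (ball x \<delta>) y * (\<integral>\<^sup>+t\<in>{l..}. ennreal (t powr (- (d + \<alpha>) - 1)) \<partial>lborel)"
          by (intro mult_left_mono nn_integral_mono) (auto simp: indicator_def l_def \<beta>_def algebra_simps)
        also have "(\<integral>\<^sup>+t\<in>{l..}. ennreal (t powr (- (d + \<alpha>) - 1)) \<partial>lborel) = ennreal (l powr (- (d + \<alpha>)) / (d + \<alpha>))"
          by (rule nn_integral_powr_tail) (use l d \<alpha> in auto)
        also have "l powr (- (d + \<alpha>)) / (d + \<alpha>) = (1 / 2) powr (- d - \<alpha>) / (d + \<alpha>) * norm (x - y) powr (- d - \<alpha>)"
          using powr_mult[of "1 / 2" "norm (x - y)" "- d - \<alpha>"] by (simp add: l_def dist_norm)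
        also have "ennreal \<dots> = C * frac_kernel \<alpha> x y"
        proof -
          have K: "frac_kernel \<alpha> x y = ennreal (norm (x - y) powr (- d - \<alpha>))"
            using False by (simp add: frac_kernel_def d_def)
          have "0 \<le> (1 / 2) powr (- d - \<alpha>) / (d + \<alpha>)" using d \<alpha> by simp
          then show ?thesis unfolding K C_def by (rule ennreal_mult')
        qed
        finally show ?thesis by (simp add: mult_ac)
      qed
    qed
    also have "\<dots> = C * (\<integral>\<^sup>+y\<in>ball x \<delta>. sqd f x y * frac_kernel \<alpha> x y \<partial>lborel)"
      by (rule nn_integral_cmult) measurable
    also have "\<dots> < top" using fin by (simp add: C_def ennreal_mult_less_top)
    finally have "(\<integral>\<^sup>+t. ennreal (t powr \<beta>) * cone_dev f e b t x * indicator {0<..<\<eta>} t \<partial>lborel) < top" .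
    moreover have "?I < top" by (rule set_nn_integral_square_diff_finite) (use S in auto)
    moreover have "emeasure lborel {\<eta>..t0} < top" by (simp add: emeasure_lborel_Icc_eq)
    ultimately show ?thesis by (simp add: ennreal_mult_less_top)
  qed
  finally show ?thesis .
qed

text \<open>Points \<open>x\<close> and \<open>y\<close> are compared through an average over a ball that is contained both in
  \<open>ball (x + t e) (b t)\<close> and in \<open>ball (y + t e) (b t)\<close>, for \<open>t\<close> comparable to \<open>dist x y\<close>.\<close>
lemma frac_energy_le_cone_energy:
  fixes U :: "'a::euclidean_space set" and f :: "'a \<Rightarrow> real"
  assumes [measurable]: "f \<in> borel_measurable borel" "U \<in> sets borel"
    and b: "0 < b" and \<alpha>: "0 < \<alpha>"
    and diam: "\<And>x y. x \<in> U \<Longrightarrow> y \<in> U \<Longrightarrow> 4 / b * dist x y \<le> t0"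
  defines "m \<equiv> unit_ball_vol (real DIM('a)) * (b / 2) ^ DIM('a) / 2 *
      (2 / b * (4 / b) powr (- \<alpha> - 1 - real DIM('a)))"
  shows "dint U (\<lambda>x y. sqd f x y * frac_kernel \<alpha> x y) \<le>
    ennreal (2 / m * (unit_ball_vol (real DIM('a)) * b ^ DIM('a))) * (\<integral>\<^sup>+x\<in>U. cone_energy \<alpha> f e b t0 x \<partial>lborel)"
proof -
  define d where "d = real DIM('a)"
  have d: "d > 0" by (simp add: d_def)
  define \<omega> where "\<omega> = unit_ball_vol d"
  have \<omega>: "\<omega> > 0" using d by (simp add: \<omega>_def)
  define \<gamma> where "\<gamma> = - \<alpha> - 1 - d"
  have \<gamma>: "\<gamma> < 0" using \<alpha> d by (simp add: \<gamma>_def)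
  have m_eq: "m = \<omega> * (b / 2) ^ DIM('a) / 2 * (2 / b * (4 / b) powr \<gamma>)"
    by (simp add: m_def \<omega>_def \<gamma>_def d_def)
  have m: "m > 0" using \<omega> b by (simp add: m_eq)
  define w where "w t = indicator {0<..t0} t * ennreal (t powr (\<gamma> - d))" for t
  have [measurable]: "w \<in> borel_measurable borel" unfolding w_def by measurable
  \<comment> \<open>The indicator equals 1 for the scales used in the pointwise bound. Its purpose
    is the integration over \<open>y\<close>: it yields the volume of \<open>ball x (b * t)\<close>,
    and the resulting \<open>t ^ DIM('a)\<close> turns the weight \<open>w\<close> into that of
    \<open>cone_energy\<close>.\<close>
  define A where "A x y = (\<integral>\<^sup>+t. w t * indicator (ball x (b * t)) y * cone_dev f e b t x \<partial>lborel)" for x y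
  have A_meas [measurable]: "(\<lambda>z. A (g z) (h z)) \<in> borel_measurable M"
    if [measurable]: "g \<in> borel_measurable M" "h \<in> borel_measurable M" for g h and M :: "'c measure"
    unfolding A_def by measurable
  have pt: "sqd f x y * frac_kernel \<alpha> x y \<le> ennreal (1 / m) * A x y + ennreal (1 / m) * A y x" if xy: "x \<in> U" "y \<in> U" for x y
  proof (cases "x = y")
    case True then show ?thesis by (simp add: sqd_def)
  next
    case False
    define l where "l = dist x y"
    have l: "l > 0" using False by (simp add: l_def)
    have lt: "4 / b * l \<le> t0" using diam xy by (simp add: l_def)
    \<comment> \<open>The lower end of the range gives \<open>l \<le> b * t / 2\<close>, so that the
      ball of half radius at \<open>x + t *\<^sub>R e\<close> fits into the full ball at
      \<open>y + t *\<^sub>R e\<close>. The upper end is at most \<open>t0\<close> by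
      \<open>diam\<close>.\<close>
    have inner: "ennreal (\<omega> * (b / 2) ^ DIM('a) / 2 * (4 / b * l) powr \<gamma>) * sqd f x y \<le>
       w t * indicator (ball x (b * t)) y * cone_dev f e b t x + w t * indicator (ball y (b * t)) x * cone_dev f e b t y"
      if t: "t \<in> {2 / b * l..<4 / b * l}" for t
    proof -
      have t0: "t > 0" using t l b by (smt (verit) atLeastLessThan_iff divide_pos_pos mult_pos_pos)
      have tt: "t \<in> {0<..t0}" using t0 t lt by auto
      have lb: "l \<le> b * t / 2" using t b by (simp add: field_simps)
      then have lb2: "l < b * t" using l by simp
      have "ennreal (\<omega> * (b * t / 2) ^ DIM('a)) * sqd f x y \<le>
         (\<integral>\<^sup>+a\<in>ball (x + t *\<^sub>R e) (b * t / 2). 2 * sqd f x a + 2 * sqd f y a \<partial>lborel)"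
        using b t0 sqd_triangle[of f x y]
        by (intro nn_integral_ge_const_on) (auto simp: emeasure_ball \<omega>_def d_def sqd_sym[of f y])
      also have "\<dots> = 2 * (\<integral>\<^sup>+a\<in>ball (x + t *\<^sub>R e) (b * t / 2). sqd f x a \<partial>lborel) +
          2 * (\<integral>\<^sup>+a\<in>ball (x + t *\<^sub>R e) (b * t / 2). sqd f y a \<partial>lborel)"
        by (rule set_nn_integral_linear) measurable
      also have "\<dots> \<le> 2 * cone_dev f e b t x + 2 * cone_dev f e b t y"
        unfolding cone_dev_def
      proof (intro add_mono mult_left_mono set_nn_integral_mono)
        show "ball (x + t *\<^sub>R e) (b * t / 2) \<subseteq> ball (x + t *\<^sub>R e) (b * t)"
          using b t0 by (intro subset_ball) simp
        show "ball (x + t *\<^sub>R e) (b * t / 2) \<subseteq> ball (y + t *\<^sub>R e) (b * t)"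
        proof
          fix a assume "a \<in> ball (x + t *\<^sub>R e) (b * t / 2)"
          moreover have "dist (y + t *\<^sub>R e) (x + t *\<^sub>R e) = l" by (simp add: l_def dist_commute)
          ultimately show "a \<in> ball (y + t *\<^sub>R e) (b * t)"
            using lb dist_triangle[of "y + t *\<^sub>R e" a "x + t *\<^sub>R e"] by simp
        qed
      qed auto
      finally have "ennreal (\<omega> * (b * t / 2) ^ DIM('a)) * sqd f x y \<le> 2 * (cone_dev f e b t x + cone_dev f e b t y)"
        by (simp add: distrib_left)
      from mult_left_mono[OF this zero_le, of "ennreal (1 / 2)"]
      have h: "ennreal (1 / 2) * (ennreal (\<omega> * (b * t / 2) ^ DIM('a)) * sqd f x y) \<le> cone_dev f e b t x + cone_dev f e b t y"
        by (simp only: ennreal_half_double)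
      have r: "\<omega> * (b / 2) ^ DIM('a) / 2 * (4 / b * l) powr \<gamma> \<le> t powr (\<gamma> - d) * (1 / 2 * (\<omega> * (b * t / 2) ^ DIM('a)))"
      proof -
        have "t powr (\<gamma> - d) * t ^ DIM('a) = t powr \<gamma>"
          using t0 by (simp add: powr_diff powr_realpow d_def)
        then have "t powr (\<gamma> - d) * (1 / 2 * (\<omega> * (b * t / 2) ^ DIM('a))) = \<omega> * (b / 2) ^ DIM('a) / 2 * t powr \<gamma>"
          by (simp add: power_mult_distrib power_divide mult_ac)
        moreover have "(4 / b * l) powr \<gamma> \<le> t powr \<gamma>" using t t0 \<gamma> by (intro powr_mono2') auto
        ultimately show ?thesis using \<omega> b by (simp only:) (intro mult_left_mono; simp)
      qed
      have "ennreal (\<omega> * (b / 2) ^ DIM('a) / 2 * (4 / b * l) powr \<gamma>) * sqd f x y \<le>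
         ennreal (t powr (\<gamma> - d) * (1 / 2 * (\<omega> * (b * t / 2) ^ DIM('a)))) * sqd f x y"
        by (intro mult_right_mono ennreal_leI r) auto
      also have "\<dots> = ennreal (t powr (\<gamma> - d)) * (ennreal (1 / 2) * (ennreal (\<omega> * (b * t / 2) ^ DIM('a)) * sqd f x y))"
        by (simp only: ennreal_mult' powr_ge_zero zero_le_divide_1_iff zero_le_numeral mult.assoc)
      also have "\<dots> \<le> ennreal (t powr (\<gamma> - d)) * (cone_dev f e b t x + cone_dev f e b t y)"
        by (intro mult_left_mono h) auto
      also have "\<dots> = w t * indicator (ball x (b * t)) y * cone_dev f e b t x + w t * indicator (ball y (b * t)) x * cone_dev f e b t y"
        using tt lb2 by (simp add: w_def distrib_left l_def dist_commute)
      finally show ?thesis .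
    qed
    have "ennreal (2 / b * l) * (ennreal (\<omega> * (b / 2) ^ DIM('a) / 2 * (4 / b * l) powr \<gamma>) * sqd f x y) \<le>
       (\<integral>\<^sup>+t\<in>{2 / b * l..<4 / b * l}. (w t * indicator (ball x (b * t)) y * cone_dev f e b t x + w t * indicator (ball y (b * t)) x * cone_dev f e b t y) \<partial>lborel)"
    proof (rule nn_integral_ge_const_on)
      have "2 / b * l \<le> 4 / b * l" using b l by (simp add: field_simps)
      then show "ennreal (2 / b * l) \<le> emeasure lborel {2 / b * l..<4 / b * l}"
        by (simp add: field_simps)
    qed (use inner in auto)
    also have "\<dots> \<le> (\<integral>\<^sup>+t. (w t * indicator (ball x (b * t)) y * cone_dev f e b t x + w t * indicator (ball y (b * t)) x * cone_dev f e b t y) \<partial>lborel)"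
      by (intro nn_integral_mono) (auto simp: indicator_def)
    also have "\<dots> = A x y + A y x"
      unfolding A_def by (rule nn_integral_add) measurable
    finally have "ennreal (2 / b * l) * (ennreal (\<omega> * (b / 2) ^ DIM('a) / 2 * (4 / b * l) powr \<gamma>) * sqd f x y) \<le> A x y + A y x" .
    moreover have "ennreal (2 / b * l) * (ennreal (\<omega> * (b / 2) ^ DIM('a) / 2 * (4 / b * l) powr \<gamma>) * sqd f x y) =
       ennreal m * (sqd f x y * frac_kernel \<alpha> x y)"
    proof -
      have "l * l powr \<gamma> = l powr (1 + \<gamma>)" using l by (simp add: powr_add)
      moreover have "1 + \<gamma> = - d - \<alpha>" by (simp add: \<gamma>_def)
      ultimately have "l * l powr \<gamma> = l powr (- d - \<alpha>)" by (simp only:)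
      moreover have "(4 / b * l) powr \<gamma> = (4 / b) powr \<gamma> * l powr \<gamma>" using b l by (intro powr_mult) 
      ultimately have "2 / b * l * (\<omega> * (b / 2) ^ DIM('a) / 2 * (4 / b * l) powr \<gamma>) = m * l powr (- d - \<alpha>)"
        by (simp add: m_eq mult_ac)
      moreover have "frac_kernel \<alpha> x y = ennreal (l powr (- d - \<alpha>))"
        using False by (simp add: frac_kernel_def l_def dist_norm d_def)
      moreover have "ennreal (2 / b * l) * ennreal (\<omega> * (b / 2) ^ DIM('a) / 2 * (4 / b * l) powr \<gamma>) =
         ennreal (2 / b * l * (\<omega> * (b / 2) ^ DIM('a) / 2 * (4 / b * l) powr \<gamma>))"
        using b l by (intro ennreal_mult'[symmetric]) simp
      moreover have "ennreal (m * l powr (- d - \<alpha>)) = ennreal m * ennreal (l powr (- d - \<alpha>))"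
        using m by (intro ennreal_mult') simp
      ultimately show ?thesis by (metis mult.assoc mult.commute)
    qed
    ultimately have "ennreal m * (sqd f x y * frac_kernel \<alpha> x y) \<le> A x y + A y x" by simp
    from ennreal_le_divide_mult[OF this m] show ?thesis by (simp add: distrib_left)
  qed
  have "dint U (\<lambda>x y. sqd f x y * frac_kernel \<alpha> x y) \<le>
     (\<integral>\<^sup>+x\<in>U. (\<integral>\<^sup>+y\<in>U. ennreal (1 / m) * A x y + ennreal (1 / m) * A y x \<partial>lborel) \<partial>lborel)"
    unfolding dint_def by (intro set_nn_integral_mono pt) auto
  also have "\<dots> = (\<integral>\<^sup>+x\<in>U. ennreal (1 / m) * (\<integral>\<^sup>+y\<in>U. A x y \<partial>lborel) + ennreal (1 / m) * (\<integral>\<^sup>+y\<in>U. A y x \<partial>lborel) \<partial>lborel)"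
    by (subst set_nn_integral_linear) auto
  also have "\<dots> = ennreal (1 / m) * (\<integral>\<^sup>+x\<in>U. (\<integral>\<^sup>+y\<in>U. A x y \<partial>lborel) \<partial>lborel) + ennreal (1 / m) * (\<integral>\<^sup>+x\<in>U. (\<integral>\<^sup>+y\<in>U. A y x \<partial>lborel) \<partial>lborel)"
    by (rule set_nn_integral_linear) measurable
  also have "(\<integral>\<^sup>+x\<in>U. (\<integral>\<^sup>+y\<in>U. A y x \<partial>lborel) \<partial>lborel) = (\<integral>\<^sup>+x\<in>U. (\<integral>\<^sup>+y\<in>U. A x y \<partial>lborel) \<partial>lborel)"
  proof -
    have "dint U (\<lambda>x y. A y x) = dint U A"
      unfolding dint_conv by (subst nn_integral_lborel_swap) (auto simp: mult.commute)
    then show ?thesis by (simp add: dint_def)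
  qed
  also have "ennreal (1 / m) * (\<integral>\<^sup>+x\<in>U. (\<integral>\<^sup>+y\<in>U. A x y \<partial>lborel) \<partial>lborel) + ennreal (1 / m) * (\<integral>\<^sup>+x\<in>U. (\<integral>\<^sup>+y\<in>U. A x y \<partial>lborel) \<partial>lborel) =
     ennreal (2 / m) * (\<integral>\<^sup>+x\<in>U. (\<integral>\<^sup>+y\<in>U. A x y \<partial>lborel) \<partial>lborel)"
    using m by (simp add: distrib_right[symmetric] ennreal_plus[symmetric] del: ennreal_plus)
  also have "(\<integral>\<^sup>+x\<in>U. (\<integral>\<^sup>+y\<in>U. A x y \<partial>lborel) \<partial>lborel) \<le> (\<integral>\<^sup>+x\<in>U. ennreal (\<omega> * b ^ DIM('a)) * cone_energy \<alpha> f e b t0 x \<partial>lborel)"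
  proof (rule set_nn_integral_mono)
    fix x
    have "(\<integral>\<^sup>+y\<in>U. A x y \<partial>lborel) \<le> (\<integral>\<^sup>+y. \<integral>\<^sup>+t. w t * indicator (ball x (b * t)) y * cone_dev f e b t x \<partial>lborel \<partial>lborel)"
      unfolding A_def by (intro nn_integral_mono) (auto simp: indicator_def)
    also have "\<dots> = (\<integral>\<^sup>+t. \<integral>\<^sup>+y. w t * indicator (ball x (b * t)) y * cone_dev f e b t x \<partial>lborel \<partial>lborel)"
      by (rule nn_integral_lborel_swap) measurable
    also have "\<dots> = (\<integral>\<^sup>+t. ennreal (\<omega> * b ^ DIM('a)) * (ennreal (t powr \<gamma>) * cone_dev f e b t x * indicator {0<..t0} t) \<partial>lborel)"
    proof (rule nn_integral_cong)
      fix t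
      have "(\<integral>\<^sup>+y. w t * indicator (ball x (b * t)) y * cone_dev f e b t x \<partial>lborel) =
         (\<integral>\<^sup>+y. (w t * cone_dev f e b t x) * indicator (ball x (b * t)) y \<partial>lborel)"
        by (simp add: mult_ac)
      also have "\<dots> = w t * cone_dev f e b t x * emeasure lborel (ball x (b * t))"
        by (rule nn_integral_cmult_indicator) simp
      also have "\<dots> = ennreal (\<omega> * b ^ DIM('a)) * (ennreal (t powr \<gamma>) * cone_dev f e b t x * indicator {0<..t0} t)"
      proof (cases "t \<in> {0<..t0}")
        case True
        have "t powr (\<gamma> - d) * t ^ DIM('a) = t powr \<gamma>"
          using True by (simp add: powr_diff powr_realpow d_def)
        then have "t powr (\<gamma> - d) * (\<omega> * (b * t) ^ DIM('a)) = \<omega> * b ^ DIM('a) * t powr \<gamma>"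
          by (simp add: power_mult_distrib mult_ac)
        moreover have "ennreal (t powr (\<gamma> - d)) * ennreal (\<omega> * (b * t) ^ DIM('a)) = ennreal (t powr (\<gamma> - d) * (\<omega> * (b * t) ^ DIM('a)))"
          by (intro ennreal_mult'[symmetric]) simp
        moreover have "ennreal (\<omega> * b ^ DIM('a)) * ennreal (t powr \<gamma>) = ennreal (\<omega> * b ^ DIM('a) * t powr \<gamma>)"
          using \<omega> b by (intro ennreal_mult'[symmetric]) simp
        ultimately have e: "ennreal (t powr (\<gamma> - d)) * ennreal (\<omega> * (b * t) ^ DIM('a)) = ennreal (\<omega> * b ^ DIM('a)) * ennreal (t powr \<gamma>)"
          by (simp only:)
        have v: "emeasure lborel (ball x (b * t)) = ennreal (\<omega> * (b * t) ^ DIM('a))"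
          using True b by (simp add: emeasure_ball \<omega>_def d_def)
        have "w t * cone_dev f e b t x * emeasure lborel (ball x (b * t)) =
          (ennreal (t powr (\<gamma> - d)) * ennreal (\<omega> * (b * t) ^ DIM('a))) * cone_dev f e b t x"
          unfolding v using True by (simp only: w_def indicator_simps mult_1 mult_ac)
        also have "\<dots> = ennreal (\<omega> * b ^ DIM('a)) * (ennreal (t powr \<gamma>) * cone_dev f e b t x * indicator {0<..t0} t)"
          unfolding e using True by (simp add: mult.assoc)
        finally show ?thesis .
      qed (simp add: w_def)
      finally show "(\<integral>\<^sup>+y. w t * indicator (ball x (b * t)) y * cone_dev f e b t x \<partial>lborel) =
        ennreal (\<omega> * b ^ DIM('a)) * (ennreal (t powr \<gamma>) * cone_dev f e b t x * indicator {0<..t0} t)" .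
    qed
    also have "\<dots> = ennreal (\<omega> * b ^ DIM('a)) * (\<integral>\<^sup>+t. (ennreal (t powr \<gamma>) * cone_dev f e b t x * indicator {0<..t0} t) \<partial>lborel)"
      by (rule nn_integral_cmult) measurable
    finally show "(\<integral>\<^sup>+y\<in>U. A x y \<partial>lborel) \<le> ennreal (\<omega> * b ^ DIM('a)) * cone_energy \<alpha> f e b t0 x"
      by (simp add: cone_energy_def \<gamma>_def d_def)
  qed simp
  also have "\<dots> = ennreal (\<omega> * b ^ DIM('a)) * (\<integral>\<^sup>+x\<in>U. cone_energy \<alpha> f e b t0 x \<partial>lborel)"
    by (rule set_nn_integral_cmult) measurable
  also have "ennreal (2 / m) * (ennreal (\<omega> * b ^ DIM('a)) * (\<integral>\<^sup>+x\<in>U. cone_energy \<alpha> f e b t0 x \<partial>lborel)) =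
     ennreal (2 / m * (\<omega> * b ^ DIM('a))) * (\<integral>\<^sup>+x\<in>U. cone_energy \<alpha> f e b t0 x \<partial>lborel)"
  proof -
    have "0 \<le> 2 / m" using m by simp
    then show ?thesis by (simp only: ennreal_mult' mult.assoc)
  qed
  finally show ?thesis by (simp add: \<omega>_def d_def mult_left_mono)
qed

context thick_relation
begin

text \<open>Supplies the finiteness that is needed to absorb terms in the estimate at the boundary.\<close>
lemma AE_interior_frac_energy_finite:
  assumes [measurable]: "f \<in> borel_measurable borel" and \<Omega>: "open \<Omega>" and \<alpha>: "0 < \<alpha>"
    and fin: "dint \<Omega> (\<lambda>x y. Gsq f x y * frac_kernel \<alpha> x y) < top"
  shows "AE x in lborel. x \<in> \<Omega> \<longrightarrow> (\<exists>\<delta>>0. (\<integral>\<^sup>+y\<in>ball x \<delta>. sqd f x y * frac_kernel \<alpha> x y \<partial>lborel) < top)"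
proof -
  obtain C where C: "C < top" and le: "\<forall>f p r. f \<in> borel_measurable borel \<longrightarrow>
    dint (ball p r) (\<lambda>x y. sqd f x y * frac_kernel \<alpha> x y) \<le>
    C * dint (ball p (27 * r)) (\<lambda>x y. Gsq f x y * frac_kernel \<alpha> x y)"
    using frac_energy_ball_le[OF \<alpha>] by blast
  define F where "F = {ball p r |p r. ball p (27 * r) \<subseteq> \<Omega>}"
  \<comment> \<open>A countable subcover is required, because the finiteness obtained on each ball
    holds outside a null set that depends on the ball.\<close>
  obtain F' where F': "F' \<subseteq> F" "countable F'" "\<Union>F' = \<Union>F"
    using Lindelof[of F] by (auto simp: F_def)
  have U: "\<Omega> \<subseteq> \<Union>F"
  proof
    fix p assume "p \<in> \<Omega>"
    then obtain r where r: "r > 0" "ball p r \<subseteq> \<Omega>" using \<Omega> open_contains_ball by blast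
    then have "ball p (r / 27) \<in> F" by (auto simp: F_def intro!: exI[of _ p] exI[of _ "r / 27"])
    moreover have "p \<in> ball p (r / 27)" using r by simp
    ultimately show "p \<in> \<Union>F" by blast
  qed
  have "AE x in lborel. \<forall>S\<in>F'. x \<in> S \<longrightarrow> (\<integral>\<^sup>+y\<in>S. sqd f x y * frac_kernel \<alpha> x y \<partial>lborel) \<noteq> \<infinity>"
    unfolding AE_ball_countable[OF F'(2)]
  proof
    fix S assume "S \<in> F'"
    then obtain p r where S: "S = ball p r" "ball p (27 * r) \<subseteq> \<Omega>" using F'(1) by (auto simp: F_def)
    have "dint S (\<lambda>x y. sqd f x y * frac_kernel \<alpha> x y) \<le>
        C * dint (ball p (27 * r)) (\<lambda>x y. Gsq f x y * frac_kernel \<alpha> x y)"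
      unfolding S by (intro le[rule_format]) simp
    also have "\<dots> \<le> C * dint \<Omega> (\<lambda>x y. Gsq f x y * frac_kernel \<alpha> x y)"
      by (intro mult_left_mono dint_mono S) auto
    also have "\<dots> < top" using C fin by (simp add: ennreal_mult_less_top)
    finally have "(\<integral>\<^sup>+x. (\<integral>\<^sup>+y\<in>S. sqd f x y * frac_kernel \<alpha> x y \<partial>lborel) * indicator S x \<partial>lborel) \<noteq> \<infinity>"
      by (simp add: dint_def)
    then have "AE x in lborel. (\<integral>\<^sup>+y\<in>S. sqd f x y * frac_kernel \<alpha> x y \<partial>lborel) * indicator S x \<noteq> \<infinity>"
      by (intro nn_integral_PInf_AE) (auto simp: S)
    then show "AE x in lborel. x \<in> S \<longrightarrow> (\<integral>\<^sup>+y\<in>S. sqd f x y * frac_kernel \<alpha> x y \<partial>lborel) \<noteq> \<infinity>"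
      by eventually_elim auto
  qed
  then show ?thesis
  proof eventually_elim
    case (elim x)
    show ?case
    proof
      assume "x \<in> \<Omega>"
      then obtain S where S: "S \<in> F'" "x \<in> S" using U F'(3) by blast
      then have "open S" using F'(1) by (auto simp: F_def)
      then obtain \<delta> where \<delta>: "\<delta> > 0" "ball x \<delta> \<subseteq> S" using S open_contains_ball by blast
      have "(\<integral>\<^sup>+y\<in>ball x \<delta>. sqd f x y * frac_kernel \<alpha> x y \<partial>lborel) \<le> (\<integral>\<^sup>+y\<in>S. sqd f x y * frac_kernel \<alpha> x y \<partial>lborel)"
        by (intro set_nn_integral_mono \<delta>) auto
      also have "\<dots> < top" using elim S by (simp add: top.not_eq_extremum)
      finally show "\<exists>\<delta>>0. (\<integral>\<^sup>+y\<in>ball x \<delta>. sqd f x y * frac_kernel \<alpha> x y \<partial>lborel) < top"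
        using \<delta> by blast
    qed
  qed
qed

text \<open>The absorption leaves full energies of balls of radius \<open>2 * b * t\<close>.
  Replacing them by cone energies triples the radius, which is why balls of radius
  \<open>6 * b * t\<close> must lie in the domain. The factor \<open>4 / b\<close> in the condition
  on the diameter comes from \<open>frac_energy_le_cone_energy\<close>.\<close>

lemma boundary_energy_le:
  assumes \<alpha>: "0 < \<alpha>" and b: "0 < b" "b < 1" and e: "norm e = 1"
  shows "\<exists>C<top. \<forall>f U \<Omega> t0. f \<in> borel_measurable borel \<longrightarrow> U \<in> sets borel \<longrightarrow> open \<Omega> \<longrightarrow> U \<subseteq> \<Omega> \<longrightarrow>
    emeasure lborel \<Omega> < top \<longrightarrow> (\<integral>\<^sup>+y\<in>\<Omega>. ennreal ((f y)\<^sup>2) \<partial>lborel) < top \<longrightarrow>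
    (\<forall>x\<in>U. \<forall>t\<in>{0<..t0}. ball (x + t *\<^sub>R e) (6 * b * t) \<subseteq> \<Omega>) \<longrightarrow>
    (\<forall>x\<in>U. \<forall>y\<in>U. 4 / b * dist x y \<le> t0) \<longrightarrow>
    dint U (\<lambda>x y. sqd f x y * frac_kernel \<alpha> x y) \<le> C * dint \<Omega> (\<lambda>x y. Gsq f x y * frac_kernel \<alpha> x y)"
proof -
  obtain C1 where C1: "C1 < top" and dint_ball: "\<forall>f p \<rho>. f \<in> borel_measurable borel \<longrightarrow> \<rho> > 0 \<longrightarrow>
    dint (ball p \<rho>) (sqd f) \<le> C1 * dint (ball p (3 * \<rho>)) (Gsq f)"
    using dint_ball_le by blast
  define q where "q = 1 - b"
  define \<epsilon> where "\<epsilon> = q powr (- \<alpha> / 2) - 1"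
  define M where "M = ennreal ((1 + 1 / \<epsilon>) / (unit_ball_vol (real DIM('a)) * (b * q) ^ DIM('a)))"
  define Ca where "Ca = ennreal (1 / (1 - q powr (\<alpha> / 2)))"
  define Cs where "Cs = ennreal (unit_ball_vol DIM('a) * (6 * b) ^ DIM('a) *
    ((1 / (2 * (6 * b))) powr (- real DIM('a) - \<alpha>) / (real DIM('a) + \<alpha>)))"
  define Cd where "Cd = ennreal (2 / (unit_ball_vol (real DIM('a)) * (b / 2) ^ DIM('a) / 2 *
      (2 / b * (4 / b) powr (- \<alpha> - 1 - real DIM('a)))) * (unit_ball_vol (real DIM('a)) * b ^ DIM('a)))"
  \<comment> \<open>The summand 1 keeps \<open>C\<close> away from \<open>0\<close>, so that the
    estimate is trivial when the cone energy is infinite; only the finite case supplies what the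
    absorption requires.\<close>
  define C where "C = Cd * (Ca * (M * (C1 * Cs))) + 1"
  define \<gamma> where "\<gamma> = - \<alpha> - 1 - 2 * real DIM('a)"
  show ?thesis
  proof (intro exI[of _ C] conjI allI impI)
    show "C < top" using C1 by (simp add: C_def Cd_def Ca_def M_def Cs_def ennreal_mult_less_top)
    fix f :: "'a \<Rightarrow> real" and U \<Omega> :: "'a set" and t0 :: real
    assume f [measurable]: "f \<in> borel_measurable borel" and U [measurable]: "U \<in> sets borel" and \<Omega>: "open \<Omega>" "U \<subseteq> \<Omega>"
      and L: "emeasure lborel \<Omega> < top" "(\<integral>\<^sup>+y\<in>\<Omega>. ennreal ((f y)\<^sup>2) \<partial>lborel) < top"
      and sub: "\<forall>x\<in>U. \<forall>t\<in>{0<..t0}. ball (x + t *\<^sub>R e) (6 * b * t) \<subseteq> \<Omega>"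
      and diam: "\<forall>x\<in>U. \<forall>y\<in>U. 4 / b * dist x y \<le> t0"
    have [measurable]: "\<Omega> \<in> sets borel" using \<Omega> by simp
    let ?E = "dint \<Omega> (\<lambda>x y. Gsq f x y * frac_kernel \<alpha> x y)"
    show "dint U (\<lambda>x y. sqd f x y * frac_kernel \<alpha> x y) \<le> C * ?E"
    proof (cases "?E < top")
      case False
      then have "?E = top" using less_top by blast
      moreover have "C \<noteq> 0" by (simp add: C_def)
      ultimately show ?thesis by (simp add: ennreal_mult_top)
    next
      case True
      define \<Phi> where "\<Phi> = (\<lambda>x y. Gsq f x y * (indicator \<Omega> x * indicator \<Omega> y))"
      have [measurable]: "case_prod \<Phi> \<in> borel_measurable (borel \<Otimes>\<^sub>M borel)"
        unfolding \<Phi>_def by measurable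
      have [measurable]: "case_prod (sqd f) \<in> borel_measurable (borel \<Otimes>\<^sub>M borel)" by measurable
      have dm [measurable]: "(\<lambda>x. dint (ball (g x) (h x)) \<Psi>) \<in> borel_measurable M"
        if [measurable]: "g \<in> borel_measurable M" "h \<in> borel_measurable M" "case_prod \<Psi> \<in> borel_measurable (borel \<Otimes>\<^sub>M borel)"
        for g h \<Psi> and M :: "'c measure"
        unfolding dint_def by measurable
      define Y where "Y x = (\<integral>\<^sup>+t\<in>{0<..}. ennreal (t powr \<gamma>) * dint (ball (x + t *\<^sub>R e) (6 * b * t)) \<Phi> \<partial>lborel)" for x
      have [measurable]: "Y \<in> borel_measurable borel" unfolding Y_def by measurable
      \<comment> \<open>\<open>AE_interior_frac_energy_finite\<close> makes the left-hand side
        finite at almost every \<open>x\<close>. There the absorption is legitimate, and the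
        resulting bound no longer depends on the size of that finite value.\<close>
      have "AE x in lborel. cone_energy \<alpha> f e b t0 x * indicator U x \<le> Ca * (M * (C1 * Y x)) * indicator U x"
        using AE_interior_frac_energy_finite[OF f \<Omega>(1) \<alpha> True]
      proof eventually_elim
        case (elim x)
        show ?case
        proof (cases "x \<in> U")
          case xU: True
          then obtain \<delta> where \<delta>: "\<delta> > 0" "(\<integral>\<^sup>+y\<in>ball x \<delta>. sqd f x y * frac_kernel \<alpha> x y \<partial>lborel) < top"
            using elim \<Omega> by blast
          have "cone_energy \<alpha> f e b t0 x < top"
          proof (rule cone_energy_finite[OF f _ L e b \<alpha> \<delta>])
            fix t assume t: "t \<in> {0<..t0}"
            have "ball (x + t *\<^sub>R e) (b * t) \<subseteq> ball (x + t *\<^sub>R e) (6 * b * t)"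
              using t b by (intro subset_ball) simp
            then show "ball (x + t *\<^sub>R e) (b * t) \<subseteq> \<Omega>" using sub xU t by blast
          qed simp
          from cone_energy_absorb[OF f b e \<alpha> this]
          have "cone_energy \<alpha> f e b t0 x \<le> Ca * (M *
            (\<integral>\<^sup>+t\<in>{0<..t0}. ennreal (t powr \<gamma>) * dint (ball (x + t *\<^sub>R e) (2 * b * t)) (sqd f) \<partial>lborel))"
            by (simp only: Ca_def M_def \<epsilon>_def q_def \<gamma>_def)
          also have "\<dots> \<le> Ca * (M *
            (\<integral>\<^sup>+t\<in>{0<..}. C1 * (ennreal (t powr \<gamma>) * dint (ball (x + t *\<^sub>R e) (6 * b * t)) \<Phi>) \<partial>lborel))"
          proof (intro mult_left_mono set_nn_integral_mono)
            fix t assume t: "t \<in> {0<..t0}"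
            have "dint (ball (x + t *\<^sub>R e) (2 * b * t)) (sqd f) \<le> C1 * dint (ball (x + t *\<^sub>R e) (3 * (2 * b * t))) (Gsq f)"
              using t b by (intro dint_ball[rule_format]) auto
            also have "dint (ball (x + t *\<^sub>R e) (3 * (2 * b * t))) (Gsq f) \<le> dint (ball (x + t *\<^sub>R e) (6 * b * t)) \<Phi>"
            proof (rule dint_mono)
              fix y z assume "y \<in> ball (x + t *\<^sub>R e) (3 * (2 * b * t))" "z \<in> ball (x + t *\<^sub>R e) (3 * (2 * b * t))"
              moreover have "ball (x + t *\<^sub>R e) (6 * b * t) \<subseteq> \<Omega>" using sub xU t by blast
              ultimately have "y \<in> \<Omega>" "z \<in> \<Omega>" by auto
              then show "Gsq f y z \<le> \<Phi> y z" by (simp add: \<Phi>_def)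
            next
              have "3 * (2 * b * t) = 6 * b * t" by simp
              then show "ball (x + t *\<^sub>R e) (3 * (2 * b * t)) \<subseteq> ball (x + t *\<^sub>R e) (6 * b * t)"
                by (simp only: order_refl)
            qed
            finally have "dint (ball (x + t *\<^sub>R e) (2 * b * t)) (sqd f) \<le> C1 * dint (ball (x + t *\<^sub>R e) (6 * b * t)) \<Phi>"
              by (simp add: mult_left_mono)
            from mult_left_mono[OF this zero_le, of "ennreal (t powr \<gamma>)"]
            show "ennreal (t powr \<gamma>) * dint (ball (x + t *\<^sub>R e) (2 * b * t)) (sqd f) \<le>
              C1 * (ennreal (t powr \<gamma>) * dint (ball (x + t *\<^sub>R e) (6 * b * t)) \<Phi>)"
              by (simp only: mult.left_commute)
          qed auto
          also have "(\<integral>\<^sup>+t\<in>{0<..}. C1 * (ennreal (t powr \<gamma>) * dint (ball (x + t *\<^sub>R e) (6 * b * t)) \<Phi>) \<partial>lborel) = C1 * Y x"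
            unfolding Y_def by (rule set_nn_integral_cmult) measurable
          finally show ?thesis using xU by simp
        qed simp
      qed
      then have "(\<integral>\<^sup>+x\<in>U. cone_energy \<alpha> f e b t0 x \<partial>lborel) \<le> (\<integral>\<^sup>+x\<in>U. Ca * (M * (C1 * Y x)) \<partial>lborel)"
        by (rule nn_integral_mono_AE)
      also have "\<dots> \<le> (\<integral>\<^sup>+x. Ca * (M * (C1 * Y x)) \<partial>lborel)"
        by (intro nn_integral_mono) (auto simp: indicator_def)
      also have "\<dots> = Ca * (M * (C1 * (\<integral>\<^sup>+x. Y x \<partial>lborel)))"
        by (simp add: nn_integral_cmult)
      also have "(\<integral>\<^sup>+x. Y x \<partial>lborel) = (\<integral>\<^sup>+t. \<integral>\<^sup>+x. ennreal (t powr \<gamma>) * dint (ball (x + t *\<^sub>R e) (6 * b * t)) \<Phi> * indicator {0<..} t \<partial>lborel \<partial>lborel)"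
        unfolding Y_def by (rule nn_integral_lborel_swap) measurable
      also have "\<dots> = (\<integral>\<^sup>+t\<in>{0<..}. ennreal (t powr \<gamma>) * (\<integral>\<^sup>+x. dint (ball (x + t *\<^sub>R e) (6 * b * t)) \<Phi> \<partial>lborel) \<partial>lborel)"
      proof (rule nn_integral_cong)
        fix t
        have "(\<lambda>x. dint (ball (x + t *\<^sub>R e) (6 * b * t)) \<Phi>) \<in> borel_measurable lborel" by measurable
        then show "(\<integral>\<^sup>+x. ennreal (t powr \<gamma>) * dint (ball (x + t *\<^sub>R e) (6 * b * t)) \<Phi> * indicator {0<..} t \<partial>lborel) =
          ennreal (t powr \<gamma>) * (\<integral>\<^sup>+x. dint (ball (x + t *\<^sub>R e) (6 * b * t)) \<Phi> \<partial>lborel) * indicator {0<..} t"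
          by (simp add: nn_integral_cmult nn_integral_multc)
      qed
      also have "\<dots> \<le> Cs * (\<integral>\<^sup>+x. \<integral>\<^sup>+y. \<Phi> x y * frac_kernel \<alpha> x y \<partial>lborel \<partial>lborel)"
        unfolding Cs_def \<gamma>_def using b by (intro scale_integral_le \<alpha>) auto
      also have "(\<integral>\<^sup>+x. \<integral>\<^sup>+y. \<Phi> x y * frac_kernel \<alpha> x y \<partial>lborel \<partial>lborel) = ?E"
        unfolding dint_conv \<Phi>_def by (simp add: mult_ac)
      finally have X: "(\<integral>\<^sup>+x\<in>U. cone_energy \<alpha> f e b t0 x \<partial>lborel) \<le> Ca * (M * (C1 * (Cs * ?E)))"
        by (simp add: mult_left_mono)
      have "dint U (\<lambda>x y. sqd f x y * frac_kernel \<alpha> x y) \<le> Cd * (\<integral>\<^sup>+x\<in>U. cone_energy \<alpha> f e b t0 x \<partial>lborel)"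
        unfolding Cd_def by (rule frac_energy_le_cone_energy[OF f U b(1) \<alpha>]) (use diam in blast)
      also have "\<dots> \<le> Cd * (Ca * (M * (C1 * (Cs * ?E))))" by (intro mult_left_mono X) simp
      also have "\<dots> \<le> C * ?E" by (simp add: C_def distrib_right mult.assoc)
      finally show ?thesis .
    qed
  qed
qed

end

section \<open>From local to global\<close>

definition cross_int :: "'a::euclidean_space set \<Rightarrow> 'a set \<Rightarrow> ('a \<Rightarrow> 'a \<Rightarrow> ennreal) \<Rightarrow> ennreal" where
  "cross_int S T \<Phi> = (\<integral>\<^sup>+x. \<integral>\<^sup>+y. \<Phi> x y * (indicator S x * indicator T y) \<partial>lborel \<partial>lborel)"

lemma cross_int_mono:
  assumes "S \<subseteq> S'" "T \<subseteq> T'"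
  shows "cross_int S T \<Phi> \<le> cross_int S' T' \<Phi>"
  unfolding cross_int_def by (intro nn_integral_mono) (use assms in \<open>auto simp: indicator_def\<close>)

text \<open>The triangle inequality \<open>sqd_triangle\<close> through \<open>z\<close>, integrated
  over \<open>x \<in> S\<close>, \<open>y \<in> T\<close> and \<open>z \<in> Z\<close>. The variable
  missing from each term contributes the measure of its set.\<close>

lemma cross_int_chain:
  fixes f :: "'a::euclidean_space \<Rightarrow> real"
  assumes [measurable]: "f \<in> borel_measurable borel" "S \<in> sets borel" "T \<in> sets borel" "Z \<in> sets borel"
  shows "emeasure lborel Z * cross_int S T (sqd f) \<le>
    2 * (emeasure lborel T * cross_int S Z (sqd f)) + 2 * (emeasure lborel S * cross_int Z T (sqd f))"
proof -
  have "emeasure lborel Z * cross_int S T (sqd f) =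
      (\<integral>\<^sup>+x. \<integral>\<^sup>+y. \<integral>\<^sup>+z. sqd f x y * (indicator S x * indicator T y) * indicator Z z \<partial>lborel \<partial>lborel \<partial>lborel)"
    unfolding cross_int_def by (simp add: nn_integral_cmult_indicator nn_integral_multc mult.commute[of "emeasure lborel Z"])
  also have "\<dots> \<le> (\<integral>\<^sup>+x. \<integral>\<^sup>+y. \<integral>\<^sup>+z. 2 * (sqd f x z * (indicator S x * indicator Z z) * indicator T y) +
      2 * (sqd f z y * (indicator Z z * indicator T y) * indicator S x) \<partial>lborel \<partial>lborel \<partial>lborel)"
    by (intro nn_integral_mono) (use sqd_triangle[of f] in \<open>auto simp: indicator_def\<close>)
  also have "\<dots> = 2 * (\<integral>\<^sup>+x. \<integral>\<^sup>+y. \<integral>\<^sup>+z. sqd f x z * (indicator S x * indicator Z z) * indicator T y \<partial>lborel \<partial>lborel \<partial>lborel) +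
      2 * (\<integral>\<^sup>+x. \<integral>\<^sup>+y. \<integral>\<^sup>+z. sqd f z y * (indicator Z z * indicator T y) * indicator S x \<partial>lborel \<partial>lborel \<partial>lborel)"
    by (simp add: nn_integral_add nn_integral_cmult)
  also have "(\<integral>\<^sup>+x. \<integral>\<^sup>+y. \<integral>\<^sup>+z. sqd f x z * (indicator S x * indicator Z z) * indicator T y \<partial>lborel \<partial>lborel \<partial>lborel) =
      emeasure lborel T * cross_int S Z (sqd f)"
    unfolding cross_int_def
    by (simp add: nn_integral_multc nn_integral_cmult_indicator mult.commute[of "emeasure lborel T"])
  also have "(\<integral>\<^sup>+x. \<integral>\<^sup>+y. \<integral>\<^sup>+z. sqd f z y * (indicator Z z * indicator T y) * indicator S x \<partial>lborel \<partial>lborel \<partial>lborel) =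
      emeasure lborel S * cross_int Z T (sqd f)"
  proof -
    have "(\<integral>\<^sup>+x. \<integral>\<^sup>+y. \<integral>\<^sup>+z. sqd f z y * (indicator Z z * indicator T y) * indicator S x \<partial>lborel \<partial>lborel \<partial>lborel) =
        (\<integral>\<^sup>+y. \<integral>\<^sup>+z. sqd f z y * (indicator Z z * indicator T y) \<partial>lborel \<partial>lborel) * emeasure lborel S"
      by (simp add: nn_integral_multc nn_integral_cmult_indicator)
    also have "(\<integral>\<^sup>+y. \<integral>\<^sup>+z. sqd f z y * (indicator Z z * indicator T y) \<partial>lborel \<partial>lborel) = cross_int Z T (sqd f)"
      unfolding cross_int_def by (rule nn_integral_lborel_swap) measurable
    finally show ?thesis by (simp add: mult.commute)
  qed
  finally show ?thesis .
qed

lemma cross_int_chain_bound: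
  fixes f :: "'a::euclidean_space \<Rightarrow> real"
  assumes f: "f \<in> borel_measurable borel" and S: "S \<in> sets borel" "T \<in> sets borel" "Z \<in> sets borel"
    and Z: "0 < emeasure lborel Z" "emeasure lborel Z < top"
  shows "cross_int S T (sqd f) \<le> inverse (emeasure lborel Z) *
    (2 * (emeasure lborel T * cross_int S Z (sqd f)) + 2 * (emeasure lborel S * cross_int Z T (sqd f)))"
proof -
  have "inverse (emeasure lborel Z) * emeasure lborel Z = 1"
    using Z ennreal_divide_self[of "emeasure lborel Z"]
    by (simp add: divide_ennreal_def mult.commute less_top)
  then have "cross_int S T (sqd f) = inverse (emeasure lborel Z) * (emeasure lborel Z * cross_int S T (sqd f))"
    by (simp add: mult.assoc[symmetric])
  also have "\<dots> \<le> inverse (emeasure lborel Z) *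
    (2 * (emeasure lborel T * cross_int S Z (sqd f)) + 2 * (emeasure lborel S * cross_int Z T (sqd f)))"
    by (intro mult_left_mono cross_int_chain f S) simp
  finally show ?thesis .
qed

lemma emeasure_lborel_open_pos:
  fixes S :: "'a::euclidean_space set"
  assumes "open S" "S \<noteq> {}"
  shows "0 < emeasure lborel S"
proof -
  obtain x r where "r > 0" "ball x r \<subseteq> S" using assms open_contains_ball by blast
  then have "0 < emeasure lborel (ball x r)" by (simp add: emeasure_ball ennreal_less_zero_iff)
  also have "\<dots> \<le> emeasure lborel S" using \<open>ball x r \<subseteq> S\<close> assms by (intro emeasure_mono) auto
  finally show ?thesis .
qed

lemma emeasure_lborel_bounded_less_top:
  fixes S :: "'a::euclidean_space set"
  assumes "bounded S"
  shows "emeasure lborel S < top"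
proof -
  obtain r where r: "r > 0" "S \<subseteq> ball 0 r" using assms bounded_subset_ballD by blast
  have "emeasure lborel S \<le> emeasure lborel (ball (0::'a) r)"
    using r(2) by (intro emeasure_mono) auto
  also have "\<dots> < top" using r by (simp add: emeasure_ball)
  finally show ?thesis .
qed

lemma sqd_le_kernel:
  fixes x y :: "'a::euclidean_space"
  assumes "dist x y \<le> D" "0 < D" and \<alpha>: "0 < \<alpha>"
  shows "sqd f x y \<le> ennreal (D powr (real DIM('a) + \<alpha>)) * (sqd f x y * frac_kernel \<alpha> x y)"
proof (cases "x = y")
  case True then show ?thesis by (simp add: sqd_def)
next
  case False
  have "1 = D powr (real DIM('a) + \<alpha>) * D powr (- real DIM('a) - \<alpha>)"
    using assms by (simp add: powr_add[symmetric])
  also have "\<dots> \<le> D powr (real DIM('a) + \<alpha>) * dist x y powr (- real DIM('a) - \<alpha>)"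
    using False assms by (intro mult_left_mono powr_mono2') auto
  finally have "ennreal 1 \<le> ennreal (D powr (real DIM('a) + \<alpha>) * dist x y powr (- real DIM('a) - \<alpha>))"
    by (rule ennreal_leI)
  also have "\<dots> = ennreal (D powr (real DIM('a) + \<alpha>)) * frac_kernel \<alpha> x y"
    using False by (simp add: frac_kernel_def dist_norm ennreal_mult')
  finally have "1 \<le> ennreal (D powr (real DIM('a) + \<alpha>)) * frac_kernel \<alpha> x y" by simp
  from mult_left_mono[OF this zero_le, of "sqd f x y"] show ?thesis by (simp add: mult_ac)
qed

lemma kernel_le_far:
  fixes x y :: "'a::euclidean_space"
  assumes "\<delta> \<le> dist x y" "0 < \<delta>" and \<alpha>: "0 < \<alpha>"
  shows "frac_kernel \<alpha> x y \<le> ennreal (\<delta> powr (- real DIM('a) - \<alpha>))"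
proof -
  have "dist x y powr (- real DIM('a) - \<alpha>) \<le> \<delta> powr (- real DIM('a) - \<alpha>)"
    using assms by (intro powr_mono2') auto
  then show ?thesis using assms by (auto simp: frac_kernel_def dist_norm intro: ennreal_leI)
qed

text \<open>Far pairs are reached along a chain of overlapping sets of a finite subcover; connectedness
  of the domain makes any two of these sets linked.\<close>
lemma frac_energy_globalise:
  fixes \<Omega> :: "'a::euclidean_space set" and F :: "('a \<Rightarrow> real) set" and Q :: "('a \<Rightarrow> real) \<Rightarrow> ennreal"
  assumes \<Omega>: "open \<Omega>" "connected \<Omega>" "bounded \<Omega>" and \<alpha>: "0 < \<alpha>"
    and F: "\<And>f. f \<in> F \<Longrightarrow> f \<in> borel_measurable borel"
    and loc: "\<And>p. p \<in> closure \<Omega> \<Longrightarrow> \<exists>W. open W \<and> p \<in> W \<and>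
      (\<exists>C<top. \<forall>f\<in>F. dint (W \<inter> \<Omega>) (\<lambda>x y. sqd f x y * frac_kernel \<alpha> x y) \<le> C * Q f)"
  shows "\<exists>C<top. \<forall>f\<in>F. dint \<Omega> (\<lambda>x y. sqd f x y * frac_kernel \<alpha> x y) \<le> C * Q f"
proof (cases "\<Omega> = {}")
  case True
  then show ?thesis by (intro exI[of _ 0]) (simp add: dint_def)
next
  case False
  define good where "good W \<longleftrightarrow> open W \<and>
      (\<exists>C<top. \<forall>f\<in>F. dint (W \<inter> \<Omega>) (\<lambda>x y. sqd f x y * frac_kernel \<alpha> x y) \<le> C * Q f)" for W :: "'a set"
  have comp: "compact (closure \<Omega>)" using \<Omega> by simp
  have cov: "closure \<Omega> \<subseteq> \<Union>{W. good W}"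
  proof
    fix p assume "p \<in> closure \<Omega>"
    from loc[OF this] obtain W where "good W" "p \<in> W" unfolding good_def by blast
    then show "p \<in> \<Union>{W. good W}" by blast
  qed
  have opg: "open W" if "W \<in> {W. good W}" for W using that unfolding good_def by blast
  obtain \<W> where \<W>: "\<W> \<subseteq> {W. good W}" "finite \<W>" "closure \<Omega> \<subseteq> \<Union>\<W>"
    by (rule compactE[OF comp cov opg])
  have opW: "open W" if "W \<in> \<W>" for W using \<W>(1) that opg by blast
  have "\<exists>C. \<forall>W\<in>\<W>. C W < top \<and> (\<forall>f\<in>F. dint (W \<inter> \<Omega>) (\<lambda>x y. sqd f x y * frac_kernel \<alpha> x y) \<le> C W * Q f)"
    by (rule bchoice) (use \<W>(1) in \<open>unfold good_def, blast\<close>)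
  then obtain C0 where C0: "\<And>W. W \<in> \<W> \<Longrightarrow> C0 W < top"
      "\<And>W f. W \<in> \<W> \<Longrightarrow> f \<in> F \<Longrightarrow> dint (W \<inter> \<Omega>) (\<lambda>x y. sqd f x y * frac_kernel \<alpha> x y) \<le> C0 W * Q f"
    by blast
  obtain D where D: "D > 0" "\<And>x y. x \<in> \<Omega> \<Longrightarrow> y \<in> \<Omega> \<Longrightarrow> dist x y \<le> D"
  proof -
    have "dist x y \<le> diameter \<Omega> + 1" if "x \<in> \<Omega>" "y \<in> \<Omega>" for x y
      using diameter_bounded_bound[OF \<Omega>(3) that] by simp
    moreover have "diameter \<Omega> + 1 > 0" using diameter_ge_0[OF \<Omega>(3)] by simp
    ultimately show ?thesis using that by blast
  qed
  have meas: "W \<inter> \<Omega> \<in> sets borel" if "W \<in> \<W>" for W using opW[OF that] \<Omega> by (intro borel_open open_Int)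
  have emf: "emeasure lborel (W \<inter> \<Omega>) < top" for W
    using \<Omega> by (intro emeasure_lborel_bounded_less_top) (simp add: bounded_Int)
  \<comment> \<open>Linking concerns differences without the kernel. On the bounded set
    \<open>\<Omega>\<close> the kernel is bounded below, so a local energy estimate links a set with
    itself; far apart it is bounded above, so links suffice for the distant pairs.\<close>
  define linked where "linked W W' \<longleftrightarrow> (\<exists>C<top. \<forall>f\<in>F. cross_int (W \<inter> \<Omega>) (W' \<inter> \<Omega>) (sqd f) \<le> C * Q f)" for W W'
  have refl: "linked W W" if W: "W \<in> \<W>" for W
    unfolding linked_def
  proof (intro exI[of _ "ennreal (D powr (real DIM('a) + \<alpha>)) * C0 W"] conjI ballI)
    show "ennreal (D powr (real DIM('a) + \<alpha>)) * C0 W < top" using C0(1)[OF W] by (simp add: ennreal_mult_less_top)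
    fix f assume f: "f \<in> F"
    have [measurable]: "f \<in> borel_measurable borel" "W \<inter> \<Omega> \<in> sets borel" using F[OF f] meas[OF W] by auto
    have "cross_int (W \<inter> \<Omega>) (W \<inter> \<Omega>) (sqd f) \<le>
        (\<integral>\<^sup>+x. \<integral>\<^sup>+y. ennreal (D powr (real DIM('a) + \<alpha>)) * (sqd f x y * frac_kernel \<alpha> x y * (indicator (W \<inter> \<Omega>) x * indicator (W \<inter> \<Omega>) y)) \<partial>lborel \<partial>lborel)"
      unfolding cross_int_def
    proof (intro nn_integral_mono)
      fix x y
      show "sqd f x y * (indicator (W \<inter> \<Omega>) x * indicator (W \<inter> \<Omega>) y) \<le>
        ennreal (D powr (real DIM('a) + \<alpha>)) * (sqd f x y * frac_kernel \<alpha> x y * (indicator (W \<inter> \<Omega>) x * indicator (W \<inter> \<Omega>) y))"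
        using sqd_le_kernel[of x y D \<alpha> f] D \<alpha> by (auto simp: indicator_def)
    qed
    also have "\<dots> = ennreal (D powr (real DIM('a) + \<alpha>)) * dint (W \<inter> \<Omega>) (\<lambda>x y. sqd f x y * frac_kernel \<alpha> x y)"
      unfolding dint_conv by (simp add: nn_integral_cmult)
    also have "\<dots> \<le> ennreal (D powr (real DIM('a) + \<alpha>)) * (C0 W * Q f)"
      by (intro mult_left_mono C0 W f) simp
    finally show "cross_int (W \<inter> \<Omega>) (W \<inter> \<Omega>) (sqd f) \<le> ennreal (D powr (real DIM('a) + \<alpha>)) * C0 W * Q f"
      by (simp add: mult.assoc)
  qed
  have step: "linked W W''" if L: "linked W W'" and W: "W \<in> \<W>" "W' \<in> \<W>" "W'' \<in> \<W>" and ne: "W' \<inter> W'' \<inter> \<Omega> \<noteq> {}" for W W' W''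
  proof -
    obtain C1 where C1: "C1 < top" "\<And>f. f \<in> F \<Longrightarrow> cross_int (W \<inter> \<Omega>) (W' \<inter> \<Omega>) (sqd f) \<le> C1 * Q f"
      using L by (auto simp: linked_def)
    obtain C2 where C2: "C2 < top" "\<And>f. f \<in> F \<Longrightarrow> cross_int (W'' \<inter> \<Omega>) (W'' \<inter> \<Omega>) (sqd f) \<le> C2 * Q f"
      using refl[OF W(3)] by (auto simp: linked_def)
    define Z where "Z = W' \<inter> W'' \<inter> \<Omega>"
    have Z: "open Z" "Z \<noteq> {}" "Z \<subseteq> W' \<inter> \<Omega>" "Z \<subseteq> W'' \<inter> \<Omega>"
      using ne opW W \<Omega> by (auto simp: Z_def intro!: open_Int)
    have Zm: "0 < emeasure lborel Z" "emeasure lborel Z < top"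
      using emeasure_lborel_open_pos[OF Z(1,2)] emf[of "W' \<inter> W''"] by (auto simp: Z_def)
    let ?i = "inverse (emeasure lborel Z)" and ?m = "emeasure lborel (W \<inter> \<Omega>)" and ?m'' = "emeasure lborel (W'' \<inter> \<Omega>)"
    have i: "?i < top" using Zm by (simp add: less_top[symmetric] ennreal_inverse_eq_top_iff)
    show ?thesis
      unfolding linked_def
    proof (intro exI[of _ "?i * (2 * (?m'' * C1) + 2 * (?m * C2))"] conjI ballI)
      show "?i * (2 * (?m'' * C1) + 2 * (?m * C2)) < top"
        using i emf C1 C2 by (simp add: ennreal_mult_less_top)
      fix f assume f: "f \<in> F"
      have "cross_int (W \<inter> \<Omega>) (W'' \<inter> \<Omega>) (sqd f) \<le> ?i *
        (2 * (?m'' * cross_int (W \<inter> \<Omega>) Z (sqd f)) + 2 * (?m * cross_int Z (W'' \<inter> \<Omega>) (sqd f)))"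
        using Z W by (intro cross_int_chain_bound F f meas Zm) auto
      also have "\<dots> \<le> ?i * (2 * (?m'' * (C1 * Q f)) + 2 * (?m * (C2 * Q f)))"
      proof (intro mult_left_mono add_mono zero_le)
        show "cross_int (W \<inter> \<Omega>) Z (sqd f) \<le> C1 * Q f"
          by (rule order_trans[OF cross_int_mono[OF order_refl Z(3)] C1(2)[OF f]])
        show "cross_int Z (W'' \<inter> \<Omega>) (sqd f) \<le> C2 * Q f"
          by (rule order_trans[OF cross_int_mono[OF Z(4) order_refl] C2(2)[OF f]])
      qed
      also have "\<dots> = ?i * (2 * (?m'' * C1) + 2 * (?m * C2)) * Q f"
        by (simp add: distrib_left distrib_right mult.assoc)
      finally show "cross_int (W \<inter> \<Omega>) (W'' \<inter> \<Omega>) (sqd f) \<le> ?i * (2 * (?m'' * C1) + 2 * (?m * C2)) * Q f" .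
    qed
  qed
  have all_linked: "linked W W'" if W: "W \<in> \<W>" "W' \<in> \<W>" "W \<inter> \<Omega> \<noteq> {}" "W' \<inter> \<Omega> \<noteq> {}" for W W'
  proof (rule ccontr)
    assume n: "\<not> linked W W'"
    \<comment> \<open>If \<open>W\<close> were not linked with some set of the cover, the sets
      linked with \<open>W\<close> and the others would separate \<open>\<Omega>\<close>: an overlap
      of the two families inside \<open>\<Omega>\<close> would extend the link by
      \<open>step\<close>.\<close>
    define A where "A = \<Union>{V \<inter> \<Omega> |V. V \<in> \<W> \<and> linked W V}"
    define B where "B = \<Union>{V \<inter> \<Omega> |V. V \<in> \<W> \<and> \<not> linked W V}"
    have "open A" "open B" using opW \<Omega> by (auto simp: A_def B_def)
    moreover have "\<Omega> \<subseteq> A \<union> B"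
    proof
      fix x assume x: "x \<in> \<Omega>"
      then obtain V where "V \<in> \<W>" "x \<in> V" using \<W>(3) closure_subset by blast
      then show "x \<in> A \<union> B" using x by (auto simp: A_def B_def)
    qed
    moreover have "A \<inter> B \<inter> \<Omega> = {}"
    proof (rule ccontr)
      assume "A \<inter> B \<inter> \<Omega> \<noteq> {}"
      then obtain z V V' where "V \<in> \<W>" "linked W V" "z \<in> V" "V' \<in> \<W>" "\<not> linked W V'" "z \<in> V'" "z \<in> \<Omega>"
        by (auto simp: A_def B_def)
      then show False using step[of W V V'] W(1) by blast
    qed
    moreover have "A \<inter> \<Omega> \<noteq> {}" using W refl[OF W(1)] by (auto simp: A_def)
    moreover have "B \<inter> \<Omega> \<noteq> {}" using W n by (auto simp: B_def)
    ultimately show False using \<Omega>(2) unfolding connected_def by blast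
  qed
  define \<W>0 where "\<W>0 = {W \<in> \<W>. W \<inter> \<Omega> \<noteq> {}}"
  have fin0: "finite \<W>0" using \<W> by (simp add: \<W>0_def)
  have "\<exists>C. \<forall>P\<in>\<W>0 \<times> \<W>0. C P < top \<and> (\<forall>f\<in>F. cross_int (fst P \<inter> \<Omega>) (snd P \<inter> \<Omega>) (sqd f) \<le> C P * Q f)"
  proof (rule bchoice, rule ballI)
    fix P assume "P \<in> \<W>0 \<times> \<W>0"
    then have "linked (fst P) (snd P)" by (intro all_linked) (auto simp: \<W>0_def)
    then show "\<exists>C. C < top \<and> (\<forall>f\<in>F. cross_int (fst P \<inter> \<Omega>) (snd P \<inter> \<Omega>) (sqd f) \<le> C * Q f)"
      unfolding linked_def .
  qed
  then obtain C1 where C1': "\<forall>P\<in>\<W>0 \<times> \<W>0. C1 P < top \<and>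
      (\<forall>f\<in>F. cross_int (fst P \<inter> \<Omega>) (snd P \<inter> \<Omega>) (sqd f) \<le> C1 P * Q f)" ..
  have C1: "C1 P < top" "f \<in> F \<Longrightarrow> cross_int (fst P \<inter> \<Omega>) (snd P \<inter> \<Omega>) (sqd f) \<le> C1 P * Q f"
    if "P \<in> \<W>0 \<times> \<W>0" for P f
    using bspec[OF C1' that] by auto
  have sub: "\<Omega> \<subseteq> \<Union>\<W>" using \<W>(3) closure_subset[of \<Omega>] by blast
  have "\<W> \<noteq> {}" using sub False by blast
  \<comment> \<open>A Lebesgue number of the cover: pairs at distance less than
    \<open>\<delta>\<close> lie in a common member and belong to its local energy, while for all
    other pairs the kernel is at most the constant \<open>c\<close>.\<close>
  obtain \<delta> where \<delta>: "\<delta> > 0" "\<And>T. T \<subseteq> closure \<Omega> \<Longrightarrow> diameter T < \<delta> \<Longrightarrow> \<exists>B\<in>\<W>. T \<subseteq> B"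
    by (rule Lebesgue_number_lemma[OF comp \<open>\<W> \<noteq> {}\<close> \<W>(3) opW]) auto
  define c where "c = ennreal (\<delta> powr (- real DIM('a) - \<alpha>))"
  have near_far: "sqd f x y * frac_kernel \<alpha> x y * (indicator \<Omega> x * indicator \<Omega> y) \<le>
      (\<Sum>W\<in>\<W>0. sqd f x y * frac_kernel \<alpha> x y * (indicator (W \<inter> \<Omega>) x * indicator (W \<inter> \<Omega>) y)) +
      c * (\<Sum>P\<in>\<W>0 \<times> \<W>0. sqd f x y * (indicator (fst P \<inter> \<Omega>) x * indicator (snd P \<inter> \<Omega>) y))" for f :: "'a \<Rightarrow> real" and x y
  proof (cases "x \<in> \<Omega> \<and> y \<in> \<Omega>")
    case xy: True
    show ?thesis
    proof (cases "dist x y < \<delta>")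
      case True
      have "diameter {x, y} \<le> dist x y"
        by (rule diameter_le) (auto simp: dist_norm norm_minus_commute)
      moreover have "{x, y} \<subseteq> closure \<Omega>" using xy closure_subset[of \<Omega>] by blast
      ultimately obtain W where W: "W \<in> \<W>" "x \<in> W" "y \<in> W" using \<delta>(2)[of "{x, y}"] True by auto
      then have W0: "W \<in> \<W>0" using xy by (auto simp: \<W>0_def)
      have "sqd f x y * frac_kernel \<alpha> x y * (indicator \<Omega> x * indicator \<Omega> y) =
          sqd f x y * frac_kernel \<alpha> x y * (indicator (W \<inter> \<Omega>) x * indicator (W \<inter> \<Omega>) y)"
        using W xy by simp
      also have "\<dots> \<le> (\<Sum>W\<in>\<W>0. sqd f x y * frac_kernel \<alpha> x y * (indicator (W \<inter> \<Omega>) x * indicator (W \<inter> \<Omega>) y))"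
        using W0 fin0 by (intro member_le_sum) auto
      finally show ?thesis by (rule add_increasing2[rotated]) simp
    next
      case False
      obtain W where W: "W \<in> \<W>0" "x \<in> W" using xy sub unfolding \<W>0_def by blast
      obtain W' where W': "W' \<in> \<W>0" "y \<in> W'" using xy sub unfolding \<W>0_def by blast
      have "sqd f x y * frac_kernel \<alpha> x y \<le> sqd f x y * c"
        unfolding c_def using False \<delta> \<alpha> by (intro mult_left_mono kernel_le_far) auto
      then have "sqd f x y * frac_kernel \<alpha> x y * (indicator \<Omega> x * indicator \<Omega> y) \<le>
          c * (sqd f x y * (indicator (fst (W, W') \<inter> \<Omega>) x * indicator (snd (W, W') \<inter> \<Omega>) y))"
        using W W' xy by (simp add: mult.commute)
      also have "\<dots> \<le> c * (\<Sum>P\<in>\<W>0 \<times> \<W>0. sqd f x y * (indicator (fst P \<inter> \<Omega>) x * indicator (snd P \<inter> \<Omega>) y))"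
        using W W' fin0 by (intro mult_left_mono member_le_sum) auto
      finally show ?thesis by (rule add_increasing[rotated]) (simp add: sum_nonneg)
    qed
  qed auto
  show ?thesis
  proof (intro exI[of _ "(\<Sum>W\<in>\<W>0. C0 W) + c * (\<Sum>P\<in>\<W>0 \<times> \<W>0. C1 P)"] conjI ballI)
    show "(\<Sum>W\<in>\<W>0. C0 W) + c * (\<Sum>P\<in>\<W>0 \<times> \<W>0. C1 P) < top"
      using fin0 C0 C1 by (auto simp: c_def ennreal_mult_less_top \<W>0_def)
    fix f assume f: "f \<in> F"
    note [measurable] = F[OF f]
    have [measurable]: "W \<in> \<W>0 \<Longrightarrow> W \<inter> \<Omega> \<in> sets borel" for W using meas by (auto simp: \<W>0_def)
    have [measurable]: "P \<in> \<W>0 \<times> \<W>0 \<Longrightarrow> fst P \<inter> \<Omega> \<in> sets borel" "P \<in> \<W>0 \<times> \<W>0 \<Longrightarrow> snd P \<inter> \<Omega> \<in> sets borel" for P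
      using meas by (auto simp: \<W>0_def)
    have "dint \<Omega> (\<lambda>x y. sqd f x y * frac_kernel \<alpha> x y) \<le> (\<integral>\<^sup>+x. \<integral>\<^sup>+y.
      (\<Sum>W\<in>\<W>0. sqd f x y * frac_kernel \<alpha> x y * (indicator (W \<inter> \<Omega>) x * indicator (W \<inter> \<Omega>) y)) +
      c * (\<Sum>P\<in>\<W>0 \<times> \<W>0. sqd f x y * (indicator (fst P \<inter> \<Omega>) x * indicator (snd P \<inter> \<Omega>) y)) \<partial>lborel \<partial>lborel)"
      unfolding dint_conv by (intro nn_integral_mono near_far)
    also have "\<dots> = (\<Sum>W\<in>\<W>0. dint (W \<inter> \<Omega>) (\<lambda>x y. sqd f x y * frac_kernel \<alpha> x y)) +
      c * (\<Sum>P\<in>\<W>0 \<times> \<W>0. cross_int (fst P \<inter> \<Omega>) (snd P \<inter> \<Omega>) (sqd f))"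
      unfolding dint_conv cross_int_def
      by (simp add: nn_integral_add nn_integral_cmult nn_integral_sum del: sum.cartesian_product)
    also have "\<dots> \<le> (\<Sum>W\<in>\<W>0. C0 W * Q f) + c * (\<Sum>P\<in>\<W>0 \<times> \<W>0. C1 P * Q f)"
      using C0(2)[OF _ f] C1(2)[OF _ f] by (intro add_mono sum_mono mult_left_mono) (auto simp: \<W>0_def)
    also have "\<dots> = ((\<Sum>W\<in>\<W>0. C0 W) + c * (\<Sum>P\<in>\<W>0 \<times> \<W>0. C1 P)) * Q f"
      by (simp add: sum_distrib_right[symmetric] distrib_right mult.assoc)
    finally show "dint \<Omega> (\<lambda>x y. sqd f x y * frac_kernel \<alpha> x y) \<le> ((\<Sum>W\<in>\<W>0. C0 W) + c * (\<Sum>P\<in>\<W>0 \<times> \<W>0. C1 P)) * Q f" .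
  qed
qed

text \<open>The uniform interior cone condition near a boundary point. From \<open>x\<close> to
  \<open>y = x + t *\<^sub>R e + h\<close> the height grows by at least \<open>t - norm h\<close>
  and the graph function by at most \<open>L * norm h\<close>. The radii \<open>r / 2\<close> and
  \<open>r / 4\<close> keep \<open>y\<close> in \<open>ball z r\<close>, where the graph
  representation is valid, since \<open>dist x y < 2 * t\<close>.\<close>

lemma lipschitz_domain_cone:
  fixes \<Omega> :: "'a::euclidean_space set"
  assumes \<Omega>: "lipschitz_domain \<Omega>" and z: "z \<in> frontier \<Omega>"
  obtains e r c where "norm e = 1" "0 < r" "0 < c" "c < 1"
    "\<And>x t. x \<in> \<Omega> \<inter> ball z (r / 2) \<Longrightarrow> t \<in> {0<..r / 4} \<Longrightarrow> ball (x + t *\<^sub>R e) (c * t) \<subseteq> \<Omega> \<inter> ball z r"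
proof -
  obtain e r L \<phi> where e: "norm e = 1" and r: "0 < r" and L: "L-lipschitz_on {y. e \<bullet> y = 0} \<phi>"
    and epi: "\<Omega> \<inter> ball z r = {x \<in> ball z r. e \<bullet> x > \<phi> (x - (e \<bullet> x) *\<^sub>R e)}"
    using \<Omega> z unfolding lipschitz_domain_def by blast
  have L0: "L \<ge> 0" using L by (rule lipschitz_on_nonneg)
  \<comment> \<open>The cone condition asks for \<open>c * (1 + L) \<le> 1\<close>; the summand 2
    instead of 1 gives \<open>c < 1\<close> even for \<open>L = 0\<close>.\<close>
  define c where "c = 1 / (2 + L)"
  have c: "0 < c" "c < 1" "c * (1 + L) \<le> 1" using L0 by (auto simp: c_def field_simps)
  have ee: "e \<bullet> e = 1" using e by (simp add: dot_square_norm)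
  show ?thesis
  proof (rule that[OF e r c(1,2)])
    fix x t assume x: "x \<in> \<Omega> \<inter> ball z (r / 2)" and t: "t \<in> {0<..r / 4}"
    show "ball (x + t *\<^sub>R e) (c * t) \<subseteq> \<Omega> \<inter> ball z r"
    proof
      fix y assume y: "y \<in> ball (x + t *\<^sub>R e) (c * t)"
      define h where "h = y - (x + t *\<^sub>R e)"
      have h: "norm h < c * t" using y by (simp add: h_def dist_norm norm_minus_commute)
      have ct: "c * t \<le> t" using c t by (simp add: mult_left_le_one_le)
      have y_eq: "y = x + t *\<^sub>R e + h" by (simp add: h_def)
      have "dist x y \<le> norm (t *\<^sub>R e) + norm h"
      proof -
        have "y - x = t *\<^sub>R e + h" by (simp add: y_eq)
        then have "dist y x = norm (t *\<^sub>R e + h)" by (simp only: dist_norm)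
        then show ?thesis
          using norm_triangle_ineq[of "t *\<^sub>R e" h] by (simp only: dist_commute[of x y])
      qed
      moreover have "norm (t *\<^sub>R e) = t" using e t by simp
      ultimately have "dist x y < t + t" using h ct by linarith
      then have yb: "y \<in> ball z r" using x t dist_triangle[of z y x] by simp
      have xr: "x \<in> \<Omega> \<inter> ball z r" using x r by auto
      then have ex: "e \<bullet> x > \<phi> (x - (e \<bullet> x) *\<^sub>R e)" unfolding epi by simp
      have orth: "e \<bullet> (v - (e \<bullet> v) *\<^sub>R e) = 0" for v by (simp add: inner_diff_right ee)
      have "dist (\<phi> (y - (e \<bullet> y) *\<^sub>R e)) (\<phi> (x - (e \<bullet> x) *\<^sub>R e)) \<le>
          L * dist (y - (e \<bullet> y) *\<^sub>R e) (x - (e \<bullet> x) *\<^sub>R e)"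
        using L orth by (intro lipschitz_onD) auto
      also have "(y - (e \<bullet> y) *\<^sub>R e) - (x - (e \<bullet> x) *\<^sub>R e) = h - (e \<bullet> h) *\<^sub>R e"
        by (simp add: y_eq inner_add_right ee algebra_simps)
      then have "dist (y - (e \<bullet> y) *\<^sub>R e) (x - (e \<bullet> x) *\<^sub>R e) = norm (h - (e \<bullet> h) *\<^sub>R e)"
        by (simp add: dist_norm)
      also have "norm (h - (e \<bullet> h) *\<^sub>R e) \<le> norm h"
      proof (rule power2_le_imp_le)
        show "(norm (h - (e \<bullet> h) *\<^sub>R e))\<^sup>2 \<le> (norm h)\<^sup>2"
          by (simp only: power2_norm_eq_inner)
             (simp add: inner_diff_left inner_diff_right ee inner_commute[of h e])
      qed simp
      finally have "dist (\<phi> (y - (e \<bullet> y) *\<^sub>R e)) (\<phi> (x - (e \<bullet> x) *\<^sub>R e)) \<le> L * norm h"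
        using L0 by (simp add: mult_left_mono)
      also have "\<dots> \<le> L * (c * t)" using L0 h by (intro mult_left_mono) auto
      finally have \<phi>: "\<phi> (y - (e \<bullet> y) *\<^sub>R e) \<le> \<phi> (x - (e \<bullet> x) *\<^sub>R e) + L * (c * t)"
        by (simp add: dist_real_def)
      have "e \<bullet> h \<ge> - norm h" using Cauchy_Schwarz_ineq2[of e h] e by simp
      then have "e \<bullet> y > e \<bullet> x + t - c * t" using h by (simp add: y_eq inner_add_right ee)
      moreover have "c * t + L * (c * t) \<le> t"
      proof -
        have "c * t + L * (c * t) = (c * (1 + L)) * t" by (simp add: algebra_simps)
        then show ?thesis using c t by (simp add: mult_left_le_one_le)
      qed
      ultimately have "e \<bullet> y > \<phi> (y - (e \<bullet> y) *\<^sub>R e)" using ex \<phi> by linarith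
      then have "y \<in> \<Omega> \<inter> ball z r" unfolding epi using yb by simp
      then show "y \<in> \<Omega> \<inter> ball z r" .
    qed
  qed
qed

context thick_relation
begin

lemma frac_energy_lipschitz_domain_le:
  assumes \<alpha>: "0 < \<alpha>" and bdd: "bounded \<Omega>" and lip: "lipschitz_domain \<Omega>"
  shows "\<exists>C<top. \<forall>f. f \<in> borel_measurable borel \<longrightarrow> (\<integral>\<^sup>+y\<in>\<Omega>. ennreal ((f y)\<^sup>2) \<partial>lborel) < top \<longrightarrow>
    dint \<Omega> (\<lambda>x y. sqd f x y * frac_kernel \<alpha> x y) \<le> C * dint \<Omega> (\<lambda>x y. Gsq f x y * frac_kernel \<alpha> x y)"
proof -
  define F where "F = {f. f \<in> borel_measurable borel \<and> (\<integral>\<^sup>+y\<in>\<Omega>. ennreal ((f y)\<^sup>2) \<partial>lborel) < top}"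
  define Q where "Q f = dint \<Omega> (\<lambda>x y. Gsq f x y * frac_kernel \<alpha> x y)" for f
  have op: "open \<Omega>" and con: "connected \<Omega>" using lip by (auto simp: lipschitz_domain_def)
  have em: "emeasure lborel \<Omega> < top" using bdd by (rule emeasure_lborel_bounded_less_top)
  have "\<exists>C<top. \<forall>f\<in>F. dint \<Omega> (\<lambda>x y. sqd f x y * frac_kernel \<alpha> x y) \<le> C * Q f"
  proof (rule frac_energy_globalise[OF op con bdd \<alpha>])
    show "f \<in> borel_measurable borel" if "f \<in> F" for f using that by (simp add: F_def)
    fix p assume p: "p \<in> closure \<Omega>"
    show "\<exists>W. open W \<and> p \<in> W \<and> (\<exists>C<top. \<forall>f\<in>F. dint (W \<inter> \<Omega>) (\<lambda>x y. sqd f x y * frac_kernel \<alpha> x y) \<le> C * Q f)"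
    proof (cases "p \<in> \<Omega>")
      case True
      then obtain r where r: "r > 0" "ball p r \<subseteq> \<Omega>" using op open_contains_ball by blast
      obtain C where C: "C < top" and le: "\<forall>f p r. f \<in> borel_measurable borel \<longrightarrow>
        dint (ball p r) (\<lambda>x y. sqd f x y * frac_kernel \<alpha> x y) \<le>
        C * dint (ball p (27 * r)) (\<lambda>x y. Gsq f x y * frac_kernel \<alpha> x y)"
        using frac_energy_ball_le[OF \<alpha>] by blast
      show ?thesis
      proof (intro exI[of _ "ball p (r / 27)"] conjI exI[of _ C] ballI)
        fix f assume f: "f \<in> F"
        have "dint (ball p (r / 27) \<inter> \<Omega>) (\<lambda>x y. sqd f x y * frac_kernel \<alpha> x y) \<le>
          dint (ball p (r / 27)) (\<lambda>x y. sqd f x y * frac_kernel \<alpha> x y)" by (intro dint_mono) auto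
        also have "\<dots> \<le> C * dint (ball p (27 * (r / 27))) (\<lambda>x y. Gsq f x y * frac_kernel \<alpha> x y)"
          by (intro le[rule_format]) (use f in \<open>simp add: F_def\<close>)
        also have "\<dots> \<le> C * Q f"
          unfolding Q_def using r by (intro mult_left_mono dint_mono) auto
        finally show "dint (ball p (r / 27) \<inter> \<Omega>) (\<lambda>x y. sqd f x y * frac_kernel \<alpha> x y) \<le> C * Q f" .
      qed (use C r in auto)
    next
      case False
      then have "p \<in> frontier \<Omega>" using p op by (simp add: frontier_def interior_open)
      from lipschitz_domain_cone[OF lip this] obtain e r c where e: "norm e = 1" and r: "0 < r" and c: "0 < c" "c < 1"
        and cone: "\<And>x t. x \<in> \<Omega> \<inter> ball p (r / 2) \<Longrightarrow> t \<in> {0<..r / 4} \<Longrightarrow> ball (x + t *\<^sub>R e) (c * t) \<subseteq> \<Omega> \<inter> ball p r"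
        by blast
      \<comment> \<open>\<open>boundary_energy_le\<close> demands balls of radius
        \<open>6 * b * t\<close> inside the domain, and the interior cone offers the radius
        \<open>c * t\<close>.\<close>
      define b where "b = c / 6"
      have b: "0 < b" "b < 1" using c by (auto simp: b_def)
      \<comment> \<open>Two points of \<open>ball p s\<close> have distance at most
        \<open>2 * s\<close>, and \<open>4 / b * (2 * s) = r / 4\<close>, the length for which the
        interior cone is available.\<close>
      define s where "s = b * r / 32"
      have s: "s > 0" "s \<le> r / 2" using b r by (auto simp: s_def)
      define U where "U = ball p s \<inter> \<Omega>"
      obtain C where C: "C < top" and le: "\<forall>f U \<Omega> t0. f \<in> borel_measurable borel \<longrightarrow> U \<in> sets borel \<longrightarrow> open \<Omega> \<longrightarrow> U \<subseteq> \<Omega> \<longrightarrow>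
        emeasure lborel \<Omega> < top \<longrightarrow> (\<integral>\<^sup>+y\<in>\<Omega>. ennreal ((f y)\<^sup>2) \<partial>lborel) < top \<longrightarrow>
        (\<forall>x\<in>U. \<forall>t\<in>{0<..t0}. ball (x + t *\<^sub>R e) (6 * b * t) \<subseteq> \<Omega>) \<longrightarrow>
        (\<forall>x\<in>U. \<forall>y\<in>U. 4 / b * dist x y \<le> t0) \<longrightarrow>
        dint U (\<lambda>x y. sqd f x y * frac_kernel \<alpha> x y) \<le> C * dint \<Omega> (\<lambda>x y. Gsq f x y * frac_kernel \<alpha> x y)"
        using boundary_energy_le[OF \<alpha> b e] by blast
      show ?thesis
      proof (intro exI[of _ "ball p s"] conjI exI[of _ C] ballI)
        fix f assume f: "f \<in> F"
        show "dint (ball p s \<inter> \<Omega>) (\<lambda>x y. sqd f x y * frac_kernel \<alpha> x y) \<le> C * Q f"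
          unfolding Q_def U_def[symmetric]
        proof (rule le[rule_format, of f U \<Omega> "r / 4"])
          show "U \<in> sets borel" using op by (simp add: U_def borel_open open_Int)
          fix x t assume x: "x \<in> U" and t: "t \<in> {0<..r / 4}"
          have "x \<in> \<Omega> \<inter> ball p (r / 2)" using x s by (auto simp: U_def)
          from cone[OF this t] show "ball (x + t *\<^sub>R e) (6 * b * t) \<subseteq> \<Omega>" by (simp add: b_def)
        next
          fix x y assume "x \<in> U" "y \<in> U"
          then have "dist x y \<le> 2 * s" using dist_triangle[of x y p] by (simp add: U_def dist_commute)
          then show "4 / b * dist x y \<le> r / 4" using b by (simp add: s_def field_simps)
        qed (use f op em in \<open>auto simp: F_def U_def\<close>)
      qed (use C s in auto)
    qed
  qed
  then show ?thesis by (auto simp: F_def Q_def)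
qed

end

section \<open>Comparison of the energies\<close>

lemma borel_measurable_fst_snd [measurable]:
  "fst \<in> borel_measurable (borel :: ('a::euclidean_space \<times> 'b::euclidean_space) measure)"
  "snd \<in> borel_measurable (borel :: ('a::euclidean_space \<times> 'b::euclidean_space) measure)"
  by (intro borel_measurable_continuous_onI continuous_intros)+

lemma Times_sets_borel [measurable]:
  fixes S :: "'a::euclidean_space set" and T :: "'b::euclidean_space set"
  assumes "S \<in> sets borel" "T \<in> sets borel"
  shows "S \<times> T \<in> sets borel"
proof -
  have "S \<times> T \<in> sets (borel \<Otimes>\<^sub>M borel)" using assms by (intro pair_measureI) auto
  then show ?thesis unfolding borel_prod .
qed

lemma dint_eq_product:
  assumes "case_prod \<Phi> \<in> borel_measurable (borel \<Otimes>\<^sub>M borel)" "S \<in> sets borel"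
  shows "dint S \<Phi> = (\<integral>\<^sup>+z\<in>S \<times> S. case_prod \<Phi> z \<partial>lborel)"
proof -
  have [measurable]: "case_prod \<Phi> \<in> borel_measurable borel" using assms(1) by (simp add: borel_prod)
  note [measurable] = assms(2)
  show ?thesis
    unfolding dint_conv
    by (subst nn_integral_lborel_pair) (auto simp: indicator_times)
qed

context thick_relation
begin

text \<open>The constant of the ball estimate does not depend on the radius, so monotone convergence
  over the balls \<open>ball 0 (real n)\<close> yields the whole space.\<close>

lemma frac_energy_UNIV_le:
  assumes \<alpha>: "0 < \<alpha>"
  shows "\<exists>C<top. \<forall>f. f \<in> borel_measurable borel \<longrightarrow>
    dint UNIV (\<lambda>x y. sqd f x y * frac_kernel \<alpha> x y) \<le> C * dint UNIV (\<lambda>x y. Gsq f x y * frac_kernel \<alpha> x y)"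
proof -
  obtain C where C: "C < top" and le: "\<forall>f p r. f \<in> borel_measurable borel \<longrightarrow>
    dint (ball p r) (\<lambda>x y. sqd f x y * frac_kernel \<alpha> x y) \<le>
    C * dint (ball p (27 * r)) (\<lambda>x y. Gsq f x y * frac_kernel \<alpha> x y)"
    using frac_energy_ball_le[OF \<alpha>] by blast
  show ?thesis
  proof (intro exI[of _ C] conjI allI impI C)
    fix f :: "'a \<Rightarrow> real" assume f [measurable]: "f \<in> borel_measurable borel"
    define \<Phi> where "\<Phi> = (\<lambda>x y. sqd f x y * frac_kernel \<alpha> x y)"
    have [measurable]: "case_prod \<Phi> \<in> borel_measurable (borel \<Otimes>\<^sub>M borel)" unfolding \<Phi>_def by measurable
    then have [measurable]: "case_prod \<Phi> \<in> borel_measurable borel" by (simp add: borel_prod)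
    let ?B = "\<lambda>n. ball (0::'a) (real n) \<times> ball (0::'a) (real n)"
    have mono: "incseq (\<lambda>n z. case_prod \<Phi> z * indicator (?B n) z)"
      by (intro incseq_SucI le_funI mult_left_mono) (auto simp: indicator_def)
    have sup: "(SUP n. case_prod \<Phi> z * indicator (?B n) z) = case_prod \<Phi> z" for z
    proof (rule antisym)
      show "(SUP n. case_prod \<Phi> z * indicator (?B n) z) \<le> case_prod \<Phi> z"
        by (intro SUP_least) (auto simp: indicator_def)
      obtain n where "norm (fst z) + norm (snd z) < real n" using reals_Archimedean2 by blast
      then have n: "norm (fst z) < real n" "norm (snd z) < real n"
        using norm_ge_zero[of "fst z"] norm_ge_zero[of "snd z"] by linarith+
      have "z \<in> ?B n" using n by (cases z) simp
      then have "case_prod \<Phi> z = case_prod \<Phi> z * indicator (?B n) z" by simp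
      also have "\<dots> \<le> (SUP n. case_prod \<Phi> z * indicator (?B n) z)" by (rule SUP_upper) simp
      finally show "case_prod \<Phi> z \<le> (SUP n. case_prod \<Phi> z * indicator (?B n) z)" .
    qed
    have "dint UNIV \<Phi> = (\<integral>\<^sup>+z. case_prod \<Phi> z \<partial>lborel)"
      by (subst dint_eq_product) auto
    also have "\<dots> = (\<integral>\<^sup>+z. (SUP n. case_prod \<Phi> z * indicator (?B n) z) \<partial>lborel)"
      by (simp only: sup)
    also have "\<dots> = (SUP n. (\<integral>\<^sup>+z. case_prod \<Phi> z * indicator (?B n) z \<partial>lborel))"
      by (rule nn_integral_monotone_convergence_SUP[OF mono]) measurable
    also have "\<dots> = (SUP n. dint (ball 0 (real n)) \<Phi>)"
      by (subst dint_eq_product) auto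
    also have "\<dots> \<le> C * dint UNIV (\<lambda>x y. Gsq f x y * frac_kernel \<alpha> x y)"
    proof (rule SUP_least)
      fix n
      have "dint (ball 0 (real n)) \<Phi> \<le> C * dint (ball 0 (27 * real n)) (\<lambda>x y. Gsq f x y * frac_kernel \<alpha> x y)"
        unfolding \<Phi>_def by (intro le[rule_format]) simp
      also have "\<dots> \<le> C * dint UNIV (\<lambda>x y. Gsq f x y * frac_kernel \<alpha> x y)"
        by (intro mult_left_mono dint_mono) auto
      finally show "dint (ball 0 (real n)) \<Phi> \<le> C * dint UNIV (\<lambda>x y. Gsq f x y * frac_kernel \<alpha> x y)" .
    qed
    finally show "dint UNIV (\<lambda>x y. sqd f x y * frac_kernel \<alpha> x y) \<le> C * dint UNIV (\<lambda>x y. Gsq f x y * frac_kernel \<alpha> x y)"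
      by (simp add: \<Phi>_def)
  qed
qed

end

text \<open>Passing to the completion leaves \<open>nn_integral\<close> unchanged for every
  integrand, so the Lebesgue measurable kernel \<open>k\<close> can be handled inside integrals over
  \<open>lborel\<close>.\<close>

lemma Hk_energy_eq_lborel:
  fixes \<Omega> :: "'a::euclidean_space set"
  assumes "\<Omega> \<in> sets borel"
  shows "Hk_energy \<Omega> k f = (\<integral>\<^sup>+z\<in>\<Omega> \<times> \<Omega>. ennreal ((f (snd z) - f (fst z))\<^sup>2) * k (fst z) (snd z) \<partial>lborel)"
proof -
  have "\<Omega> \<times> \<Omega> \<in> sets borel" using assms by measurable
  then have "(\<Omega> \<times> \<Omega>) \<inter> space lebesgue \<in> sets lebesgue" by auto
  then show ?thesis
    unfolding Hk_energy_def
    by (simp add: nn_integral_restrict_space nn_integral_completion case_prod_unfold)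
qed

lemma L2_integral_eq_lborel:
  fixes \<Omega> :: "'a::euclidean_space set"
  assumes "\<Omega> \<in> sets borel"
  shows "(\<integral>\<^sup>+x. g x \<partial>lebesgue_on \<Omega>) = (\<integral>\<^sup>+x\<in>\<Omega>. g x \<partial>lborel)"
proof -
  have "\<Omega> \<inter> space lebesgue \<in> sets lebesgue" using assms by auto
  then show ?thesis by (simp add: nn_integral_restrict_space nn_integral_completion)
qed

text \<open>Exceptional null sets \<open>N\<close> and \<open>N'\<close> turn into the strips
  \<open>N \<times> UNIV\<close> and \<open>UNIV \<times> N'\<close>, which are null in the product.
  Consequently the energy depends on \<open>f\<close> only up to null sets.\<close>

lemma AE_lborel_pair:
  fixes P Q :: "'a::euclidean_space \<Rightarrow> bool"
  assumes "AE x in lborel. P x" "AE x in lborel. Q x"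
  shows "AE z in (lborel :: ('a \<times> 'a) measure). P (fst z) \<and> Q (snd z)"
proof -
  obtain N where N: "{x. \<not> P x} \<subseteq> N" "N \<in> null_sets lborel"
    using AE_E[OF assms(1)] by (auto simp: null_sets_def)
  obtain N' where N': "{x. \<not> Q x} \<subseteq> N'" "N' \<in> null_sets lborel"
    using AE_E[OF assms(2)] by (auto simp: null_sets_def)
  have "N \<times> UNIV \<in> null_sets (lborel \<Otimes>\<^sub>M (lborel :: 'a measure))"
    using N by (auto simp: null_sets_def lborel.emeasure_pair_measure_Times)
  moreover have "UNIV \<times> N' \<in> null_sets ((lborel :: 'a measure) \<Otimes>\<^sub>M lborel)"
    using N' by (auto simp: null_sets_def lborel.emeasure_pair_measure_Times)
  ultimately have "N \<times> UNIV \<union> UNIV \<times> N' \<in> null_sets (lborel :: ('a \<times> 'a) measure)"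
    unfolding lborel_prod by (rule null_sets.Un)
  then show ?thesis
    by (rule AE_I') (use N N' in \<open>auto simp: case_prod_unfold\<close>)
qed

lemma Hk_energy_cong_AE:
  fixes \<Omega> :: "'a::euclidean_space set"
  assumes "\<Omega> \<in> sets borel" "AE x in lborel. x \<in> \<Omega> \<longrightarrow> f x = g x"
  shows "Hk_energy \<Omega> k f = Hk_energy \<Omega> k g"
  unfolding Hk_energy_eq_lborel[OF assms(1)]
proof (rule nn_integral_cong_AE)
  show "AE z in lborel. ennreal ((f (snd z) - f (fst z))\<^sup>2) * k (fst z) (snd z) * indicator (\<Omega> \<times> \<Omega>) z =
      ennreal ((g (snd z) - g (fst z))\<^sup>2) * k (fst z) (snd z) * indicator (\<Omega> \<times> \<Omega>) z"
    using AE_lborel_pair[OF assms(2) assms(2)]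
    by eventually_elim (auto simp: indicator_def)
qed

lemma L2_integral_cong_AE:
  fixes \<Omega> :: "'a::euclidean_space set"
  assumes "\<Omega> \<in> sets borel" "AE x in lborel. x \<in> \<Omega> \<longrightarrow> f x = (g x :: real)"
  shows "(\<integral>\<^sup>+x. ennreal ((f x)\<^sup>2) \<partial>lebesgue_on \<Omega>) = (\<integral>\<^sup>+x\<in>\<Omega>. ennreal ((g x)\<^sup>2) \<partial>lborel)"
  unfolding L2_integral_eq_lborel[OF assms(1)]
  by (rule nn_integral_cong_AE) (use assms(2) in \<open>eventually_elim, auto simp: indicator_def\<close>)

text \<open>Gives access to the Borel theory of the previous sections. The extension by zero is
  essential for density: it makes the representative integrable over the whole space, so that it can
  be convolved.\<close>

lemma lebesgue_on_borel_representative: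
  fixes \<Omega> :: "'a::euclidean_space set" and f :: "'a \<Rightarrow> real"
  assumes \<Omega>: "\<Omega> \<in> sets borel" and f: "f \<in> borel_measurable (lebesgue_on \<Omega>)"
  obtains g where "g \<in> borel_measurable borel" "AE x in lborel. x \<in> \<Omega> \<longrightarrow> f x = g x" "\<And>x. x \<notin> \<Omega> \<Longrightarrow> g x = 0"
proof -
  have "(\<lambda>x. f x * indicator \<Omega> x) \<in> borel_measurable lebesgue"
    using borel_measurable_restrict_space_iff[of \<Omega> lebesgue f] f \<Omega>
    by (simp add: mult.commute)
  from completion_ex_borel_measurable_real[OF this] obtain g'
    where g': "g' \<in> borel_measurable lborel" "AE x in lborel. f x * indicator \<Omega> x = g' x" by blast
  show ?thesis
  proof (rule that[of "\<lambda>x. g' x * indicator \<Omega> x"])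
    show "(\<lambda>x. g' x * indicator \<Omega> x) \<in> borel_measurable borel" using g' \<Omega> by simp
    show "AE x in lborel. x \<in> \<Omega> \<longrightarrow> f x = g' x * indicator \<Omega> x"
      using g'(2) by eventually_elim auto
  qed auto
qed

lemma Hk_energy_frac_eq_dint:
  fixes \<Omega> :: "'a::euclidean_space set"
  assumes \<Omega>: "\<Omega> \<in> sets borel" and [measurable]: "f \<in> borel_measurable borel"
  shows "Hk_energy \<Omega> (frac_kernel \<alpha>) f = dint \<Omega> (\<lambda>x y. sqd f x y * frac_kernel \<alpha> x y)"
  unfolding Hk_energy_eq_lborel[OF \<Omega>]
  by (subst dint_eq_product) (use \<Omega> in \<open>auto simp: case_prod_unfold sqd_def\<close>)

lemma (in thick_relation) Gsq_energy_le_Hk_energy: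
  assumes \<Omega>: "\<Omega> \<in> sets borel" and [measurable]: "f \<in> borel_measurable borel" and \<Lambda>: "\<Lambda> > 0"
    and k: "\<And>x y. ennreal (1 / \<Lambda>) * indicator G (x, y) * frac_kernel \<alpha> x y \<le> k x y"
  shows "dint \<Omega> (\<lambda>x y. Gsq f x y * frac_kernel \<alpha> x y) \<le> ennreal \<Lambda> * Hk_energy \<Omega> k f"
proof -
  note [measurable] = \<Omega>
  have "ennreal (1 / \<Lambda>) * dint \<Omega> (\<lambda>x y. Gsq f x y * frac_kernel \<alpha> x y) =
      (\<integral>\<^sup>+z. ennreal (1 / \<Lambda>) * ((Gsq f (fst z) (snd z) * frac_kernel \<alpha> (fst z) (snd z)) * indicator (\<Omega> \<times> \<Omega>) z) \<partial>lborel)"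
    using \<Omega> by (subst dint_eq_product) (auto simp: case_prod_unfold nn_integral_cmult)
  also have "\<dots> \<le> Hk_energy \<Omega> k f"
    unfolding Hk_energy_eq_lborel[OF \<Omega>]
  proof (rule nn_integral_mono)
    fix z :: "'a \<times> 'a"
    show "ennreal (1 / \<Lambda>) * ((Gsq f (fst z) (snd z) * frac_kernel \<alpha> (fst z) (snd z)) * indicator (\<Omega> \<times> \<Omega>) z) \<le>
        ennreal ((f (snd z) - f (fst z))\<^sup>2) * k (fst z) (snd z) * indicator (\<Omega> \<times> \<Omega>) z"
      using mult_right_mono[OF mult_left_mono[OF k[of "fst z" "snd z"] zero_le, of "sqd f (fst z) (snd z)"], of "indicator (\<Omega> \<times> \<Omega>) z"]
      by (simp add: Gsq_def sqd_def mult_ac)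
  qed
  finally have "ennreal (1 / \<Lambda>) * dint \<Omega> (\<lambda>x y. Gsq f x y * frac_kernel \<alpha> x y) \<le> Hk_energy \<Omega> k f" .
  from ennreal_le_divide_mult[OF this] \<Lambda> show ?thesis by simp
qed

lemma Hk_energy_le_frac_energy:
  fixes \<Omega> :: "'a::euclidean_space set"
  assumes \<Omega>: "\<Omega> \<in> sets borel" and [measurable]: "f \<in> borel_measurable borel"
    and k: "\<And>x y. k x y \<le> ennreal \<Lambda> * frac_kernel \<alpha> x y"
  shows "Hk_energy \<Omega> k f \<le> ennreal \<Lambda> * Hk_energy \<Omega> (frac_kernel \<alpha>) f"
proof -
  note [measurable] = \<Omega>
  have "Hk_energy \<Omega> k f \<le> (\<integral>\<^sup>+z. ennreal \<Lambda> * (ennreal ((f (snd z) - f (fst z))\<^sup>2) * frac_kernel \<alpha> (fst z) (snd z) * indicator (\<Omega> \<times> \<Omega>) z) \<partial>lborel)"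
    unfolding Hk_energy_eq_lborel[OF \<Omega>]
  proof (rule nn_integral_mono)
    fix z :: "'a \<times> 'a"
    show "ennreal ((f (snd z) - f (fst z))\<^sup>2) * k (fst z) (snd z) * indicator (\<Omega> \<times> \<Omega>) z \<le>
      ennreal \<Lambda> * (ennreal ((f (snd z) - f (fst z))\<^sup>2) * frac_kernel \<alpha> (fst z) (snd z) * indicator (\<Omega> \<times> \<Omega>) z)"
      using mult_right_mono[OF mult_left_mono[OF k[of "fst z" "snd z"] zero_le, of "ennreal ((f (snd z) - f (fst z))\<^sup>2)"], of "indicator (\<Omega> \<times> \<Omega>) z"]
      by (simp add: mult_ac)
  qed
  also have "\<dots> = ennreal \<Lambda> * Hk_energy \<Omega> (frac_kernel \<alpha>) f"
    unfolding Hk_energy_eq_lborel[OF \<Omega>] by (rule nn_integral_cmult) measurable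
  finally show ?thesis .
qed

text \<open>Since \<open>enn2real top = 0\<close>, the inequality survives the conversion to real
  numbers only if the larger side is finite.\<close>

lemma sqrt_enn2real_le:
  assumes "A \<le> ennreal M * B" "B < top" "0 \<le> M"
  shows "sqrt (enn2real A) \<le> sqrt M * sqrt (enn2real B)"
proof -
  have "enn2real A \<le> enn2real (ennreal M * B)"
    using assms by (intro enn2real_mono) (auto simp: ennreal_mult_less_top)
  also have "\<dots> = M * enn2real B" using assms(3) by (simp add: enn2real_mult)
  finally show ?thesis by (simp add: real_sqrt_mult[symmetric])
qed

text \<open>Two-sided bounds of the squared energies become comparability with constant
  \<open>sqrt M\<close>. For the norms the same constant works, because \<open>M \<ge> 1\<close>
  lets the \<open>L2\<close> part be enlarged by the factor \<open>M\<close> as well.\<close>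

lemma Hk_comparability:
  fixes \<Omega> :: "'a::euclidean_space set" and k k' :: "'a \<Rightarrow> 'a \<Rightarrow> ennreal"
  assumes M: "M \<ge> 1"
    and le1: "\<And>f. f \<in> L2_space \<Omega> \<Longrightarrow> Hk_energy \<Omega> k f \<le> ennreal M * Hk_energy \<Omega> k' f"
    and le2: "\<And>f. f \<in> L2_space \<Omega> \<Longrightarrow> Hk_energy \<Omega> k' f \<le> ennreal M * Hk_energy \<Omega> k f"
  shows "Hk_space \<Omega> k = Hk_space \<Omega> k'"
    and "comparable_on (Hk_space \<Omega> k) (Hk_seminorm \<Omega> k) (Hk_seminorm \<Omega> k')"
    and "comparable_on (Hk_space \<Omega> k) (Hk_norm \<Omega> k) (Hk_norm \<Omega> k')"
proof -
  have fin: "Hk_energy \<Omega> k f < top \<longleftrightarrow> Hk_energy \<Omega> k' f < top" if "f \<in> L2_space \<Omega>" for f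
  proof
    assume "Hk_energy \<Omega> k f < top"
    then have "ennreal M * Hk_energy \<Omega> k f < top" by (simp add: ennreal_mult_less_top)
    then show "Hk_energy \<Omega> k' f < top" using le2[OF that] by (rule le_less_trans[rotated])
  next
    assume "Hk_energy \<Omega> k' f < top"
    then have "ennreal M * Hk_energy \<Omega> k' f < top" by (simp add: ennreal_mult_less_top)
    then show "Hk_energy \<Omega> k f < top" using le1[OF that] by (rule le_less_trans[rotated])
  qed
  then show "Hk_space \<Omega> k = Hk_space \<Omega> k'" by (auto simp: Hk_space_def)
  have sM: "sqrt M \<ge> 1" using M by simp
  have div: "p / sqrt M \<le> q" if "p \<le> sqrt M * q" for p q
    using that sM by (simp add: pos_divide_le_eq mult.commute)
  show "comparable_on (Hk_space \<Omega> k) (Hk_seminorm \<Omega> k) (Hk_seminorm \<Omega> k')"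
    unfolding comparable_on_def
  proof (intro exI[of _ "sqrt M"] conjI ballI sM)
    fix f assume f: "f \<in> Hk_space \<Omega> k"
    then have f2: "f \<in> L2_space \<Omega>" and e: "Hk_energy \<Omega> k f < top" "Hk_energy \<Omega> k' f < top"
      using fin by (auto simp: Hk_space_def)
    show "Hk_seminorm \<Omega> k' f \<le> sqrt M * Hk_seminorm \<Omega> k f"
      unfolding Hk_seminorm_def using M by (intro sqrt_enn2real_le le2 f2 e) auto
    show "Hk_seminorm \<Omega> k f / sqrt M \<le> Hk_seminorm \<Omega> k' f"
      unfolding Hk_seminorm_def using M by (intro div sqrt_enn2real_le le1 f2 e) auto
  qed
  show "comparable_on (Hk_space \<Omega> k) (Hk_norm \<Omega> k) (Hk_norm \<Omega> k')"
    unfolding comparable_on_def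
  proof (intro exI[of _ "sqrt M"] conjI ballI sM)
    fix f assume f: "f \<in> Hk_space \<Omega> k"
    then have f2: "f \<in> L2_space \<Omega>" and e: "Hk_energy \<Omega> k f < top" "Hk_energy \<Omega> k' f < top"
      using fin by (auto simp: Hk_space_def)
    let ?N = "\<integral>\<^sup>+x. ennreal ((f x)\<^sup>2) \<partial>lebesgue_on \<Omega>"
    have N: "?N < top" using f2 by (simp add: L2_space_def)
    have NM: "?N \<le> ennreal M * ?N"
    proof -
      have "1 * ?N \<le> ennreal M * ?N" using M ennreal_leI[OF M] by (intro mult_right_mono) auto
      then show ?thesis by simp
    qed
    show "Hk_norm \<Omega> k' f \<le> sqrt M * Hk_norm \<Omega> k f"
      unfolding Hk_norm_def
      by (rule sqrt_enn2real_le) (use M N e NM le2[OF f2] in \<open>auto simp: distrib_left intro: add_mono\<close>)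
    show "Hk_norm \<Omega> k f / sqrt M \<le> Hk_norm \<Omega> k' f"
      unfolding Hk_norm_def
      by (rule div, rule sqrt_enn2real_le) (use M N e NM le1[OF f2] in \<open>auto simp: distrib_left intro: add_mono\<close>)
  qed
qed

lemma (in thick_relation) frac_energy_le_Hk_energy:
  assumes \<Omega>: "\<Omega> \<in> sets borel" and \<Lambda>: "\<Lambda> > 0"
    and k: "\<And>x y. ennreal (1 / \<Lambda>) * indicator G (x, y) * frac_kernel \<alpha> x y \<le> k x y"
    and le: "\<exists>C<top. \<forall>f. f \<in> borel_measurable borel \<longrightarrow> (\<integral>\<^sup>+y\<in>\<Omega>. ennreal ((f y)\<^sup>2) \<partial>lborel) < top \<longrightarrow>
      dint \<Omega> (\<lambda>x y. sqd f x y * frac_kernel \<alpha> x y) \<le> C * dint \<Omega> (\<lambda>x y. Gsq f x y * frac_kernel \<alpha> x y)"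
  shows "\<exists>M. \<forall>f\<in>L2_space \<Omega>. Hk_energy \<Omega> (frac_kernel \<alpha>) f \<le> ennreal M * Hk_energy \<Omega> k f"
proof -
  obtain C where C: "C < top" and le: "\<forall>f. f \<in> borel_measurable borel \<longrightarrow> (\<integral>\<^sup>+y\<in>\<Omega>. ennreal ((f y)\<^sup>2) \<partial>lborel) < top \<longrightarrow>
      dint \<Omega> (\<lambda>x y. sqd f x y * frac_kernel \<alpha> x y) \<le> C * dint \<Omega> (\<lambda>x y. Gsq f x y * frac_kernel \<alpha> x y)"
    using le by blast
  show ?thesis
  proof (intro exI[of _ "enn2real (C * ennreal \<Lambda>)"] ballI)
    have CL: "ennreal (enn2real (C * ennreal \<Lambda>)) = C * ennreal \<Lambda>"
      using C by (intro ennreal_enn2real) (simp add: ennreal_mult_less_top)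
    fix f assume f: "f \<in> L2_space \<Omega>"
    then have "f \<in> borel_measurable (lebesgue_on \<Omega>)" by (simp add: L2_space_def)
    from lebesgue_on_borel_representative[OF \<Omega> this] obtain g
      where g: "g \<in> borel_measurable borel" "AE x in lborel. x \<in> \<Omega> \<longrightarrow> f x = g x" by blast
    have g2: "(\<integral>\<^sup>+y\<in>\<Omega>. ennreal ((g y)\<^sup>2) \<partial>lborel) < top"
      using f L2_integral_cong_AE[OF \<Omega> g(2)] by (simp add: L2_space_def)
    have "Hk_energy \<Omega> (frac_kernel \<alpha>) f = dint \<Omega> (\<lambda>x y. sqd g x y * frac_kernel \<alpha> x y)"
      using Hk_energy_cong_AE[OF \<Omega> g(2)] Hk_energy_frac_eq_dint[OF \<Omega> g(1)] by simp
    also have "\<dots> \<le> C * dint \<Omega> (\<lambda>x y. Gsq g x y * frac_kernel \<alpha> x y)"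
      by (rule le[rule_format, OF g(1) g2])
    also have "\<dots> \<le> C * (ennreal \<Lambda> * Hk_energy \<Omega> k g)"
      by (intro mult_left_mono Gsq_energy_le_Hk_energy[OF \<Omega> g(1) \<Lambda> k]) simp
    also have "Hk_energy \<Omega> k g = Hk_energy \<Omega> k f"
      by (rule Hk_energy_cong_AE[OF \<Omega> g(2), symmetric])
    finally show "Hk_energy \<Omega> (frac_kernel \<alpha>) f \<le> ennreal (enn2real (C * ennreal \<Lambda>)) * Hk_energy \<Omega> k f"
      by (simp only: CL mult.assoc)
  qed
qed

lemma Hk_energy_le_frac_energy_L2:
  fixes \<Omega> :: "'a::euclidean_space set"
  assumes \<Omega>: "\<Omega> \<in> sets borel" and f: "f \<in> L2_space \<Omega>"
    and k: "\<And>x y. k x y \<le> ennreal \<Lambda> * frac_kernel \<alpha> x y"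
  shows "Hk_energy \<Omega> k f \<le> ennreal \<Lambda> * Hk_energy \<Omega> (frac_kernel \<alpha>) f"
proof -
  have "f \<in> borel_measurable (lebesgue_on \<Omega>)" using f by (simp add: L2_space_def)
  from lebesgue_on_borel_representative[OF \<Omega> this] obtain g
    where g: "g \<in> borel_measurable borel" "AE x in lborel. x \<in> \<Omega> \<longrightarrow> f x = g x" by blast
  show ?thesis
    using Hk_energy_le_frac_energy[OF \<Omega> g(1) k] by (simp add: Hk_energy_cong_AE[OF \<Omega> g(2)])
qed

section \<open>Smooth functions and mollifiers\<close>

text \<open>Note the shift: \<open>Ck n\<close> asks for \<open>n + 1\<close> derivatives. In
  contrast to \<open>iterated_deriv\<close>, the recursion differentiates \<open>f\<close> itself
  first, so closure under sums, products and convolution follows by induction with the function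
  generalised.\<close>

primrec Ck :: "nat \<Rightarrow> ('a::euclidean_space \<Rightarrow> real) \<Rightarrow> bool" where
  "Ck 0 f = (\<forall>x. f differentiable at x)"
| "Ck (Suc n) f = ((\<forall>x. f differentiable at x) \<and> (\<forall>v. Ck n (\<lambda>x. frechet_derivative f (at x) v)))"

lemma Ck_differentiable: "Ck n f \<Longrightarrow> f differentiable at x"
  by (cases n) auto

lemma Ck_pred: "Ck (Suc n) f \<Longrightarrow> Ck n f"
  by (induction n arbitrary: f) auto

lemma Ck_SucI:
  assumes "\<And>x. (f has_derivative f' x) (at x)" "\<And>v. Ck n (\<lambda>x. f' x v)"
  shows "Ck (Suc n) f"
proof -
  have "f' = (\<lambda>x. frechet_derivative f (at x))"
    using frechet_derivative_at[OF assms(1)] by (intro ext) auto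
  then show ?thesis using assms by (auto simp: differentiable_def)
qed

lemma Ck_SucE:
  assumes "Ck (Suc n) f"
  obtains f' where "\<And>x. (f has_derivative f' x) (at x)" "\<And>v. Ck n (\<lambda>x. f' x v)"
proof (rule that)
  show "(f has_derivative frechet_derivative f (at x)) (at x)" for x
    using Ck_differentiable[OF assms, of x] by (simp only: frechet_derivative_works)
  show "Ck n (\<lambda>x. frechet_derivative f (at x) v)" for v using assms by simp
qed

lemma Ck_const: "Ck n (\<lambda>x. c)"
proof (induction n arbitrary: c)
  case (Suc n)
  show ?case by (rule Ck_SucI[OF has_derivative_const]) (rule Suc)
qed simp

lemma Ck_add: "Ck n f \<Longrightarrow> Ck n g \<Longrightarrow> Ck n (\<lambda>x. f x + g x)"
proof (induction n arbitrary: f g)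
  case (Suc n)
  obtain f' where f': "\<And>x. (f has_derivative f' x) (at x)" "\<And>v. Ck n (\<lambda>x. f' x v)" using Ck_SucE[OF Suc.prems(1)] by blast
  obtain g' where g': "\<And>x. (g has_derivative g' x) (at x)" "\<And>v. Ck n (\<lambda>x. g' x v)" using Ck_SucE[OF Suc.prems(2)] by blast
  show ?case by (rule Ck_SucI[OF has_derivative_add[OF f'(1) g'(1)]]) (rule Suc.IH[OF f'(2) g'(2)])
qed auto

lemma Ck_mult: "Ck n f \<Longrightarrow> Ck n g \<Longrightarrow> Ck n (\<lambda>x. f x * g x)"
proof (induction n arbitrary: f g)
  case (Suc n)
  obtain f' where f': "\<And>x. (f has_derivative f' x) (at x)" "\<And>v. Ck n (\<lambda>x. f' x v)" using Ck_SucE[OF Suc.prems(1)] by blast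
  obtain g' where g': "\<And>x. (g has_derivative g' x) (at x)" "\<And>v. Ck n (\<lambda>x. g' x v)" using Ck_SucE[OF Suc.prems(2)] by blast
  show ?case
    by (rule Ck_SucI[OF has_derivative_mult[OF f'(1) g'(1)]])
       (intro Ck_add Suc.IH f' g' Ck_pred[OF Suc.prems(1)] Ck_pred[OF Suc.prems(2)])
qed auto

lemma Ck_inner: "Ck n (\<lambda>x. x \<bullet> v)"
proof (cases n)
  case (Suc m)
  have "((\<lambda>x. x \<bullet> v) has_derivative (\<lambda>h. h \<bullet> v)) (at x)" for x
    by (auto intro!: derivative_eq_intros)
  then show ?thesis unfolding Suc by (rule Ck_SucI) (rule Ck_const)
qed (auto intro!: differentiable_inner)

lemma Ck_cmult: "Ck n f \<Longrightarrow> Ck n (\<lambda>x. c * f x)"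
  by (intro Ck_mult Ck_const)

lemma Ck_affine:
  fixes f :: "'a::euclidean_space \<Rightarrow> real"
  shows "Ck n f \<Longrightarrow> Ck n (\<lambda>x. f (a *\<^sub>R x + b))"
proof (induction n arbitrary: f)
  case 0
  have "(\<lambda>x. a *\<^sub>R x + b) differentiable at x" for x by (intro derivative_intros)
  then have "(f \<circ> (\<lambda>x. a *\<^sub>R x + b)) differentiable at x" for x
    using 0 by (intro differentiable_chain_at) auto
  then show ?case by (simp add: o_def)
next
  case (Suc n)
  obtain f' where f': "\<And>x. (f has_derivative f' x) (at x)" "\<And>v. Ck n (\<lambda>x. f' x v)" using Ck_SucE[OF Suc.prems(1)] by blast
  have "((\<lambda>x. f (a *\<^sub>R x + b)) has_derivative (\<lambda>h. f' (a *\<^sub>R x + b) (a *\<^sub>R h))) (at x)" for x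
  proof -
    have "((\<lambda>x. a *\<^sub>R x + b) has_derivative (\<lambda>h. a *\<^sub>R h)) (at x)"
      by (auto intro!: derivative_eq_intros)
    from has_derivative_compose[OF this f'(1)] show ?thesis .
  qed
  then show ?case by (rule Ck_SucI) (rule Suc.IH[OF f'(2)])
qed

lemma Ck_sum: "(\<And>i. i \<in> I \<Longrightarrow> Ck n (f i)) \<Longrightarrow> Ck n (\<lambda>x. \<Sum>i\<in>I. f i x)"
  by (induction I rule: infinite_finite_induct) (auto intro: Ck_const Ck_add)

definition smooth :: "('a::euclidean_space \<Rightarrow> real) \<Rightarrow> bool" where
  "smooth f \<longleftrightarrow> (\<forall>n. Ck n f)"

text \<open>The bridge between \<open>iterated_deriv\<close>, where the head of the list is the last
  direction applied, and \<open>Ck\<close>, which peels off the first derivative.\<close>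

lemma iterated_deriv_snoc:
  "iterated_deriv (vs @ [v]) f = iterated_deriv vs (\<lambda>x. frechet_derivative f (at x) v)"
  by (induction vs) auto

lemma smooth_imp_C_infinity:
  assumes "smooth f"
  shows "f \<in> C_infinity \<Omega>"
proof -
  have "iterated_deriv vs f differentiable at x" if "Ck (length vs) f" for vs and f :: "'a \<Rightarrow> real" and x
    using that
  proof (induction vs arbitrary: f rule: rev_induct)
    case (snoc v vs)
    then show ?case unfolding iterated_deriv_snoc by (intro snoc.IH) simp
  qed simp
  then show ?thesis using assms by (auto simp: C_infinity_def smooth_def)
qed

lemma C_infinity_imp_smooth:
  assumes "f \<in> C_infinity UNIV"
  shows "smooth f"
proof -
  have "Ck n f" if "f \<in> C_infinity UNIV" for n and f :: "'a \<Rightarrow> real"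
    using that
  proof (induction n arbitrary: f)
    case 0
    then have "iterated_deriv [] f differentiable at x" for x unfolding C_infinity_def by blast
    then show ?case by simp
  next
    case (Suc n)
    then have "iterated_deriv [] f differentiable at x" for x unfolding C_infinity_def by blast
    moreover have "(\<lambda>x. frechet_derivative f (at x) v) \<in> C_infinity UNIV" for v
      using Suc.prems by (auto simp: C_infinity_def iterated_deriv_snoc[symmetric])
    ultimately show ?case using Suc.IH by simp
  qed
  then show ?thesis using assms by (simp add: smooth_def)
qed

lemma smooth_add: "smooth f \<Longrightarrow> smooth g \<Longrightarrow> smooth (\<lambda>x. f x + g x)"
  and smooth_mult: "smooth f \<Longrightarrow> smooth g \<Longrightarrow> smooth (\<lambda>x. f x * g x)"
  and smooth_const: "smooth (\<lambda>x. c)"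
  by (auto simp: smooth_def intro: Ck_add Ck_mult Ck_const)

lemma smooth_deriv: "smooth f \<Longrightarrow> smooth (\<lambda>x. frechet_derivative f (at x) v)"
  unfolding smooth_def using Ck.simps(2) by blast

lemma smooth_differentiable: "smooth f \<Longrightarrow> f differentiable at x"
  unfolding smooth_def using Ck.simps(1) by blast

lemma smooth_continuous: "smooth f \<Longrightarrow> continuous_on S f"
  by (intro continuous_at_imp_continuous_on ballI differentiable_imp_continuous_within smooth_differentiable)

section \<open>A smooth function built from exp(-1/t), compact supports, and normalised
  bumps\<close>

lemma power_le_fact_exp:
  fixes u :: real
  assumes "u \<ge> 0"
  shows "u ^ n \<le> fact n * exp u"
proof -
  have "(\<Sum>k\<in>{n}. u ^ k /\<^sub>R fact k) \<le> (\<Sum>k. u ^ k /\<^sub>R fact k)"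
    using assms by (intro sum_le_suminf summable_exp_generic) auto
  then have "u ^ n / fact n \<le> exp u" by (simp add: exp_def divide_inverse mult.commute)
  then show ?thesis by (simp add: divide_le_eq mult.commute)
qed

text \<open>The family is closed under differentiation, so smoothness follows by induction for all \<open>k\<close> at once.\<close>
definition flat_exp :: "nat \<Rightarrow> real \<Rightarrow> real" where
  "flat_exp k t = (if t > 0 then (1 / t) ^ k * exp (- 1 / t) else 0)"

text \<open>The bound \<open>power_le_fact_exp\<close> at \<open>u = 1 / h\<close> with exponent
  \<open>k + 2\<close>: the exponential beats the negative powers and leaves a square, hence the
  derivative at \<open>0\<close> exists and is \<open>0\<close>.\<close>

lemma flat_exp_le: "\<bar>flat_exp k h\<bar> \<le> fact (k + 2) * h\<^sup>2"
proof (cases "h > 0")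
  case True
  have "(1 / h) ^ (k + 2) \<le> fact (k + 2) * exp (1 / h)" using True by (intro power_le_fact_exp) simp
  then have "(1 / h) ^ (k + 2) * exp (- 1 / h) \<le> fact (k + 2) * exp (1 / h) * exp (- 1 / h)"
    by (intro mult_right_mono) auto
  also have "\<dots> = fact (k + 2)" by (simp add: exp_minus field_simps)
  finally have "(1 / h) ^ (k + 2) * exp (- 1 / h) * h\<^sup>2 \<le> fact (k + 2) * h\<^sup>2" by (intro mult_right_mono) auto
  moreover have "(1 / h) ^ (k + 2) * exp (- 1 / h) * h\<^sup>2 = flat_exp k h"
    using True by (simp add: flat_exp_def power_add power2_eq_square field_simps)
  moreover have "flat_exp k h \<ge> 0" using True by (simp add: flat_exp_def)
  ultimately show ?thesis by simp
qed (simp add: flat_exp_def)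

lemma flat_exp_deriv:
  "(flat_exp k has_real_derivative (- real k * flat_exp (k + 1) t + flat_exp (k + 2) t)) (at t)"
proof (cases "t = 0")
  case True
  have "((\<lambda>h. flat_exp k h / h) \<longlongrightarrow> 0) (at 0)"
  proof (rule Lim_null_comparison)
    show "\<forall>\<^sub>F h in at 0. norm (flat_exp k h / h) \<le> fact (k + 2) * \<bar>h\<bar>"
    proof (rule always_eventually, rule allI)
      fix h :: real
      show "norm (flat_exp k h / h) \<le> fact (k + 2) * \<bar>h\<bar>"
        using flat_exp_le[of k h]
        by (cases "h = 0") (auto simp: power2_eq_square divide_le_eq abs_mult mult.assoc)
    qed
    show "((\<lambda>h. fact (k + 2) * \<bar>h\<bar>) \<longlongrightarrow> (0::real)) (at 0)"
      by (auto intro!: tendsto_eq_intros)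
  qed
  then show ?thesis using True by (simp add: DERIV_def flat_exp_def)
next
  case False
  show ?thesis
  proof (cases "t > 0")
    case True
    have "((\<lambda>t. (1 / t) ^ k * exp (- 1 / t)) has_real_derivative
        (real k * (1 / t) ^ (k - 1) * (- 1 / t\<^sup>2) * exp (- 1 / t) + (1 / t) ^ k * (exp (- 1 / t) * (1 / t\<^sup>2)))) (at t)"
      using True by (auto intro!: derivative_eq_intros simp: power2_eq_square)
    moreover have "real k * (1 / t) ^ (k - 1) * (- 1 / t\<^sup>2) * exp (- 1 / t) + (1 / t) ^ k * (exp (- 1 / t) * (1 / t\<^sup>2)) =
        - real k * flat_exp (k + 1) t + flat_exp (k + 2) t"
    proof (cases k)
      case 0 then show ?thesis using True by (simp add: flat_exp_def power2_eq_square)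
    next
      case (Suc m) then show ?thesis using True by (simp add: flat_exp_def power2_eq_square field_simps)
    qed
    ultimately have d: "((\<lambda>t. (1 / t) ^ k * exp (- 1 / t)) has_real_derivative
        (- real k * flat_exp (k + 1) t + flat_exp (k + 2) t)) (at t)" by simp
    show ?thesis
      by (rule has_field_derivative_transform_within_open[OF d, of "{0<..}"]) (use True in \<open>auto simp: flat_exp_def\<close>)
  next
    case neg: False
    have d: "((\<lambda>t. 0) has_real_derivative 0) (at t)" by simp
    have "(flat_exp k has_real_derivative 0) (at t)"
      by (rule has_field_derivative_transform_within_open[OF d, of "{..<0}"]) (use neg False in \<open>auto simp: flat_exp_def\<close>)
    then show ?thesis using neg by (simp add: flat_exp_def)
  qed
qed

lemma flat_exp_has_derivative:
  "((\<lambda>x::'a::euclidean_space. flat_exp k (1 - x \<bullet> x)) has_derivative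
    (\<lambda>v. (- real k * flat_exp (k + 1) (1 - x \<bullet> x) + flat_exp (k + 2) (1 - x \<bullet> x)) * (- 2 * (x \<bullet> v)))) (at x)"
proof -
  have "((\<lambda>x::'a. 1 - x \<bullet> x) has_derivative (\<lambda>v. - 2 * (x \<bullet> v))) (at x)"
    by (auto intro!: derivative_eq_intros simp: inner_commute)
  from has_derivative_compose[OF this flat_exp_deriv[unfolded has_field_derivative_def]]
  show ?thesis by simp
qed

lemma Ck_flat_exp: "Ck n (\<lambda>x::'a::euclidean_space. flat_exp k (1 - x \<bullet> x))"
proof (induction n arbitrary: k)
  case 0
  show ?case using flat_exp_has_derivative by (auto simp: differentiable_def)
next
  case (Suc n)
  show ?case
    by (rule Ck_SucI[OF flat_exp_has_derivative]) (intro Ck_mult Ck_add Ck_const Suc.IH Ck_inner)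
qed

text \<open>A quantitative form of compact support. The explicit radius expresses the smallness of a
  mollifier and can be tracked through derivatives and convolutions.\<close>

definition vanishes_outside :: "real \<Rightarrow> ('a::real_normed_vector \<Rightarrow> real) \<Rightarrow> bool" where
  "vanishes_outside r f \<longleftrightarrow> (\<forall>x. norm x \<ge> r \<longrightarrow> f x = 0)"

text \<open>Derivatives are read off on the open complement of \<open>cball 0 r\<close>; enlarging
  the radius by 1 avoids the sphere \<open>norm x = r\<close>.\<close>

lemma vanishes_outside_deriv:
  fixes f :: "'a::euclidean_space \<Rightarrow> real"
  assumes "vanishes_outside r f"
  shows "vanishes_outside (r + 1) (\<lambda>x. frechet_derivative f (at x) v)"
  unfolding vanishes_outside_def
proof (intro allI impI)
  fix x :: 'a assume "norm x \<ge> r + 1"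
  then have x: "x \<in> - cball 0 r" by simp
  have "(f has_derivative (\<lambda>h. 0)) (at x)"
    by (rule has_derivative_transform_within_open[of "\<lambda>x. 0" _ _ _ "- cball 0 r"])
       (use x assms in \<open>auto simp: vanishes_outside_def\<close>)
  then show "frechet_derivative f (at x) v = 0" by (metis frechet_derivative_at)
qed

lemma vanishes_outside_bounded:
  fixes f :: "'a::euclidean_space \<Rightarrow> real"
  assumes "continuous_on UNIV f" "vanishes_outside r f"
  obtains B where "B > 0" "\<And>x. \<bar>f x\<bar> \<le> B"
proof -
  have "compact (f ` cball 0 r)" using assms(1) by (intro compact_continuous_image) (auto intro: continuous_on_subset)
  then have "bounded (f ` cball 0 r)" by (rule compact_imp_bounded)
  then obtain B where B: "B > 0" "\<And>y. y \<in> f ` cball 0 r \<Longrightarrow> norm y \<le> B"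
    unfolding bounded_pos by blast
  show ?thesis
  proof (rule that[OF B(1)])
    fix x show "\<bar>f x\<bar> \<le> B"
      using B(2)[of "f x"] B(1) assms(2) by (cases "norm x \<le> r") (auto simp: vanishes_outside_def)
  qed
qed

lemma vanishes_outside_uniformly_continuous:
  fixes f :: "'a::euclidean_space \<Rightarrow> real"
  assumes "continuous_on UNIV f" "vanishes_outside r f"
  shows "uniformly_continuous_on UNIV f"
  unfolding uniformly_continuous_on_def
proof (intro allI impI)
  fix e :: real assume e: "e > 0"
  have "uniformly_continuous_on (cball 0 (r + 2)) f"
    using assms(1) by (intro compact_uniformly_continuous) (auto intro: continuous_on_subset)
  then obtain d where d: "d > 0" "\<And>x y. x \<in> cball 0 (r + 2) \<Longrightarrow> y \<in> cball 0 (r + 2) \<Longrightarrow> dist y x < d \<Longrightarrow> dist (f y) (f x) < e"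
    unfolding uniformly_continuous_on_def using e by blast
  show "\<exists>d>0. \<forall>x\<in>UNIV. \<forall>y\<in>UNIV. dist y x < d \<longrightarrow> dist (f y) (f x) < e"
  proof (intro exI[of _ "min d 1"] conjI ballI impI)
    fix x y :: 'a assume "dist y x < min d 1"
    then have xy: "dist y x < d" "dist y x < 1" by auto
    have t: "norm y \<le> norm x + 1" "norm x \<le> norm y + 1"
      using xy(2) norm_triangle_ineq2[of y x] norm_triangle_ineq2[of x y] by (auto simp: dist_norm norm_minus_commute)
    show "dist (f y) (f x) < e"
    proof (cases "norm x \<le> r + 1")
      case True then show ?thesis using d(2)[of x y] xy t by auto
    next
      case False
      then have "f x = 0" "f y = 0" using assms(2) t by (auto simp: vanishes_outside_def)
      then show ?thesis using e by simp
    qed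
  qed (use d in auto)
qed

text \<open>The centre \<open>p\<close> is arbitrary, because at the boundary the mollifier must be
  supported in a ball away from the origin, inside the interior cone.\<close>

lemma mollifier_exists:
  fixes p :: "'a::euclidean_space"
  assumes r: "r > 0"
  obtains \<eta> :: "'a \<Rightarrow> real" where "smooth \<eta>" "\<And>x. 0 \<le> \<eta> x" "\<And>x. x \<notin> ball p r \<Longrightarrow> \<eta> x = 0"
    "(\<integral>\<^sup>+x. ennreal (\<eta> x) \<partial>lborel) = 1"
proof -
  define \<psi> :: "'a \<Rightarrow> real" where "\<psi> x = flat_exp 0 (1 - ((1 / r) *\<^sub>R x + - (1 / r) *\<^sub>R p) \<bullet> ((1 / r) *\<^sub>R x + - (1 / r) *\<^sub>R p))" for x
  have sm: "Ck n \<psi>" for n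
    unfolding \<psi>_def by (rule Ck_affine[of n "\<lambda>x. flat_exp 0 (1 - x \<bullet> x)"]) (rule Ck_flat_exp)
  have eq: "\<psi> x = flat_exp 0 (1 - (dist p x / r)\<^sup>2)" for x
  proof -
    have "(1 / r) *\<^sub>R x + - (1 / r) *\<^sub>R p = (1 / r) *\<^sub>R (x - p)" by (simp add: algebra_simps)
    then show ?thesis using r unfolding \<psi>_def
      by (simp add: dot_square_norm dist_norm norm_minus_commute power_divide)
  qed
  have nn: "0 \<le> \<psi> x" "\<psi> x \<le> 1" for x by (auto simp: eq flat_exp_def)
  have out: "\<psi> x = 0" if "x \<notin> ball p r" for x
  proof -
    have "dist p x / r \<ge> 1" using that r by simp
    then have "(dist p x / r)\<^sup>2 \<ge> 1" by (simp add: one_le_power)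
    then show ?thesis by (simp add: eq flat_exp_def)
  qed
  \<comment> \<open>On the ball of half the radius the argument of \<open>flat_exp\<close> is at
    least \<open>1 - 1 / 4 = 3 / 4\<close>, whence \<open>exp (- 4 / 3)\<close>. Its only use is
    that the integral \<open>Z\<close> is positive and can be normalised.\<close>
  have low: "exp (- 4 / 3) \<le> \<psi> x" if "x \<in> ball p (r / 2)" for x
  proof -
    have "(dist p x / r)\<^sup>2 \<le> (1 / 2)\<^sup>2" using that r by (intro power_mono) (auto simp: field_simps)
    then have q: "1 - (dist p x / r)\<^sup>2 \<ge> 3 / 4" by (simp add: power2_eq_square)
    then have "1 / (1 - (dist p x / r)\<^sup>2) \<le> 1 / (3 / 4)" by (intro divide_left_mono) auto
    then show ?thesis using q by (simp add: eq flat_exp_def)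
  qed
  have cont: "continuous_on UNIV \<psi>"
    using sm by (intro smooth_continuous) (simp add: smooth_def)
  then have [measurable]: "\<psi> \<in> borel_measurable borel" by (rule borel_measurable_continuous_onI)
  define Z where "Z = (\<integral>\<^sup>+x. ennreal (\<psi> x) \<partial>lborel)"
  have "Z \<le> (\<integral>\<^sup>+x. indicator (ball p r) x \<partial>lborel)"
    unfolding Z_def
  proof (rule nn_integral_mono)
    fix x show "ennreal (\<psi> x) \<le> indicator (ball p r) x"
      using nn[of x] out[of x] ennreal_leI[OF nn(2)[of x]] by (cases "x \<in> ball p r") auto
  qed
  also have "\<dots> < top" using r by (simp add: emeasure_ball)
  finally have Zf: "Z < top" .
  have "0 < ennreal (exp (- 4 / 3)) * emeasure lborel (ball p (r / 2))"
    using r by (simp add: emeasure_ball ennreal_zero_less_mult_iff ennreal_less_zero_iff)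
  also have "\<dots> = (\<integral>\<^sup>+x. ennreal (exp (- 4 / 3)) * indicator (ball p (r / 2)) x \<partial>lborel)"
    by (simp add: nn_integral_cmult_indicator)
  also have "\<dots> \<le> Z"
    unfolding Z_def by (intro nn_integral_mono) (use low in \<open>auto simp: indicator_def intro: ennreal_leI\<close>)
  finally have Z0: "0 < Z" .
  define c where "c = enn2real Z"
  have c: "c > 0" "Z = ennreal c" using Z0 Zf by (auto simp: c_def enn2real_positive_iff)
  show ?thesis
  proof (rule that[of "\<lambda>x. 1 / c * \<psi> x"])
    show "smooth (\<lambda>x. 1 / c * \<psi> x)" using sm unfolding smooth_def by (intro allI Ck_cmult) auto
    show "0 \<le> 1 / c * \<psi> x" for x using nn c by simp
    show "1 / c * \<psi> x = 0" if "x \<notin> ball p r" for x using out[OF that] by simp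
    have "(\<integral>\<^sup>+x. ennreal (1 / c * \<psi> x) \<partial>lborel) = (\<integral>\<^sup>+x. ennreal (1 / c) * ennreal (\<psi> x) \<partial>lborel)"
      using c by (intro nn_integral_cong ennreal_mult') simp
    also have "\<dots> = ennreal (1 / c) * Z" unfolding Z_def by (rule nn_integral_cmult) simp
    also have "\<dots> = ennreal (1 / c * c)" unfolding c(2) using c by (intro ennreal_mult'[symmetric]) simp
    finally show "(\<integral>\<^sup>+x. ennreal (1 / c * \<psi> x) \<partial>lborel) = 1" using c by simp
  qed
qed

text \<open>Convolution with the reflected kernel: by \<open>conv_translate\<close> it averages
  \<open>u (x + h)\<close> with the weight \<open>\<eta> h\<close>, so the support of
  \<open>\<eta>\<close> is exactly the set of shifts that are used.\<close>

definition conv :: "('a::euclidean_space \<Rightarrow> real) \<Rightarrow> ('a \<Rightarrow> real) \<Rightarrow> 'a \<Rightarrow> real" where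
  "conv \<eta> u x = (LINT y|lborel. \<eta> (y - x) * u y)"

lemma integrable_bounded_mult:
  fixes u \<phi> :: "'a::euclidean_space \<Rightarrow> real"
  assumes u: "integrable lborel u" and \<phi> [measurable]: "\<phi> \<in> borel_measurable borel" and B: "\<And>x. \<bar>\<phi> x\<bar> \<le> B"
  shows "integrable lborel (\<lambda>y. \<phi> y * u y)"
proof (rule Bochner_Integration.integrable_bound)
  show "integrable lborel (\<lambda>y. B * u y)" using u by simp
  have "B \<ge> 0" using B[of undefined] by linarith
  then show "AE x in lborel. norm (\<phi> x * u x) \<le> norm (B * u x)"
    using B by (intro AE_I2) (simp add: abs_mult mult_right_mono)
  show "(\<lambda>y. \<phi> y * u y) \<in> borel_measurable lborel" using u by measurable
qed

lemma integrable_conv: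
  fixes u \<phi> :: "'a::euclidean_space \<Rightarrow> real"
  assumes u: "integrable lborel u" and \<phi>: "continuous_on UNIV \<phi>" "vanishes_outside r \<phi>"
  shows "integrable lborel (\<lambda>y. \<phi> (y - x) * u y)"
proof -
  obtain B where B: "B > 0" "\<And>x. \<bar>\<phi> x\<bar> \<le> B" using vanishes_outside_bounded[OF \<phi>] by blast
  have [measurable]: "\<phi> \<in> borel_measurable borel" using \<phi>(1) by (rule borel_measurable_continuous_onI)
  show ?thesis by (rule integrable_bounded_mult[OF u _ B(2)]) measurable
qed

text \<open>Each partial derivative is continuous with compact support, hence uniformly continuous;
  the finitely many moduli over \<open>Basis\<close> are combined by their minimum, and the operator
  norm is estimated coordinatewise.\<close>

lemma deriv_uniform_onorm:
  fixes \<eta> :: "'a::euclidean_space \<Rightarrow> real"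
  assumes \<eta>: "smooth \<eta>" "vanishes_outside r \<eta>" and e: "e > 0"
  obtains d where "d > 0" "\<And>z z'. dist z z' < d \<Longrightarrow>
    onorm (\<lambda>v. frechet_derivative \<eta> (at z) v - frechet_derivative \<eta> (at z') v) \<le> e"
proof -
  let ?D = "\<lambda>z. frechet_derivative \<eta> (at z)"
  define e' where "e' = e / DIM('a)"
  have e': "e' > 0" using e by (simp add: e'_def)
  have "\<exists>d>0. \<forall>z z'. dist z' z < d \<longrightarrow> dist (?D z' b) (?D z b) < e'" for b
  proof -
    have "uniformly_continuous_on UNIV (\<lambda>z. ?D z b)"
      by (rule vanishes_outside_uniformly_continuous[OF smooth_continuous[OF smooth_deriv[OF \<eta>(1)]] vanishes_outside_deriv[OF \<eta>(2)]])
    then show ?thesis using e' unfolding uniformly_continuous_on_def by auto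
  qed
  then obtain d where d: "\<And>b. d b > 0" "\<And>b z z'. dist z' z < d b \<Longrightarrow> dist (?D z' b) (?D z b) < e'"
    by metis
  show ?thesis
  proof (rule that[of "Min (d ` Basis)"])
    show "Min (d ` (Basis :: 'a set)) > 0" using d(1) by simp
    fix z z' :: 'a assume zz: "dist z z' < Min (d ` Basis)"
    have lin: "linear (?D z)" for z
      using smooth_differentiable[OF \<eta>(1), of z] by (simp add: linear_frechet_derivative)
    show "onorm (\<lambda>v. ?D z v - ?D z' v) \<le> e"
    proof (rule onorm_le)
      fix v :: 'a
      have ex: "?D z v = (\<Sum>b\<in>Basis. (v \<bullet> b) * ?D z b)" for z
      proof -
        have "?D z v = ?D z (\<Sum>b\<in>Basis. (v \<bullet> b) *\<^sub>R b)" by (simp add: euclidean_representation)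
        also have "\<dots> = (\<Sum>b\<in>Basis. (v \<bullet> b) * ?D z b)" by (simp add: linear_sum[OF lin] linear_scale[OF lin])
        finally show ?thesis .
      qed
      have "norm (?D z v - ?D z' v) = norm (\<Sum>b\<in>Basis. (v \<bullet> b) * (?D z b - ?D z' b))"
        unfolding ex[of z] ex[of z'] by (simp add: sum_subtractf right_diff_distrib)
      also have "\<dots> \<le> (\<Sum>b\<in>(Basis :: 'a set). norm v * e')"
      proof (rule sum_norm_le)
        fix b :: 'a assume b: "b \<in> Basis"
        have "dist z z' < d b" using zz b by (simp add: Min_gr_iff)
        then have "\<bar>?D z b - ?D z' b\<bar> \<le> e'" using d(2)[of z z' b] by (simp add: dist_real_def)
        then show "norm ((v \<bullet> b) * (?D z b - ?D z' b)) \<le> norm v * e'"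
          using Basis_le_norm[OF b, of v] by (simp add: abs_mult mult_mono)
      qed
      also have "\<dots> = e * norm v" by (simp add: e'_def)
      finally show "norm (?D z v - ?D z' v) \<le> e * norm v" .
    qed
  qed
qed

text \<open>Differentiation under the integral. The uniform continuity of the derivative of
  \<open>\<eta>\<close> makes the remainder small uniformly in \<open>y\<close>, so it can be
  integrated against \<open>\<bar>u y\<bar>\<close>. The sign comes from the argument
  \<open>y - x\<close>; it is written as a factor to keep the kernel within the reach of
  \<open>smooth_mult\<close>.\<close>

lemma conv_has_derivative:
  fixes \<eta> u :: "'a::euclidean_space \<Rightarrow> real"
  assumes \<eta>: "smooth \<eta>" "vanishes_outside r \<eta>" and u: "integrable lborel u"
  shows "(conv \<eta> u has_derivative (\<lambda>v. conv (\<lambda>z. - 1 * frechet_derivative \<eta> (at z) v) u x)) (at x)"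
proof -
  let ?D = "\<lambda>z. frechet_derivative \<eta> (at z)"
  have lin: "linear (?D z)" for z
    using smooth_differentiable[OF \<eta>(1), of z] by (simp add: linear_frechet_derivative)
  have der: "(\<eta> has_derivative ?D z) (at z)" for z
    using smooth_differentiable[OF \<eta>(1), of z] by (simp only: frechet_derivative_works)
  have int0: "integrable lborel (\<lambda>y. \<eta> (y - x) * u y)" for x
    by (rule integrable_conv[OF u smooth_continuous[OF \<eta>(1)] \<eta>(2)])
  have int1: "integrable lborel (\<lambda>y. ?D (y - x) v * u y)" for x v
    by (rule integrable_conv[OF u smooth_continuous[OF smooth_deriv[OF \<eta>(1)]] vanishes_outside_deriv[OF \<eta>(2)]])
  have D_eq: "conv (\<lambda>z. - 1 * ?D z v) u x = - (LINT y|lborel. ?D (y - x) v * u y)" for v x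
    by (simp add: conv_def)
  define I where "I = (LINT y|lborel. \<bar>u y\<bar>)"
  have I: "I \<ge> 0" by (simp add: I_def)
  have uabs: "integrable lborel (\<lambda>y. \<bar>u y\<bar>)" using u by simp
  show ?thesis
    unfolding has_derivative_at_alt
  proof (intro conjI allI impI)
    show "bounded_linear (\<lambda>v. conv (\<lambda>z. - 1 * ?D z v) u x)"
      unfolding linear_conv_bounded_linear[symmetric] D_eq
    proof (rule linearI)
      fix a b
      show "- (LINT y|lborel. ?D (y - x) (a + b) * u y) = - (LINT y|lborel. ?D (y - x) a * u y) + - (LINT y|lborel. ?D (y - x) b * u y)"
        using int1 by (simp add: linear_add[OF lin] distrib_right)
    next
      fix c a
      show "- (LINT y|lborel. ?D (y - x) (c *\<^sub>R a) * u y) = c *\<^sub>R - (LINT y|lborel. ?D (y - x) a * u y)"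
        by (simp add: linear_scale[OF lin] mult.assoc)
    qed
    fix e :: real assume e: "e > 0"
    define e' where "e' = e / (I + 1)"
    have e': "e' > 0" using e I by (simp add: e'_def)
    obtain d where d: "d > 0" "\<And>z z'. dist z z' < d \<Longrightarrow> onorm (\<lambda>v. ?D z v - ?D z' v) \<le> e'"
      using deriv_uniform_onorm[OF \<eta> e'] by blast
    show "\<exists>d>0. \<forall>y. norm (y - x) < d \<longrightarrow>
      norm (conv \<eta> u y - conv \<eta> u x - conv (\<lambda>z. - 1 * ?D z (y - x)) u x) \<le> e * norm (y - x)"
    proof (intro exI[of _ d] conjI allI impI d(1))
      fix x' assume x': "norm (x' - x) < d"
      have rem: "\<bar>\<eta> (y - x') - \<eta> (y - x) + ?D (y - x) (x' - x)\<bar> \<le> norm (x' - x) * e'" for y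
      proof -
        have "norm (\<eta> (y - x') - \<eta> (y - x) - ?D (y - x) ((y - x') - (y - x))) \<le> norm ((y - x') - (y - x)) * e'"
        proof (rule differentiable_bound_linearization[where S = "ball (y - x) d"])
          fix t :: real assume t: "t \<in> {0..1}"
          have "norm (t *\<^sub>R (x - x')) \<le> norm (x - x')" using t by (simp add: mult_left_le_one_le)
          also have "\<dots> < d" using x' by (simp add: norm_minus_commute)
          finally show "y - x + t *\<^sub>R (y - x' - (y - x)) \<in> ball (y - x) d" by (simp add: dist_norm)
        next
          fix z assume "z \<in> ball (y - x) d"
          then show "onorm (?D z - ?D (y - x)) \<le> e'"
            using d(2)[of z "y - x"] by (simp add: dist_commute fun_diff_def)
          show "(\<eta> has_derivative ?D z) (at z within ball (y - x) d)"
            by (rule has_derivative_at_withinI[OF der])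
        qed (use d in simp)
        moreover have "?D (y - x) ((y - x') - (y - x)) = - ?D (y - x) (x' - x)"
          using linear_neg[OF lin, of "y - x" "x' - x"] by simp
        ultimately show ?thesis by (simp add: norm_minus_commute)
      qed
      have "conv \<eta> u x' - conv \<eta> u x - conv (\<lambda>z. - 1 * ?D z (x' - x)) u x =
          (LINT y|lborel. (\<eta> (y - x') - \<eta> (y - x) + ?D (y - x) (x' - x)) * u y)"
        unfolding D_eq using int0 int1
        by (simp add: conv_def distrib_right left_diff_distrib)
      also have "norm \<dots> \<le> (LINT y|lborel. norm (x' - x) * e' * \<bar>u y\<bar>)"
      proof (rule order_trans[OF integral_norm_bound integral_mono_AE])
        have "integrable lborel (\<lambda>y. \<eta> (y - x') * u y - \<eta> (y - x) * u y + ?D (y - x) (x' - x) * u y)"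
          using int0 int1 by (intro Bochner_Integration.integrable_add Bochner_Integration.integrable_diff)
        then show "integrable lborel (\<lambda>y. norm ((\<eta> (y - x') - \<eta> (y - x) + ?D (y - x) (x' - x)) * u y))"
          by (intro integrable_norm) (simp add: distrib_right left_diff_distrib)
        show "AE y in lborel. norm ((\<eta> (y - x') - \<eta> (y - x) + ?D (y - x) (x' - x)) * u y) \<le> norm (x' - x) * e' * \<bar>u y\<bar>"
          using rem by (intro AE_I2) (simp add: abs_mult mult_right_mono)
      qed (use uabs in simp)
      also have "\<dots> = norm (x' - x) * e' * I" by (simp add: I_def)
      also have "\<dots> \<le> e * norm (x' - x)"
      proof -
        have "e' * I \<le> e" using e I by (simp add: e'_def field_simps)
        then show ?thesis by (simp add: mult.assoc mult_left_mono mult.commute[of e])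
      qed
      finally show "norm (conv \<eta> u x' - conv \<eta> u x - conv (\<lambda>z. - 1 * ?D z (x' - x)) u x) \<le> e * norm (x' - x)" .
    qed
  qed
qed

text \<open>By \<open>conv_has_derivative\<close> a directional derivative is again a convolution of
  the same \<open>u\<close>, with a smooth kernel that vanishes outside a radius larger by 1. The
  induction therefore runs over all kernels and radii at once.\<close>

lemma smooth_conv:
  fixes \<eta> u :: "'a::euclidean_space \<Rightarrow> real"
  assumes \<eta>: "smooth \<eta>" "vanishes_outside r \<eta>" and u: "integrable lborel u"
  shows "smooth (conv \<eta> u)"
proof -
  have "Ck n (conv \<eta> u)" if "smooth \<eta>" "vanishes_outside r \<eta>" for n and \<eta> :: "'a \<Rightarrow> real" and r
    using that
  proof (induction n arbitrary: \<eta> r)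
    case 0
    show ?case using conv_has_derivative[OF 0 u] by (auto simp: differentiable_def)
  next
    case (Suc n)
    show ?case
    proof (rule Ck_SucI[OF conv_has_derivative[OF Suc.prems u]])
      fix v
      show "Ck n (conv (\<lambda>z. - 1 * frechet_derivative \<eta> (at z) v) u)"
      proof (rule Suc.IH)
        show "smooth (\<lambda>z. - 1 * frechet_derivative \<eta> (at z) v)"
          by (intro smooth_mult smooth_const smooth_deriv Suc.prems)
        show "vanishes_outside (r + 1) (\<lambda>z. - 1 * frechet_derivative \<eta> (at z) v)"
          using vanishes_outside_deriv[OF Suc.prems(2), of v] by (simp add: vanishes_outside_def)
      qed
    qed
  qed
  then show ?thesis using \<eta> by (simp add: smooth_def)
qed

section \<open>Convergence of mollifications\<close>

lemma nn_integral_lborel_translate: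
  fixes g :: "'a::euclidean_space \<Rightarrow> ennreal"
  assumes [measurable]: "g \<in> borel_measurable borel"
  shows "(\<integral>\<^sup>+z. g (z + h) \<partial>lborel) = (\<integral>\<^sup>+z. g z \<partial>lborel)"
proof -
  have "(\<integral>\<^sup>+z. g z \<partial>lborel) = (\<integral>\<^sup>+z. g z \<partial>distr lborel borel ((+) h))" by (simp add: lborel_distr_plus)
  also have "\<dots> = (\<integral>\<^sup>+z. g (h + z) \<partial>lborel)" by (rule nn_integral_distr) measurable
  finally show ?thesis by (simp add: add.commute)
qed

text \<open>Inner regularity is invoked for the finite measure with density
  \<open>indicator A\<close>, because \<open>lborel\<close> itself is infinite.\<close>

lemma compact_open_sandwich:
  fixes A :: "'a::euclidean_space set"
  assumes A: "A \<in> sets borel" "emeasure lborel A < top" and e: "(0::real) < e"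
  obtains K U where "compact K" "open U" "K \<subseteq> A" "A \<subseteq> U" "emeasure lborel (U - K) \<le> ennreal e"
proof -
  obtain U where U: "open U" "A \<subseteq> U" "emeasure lebesgue (U - A) < ennreal (e / 2)"
    by (rule sets_lebesgue_outer_open[of A "e / 2"]) (use A e in auto)
  define M where "M = density lborel (indicator A)"
  have M: "emeasure M B = emeasure lborel (A \<inter> B)" if "B \<in> sets borel" for B
    using that A by (simp add: M_def emeasure_density indicator_inter_arith[symmetric] )
  have "emeasure M A = (SUP K \<in> {K. K \<subseteq> A \<and> compact K}. emeasure M K)"
    using A M[of UNIV] by (intro inner_regular) (auto simp: M_def)
  moreover have "emeasure M A \<noteq> \<infinity>" using M[of A] A by simp
  moreover have "{} \<in> {K. K \<subseteq> A \<and> compact K}" by simp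
  then have "{K. K \<subseteq> A \<and> compact K} \<noteq> {}" by blast
  ultimately have "\<exists>K\<in>{K. K \<subseteq> A \<and> compact K}. emeasure M A < emeasure M K + ennreal (e / 2)"
    using e by (intro SUP_approx_ennreal) auto
  then obtain K where K: "K \<subseteq> A" "compact K" "emeasure M A < emeasure M K + ennreal (e / 2)" by blast
  have Kb: "K \<in> sets borel" using K by (auto intro: borel_compact)
  have KA: "emeasure lborel A < emeasure lborel K + ennreal (e / 2)"
    using K M[OF Kb] M[of A] A by (simp add: Int_absorb1)
  have Kf: "emeasure lborel K < top"
    using emeasure_mono[OF K(1), of lborel] A by (auto intro: le_less_trans)
  have "emeasure lborel (A - K) = emeasure lborel A - emeasure lborel K"
    using K A Kb Kf by (intro emeasure_Diff) (auto simp: less_top)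
  also have "\<dots> \<le> ennreal (e / 2)"
    using KA A(2) by (auto simp: ennreal_minus_le_iff less_imp_le)
  finally have 1: "emeasure lborel (A - K) \<le> ennreal (e / 2)" .
  have "emeasure lborel (U - A) = emeasure lebesgue (U - A)"
    using U A by (simp add: borel_open)
  then have 2: "emeasure lborel (U - A) \<le> ennreal (e / 2)" using U(3) by simp
  have "U - K \<subseteq> (U - A) \<union> (A - K)" by blast
  then have "emeasure lborel (U - K) \<le> emeasure lborel ((U - A) \<union> (A - K))"
    using U A Kb by (intro emeasure_mono) auto
  also have "\<dots> \<le> emeasure lborel (U - A) + emeasure lborel (A - K)"
    using U A Kb by (intro emeasure_subadditive) auto
  also have "\<dots> \<le> ennreal (e / 2) + ennreal (e / 2)" using 1 2 by (rule add_mono[rotated])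
  also have "\<dots> = ennreal e" using e by (simp add: ennreal_plus[symmetric] del: ennreal_plus)
  finally show ?thesis using that K U by blast
qed

lemma ennreal_norm_add_le:
  fixes u v w :: real
  assumes "u = v + w"
  shows "ennreal (norm u) \<le> ennreal (norm v) + ennreal (norm w)"
proof -
  have "ennreal (norm u) \<le> ennreal (norm v + norm w)" using assms by (intro ennreal_leI) simp
  then show ?thesis by (simp only: ennreal_plus norm_ge_zero)
qed

text \<open>By \<open>integrable_induct\<close> it suffices to treat indicators, sums and dominated
  limits. In the limit case both error terms of the approximation have the same size, since
  integrals are invariant under translation.\<close>

lemma L1_translation_continuous:
  fixes f :: "'a::euclidean_space \<Rightarrow> real"
  assumes "integrable lborel f"
  shows "\<forall>e>0. \<exists>d>0. \<forall>h. norm h < d \<longrightarrow> (\<integral>\<^sup>+z. ennreal (norm (f (z + h) - f z)) \<partial>lborel) \<le> ennreal e"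
  using assms
proof (induction rule: integrable_induct)
  case (base A c)
  then have A: "A \<in> sets borel" "emeasure lborel A < top" by auto
  show ?case
  proof (intro allI impI)
    fix e :: real assume e: "e > 0"
    define e' where "e' = e / (2 * (\<bar>c\<bar> + 1))"
    have e': "e' > 0" using e by (simp add: e'_def)
    obtain K U where KU: "compact K" "open U" "K \<subseteq> A" "A \<subseteq> U" "emeasure lborel (U - K) \<le> ennreal e'"
      using compact_open_sandwich[OF A e'] by blast
    have [measurable]: "U - K \<in> sets borel" using KU by (auto intro: borel_compact)
    have "K \<inter> - U = {}" using KU by blast
    then obtain d where d: "d > 0" "\<And>x y. x \<in> K \<Longrightarrow> y \<in> - U \<Longrightarrow> d \<le> dist x y"
      using separate_compact_closed[of K "- U"] KU by (auto simp: closed_def)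
    show "\<exists>d>0. \<forall>h. norm h < d \<longrightarrow> (\<integral>\<^sup>+z. ennreal (norm (indicator A (z + h) *\<^sub>R c - indicator A z *\<^sub>R c)) \<partial>lborel) \<le> ennreal e"
    proof (intro exI[of _ d] conjI allI impI d(1))
      fix h :: 'a assume h: "norm h < d"
      \<comment> \<open>If exactly one of \<open>z\<close> and \<open>z + h\<close> lies in
        \<open>A\<close>, then one of them lies in \<open>U - K\<close>: a shift shorter than the
        distance from \<open>K\<close> to the complement of \<open>U\<close> cannot leave
        \<open>U\<close> from \<open>K\<close>.\<close>
      have pt: "ennreal (norm (indicator A (z + h) *\<^sub>R c - indicator A z *\<^sub>R c)) \<le>
          ennreal \<bar>c\<bar> * (indicator (U - K) (z + h) + indicator (U - K) z)" for z
      proof -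
        have a: "z + h \<in> U" if "z \<in> K" using d(2)[OF that, of "z + h"] h by (force simp: dist_norm)
        have b: "z \<in> U" if "z + h \<in> K" using d(2)[OF that, of z] h by (force simp: dist_norm)
        have "z \<in> U - K \<or> z + h \<in> U - K" if "(z \<in> A) \<noteq> (z + h \<in> A)"
          using that a b KU by blast
        then show ?thesis by (auto simp: indicator_def mult_2_right)
      qed
      have "(\<integral>\<^sup>+z. ennreal (norm (indicator A (z + h) *\<^sub>R c - indicator A z *\<^sub>R c)) \<partial>lborel) \<le>
          (\<integral>\<^sup>+z. ennreal \<bar>c\<bar> * (indicator (U - K) (z + h) + indicator (U - K) z) \<partial>lborel)"
        by (rule nn_integral_mono) (rule pt)
      also have "\<dots> = ennreal \<bar>c\<bar> * ((\<integral>\<^sup>+z. indicator (U - K) (z + h) \<partial>lborel) + (\<integral>\<^sup>+z. indicator (U - K) z \<partial>lborel))"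
        by (simp add: nn_integral_cmult nn_integral_add)
      also have "(\<integral>\<^sup>+z. indicator (U - K) (z + h) \<partial>lborel) = (\<integral>\<^sup>+z. indicator (U - K) z \<partial>lborel)"
        by (rule nn_integral_lborel_translate) measurable
      also have "(\<integral>\<^sup>+z. indicator (U - K) z \<partial>lborel) = emeasure lborel (U - K)" by simp
      also have "ennreal \<bar>c\<bar> * (emeasure lborel (U - K) + emeasure lborel (U - K)) \<le> ennreal \<bar>c\<bar> * (ennreal e' + ennreal e')"
        by (intro mult_left_mono add_mono KU) simp
      also have "\<dots> = ennreal (\<bar>c\<bar> * (e' + e'))"
        using e' by (simp add: ennreal_plus[symmetric] ennreal_mult'[symmetric] del: ennreal_plus)
      also have "\<dots> \<le> ennreal e"
      proof (rule ennreal_leI)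
        have "e = e' * (2 * (\<bar>c\<bar> + 1))" by (simp add: e'_def)
        then have "e = \<bar>c\<bar> * (e' + e') + 2 * e'" by (simp add: algebra_simps)
        then show "\<bar>c\<bar> * (e' + e') \<le> e" using e' by linarith
      qed
      finally show "(\<integral>\<^sup>+z. ennreal (norm (indicator A (z + h) *\<^sub>R c - indicator A z *\<^sub>R c)) \<partial>lborel) \<le> ennreal e" .
    qed
  qed
next
  case (add f g)
  have [measurable]: "f \<in> borel_measurable borel" "g \<in> borel_measurable borel"
    using borel_measurable_integrable[OF add.hyps(1)] borel_measurable_integrable[OF add.hyps(2)] by auto
  show ?case
  proof (intro allI impI)
    fix e :: real assume e: "e > 0"
    then have e2: "e / 2 > 0" by simp
    obtain d1 where d1: "d1 > 0" "\<And>h. norm h < d1 \<Longrightarrow> (\<integral>\<^sup>+z. ennreal (norm (f (z + h) - f z)) \<partial>lborel) \<le> ennreal (e / 2)"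
      using add.IH(1) e2 by blast
    obtain d2 where d2: "d2 > 0" "\<And>h. norm h < d2 \<Longrightarrow> (\<integral>\<^sup>+z. ennreal (norm (g (z + h) - g z)) \<partial>lborel) \<le> ennreal (e / 2)"
      using add.IH(2) e2 by blast
    show "\<exists>d>0. \<forall>h. norm h < d \<longrightarrow> (\<integral>\<^sup>+z. ennreal (norm (f (z + h) + g (z + h) - (f z + g z))) \<partial>lborel) \<le> ennreal e"
    proof (intro exI[of _ "min d1 d2"] conjI allI impI)
      fix h :: 'a assume h: "norm h < min d1 d2"
      have "(\<integral>\<^sup>+z. ennreal (norm (f (z + h) + g (z + h) - (f z + g z))) \<partial>lborel) \<le>
          (\<integral>\<^sup>+z. ennreal (norm (f (z + h) - f z)) + ennreal (norm (g (z + h) - g z)) \<partial>lborel)"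
        by (intro nn_integral_mono ennreal_norm_add_le) simp
      also have "\<dots> = (\<integral>\<^sup>+z. ennreal (norm (f (z + h) - f z)) \<partial>lborel) + (\<integral>\<^sup>+z. ennreal (norm (g (z + h) - g z)) \<partial>lborel)"
        by (rule nn_integral_add) measurable
      also have "\<dots> \<le> ennreal (e / 2) + ennreal (e / 2)" using d1 d2 h by (intro add_mono) auto
      also have "\<dots> = ennreal e" using e by (simp add: ennreal_plus[symmetric] del: ennreal_plus)
      finally show "(\<integral>\<^sup>+z. ennreal (norm (f (z + h) + g (z + h) - (f z + g z))) \<partial>lborel) \<le> ennreal e" .
    qed (use d1 d2 in auto)
  qed
next
  case (lim f s)
  have [measurable]: "f \<in> borel_measurable borel" "\<And>i. s i \<in> borel_measurable borel"
    using borel_measurable_integrable[OF lim.hyps(4)] borel_measurable_integrable[OF lim.hyps(1)] by auto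
  have conv: "(\<lambda>i. \<integral>\<^sup>+x. ennreal (norm (f x - s i x)) \<partial>lborel) \<longlonglongrightarrow> 0"
  proof (rule nn_integral_dominated_convergence_norm)
    show "AE x in lborel. norm (s j x) \<le> 2 * norm (f x)" for j using lim.hyps(3) by auto
    show "(\<integral>\<^sup>+x. ennreal (2 * norm (f x)) \<partial>lborel) < \<infinity>"
      using lim.hyps(4) by (simp add: integrable_iff_bounded ennreal_mult' nn_integral_cmult ennreal_mult_less_top)
    show "AE x in lborel. (\<lambda>i. s i x) \<longlonglongrightarrow> f x" using lim.hyps(2) by auto
  qed auto
  show ?case
  proof (intro allI impI)
    fix e :: real assume e: "e > 0"
    then have e3: "e / 3 > 0" by simp
    have "\<forall>\<^sub>F i in sequentially. (\<integral>\<^sup>+x. ennreal (norm (f x - s i x)) \<partial>lborel) < ennreal (e / 3)"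
      using conv e3 by (intro order_tendstoD) auto
    then obtain i where i: "(\<integral>\<^sup>+x. ennreal (norm (f x - s i x)) \<partial>lborel) < ennreal (e / 3)"
      by (auto simp: eventually_sequentially)
    obtain d where d: "d > 0" "\<And>h. norm h < d \<Longrightarrow> (\<integral>\<^sup>+z. ennreal (norm (s i (z + h) - s i z)) \<partial>lborel) \<le> ennreal (e / 3)"
      using lim.IH e3 by blast
    show "\<exists>d>0. \<forall>h. norm h < d \<longrightarrow> (\<integral>\<^sup>+z. ennreal (norm (f (z + h) - f z)) \<partial>lborel) \<le> ennreal e"
    proof (intro exI[of _ d] conjI allI impI d(1))
      fix h :: 'a assume h: "norm h < d"
      have "(\<integral>\<^sup>+z. ennreal (norm (f (z + h) - f z)) \<partial>lborel) \<le>
          (\<integral>\<^sup>+z. ennreal (norm (f (z + h) - s i (z + h))) + (ennreal (norm (s i (z + h) - s i z)) + ennreal (norm (f z - s i z))) \<partial>lborel)"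
      proof (rule nn_integral_mono)
        fix z
        have "ennreal (norm (f (z + h) - f z)) \<le> ennreal (norm (f (z + h) - s i (z + h))) + ennreal (norm (s i (z + h) - f z))"
          by (rule ennreal_norm_add_le) simp
        also have "ennreal (norm (s i (z + h) - f z)) \<le> ennreal (norm (s i (z + h) - s i z)) + ennreal (norm (s i z - f z))"
          by (rule ennreal_norm_add_le) simp
        finally show "ennreal (norm (f (z + h) - f z)) \<le>
          ennreal (norm (f (z + h) - s i (z + h))) + (ennreal (norm (s i (z + h) - s i z)) + ennreal (norm (f z - s i z)))"
          by (simp add: add_left_mono abs_minus_commute)
      qed
      also have "\<dots> = (\<integral>\<^sup>+z. ennreal (norm (f (z + h) - s i (z + h))) \<partial>lborel) + ((\<integral>\<^sup>+z. ennreal (norm (s i (z + h) - s i z)) \<partial>lborel) + (\<integral>\<^sup>+z. ennreal (norm (f z - s i z)) \<partial>lborel))"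
        by (simp add: nn_integral_add)
      also have "(\<integral>\<^sup>+z. ennreal (norm (f (z + h) - s i (z + h))) \<partial>lborel) = (\<integral>\<^sup>+z. ennreal (norm (f z - s i z)) \<partial>lborel)"
        by (rule nn_integral_lborel_translate[of "\<lambda>z. ennreal (norm (f z - s i z))"]) measurable
      also have "(\<integral>\<^sup>+z. ennreal (norm (f z - s i z)) \<partial>lborel) + ((\<integral>\<^sup>+z. ennreal (norm (s i (z + h) - s i z)) \<partial>lborel) + (\<integral>\<^sup>+z. ennreal (norm (f z - s i z)) \<partial>lborel))
          \<le> ennreal (e / 3) + (ennreal (e / 3) + ennreal (e / 3))"
        using i d(2)[OF h] by (intro add_mono) auto
      also have "\<dots> = ennreal e" using e by (simp add: ennreal_plus[symmetric] del: ennreal_plus)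
      finally show "(\<integral>\<^sup>+z. ennreal (norm (f (z + h) - f z)) \<partial>lborel) \<le> ennreal e" .
    qed
  qed
qed

text \<open>For equal signs \<open>(a - b)^2\<close> is at most the difference of the squares, since
  \<open>\<bar>a - b\<bar> \<le> \<bar>a + b\<bar>\<close>; for opposite signs the right-hand side
  is \<open>2 * (a^2 + b^2)\<close>. Only the second case uses the factor 2.\<close>

lemma square_diff_le_signed_squares:
  fixes a b :: real
  shows "(a - b)\<^sup>2 \<le> 2 * \<bar>a * \<bar>a\<bar> - b * \<bar>b\<bar>\<bar>"
proof -
  have same: "(x - y)\<^sup>2 \<le> x\<^sup>2 - y\<^sup>2" if "0 \<le> y" "y \<le> x" for x y :: real
  proof -
    have "(x - y) * (x - y) \<le> (x - y) * (x + y)" using that by (intro mult_left_mono) auto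
    then show ?thesis by (simp add: power2_eq_square algebra_simps)
  qed
  have opp: "(a - b)\<^sup>2 \<le> 2 * (a\<^sup>2 + b\<^sup>2)" using sum_square_le[of a "- b"] by simp
  have gen: "p \<le> 2 * X" if "p \<le> 2 * q" "q \<le> X" for p q X :: real using that by linarith
  have absX: "a * \<bar>a\<bar> - b * \<bar>b\<bar> \<le> \<bar>a * \<bar>a\<bar> - b * \<bar>b\<bar>\<bar>" "b * \<bar>b\<bar> - a * \<bar>a\<bar> \<le> \<bar>a * \<bar>a\<bar> - b * \<bar>b\<bar>\<bar>"
    "0 \<le> \<bar>a * \<bar>a\<bar> - b * \<bar>b\<bar>\<bar>" by auto
  consider "a \<ge> 0" "b \<ge> 0" "a \<ge> b" | "a \<ge> 0" "b \<ge> 0" "b \<ge> a" | "a < 0" "b < 0" "a \<ge> b" | "a < 0" "b < 0" "b \<ge> a"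
    | "a \<ge> 0" "b < 0" | "a < 0" "b \<ge> 0" by linarith
  then show ?thesis
  proof cases
    case 1
    then have "(a - b)\<^sup>2 \<le> a * \<bar>a\<bar> - b * \<bar>b\<bar>" using same[of b a] by (simp add: power2_eq_square)
    then show ?thesis using absX by linarith
  next
    case 2
    then have "(a - b)\<^sup>2 \<le> b * \<bar>b\<bar> - a * \<bar>a\<bar>"
      using same[of a b] by (simp add: power2_commute[of a b]) (simp add: power2_eq_square)
    then show ?thesis using absX by linarith
  next
    case 3
    then have "(a - b)\<^sup>2 \<le> a * \<bar>a\<bar> - b * \<bar>b\<bar>"
      using same[of "- a" "- b"] by (simp add: power2_eq_square)
    then show ?thesis using absX by linarith
  next
    case 4
    then have "(a - b)\<^sup>2 \<le> b * \<bar>b\<bar> - a * \<bar>a\<bar>"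
      using same[of "- b" "- a"] by (simp add: power2_commute[of a b]) (simp add: power2_eq_square)
    then show ?thesis using absX by linarith
  next
    case 5
    then have eq: "a\<^sup>2 + b\<^sup>2 = a * \<bar>a\<bar> - b * \<bar>b\<bar>" by (simp add: power2_eq_square)
    show ?thesis by (rule gen[OF opp]) (unfold eq, rule absX)
  next
    case 6
    then have eq: "a\<^sup>2 + b\<^sup>2 = b * \<bar>b\<bar> - a * \<bar>a\<bar>" by (simp add: power2_eq_square)
    show ?thesis by (rule gen[OF opp]) (unfold eq, rule absX)
  qed
qed

text \<open>Reduced to \<open>L\<^sup>1\<close> by applying the \<open>L\<^sup>1\<close> statement to the signed square \<open>f * \<bar>f\<bar>\<close>.\<close>
lemma L2_translation_continuous:
  fixes F :: "'a::euclidean_space \<Rightarrow> real"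
  assumes [measurable]: "F \<in> borel_measurable borel" and fin: "(\<integral>\<^sup>+z. ennreal ((F z)\<^sup>2) \<partial>lborel) < top" and e: "e > 0"
  shows "\<exists>d>0. \<forall>h. norm h < d \<longrightarrow> (\<integral>\<^sup>+z. ennreal ((F (z + h) - F z)\<^sup>2) \<partial>lborel) \<le> ennreal e"
proof -
  have "integrable lborel (\<lambda>z. F z * \<bar>F z\<bar>)"
    unfolding integrable_iff_bounded using fin by (simp add: abs_mult power2_eq_square[symmetric])
  from L1_translation_continuous[OF this, rule_format, of "e / 2"] e obtain d where d: "d > 0"
    "\<And>h. norm h < d \<Longrightarrow> (\<integral>\<^sup>+z. ennreal (norm (F (z + h) * \<bar>F (z + h)\<bar> - F z * \<bar>F z\<bar>)) \<partial>lborel) \<le> ennreal (e / 2)"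
    by auto
  show ?thesis
  proof (intro exI[of _ d] conjI allI impI d(1))
    fix h :: 'a assume h: "norm h < d"
    have "(\<integral>\<^sup>+z. ennreal ((F (z + h) - F z)\<^sup>2) \<partial>lborel) \<le> (\<integral>\<^sup>+z. ennreal 2 * ennreal (norm (F (z + h) * \<bar>F (z + h)\<bar> - F z * \<bar>F z\<bar>)) \<partial>lborel)"
    proof (rule nn_integral_mono)
      fix z
      have "ennreal ((F (z + h) - F z)\<^sup>2) \<le> ennreal (2 * norm (F (z + h) * \<bar>F (z + h)\<bar> - F z * \<bar>F z\<bar>))"
        unfolding real_norm_def by (intro ennreal_leI square_diff_le_signed_squares)
      also have "\<dots> = ennreal 2 * ennreal (norm (F (z + h) * \<bar>F (z + h)\<bar> - F z * \<bar>F z\<bar>))" by (rule ennreal_mult') simp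
      finally show "ennreal ((F (z + h) - F z)\<^sup>2) \<le> ennreal 2 * ennreal (norm (F (z + h) * \<bar>F (z + h)\<bar> - F z * \<bar>F z\<bar>))" .
    qed
    also have "\<dots> = ennreal 2 * (\<integral>\<^sup>+z. ennreal (norm (F (z + h) * \<bar>F (z + h)\<bar> - F z * \<bar>F z\<bar>)) \<partial>lborel)"
      by (rule nn_integral_cmult) measurable
    also have "\<dots> \<le> ennreal 2 * ennreal (e / 2)" by (intro mult_left_mono d(2) h) simp
    also have "\<dots> = ennreal (2 * (e / 2))" by (rule ennreal_mult'[symmetric]) simp
    finally show "(\<integral>\<^sup>+z. ennreal ((F (z + h) - F z)\<^sup>2) \<partial>lborel) \<le> ennreal e" by simp
  qed
qed

text \<open>Nonnegativity of the variance of \<open>u\<close> under the probability density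
  \<open>\<eta>\<close>, with mean \<open>m\<close>. An infinite right-hand side is set apart first;
  when it is finite, \<open>\<bar>u h\<bar> \<le> 1 + (u h)^2\<close> makes the mean well
  defined.\<close>

lemma jensen_square:
  fixes \<eta> u :: "'a::euclidean_space \<Rightarrow> real"
  assumes [measurable]: "\<eta> \<in> borel_measurable borel" "u \<in> borel_measurable borel"
    and nn: "\<And>h. 0 \<le> \<eta> h" and one: "(\<integral>\<^sup>+h. ennreal (\<eta> h) \<partial>lborel) = 1"
  shows "ennreal ((LINT h|lborel. \<eta> h * u h)\<^sup>2) \<le> (\<integral>\<^sup>+h. ennreal (\<eta> h) * ennreal ((u h)\<^sup>2) \<partial>lborel)"
proof (cases "(\<integral>\<^sup>+h. ennreal (\<eta> h) * ennreal ((u h)\<^sup>2) \<partial>lborel) < top")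
  case False
  then have "(\<integral>\<^sup>+h. ennreal (\<eta> h) * ennreal ((u h)\<^sup>2) \<partial>lborel) = top" using less_top by blast
  then show ?thesis by simp
next
  case True
  have eq: "ennreal (\<eta> h) * ennreal ((u h)\<^sup>2) = ennreal (\<eta> h * (u h)\<^sup>2)" for h
    using nn by (intro ennreal_mult'[symmetric])
  have i1: "integrable lborel \<eta>"
    using nn one by (intro integrableI_nonneg) auto
  have i2: "integrable lborel (\<lambda>h. \<eta> h * (u h)\<^sup>2)"
    using nn True by (intro integrableI_nonneg) (auto simp: eq)
  have i3: "integrable lborel (\<lambda>h. \<eta> h * u h)"
  proof (rule Bochner_Integration.integrable_bound[OF Bochner_Integration.integrable_add[OF i1 i2]])
    show "AE h in lborel. norm (\<eta> h * u h) \<le> norm (\<eta> h + \<eta> h * (u h)\<^sup>2)"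
    proof (rule AE_I2)
      fix h
      have "0 \<le> (\<bar>u h\<bar> - 1)\<^sup>2" by simp
      then have "2 * \<bar>u h\<bar> \<le> 1 + (u h)\<^sup>2" by (simp add: power2_diff)
      then have "\<bar>u h\<bar> \<le> 1 + (u h)\<^sup>2" using abs_ge_zero[of "u h"] by linarith
      from mult_left_mono[OF this nn[of h]] nn[of h]
      show "norm (\<eta> h * u h) \<le> norm (\<eta> h + \<eta> h * (u h)\<^sup>2)"
        by (simp add: abs_mult distrib_left)
    qed
  qed measurable
  have o: "(LINT h|lborel. \<eta> h) = 1"
    using nn_integral_eq_integral[OF i1] nn one by simp
  define m where "m = (LINT h|lborel. \<eta> h * u h)"
  have "0 \<le> (LINT h|lborel. \<eta> h * (u h - m)\<^sup>2)" using nn by (intro integral_nonneg_AE AE_I2) simp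
  also have "(LINT h|lborel. \<eta> h * (u h - m)\<^sup>2) =
      (LINT h|lborel. \<eta> h * (u h)\<^sup>2 - (2 * m) * (\<eta> h * u h) + m\<^sup>2 * \<eta> h)"
    by (intro Bochner_Integration.integral_cong) (auto simp: power2_eq_square algebra_simps)
  also have "\<dots> = (LINT h|lborel. \<eta> h * (u h)\<^sup>2) - (2 * m) * m + m\<^sup>2 * 1"
    using i1 i2 i3 by (simp add: m_def o)
  finally have "m\<^sup>2 \<le> (LINT h|lborel. \<eta> h * (u h)\<^sup>2)" by (simp add: power2_eq_square)
  then have "ennreal (m\<^sup>2) \<le> ennreal (LINT h|lborel. \<eta> h * (u h)\<^sup>2)" by (rule ennreal_leI)
  also have "\<dots> = (\<integral>\<^sup>+h. ennreal (\<eta> h * (u h)\<^sup>2) \<partial>lborel)"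
    using nn by (intro nn_integral_eq_integral[symmetric] i2) auto
  finally show ?thesis by (simp add: m_def eq)
qed

lemma conv_translate:
  fixes \<eta> u :: "'a::euclidean_space \<Rightarrow> real"
  assumes [measurable]: "\<eta> \<in> borel_measurable borel" "u \<in> borel_measurable borel"
  shows "conv \<eta> u x = (LINT h|lborel. \<eta> h * u (x + h))"
proof -
  have "(LINT y|lborel. \<eta> (y - x) * u y) = (LINT y|distr lborel borel ((+) x). \<eta> (y - x) * u y)"
    by (simp add: lborel_distr_plus)
  also have "\<dots> = (LINT h|lborel. \<eta> (x + h - x) * u (x + h))"
    by (rule integral_distr) measurable
  finally show ?thesis by (simp add: conv_def)
qed

lemma integrable_translate:
  fixes u :: "'a::euclidean_space \<Rightarrow> real"
  assumes "integrable lborel u"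
  shows "integrable lborel (\<lambda>h. u (x + h))"
proof -
  have "integrable (distr lborel borel ((+) x)) u" using assms by (simp add: lborel_distr_plus)
  then show ?thesis using assms by (subst (asm) integrable_distr_eq) auto
qed

lemma conv_measurable:
  fixes \<eta> u :: "'a::euclidean_space \<Rightarrow> real"
  assumes [measurable]: "\<eta> \<in> borel_measurable borel" "u \<in> borel_measurable borel"
  shows "conv \<eta> u \<in> borel_measurable borel"
  unfolding conv_def by measurable

text \<open>The mollification of \<open>f\<close> acts on \<open>(f y - f x) * norm (x - y) powr ((- d - \<alpha>) / 2)\<close>, as a function on
  the product space, by averaging over diagonal translations, which leave the kernel invariant.\<close>
lemma mollify_small:
  fixes f :: "'a::euclidean_space \<Rightarrow> real"
  assumes f [measurable]: "f \<in> borel_measurable borel" and \<Omega> [measurable]: "\<Omega> \<in> sets borel"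
    and int: "integrable lborel f" and L2: "(\<integral>\<^sup>+x. ennreal ((f x)\<^sup>2) \<partial>lborel) < top"
    and fin: "dint \<Omega> (\<lambda>x y. sqd f x y * frac_kernel \<alpha> x y) < top" and e: "0 < (e::real)"
  obtains \<delta> where "\<delta> > 0"
    "\<And>\<eta> N. continuous_on UNIV \<eta> \<Longrightarrow> vanishes_outside \<delta> \<eta> \<Longrightarrow> (\<And>h. 0 \<le> \<eta> h) \<Longrightarrow>
      (\<integral>\<^sup>+h. ennreal (\<eta> h) \<partial>lborel) = 1 \<Longrightarrow> N \<in> sets borel \<Longrightarrow> N \<subseteq> \<Omega> \<Longrightarrow>
      (\<And>x h. x \<in> N \<Longrightarrow> \<eta> h \<noteq> 0 \<Longrightarrow> x + h \<in> \<Omega>) \<Longrightarrow>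
      (\<integral>\<^sup>+x\<in>N. ennreal ((conv \<eta> f x - f x)\<^sup>2) \<partial>lborel) \<le> ennreal e \<and>
      dint N (\<lambda>x y. sqd (\<lambda>x. conv \<eta> f x - f x) x y * frac_kernel \<alpha> x y) \<le> ennreal e"
proof -
  define \<gamma> where "\<gamma> = (- real DIM('a) - \<alpha>) / 2"
  \<comment> \<open>Half of the exponent of the kernel goes into each factor of the square, so the
    \<open>L2\<close> norm of \<open>F\<close> on the product space is the energy on
    \<open>\<Omega>\<close>. Extension by zero outside \<open>\<Omega> \<times> \<Omega>\<close>
    gives a function to which continuity of translations applies.\<close>
  define F :: "'a \<times> 'a \<Rightarrow> real" where
    "F z = (f (snd z) - f (fst z)) * norm (fst z - snd z) powr \<gamma> * indicator (\<Omega> \<times> \<Omega>) z" for z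
  have [measurable]: "F \<in> borel_measurable borel" unfolding F_def by measurable
  have K: "ennreal (a\<^sup>2) * frac_kernel \<alpha> x y = ennreal ((a * norm (x - y) powr \<gamma>)\<^sup>2)" if "x \<noteq> y" for a and x y :: 'a
  proof -
    have "(norm (x - y) powr \<gamma>)\<^sup>2 = norm (x - y) powr (\<gamma> + \<gamma>)" by (simp only: power2_eq_square powr_add)
    also have "\<gamma> + \<gamma> = - real DIM('a) - \<alpha>" by (simp add: \<gamma>_def)
    finally have "frac_kernel \<alpha> x y = ennreal ((norm (x - y) powr \<gamma>)\<^sup>2)" using that by (simp add: frac_kernel_def)
    then show ?thesis by (simp add: ennreal_mult'[symmetric] power_mult_distrib)
  qed
  have "(\<integral>\<^sup>+z. ennreal ((F z)\<^sup>2) \<partial>lborel) = (\<integral>\<^sup>+z\<in>\<Omega> \<times> \<Omega>. (case z of (x, y) \<Rightarrow> sqd f x y * frac_kernel \<alpha> x y) \<partial>lborel)"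
  proof (rule nn_integral_cong)
    fix z :: "'a \<times> 'a"
    obtain x y where z: "z = (x, y)" by (cases z)
    show "ennreal ((F z)\<^sup>2) = (case z of (x, y) \<Rightarrow> sqd f x y * frac_kernel \<alpha> x y) * indicator (\<Omega> \<times> \<Omega>) z"
    proof (cases "x = y \<or> z \<notin> \<Omega> \<times> \<Omega>")
      case True then show ?thesis by (auto simp: F_def z sqd_def)
    next
      case False then show ?thesis using K[of x y "f y - f x"] by (simp add: F_def z sqd_def)
    qed
  qed
  also have "\<dots> = dint \<Omega> (\<lambda>x y. sqd f x y * frac_kernel \<alpha> x y)"
    by (rule dint_eq_product[symmetric]) measurable
  finally have F2: "(\<integral>\<^sup>+z. ennreal ((F z)\<^sup>2) \<partial>lborel) < top" using fin by simp
  obtain d1 where d1: "d1 > 0" "\<And>h. norm h < d1 \<Longrightarrow> (\<integral>\<^sup>+x. ennreal ((f (x + h) - f x)\<^sup>2) \<partial>lborel) \<le> ennreal e"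
    using L2_translation_continuous[OF f L2 e] by blast
  obtain d2 where d2: "d2 > 0" "\<And>h. norm h < d2 \<Longrightarrow> (\<integral>\<^sup>+z. ennreal ((F (z + h) - F z)\<^sup>2) \<partial>lborel) \<le> ennreal e"
    using L2_translation_continuous[OF _ F2 e] by auto
  show ?thesis
  \<comment> \<open>The radius is fixed before \<open>\<eta>\<close> and \<open>N\<close>, so that
    one choice serves every piece of a partition. The half of \<open>d2\<close> accounts for
    \<open>norm (h, h) \<le> 2 * norm h\<close>.\<close>
  proof (rule that[of "min d1 (d2 / 2)"])
    show "min d1 (d2 / 2) > 0" using d1 d2 by simp
    fix \<eta> :: "'a \<Rightarrow> real" and N :: "'a set"
    assume \<eta>c: "continuous_on UNIV \<eta>" and \<eta>v: "vanishes_outside (min d1 (d2 / 2)) \<eta>" and nn: "\<And>h. 0 \<le> \<eta> h"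
      and one: "(\<integral>\<^sup>+h. ennreal (\<eta> h) \<partial>lborel) = 1" and N [measurable]: "N \<in> sets borel" and NO: "N \<subseteq> \<Omega>"
      and shift: "\<And>x h. x \<in> N \<Longrightarrow> \<eta> h \<noteq> 0 \<Longrightarrow> x + h \<in> \<Omega>"
    have \<eta> [measurable]: "\<eta> \<in> borel_measurable borel" using \<eta>c by (rule borel_measurable_continuous_onI)
    obtain B where B: "\<And>x. \<bar>\<eta> x\<bar> \<le> B" using vanishes_outside_bounded[OF \<eta>c \<eta>v] by blast
    have i\<eta>: "integrable lborel \<eta>" using nn one by (intro integrableI_nonneg) auto
    have o: "(LINT h|lborel. \<eta> h) = 1" using nn_integral_eq_integral[OF i\<eta>] nn one by simp
    have i1: "integrable lborel (\<lambda>h. \<eta> h * f (x + h))" for x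
      by (rule integrable_bounded_mult[OF integrable_translate[OF int] \<eta> B])
    have cv: "conv \<eta> f x - f x = (LINT h|lborel. \<eta> h * (f (x + h) - f x))" for x
      using i1 i\<eta> by (simp add: conv_translate right_diff_distrib o)
    have i2: "integrable lborel (\<lambda>h. \<eta> h * (f (x + h) - f x))" for x
      using i1 i\<eta> by (simp add: right_diff_distrib)
    have [measurable]: "conv \<eta> f \<in> borel_measurable borel" by (rule conv_measurable) measurable
    have "(\<integral>\<^sup>+x\<in>N. ennreal ((conv \<eta> f x - f x)\<^sup>2) \<partial>lborel) \<le>
        (\<integral>\<^sup>+x. \<integral>\<^sup>+h. ennreal (\<eta> h) * ennreal ((f (x + h) - f x)\<^sup>2) \<partial>lborel \<partial>lborel)"
    proof (rule nn_integral_mono)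
      fix x
      have "ennreal ((conv \<eta> f x - f x)\<^sup>2) \<le> (\<integral>\<^sup>+h. ennreal (\<eta> h) * ennreal ((f (x + h) - f x)\<^sup>2) \<partial>lborel)"
        unfolding cv by (rule jensen_square) (use nn one in auto)
      then show "ennreal ((conv \<eta> f x - f x)\<^sup>2) * indicator N x \<le> (\<integral>\<^sup>+h. ennreal (\<eta> h) * ennreal ((f (x + h) - f x)\<^sup>2) \<partial>lborel)"
        by (auto simp: indicator_def)
    qed
    also have "\<dots> = (\<integral>\<^sup>+h. \<integral>\<^sup>+x. ennreal (\<eta> h) * ennreal ((f (x + h) - f x)\<^sup>2) \<partial>lborel \<partial>lborel)"
      by (rule nn_integral_lborel_swap) measurable
    also have "\<dots> = (\<integral>\<^sup>+h. ennreal (\<eta> h) * (\<integral>\<^sup>+x. ennreal ((f (x + h) - f x)\<^sup>2) \<partial>lborel) \<partial>lborel)"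
      by (intro nn_integral_cong nn_integral_cmult) measurable
    also have "\<dots> \<le> (\<integral>\<^sup>+h. ennreal (\<eta> h) * ennreal e \<partial>lborel)"
    proof (rule nn_integral_mono)
      fix h
      show "ennreal (\<eta> h) * (\<integral>\<^sup>+x. ennreal ((f (x + h) - f x)\<^sup>2) \<partial>lborel) \<le> ennreal (\<eta> h) * ennreal e"
      proof (cases "norm h < d1")
        case True then show ?thesis by (intro mult_left_mono d1) auto
      next
        case False
        then have "\<eta> h = 0" using \<eta>v by (auto simp: vanishes_outside_def)
        then show ?thesis by simp
      qed
    qed
    also have "\<dots> = ennreal e" using one by (simp add: nn_integral_multc)
    finally have A: "(\<integral>\<^sup>+x\<in>N. ennreal ((conv \<eta> f x - f x)\<^sup>2) \<partial>lborel) \<le> ennreal e" .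
    have pt: "sqd (\<lambda>x. conv \<eta> f x - f x) x y * frac_kernel \<alpha> x y * (indicator N x * indicator N y) \<le>
        (\<integral>\<^sup>+h. ennreal (\<eta> h) * ennreal ((F ((x, y) + (h, h)) - F (x, y))\<^sup>2) \<partial>lborel)" for x y
    proof (cases "x \<noteq> y \<and> x \<in> N \<and> y \<in> N")
      case False then show ?thesis by (auto simp: sqd_def)
    next
      case True
      have "(conv \<eta> f y - f y) - (conv \<eta> f x - f x) = (LINT h|lborel. \<eta> h * ((f (y + h) - f y) - (f (x + h) - f x)))"
        unfolding cv using i2[of x] i2[of y] by (simp add: right_diff_distrib[of "\<eta> _" "f (y + _) - f y"])
      then have "sqd (\<lambda>x. conv \<eta> f x - f x) x y \<le> (\<integral>\<^sup>+h. ennreal (\<eta> h) * ennreal (((f (y + h) - f y) - (f (x + h) - f x))\<^sup>2) \<partial>lborel)"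
        unfolding sqd_def using jensen_square[OF \<eta> _ nn one, of "\<lambda>h. (f (y + h) - f y) - (f (x + h) - f x)"] by simp
      then have "sqd (\<lambda>x. conv \<eta> f x - f x) x y * frac_kernel \<alpha> x y \<le>
          (\<integral>\<^sup>+h. ennreal (\<eta> h) * ennreal (((f (y + h) - f y) - (f (x + h) - f x))\<^sup>2) \<partial>lborel) * frac_kernel \<alpha> x y"
        by (rule mult_right_mono) simp
      also have "\<dots> = (\<integral>\<^sup>+h. ennreal (\<eta> h) * ennreal (((f (y + h) - f y) - (f (x + h) - f x))\<^sup>2) * frac_kernel \<alpha> x y \<partial>lborel)"
        by (rule nn_integral_multc[symmetric]) measurable
      also have "\<dots> = (\<integral>\<^sup>+h. ennreal (\<eta> h) * ennreal ((F ((x, y) + (h, h)) - F (x, y))\<^sup>2) \<partial>lborel)"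
      proof (rule nn_integral_cong)
        fix h
        show "ennreal (\<eta> h) * ennreal (((f (y + h) - f y) - (f (x + h) - f x))\<^sup>2) * frac_kernel \<alpha> x y =
          ennreal (\<eta> h) * ennreal ((F ((x, y) + (h, h)) - F (x, y))\<^sup>2)"
        proof (cases "\<eta> h = 0")
          case False
          \<comment> \<open>The hypothesis on shifts enters here: along the support of
            \<open>\<eta>\<close> the translated pair stays in
            \<open>\<Omega> \<times> \<Omega>\<close>, so the cut-off in \<open>F\<close> is
            invisible, and \<open>norm (x - y)\<close> is unchanged by the common
            translation.\<close>
          have "x \<in> \<Omega>" "y \<in> \<Omega>" "x + h \<in> \<Omega>" "y + h \<in> \<Omega>" using True NO shift[OF _ False] by auto
          then have "F ((x, y) + (h, h)) - F (x, y) = ((f (y + h) - f y) - (f (x + h) - f x)) * norm (x - y) powr \<gamma>"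
            by (simp add: F_def algebra_simps)
          then show ?thesis using K[of x y] True by (simp add: mult.assoc)
        qed simp
      qed
      finally show ?thesis using True by simp
    qed
    have "dint N (\<lambda>x y. sqd (\<lambda>x. conv \<eta> f x - f x) x y * frac_kernel \<alpha> x y) \<le>
        (\<integral>\<^sup>+x. \<integral>\<^sup>+y. \<integral>\<^sup>+h. ennreal (\<eta> h) * ennreal ((F ((x, y) + (h, h)) - F (x, y))\<^sup>2) \<partial>lborel \<partial>lborel \<partial>lborel)"
      unfolding dint_conv by (intro nn_integral_mono pt)
    also have "\<dots> = (\<integral>\<^sup>+z. \<integral>\<^sup>+h. ennreal (\<eta> h) * ennreal ((F (z + (h, h)) - F z)\<^sup>2) \<partial>lborel \<partial>lborel)"
      by (rule nn_integral_lborel_pair[symmetric]) measurable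
    also have "\<dots> = (\<integral>\<^sup>+h. \<integral>\<^sup>+z. ennreal (\<eta> h) * ennreal ((F (z + (h, h)) - F z)\<^sup>2) \<partial>lborel \<partial>lborel)"
      by (rule nn_integral_lborel_swap) measurable
    also have "\<dots> = (\<integral>\<^sup>+h. ennreal (\<eta> h) * (\<integral>\<^sup>+z. ennreal ((F (z + (h, h)) - F z)\<^sup>2) \<partial>lborel) \<partial>lborel)"
      by (intro nn_integral_cong nn_integral_cmult) measurable
    also have "\<dots> \<le> (\<integral>\<^sup>+h. ennreal (\<eta> h) * ennreal e \<partial>lborel)"
    proof (rule nn_integral_mono)
      fix h
      show "ennreal (\<eta> h) * (\<integral>\<^sup>+z. ennreal ((F (z + (h, h)) - F z)\<^sup>2) \<partial>lborel) \<le> ennreal (\<eta> h) * ennreal e"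
      proof (cases "norm h < d2 / 2")
        case True
        have "norm (h, h) \<le> norm h + norm h" by (rule norm_Pair_le)
        then have "norm (h, h) < d2" using True by simp
        then show ?thesis by (intro mult_left_mono d2) auto
      next
        case False
        then have "\<eta> h = 0" using \<eta>v by (auto simp: vanishes_outside_def)
        then show ?thesis by simp
      qed
    qed
    also have "\<dots> = ennreal e" using one by (simp add: nn_integral_multc)
    finally show "(\<integral>\<^sup>+x\<in>N. ennreal ((conv \<eta> f x - f x)\<^sup>2) \<partial>lborel) \<le> ennreal e \<and>
      dint N (\<lambda>x y. sqd (\<lambda>x. conv \<eta> f x - f x) x y * frac_kernel \<alpha> x y) \<le> ennreal e"
      using A by blast
  qed
qed

section \<open>Cutoff functions\<close>

lemma nn_integral_powr_head:
  fixes c a :: real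
  assumes "0 \<le> c" "a > -1"
  shows "(\<integral>\<^sup>+t\<in>{0..c}. ennreal (t powr a) \<partial>lborel) = ennreal (c powr (a + 1) / (a + 1))"
proof -
  have "((\<lambda>t. t powr a * indicator {0..c} t) has_integral (c powr (a + 1) / (a + 1))) UNIV"
    using has_integral_powr_from_0[OF assms(2,1)]
    by (subst (asm) has_integral_restrict_UNIV[symmetric])
       (erule has_integral_eq[rotated], simp add: indicator_def)
  then have "(\<integral>\<^sup>+t. ennreal (t powr a * indicator {0..c} t) \<partial>lborel) = ennreal (c powr (a + 1) / (a + 1))"
    by (intro nn_integral_has_integral_lborel) auto
  moreover have "ennreal (t powr a * indicator {0..c} t) = ennreal (t powr a) * indicator {0..c} t" for t
    by (simp add: indicator_def)
  ultimately show ?thesis by simp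
qed

lemma measurable_mem_atLeast [measurable (raw)]:
  fixes f g :: "'b \<Rightarrow> real"
  assumes [measurable]: "f \<in> borel_measurable M" "g \<in> borel_measurable M"
  shows "Measurable.pred M (\<lambda>x. g x \<in> {f x..})"
  unfolding atLeast_iff by measurable

text \<open>The first factor dominates the squared difference of any cutoff with values in
  \<open>[0, 1]\<close> and Lipschitz constant \<open>L\<close>, see
  \<open>lipschitz_cutoff_square_le\<close>. It tames the singularity of the kernel on the
  diagonal.\<close>

definition truncated_kernel :: "real \<Rightarrow> real \<Rightarrow> 'a::euclidean_space \<Rightarrow> 'a \<Rightarrow> ennreal" where
  "truncated_kernel \<alpha> L x y = ennreal (min 1 (L\<^sup>2 * (norm (x - y))\<^sup>2)) * frac_kernel \<alpha> x y"

lemma truncated_kernel_measurable [measurable]: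
  fixes g h :: "'b \<Rightarrow> 'a::euclidean_space"
  assumes [measurable]: "g \<in> borel_measurable M" "h \<in> borel_measurable M"
  shows "(\<lambda>x. truncated_kernel \<alpha> L (g x) (h x)) \<in> borel_measurable M"
  unfolding truncated_kernel_def by measurable

lemma truncated_kernel_sym: "truncated_kernel \<alpha> L x y = truncated_kernel \<alpha> L y x"
  by (simp add: truncated_kernel_def frac_kernel_sym[of _ x] norm_minus_commute)

text \<open>Instead of polar coordinates: the power of the distance is written as a tail integral
  over \<open>t\<close>, the truncation, being increasing, is moved under that integral, and Tonelli
  leaves volumes of balls of radius \<open>t\<close>. Splitting at \<open>1 / L\<close>, the inner
  part converges by \<open>\<alpha> < 2\<close> and the outer part by \<open>\<alpha> > 0\<close>.
  The factor \<open>L powr \<alpha>\<close> makes flat cutoffs cheap.\<close>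

lemma truncated_kernel_integral_le:
  fixes x :: "'a::euclidean_space"
  assumes \<alpha>: "0 < \<alpha>" "\<alpha> < 2" and L: "0 < L"
  shows "(\<integral>\<^sup>+y. truncated_kernel \<alpha> L x y \<partial>lborel) \<le>
    ennreal ((real DIM('a) + \<alpha>) * unit_ball_vol DIM('a) * (1 / (2 - \<alpha>) + 1 / \<alpha>) * L powr \<alpha>)"
proof -
  define d where "d = real DIM('a)"
  have d: "d > 0" by (simp add: d_def)
  define \<omega> where "\<omega> = unit_ball_vol d"
  have \<omega>: "\<omega> > 0" using d by (simp add: \<omega>_def)
  define m where "m t = min 1 (L\<^sup>2 * t\<^sup>2)" for t :: real
  have m0: "0 \<le> m t" for t by (simp add: m_def)
  have [measurable]: "m \<in> borel_measurable borel" unfolding m_def by measurable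
  define w where "w t = ennreal ((d + \<alpha>) * m t) * ennreal (t powr (- (d + \<alpha>) - 1))" for t
  have [measurable]: "w \<in> borel_measurable borel" unfolding w_def by measurable
  have "(\<integral>\<^sup>+y. truncated_kernel \<alpha> L x y \<partial>lborel) \<le>
      (\<integral>\<^sup>+y. \<integral>\<^sup>+t. w t * indicator {dist x y..} t \<partial>lborel \<partial>lborel)"
  proof (rule nn_integral_mono)
    fix y
    show "truncated_kernel \<alpha> L x y \<le> (\<integral>\<^sup>+t. w t * indicator {dist x y..} t \<partial>lborel)"
    proof (cases "x = y")
      case True then show ?thesis by (simp add: truncated_kernel_def)
    next
      case False
      define l where "l = dist x y"
      have l: "l > 0" using False by (simp add: l_def)
      have "truncated_kernel \<alpha> L x y = ennreal (m l) * ennreal (l powr (- d - \<alpha>))"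
        using False by (simp add: truncated_kernel_def frac_kernel_def l_def m_def dist_norm d_def)
      also have "\<dots> = ennreal ((d + \<alpha>) * m l) * ennreal (l powr (- (d + \<alpha>)) / (d + \<alpha>))"
      proof -
        have "m l * l powr (- d - \<alpha>) = (d + \<alpha>) * m l * (l powr (- (d + \<alpha>)) / (d + \<alpha>))"
          using d \<alpha> by simp
        moreover have "ennreal (m l) * ennreal (l powr (- d - \<alpha>)) = ennreal (m l * l powr (- d - \<alpha>))"
          by (rule ennreal_mult'[symmetric]) (rule m0)
        moreover have "ennreal ((d + \<alpha>) * m l) * ennreal (l powr (- (d + \<alpha>)) / (d + \<alpha>)) =
            ennreal ((d + \<alpha>) * m l * (l powr (- (d + \<alpha>)) / (d + \<alpha>)))"
          by (rule ennreal_mult'[symmetric]) (use m0[of l] d \<alpha> in simp)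
        ultimately show ?thesis by (simp only:)
      qed
      also have "ennreal (l powr (- (d + \<alpha>)) / (d + \<alpha>)) = (\<integral>\<^sup>+t\<in>{l..}. ennreal (t powr (- (d + \<alpha>) - 1)) \<partial>lborel)"
        by (rule nn_integral_powr_tail[symmetric]) (use l d \<alpha> in auto)
      also have "ennreal ((d + \<alpha>) * m l) * \<dots> = (\<integral>\<^sup>+t\<in>{l..}. ennreal ((d + \<alpha>) * m l) * ennreal (t powr (- (d + \<alpha>) - 1)) \<partial>lborel)"
        by (rule set_nn_integral_cmult[symmetric]) measurable
      also have "\<dots> \<le> (\<integral>\<^sup>+t\<in>{l..}. w t \<partial>lborel)"
      proof (rule set_nn_integral_mono)
        fix t assume t: "t \<in> {l..}"
        have "l\<^sup>2 \<le> t\<^sup>2" using t l by (intro power_mono) auto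
        then have "L\<^sup>2 * l\<^sup>2 \<le> L\<^sup>2 * t\<^sup>2" by (intro mult_left_mono) auto
        then have "m l \<le> m t" by (auto simp: m_def)
        then show "ennreal ((d + \<alpha>) * m l) * ennreal (t powr (- (d + \<alpha>) - 1)) \<le> w t"
          unfolding w_def using d \<alpha> by (intro mult_right_mono ennreal_leI mult_left_mono) auto
      qed simp
      finally show ?thesis by (simp add: l_def)
    qed
  qed
  also have "\<dots> = (\<integral>\<^sup>+t. \<integral>\<^sup>+y. w t * indicator {dist x y..} t \<partial>lborel \<partial>lborel)"
    by (rule nn_integral_lborel_swap) measurable
  also have "\<dots> \<le> (\<integral>\<^sup>+t. ennreal ((d + \<alpha>) * \<omega>) * (ennreal (L\<^sup>2) * (ennreal (t powr (1 - \<alpha>)) * indicator {0..1 / L} t) +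
      ennreal (t powr (- \<alpha> - 1)) * indicator {1 / L..} t) \<partial>lborel)"
  proof (rule nn_integral_mono)
    fix t
    have v: "(\<integral>\<^sup>+y. w t * indicator {dist x y..} t \<partial>lborel) = w t * emeasure lborel (cball x t)"
    proof -
      have "(\<integral>\<^sup>+y. w t * indicator {dist x y..} t \<partial>lborel) = (\<integral>\<^sup>+y. w t * indicator (cball x t) y \<partial>lborel)"
        by (intro nn_integral_cong) (auto simp: indicator_def)
      then show ?thesis by (simp add: nn_integral_cmult_indicator)
    qed
    show "(\<integral>\<^sup>+y. w t * indicator {dist x y..} t \<partial>lborel) \<le>
      ennreal ((d + \<alpha>) * \<omega>) * (ennreal (L\<^sup>2) * (ennreal (t powr (1 - \<alpha>)) * indicator {0..1 / L} t) +
      ennreal (t powr (- \<alpha> - 1)) * indicator {1 / L..} t)"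
    proof (cases "t > 0")
      case False
      then have z: "w t * emeasure lborel (cball x t) = 0"
        by (cases "t = 0") (auto simp: w_def)
      show ?thesis unfolding v z by simp
    next
      case True
      have "t powr (- (d + \<alpha>) - 1) * t ^ DIM('a) = t powr (- (d + \<alpha>) - 1 + d)"
        unfolding powr_add using True by (simp add: powr_realpow d_def)
      then have e1: "(d + \<alpha>) * m t * t powr (- (d + \<alpha>) - 1) * (\<omega> * t ^ DIM('a)) = (d + \<alpha>) * \<omega> * (m t * t powr (- \<alpha> - 1))"
        by simp
      have "w t * emeasure lborel (cball x t) = ennreal ((d + \<alpha>) * m t * t powr (- (d + \<alpha>) - 1)) * ennreal (\<omega> * t ^ DIM('a))"
        unfolding w_def using True m0[of t] d \<alpha>
        by (simp add: emeasure_cball \<omega>_def d_def ennreal_mult')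
      also have "\<dots> = ennreal ((d + \<alpha>) * m t * t powr (- (d + \<alpha>) - 1) * (\<omega> * t ^ DIM('a)))"
        by (rule ennreal_mult'[symmetric]) (use m0[of t] d \<alpha> in simp)
      also have "\<dots> = ennreal ((d + \<alpha>) * \<omega>) * ennreal (m t * t powr (- \<alpha> - 1))"
        unfolding e1 by (rule ennreal_mult') (use d \<alpha> \<omega> in simp)
      also have "\<dots> \<le> ennreal ((d + \<alpha>) * \<omega>) * (ennreal (L\<^sup>2) * (ennreal (t powr (1 - \<alpha>)) * indicator {0..1 / L} t) +
      ennreal (t powr (- \<alpha> - 1)) * indicator {1 / L..} t)"
      proof (rule mult_left_mono)
        show "ennreal (m t * t powr (- \<alpha> - 1)) \<le> ennreal (L\<^sup>2) * (ennreal (t powr (1 - \<alpha>)) * indicator {0..1 / L} t) +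
          ennreal (t powr (- \<alpha> - 1)) * indicator {1 / L..} t"
        proof (cases "t \<le> 1 / L")
          case tl: True
          have "t\<^sup>2 * t powr (- \<alpha> - 1) = t powr (2 + (- \<alpha> - 1))"
            unfolding powr_add using True by (simp add: powr_numeral)
          then have "L\<^sup>2 * t\<^sup>2 * t powr (- \<alpha> - 1) = L\<^sup>2 * t powr (1 - \<alpha>)" by simp
          moreover have "m t * t powr (- \<alpha> - 1) \<le> L\<^sup>2 * t\<^sup>2 * t powr (- \<alpha> - 1)"
            by (intro mult_right_mono) (auto simp: m_def)
          ultimately have "m t * t powr (- \<alpha> - 1) \<le> L\<^sup>2 * t powr (1 - \<alpha>)" by (simp only:)
          then have "ennreal (m t * t powr (- \<alpha> - 1)) \<le> ennreal (L\<^sup>2 * t powr (1 - \<alpha>))"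
            by (rule ennreal_leI)
          also have "\<dots> = ennreal (L\<^sup>2) * (ennreal (t powr (1 - \<alpha>)) * indicator {0..1 / L} t)"
            using tl True by (simp add: ennreal_mult')
          finally show ?thesis by (rule add_increasing2[rotated]) simp
        next
          case False
          have "ennreal (m t * t powr (- \<alpha> - 1)) \<le> ennreal (1 * t powr (- \<alpha> - 1))"
            by (intro ennreal_leI mult_right_mono) (auto simp: m_def)
          also have "\<dots> = ennreal (t powr (- \<alpha> - 1)) * indicator {1 / L..} t" using False by simp
          finally show ?thesis by (rule add_increasing[rotated]) simp
        qed
      qed simp
      finally show ?thesis unfolding v .
    qed
  qed
  also have "\<dots> = ennreal ((d + \<alpha>) * \<omega>) * (ennreal (L\<^sup>2) * (\<integral>\<^sup>+t\<in>{0..1 / L}. ennreal (t powr (1 - \<alpha>)) \<partial>lborel) +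
      (\<integral>\<^sup>+t\<in>{1 / L..}. ennreal (t powr (- \<alpha> - 1)) \<partial>lborel))"
    by (simp add: nn_integral_cmult nn_integral_add)
  also have "(\<integral>\<^sup>+t\<in>{0..1 / L}. ennreal (t powr (1 - \<alpha>)) \<partial>lborel) = ennreal ((1 / L) powr (1 - \<alpha> + 1) / (1 - \<alpha> + 1))"
    using L \<alpha> by (intro nn_integral_powr_head) auto
  also have "(\<integral>\<^sup>+t\<in>{1 / L..}. ennreal (t powr (- \<alpha> - 1)) \<partial>lborel) = ennreal ((1 / L) powr (- \<alpha>) / \<alpha>)"
    using L \<alpha> by (intro nn_integral_powr_tail) auto
  also have "ennreal (L\<^sup>2) * ennreal ((1 / L) powr (1 - \<alpha> + 1) / (1 - \<alpha> + 1)) = ennreal (L powr \<alpha> / (2 - \<alpha>))"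
  proof -
    have inv: "(1 / L) powr a = L powr (- a)" for a using L by (simp add: powr_divide powr_minus_divide)
    have "L\<^sup>2 * (1 / L) powr (1 - \<alpha> + 1) = L powr 2 * L powr (- (1 - \<alpha> + 1))"
      unfolding inv using L by (simp add: powr_numeral)
    also have "\<dots> = L powr (2 + - (1 - \<alpha> + 1))" by (simp only: powr_add)
    also have "2 + - (1 - \<alpha> + 1) = \<alpha>" by simp
    finally have "L\<^sup>2 * ((1 / L) powr (1 - \<alpha> + 1) / (1 - \<alpha> + 1)) = L powr \<alpha> / (2 - \<alpha>)" by simp
    moreover have "ennreal (L\<^sup>2) * ennreal ((1 / L) powr (1 - \<alpha> + 1) / (1 - \<alpha> + 1)) = ennreal (L\<^sup>2 * ((1 / L) powr (1 - \<alpha> + 1) / (1 - \<alpha> + 1)))"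
      by (rule ennreal_mult'[symmetric]) simp
    ultimately show ?thesis by (simp only:)
  qed
  also have "(1 / L) powr (- \<alpha>) / \<alpha> = L powr \<alpha> / \<alpha>"
    using L by (simp add: powr_divide powr_minus_divide)
  also have "ennreal ((d + \<alpha>) * \<omega>) * (ennreal (L powr \<alpha> / (2 - \<alpha>)) + ennreal (L powr \<alpha> / \<alpha>)) =
      ennreal ((d + \<alpha>) * \<omega> * (1 / (2 - \<alpha>) + 1 / \<alpha>) * L powr \<alpha>)"
  proof -
    have "ennreal (L powr \<alpha> / (2 - \<alpha>)) + ennreal (L powr \<alpha> / \<alpha>) = ennreal (L powr \<alpha> / (2 - \<alpha>) + L powr \<alpha> / \<alpha>)"
      using \<alpha> by (intro ennreal_plus[symmetric]) auto
    moreover have "ennreal ((d + \<alpha>) * \<omega>) * ennreal (L powr \<alpha> / (2 - \<alpha>) + L powr \<alpha> / \<alpha>) =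
        ennreal ((d + \<alpha>) * \<omega> * (L powr \<alpha> / (2 - \<alpha>) + L powr \<alpha> / \<alpha>))"
      using d \<alpha> \<omega> by (intro ennreal_mult'[symmetric]) simp
    moreover have "(d + \<alpha>) * \<omega> * (L powr \<alpha> / (2 - \<alpha>) + L powr \<alpha> / \<alpha>) = (d + \<alpha>) * \<omega> * (1 / (2 - \<alpha>) + 1 / \<alpha>) * L powr \<alpha>"
      by (simp add: algebra_simps)
    ultimately show ?thesis by (simp only:)
  qed
  finally show ?thesis by (simp add: d_def \<omega>_def)
qed

lemma lipschitz_cutoff_square_le:
  fixes \<zeta> :: "'a::euclidean_space \<Rightarrow> real"
  assumes "\<And>x. 0 \<le> \<zeta> x" "\<And>x. \<zeta> x \<le> 1" "\<And>x y. \<bar>\<zeta> x - \<zeta> y\<bar> \<le> L * norm (x - y)"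
  shows "(\<zeta> x - \<zeta> y)\<^sup>2 \<le> min 1 (L\<^sup>2 * (norm (x - y))\<^sup>2)"
proof -
  have "\<bar>\<zeta> x - \<zeta> y\<bar> \<le> 1" using assms(1,2)[of x] assms(1,2)[of y] by linarith
  then have "\<bar>\<zeta> x - \<zeta> y\<bar>\<^sup>2 \<le> 1\<^sup>2" by (intro power_mono) auto
  moreover have "\<bar>\<zeta> x - \<zeta> y\<bar>\<^sup>2 \<le> (L * norm (x - y))\<^sup>2" using assms(3) by (intro power_mono) auto
  ultimately show ?thesis by (simp add: power_mult_distrib)
qed

text \<open>The product rule for differences: one term carries the difference of \<open>w\<close>,
  the other that of \<open>\<zeta>\<close>, and the latter is paid for by the truncated kernel. The
  weight \<open>\<zeta> y\<close> is kept in the first term so that a cutoff vanishing on a large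
  ball leaves only a tail of the energy. Pairs with a member of \<open>S\<close> outside
  \<open>N\<close> involve only the second term, as \<open>\<zeta>\<close> vanishes there.\<close>

lemma cutoff_energy_le:
  fixes \<zeta> w :: "'a::euclidean_space \<Rightarrow> real"
  assumes \<alpha>: "0 < \<alpha>" "\<alpha> < 2" and L: "0 < L"
    and [measurable]: "\<zeta> \<in> borel_measurable borel" "w \<in> borel_measurable borel" "N \<in> sets borel"
    and \<zeta>: "\<And>x. 0 \<le> \<zeta> x" "\<And>x. \<zeta> x \<le> 1" "\<And>x y. \<bar>\<zeta> x - \<zeta> y\<bar> \<le> L * norm (x - y)"
    and out: "\<And>x. x \<in> S \<Longrightarrow> x \<notin> N \<Longrightarrow> \<zeta> x = 0"
  defines "C \<equiv> ennreal ((real DIM('a) + \<alpha>) * unit_ball_vol DIM('a) * (1 / (2 - \<alpha>) + 1 / \<alpha>) * L powr \<alpha>)"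
  shows "dint S (\<lambda>x y. sqd (\<lambda>x. \<zeta> x * (w x * indicator N x)) x y * frac_kernel \<alpha> x y) \<le>
    2 * (\<integral>\<^sup>+x. \<integral>\<^sup>+y. ennreal ((\<zeta> y)\<^sup>2) * (sqd w x y * frac_kernel \<alpha> x y * (indicator N x * indicator N y)) \<partial>lborel \<partial>lborel) +
    4 * (C * (\<integral>\<^sup>+x\<in>N. ennreal ((w x)\<^sup>2) \<partial>lborel))"
proof -
  define v where "v x = w x * indicator N x" for x
  have [measurable]: "v \<in> borel_measurable borel" unfolding v_def by measurable
  have r: "(\<zeta> y * v y - \<zeta> x * v x)\<^sup>2 \<le> 2 * ((\<zeta> y)\<^sup>2 * ((w y - w x)\<^sup>2 * (indicator N x * indicator N y))) +
      2 * ((v x)\<^sup>2 + (v y)\<^sup>2) * (\<zeta> x - \<zeta> y)\<^sup>2" if S: "x \<in> S" "y \<in> S" for x y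
  proof (cases "x \<in> N")
    case x: True
    show ?thesis
    proof (cases "y \<in> N")
      case True
      have "(\<zeta> y * w y - \<zeta> x * w x)\<^sup>2 = (\<zeta> y * (w y - w x) + w x * (\<zeta> y - \<zeta> x))\<^sup>2" by (simp add: algebra_simps)
      also have "\<dots> \<le> 2 * (\<zeta> y * (w y - w x))\<^sup>2 + 2 * (w x * (\<zeta> y - \<zeta> x))\<^sup>2" by (rule sum_square_le)
      also have "\<dots> = 2 * ((\<zeta> y)\<^sup>2 * (w y - w x)\<^sup>2) + 2 * (w x)\<^sup>2 * (\<zeta> x - \<zeta> y)\<^sup>2"
        by (simp add: power_mult_distrib power2_commute[of "\<zeta> y" "\<zeta> x"])
      also have "\<dots> \<le> 2 * ((\<zeta> y)\<^sup>2 * (w y - w x)\<^sup>2) + 2 * ((w x)\<^sup>2 + (w y)\<^sup>2) * (\<zeta> x - \<zeta> y)\<^sup>2"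
        by (intro add_left_mono mult_right_mono) auto
      finally show ?thesis using x True by (simp add: v_def)
    next
      case False
      then show ?thesis using x out[OF S(2) False] by (simp add: v_def power_mult_distrib)
    qed
  next
    case False
    then show ?thesis using out[OF S(1) False] by (simp add: v_def power_mult_distrib mult_ac)
  qed
  have pt: "sqd (\<lambda>x. \<zeta> x * v x) x y * frac_kernel \<alpha> x y \<le>
      2 * (ennreal ((\<zeta> y)\<^sup>2) * (sqd w x y * frac_kernel \<alpha> x y * (indicator N x * indicator N y))) +
      2 * (ennreal ((v x)\<^sup>2) * truncated_kernel \<alpha> L x y + ennreal ((v y)\<^sup>2) * truncated_kernel \<alpha> L y x)" if S: "x \<in> S" "y \<in> S" for x y
  proof -
    have "sqd (\<lambda>x. \<zeta> x * v x) x y \<le> ennreal (2 * ((\<zeta> y)\<^sup>2 * ((w y - w x)\<^sup>2 * (indicator N x * indicator N y))) +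
      2 * ((v x)\<^sup>2 + (v y)\<^sup>2) * (\<zeta> x - \<zeta> y)\<^sup>2)"
      unfolding sqd_def by (intro ennreal_leI r S)
    also have "\<dots> \<le> ennreal (2 * ((\<zeta> y)\<^sup>2 * ((w y - w x)\<^sup>2 * (indicator N x * indicator N y))) +
      2 * ((v x)\<^sup>2 + (v y)\<^sup>2) * min 1 (L\<^sup>2 * (norm (x - y))\<^sup>2))"
      using \<zeta> by (intro ennreal_leI add_left_mono mult_left_mono lipschitz_cutoff_square_le) auto
    also have "\<dots> = 2 * (ennreal ((\<zeta> y)\<^sup>2) * (sqd w x y * (indicator N x * indicator N y))) +
      2 * (ennreal ((v x)\<^sup>2) + ennreal ((v y)\<^sup>2)) * ennreal (min 1 (L\<^sup>2 * (norm (x - y))\<^sup>2))"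
    proof -
      define a where "a = min 1 (L\<^sup>2 * (norm (x - y))\<^sup>2)"
      have a: "a \<ge> 0" by (simp add: a_def)
      have "ennreal (2 * ((\<zeta> y)\<^sup>2 * ((w y - w x)\<^sup>2 * (indicator N x * indicator N y))) + 2 * ((v x)\<^sup>2 + (v y)\<^sup>2) * a) =
        ennreal (2 * ((\<zeta> y)\<^sup>2 * ((w y - w x)\<^sup>2 * (indicator N x * indicator N y)))) + ennreal (2 * ((v x)\<^sup>2 + (v y)\<^sup>2) * a)"
        using a by (intro ennreal_plus) auto
      also have "ennreal (2 * ((\<zeta> y)\<^sup>2 * ((w y - w x)\<^sup>2 * (indicator N x * indicator N y)))) =
        2 * (ennreal ((\<zeta> y)\<^sup>2) * (sqd w x y * (indicator N x * indicator N y)))"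
        by (simp add: ennreal_mult' sqd_def indicator_def)
      also have "ennreal (2 * ((v x)\<^sup>2 + (v y)\<^sup>2) * a) = 2 * (ennreal ((v x)\<^sup>2) + ennreal ((v y)\<^sup>2)) * ennreal a"
        by (simp add: ennreal_mult' ennreal_plus)
      finally show ?thesis by (simp only: a_def)
    qed
    finally have "sqd (\<lambda>x. \<zeta> x * v x) x y \<le> 2 * (ennreal ((\<zeta> y)\<^sup>2) * (sqd w x y * (indicator N x * indicator N y))) +
      2 * (ennreal ((v x)\<^sup>2) + ennreal ((v y)\<^sup>2)) * ennreal (min 1 (L\<^sup>2 * (norm (x - y))\<^sup>2))" .
    from mult_right_mono[OF this zero_le, of "frac_kernel \<alpha> x y"]
    show ?thesis
      unfolding truncated_kernel_sym[of \<alpha> L y x]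
      by (simp add: truncated_kernel_def distrib_left distrib_right mult_ac)
  qed
  have T: "(\<integral>\<^sup>+x. \<integral>\<^sup>+y. ennreal ((v x)\<^sup>2) * truncated_kernel \<alpha> L x y \<partial>lborel \<partial>lborel) \<le> C * (\<integral>\<^sup>+x\<in>N. ennreal ((w x)\<^sup>2) \<partial>lborel)"
  proof -
    have "(\<integral>\<^sup>+x. \<integral>\<^sup>+y. ennreal ((v x)\<^sup>2) * truncated_kernel \<alpha> L x y \<partial>lborel \<partial>lborel) =
        (\<integral>\<^sup>+x. ennreal ((v x)\<^sup>2) * (\<integral>\<^sup>+y. truncated_kernel \<alpha> L x y \<partial>lborel) \<partial>lborel)"
      by (intro nn_integral_cong nn_integral_cmult) measurable
    also have "\<dots> \<le> (\<integral>\<^sup>+x. ennreal ((v x)\<^sup>2) * C \<partial>lborel)"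
      unfolding C_def by (intro nn_integral_mono mult_left_mono truncated_kernel_integral_le \<alpha> L) auto
    also have "\<dots> = (\<integral>\<^sup>+x. ennreal ((v x)\<^sup>2) \<partial>lborel) * C" by (rule nn_integral_multc) measurable
    also have "(\<integral>\<^sup>+x. ennreal ((v x)\<^sup>2) \<partial>lborel) = (\<integral>\<^sup>+x\<in>N. ennreal ((w x)\<^sup>2) \<partial>lborel)"
      by (intro nn_integral_cong) (auto simp: v_def indicator_def)
    finally show ?thesis by (simp add: mult.commute)
  qed
  have T': "(\<integral>\<^sup>+x. \<integral>\<^sup>+y. ennreal ((v y)\<^sup>2) * truncated_kernel \<alpha> L y x \<partial>lborel \<partial>lborel) \<le> C * (\<integral>\<^sup>+x\<in>N. ennreal ((w x)\<^sup>2) \<partial>lborel)"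
    by (subst nn_integral_lborel_swap) (use T in auto)
  have "dint S (\<lambda>x y. sqd (\<lambda>x. \<zeta> x * v x) x y * frac_kernel \<alpha> x y) \<le>
      (\<integral>\<^sup>+x. \<integral>\<^sup>+y. 2 * (ennreal ((\<zeta> y)\<^sup>2) * (sqd w x y * frac_kernel \<alpha> x y * (indicator N x * indicator N y))) +
      2 * (ennreal ((v x)\<^sup>2) * truncated_kernel \<alpha> L x y + ennreal ((v y)\<^sup>2) * truncated_kernel \<alpha> L y x) \<partial>lborel \<partial>lborel)"
    unfolding dint_conv by (intro nn_integral_mono) (use pt in \<open>auto simp: indicator_def\<close>)
  also have "\<dots> = 2 * (\<integral>\<^sup>+x. \<integral>\<^sup>+y. ennreal ((\<zeta> y)\<^sup>2) * (sqd w x y * frac_kernel \<alpha> x y * (indicator N x * indicator N y)) \<partial>lborel \<partial>lborel) +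
      2 * ((\<integral>\<^sup>+x. \<integral>\<^sup>+y. ennreal ((v x)\<^sup>2) * truncated_kernel \<alpha> L x y \<partial>lborel \<partial>lborel) +
        (\<integral>\<^sup>+x. \<integral>\<^sup>+y. ennreal ((v y)\<^sup>2) * truncated_kernel \<alpha> L y x \<partial>lborel \<partial>lborel))"
    by (simp add: nn_integral_add nn_integral_cmult)
  also have "\<dots> \<le> 2 * (\<integral>\<^sup>+x. \<integral>\<^sup>+y. ennreal ((\<zeta> y)\<^sup>2) * (sqd w x y * frac_kernel \<alpha> x y * (indicator N x * indicator N y)) \<partial>lborel \<partial>lborel) +
      2 * (C * (\<integral>\<^sup>+x\<in>N. ennreal ((w x)\<^sup>2) \<partial>lborel) + C * (\<integral>\<^sup>+x\<in>N. ennreal ((w x)\<^sup>2) \<partial>lborel))"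
    by (intro add_left_mono mult_left_mono add_mono T T') simp
  also have "2 * (C * (\<integral>\<^sup>+x\<in>N. ennreal ((w x)\<^sup>2) \<partial>lborel) + C * (\<integral>\<^sup>+x\<in>N. ennreal ((w x)\<^sup>2) \<partial>lborel)) =
      4 * (C * (\<integral>\<^sup>+x\<in>N. ennreal ((w x)\<^sup>2) \<partial>lborel))"
    by (simp only: mult_2[symmetric] mult.assoc[symmetric]) simp
  finally show ?thesis by (simp add: v_def)
qed

text \<open>The squared norm of \<open>frac_space\<close> for Borel functions, as iterated integrals
  over \<open>lborel\<close>. With values in \<open>ennreal\<close> it can be estimated before
  finiteness is known.\<close>

definition sqnorm :: "real \<Rightarrow> 'a::euclidean_space set \<Rightarrow> ('a \<Rightarrow> real) \<Rightarrow> ennreal" where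
  "sqnorm \<alpha> S u = (\<integral>\<^sup>+x\<in>S. ennreal ((u x)\<^sup>2) \<partial>lborel) + dint S (\<lambda>x y. sqd u x y * frac_kernel \<alpha> x y)"

lemma sqnorm_add:
  fixes u w :: "'a::euclidean_space \<Rightarrow> real"
  assumes [measurable]: "u \<in> borel_measurable borel" "w \<in> borel_measurable borel" "S \<in> sets borel"
  shows "sqnorm \<alpha> S (\<lambda>x. u x + w x) \<le> 2 * sqnorm \<alpha> S u + 2 * sqnorm \<alpha> S w"
proof -
  have sq: "ennreal ((a + b)\<^sup>2) \<le> 2 * ennreal (a\<^sup>2) + 2 * ennreal (b\<^sup>2)" for a b :: real
    using square_diff_triangle[of a "- b" 0] by (simp add: add.commute)
  have 1: "(\<integral>\<^sup>+x\<in>S. ennreal ((u x + w x)\<^sup>2) \<partial>lborel) \<le>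
      2 * (\<integral>\<^sup>+x\<in>S. ennreal ((u x)\<^sup>2) \<partial>lborel) + 2 * (\<integral>\<^sup>+x\<in>S. ennreal ((w x)\<^sup>2) \<partial>lborel)"
  proof -
    have "(\<integral>\<^sup>+x\<in>S. ennreal ((u x + w x)\<^sup>2) \<partial>lborel) \<le> (\<integral>\<^sup>+x\<in>S. 2 * ennreal ((u x)\<^sup>2) + 2 * ennreal ((w x)\<^sup>2) \<partial>lborel)"
      by (intro set_nn_integral_mono sq) auto
    also have "\<dots> = 2 * (\<integral>\<^sup>+x\<in>S. ennreal ((u x)\<^sup>2) \<partial>lborel) + 2 * (\<integral>\<^sup>+x\<in>S. ennreal ((w x)\<^sup>2) \<partial>lborel)"
      by (rule set_nn_integral_linear) measurable
    finally show ?thesis .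
  qed
  have s: "sqd (\<lambda>x. u x + w x) x y \<le> 2 * sqd u x y + 2 * sqd w x y" for x y
    using sq[of "u y - u x" "w y - w x"] by (simp add: sqd_def algebra_simps)
  have "dint S (\<lambda>x y. sqd (\<lambda>x. u x + w x) x y * frac_kernel \<alpha> x y) \<le>
      (\<integral>\<^sup>+x. \<integral>\<^sup>+y. 2 * (sqd u x y * frac_kernel \<alpha> x y * (indicator S x * indicator S y)) +
        2 * (sqd w x y * frac_kernel \<alpha> x y * (indicator S x * indicator S y)) \<partial>lborel \<partial>lborel)"
    unfolding dint_conv
  proof (intro nn_integral_mono)
    fix x y
    from mult_right_mono[OF s zero_le, of x y "frac_kernel \<alpha> x y * (indicator S x * indicator S y)"]
    show "sqd (\<lambda>x. u x + w x) x y * frac_kernel \<alpha> x y * (indicator S x * indicator S y) \<le>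
      2 * (sqd u x y * frac_kernel \<alpha> x y * (indicator S x * indicator S y)) +
        2 * (sqd w x y * frac_kernel \<alpha> x y * (indicator S x * indicator S y))"
      by (simp add: distrib_right mult.assoc)
  qed
  also have "\<dots> = 2 * dint S (\<lambda>x y. sqd u x y * frac_kernel \<alpha> x y) + 2 * dint S (\<lambda>x y. sqd w x y * frac_kernel \<alpha> x y)"
    unfolding dint_conv by (simp add: nn_integral_add nn_integral_cmult)
  finally have 2: "dint S (\<lambda>x y. sqd (\<lambda>x. u x + w x) x y * frac_kernel \<alpha> x y) \<le>
      2 * dint S (\<lambda>x y. sqd u x y * frac_kernel \<alpha> x y) + 2 * dint S (\<lambda>x y. sqd w x y * frac_kernel \<alpha> x y)" .
  show ?thesis unfolding sqnorm_def
    using add_mono[OF 1 2] by (simp add: distrib_left add_ac)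
qed

lemma sqnorm_sum:
  fixes u :: "'i \<Rightarrow> 'a::euclidean_space \<Rightarrow> real"
  assumes "finite I" "\<And>i. i \<in> I \<Longrightarrow> u i \<in> borel_measurable borel" and S: "S \<in> sets borel"
  shows "sqnorm \<alpha> S (\<lambda>x. \<Sum>i\<in>I. u i x) \<le> 2 ^ card I * (\<Sum>i\<in>I. sqnorm \<alpha> S (u i))"
  using assms(1,2)
proof (induction I)
  case empty
  then show ?case by (simp add: sqnorm_def sqd_def dint_def)
next
  case (insert j I)
  have m: "(\<lambda>x. \<Sum>i\<in>I. u i x) \<in> borel_measurable borel" using insert.prems by (intro borel_measurable_sum) auto
  have "sqnorm \<alpha> S (\<lambda>x. \<Sum>i\<in>insert j I. u i x) = sqnorm \<alpha> S (\<lambda>x. u j x + (\<Sum>i\<in>I. u i x))"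
    using insert.hyps by simp
  also have "\<dots> \<le> 2 * sqnorm \<alpha> S (u j) + 2 * sqnorm \<alpha> S (\<lambda>x. \<Sum>i\<in>I. u i x)"
    using insert.prems by (intro sqnorm_add m S) auto
  also have "\<dots> \<le> 2 * (2 ^ card I * sqnorm \<alpha> S (u j)) + 2 * (2 ^ card I * (\<Sum>i\<in>I. sqnorm \<alpha> S (u i)))"
  proof (intro add_mono mult_left_mono)
    have "1 * sqnorm \<alpha> S (u j) \<le> 2 ^ card I * sqnorm \<alpha> S (u j)"
      by (intro mult_right_mono one_le_power) auto
    then show "sqnorm \<alpha> S (u j) \<le> 2 ^ card I * sqnorm \<alpha> S (u j)" by simp
    show "sqnorm \<alpha> S (\<lambda>x. \<Sum>i\<in>I. u i x) \<le> 2 ^ card I * (\<Sum>i\<in>I. sqnorm \<alpha> S (u i))"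
      using insert.IH insert.prems by auto
  qed auto
  also have "\<dots> = 2 ^ card (insert j I) * (\<Sum>i\<in>insert j I. sqnorm \<alpha> S (u i))"
    using insert.hyps by (simp add: distrib_left mult.assoc)
  finally show ?case .
qed

lemma nn_integral_tail_small:
  fixes \<Phi> :: "'a::euclidean_space \<Rightarrow> ennreal"
  assumes [measurable]: "\<Phi> \<in> borel_measurable borel" "\<And>n. A n \<in> sets borel"
    and fin: "(\<integral>\<^sup>+x. \<Phi> x \<partial>lborel) < top" and A: "decseq A" "(\<Inter>n. A n) = {}" and e: "0 < (e::real)"
  shows "\<forall>\<^sub>F n in sequentially. (\<integral>\<^sup>+x\<in>A n. \<Phi> x \<partial>lborel) \<le> ennreal e"
proof -
  define M where "M = density lborel \<Phi>"
  have em: "emeasure M B = (\<integral>\<^sup>+x\<in>B. \<Phi> x \<partial>lborel)" if "B \<in> sets borel" for B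
    using that by (simp add: M_def emeasure_density)
  have "(\<lambda>n. emeasure M (A n)) \<longlonglongrightarrow> emeasure M (\<Inter>n. A n)"
  proof (rule Lim_emeasure_decseq[OF _ A(1)])
    show "range A \<subseteq> sets M" by (auto simp: M_def)
    fix n
    have "emeasure M (A n) \<le> (\<integral>\<^sup>+x. \<Phi> x \<partial>lborel)"
      unfolding em[OF assms(2)] by (intro nn_integral_mono) (auto simp: indicator_def)
    then show "emeasure M (A n) \<noteq> \<infinity>" using fin by (auto simp: top_unique)
  qed
  then have "(\<lambda>n. emeasure M (A n)) \<longlonglongrightarrow> 0" using A(2) by simp
  then have "\<forall>\<^sub>F n in sequentially. emeasure M (A n) < ennreal e"
    using e by (intro order_tendstoD) auto
  then show ?thesis by eventually_elim (simp add: em less_imp_le)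
qed

text \<open>Multiplication by a Lipschitz cutoff is bounded from the fractional space on
  \<open>N\<close> to that on \<open>S\<close>. This is how estimates near one boundary point are
  transported to the whole domain.\<close>

lemma sqnorm_cutoff_finite:
  fixes \<zeta> f :: "'a::euclidean_space \<Rightarrow> real"
  assumes \<alpha>: "0 < \<alpha>" "\<alpha> < 2" and L: "0 < L"
    and [measurable]: "\<zeta> \<in> borel_measurable borel" "f \<in> borel_measurable borel" "N \<in> sets borel"
    and \<zeta>: "\<And>x. 0 \<le> \<zeta> x" "\<And>x. \<zeta> x \<le> 1" "\<And>x y. \<bar>\<zeta> x - \<zeta> y\<bar> \<le> L * norm (x - y)"
    and out: "\<And>x. x \<in> S \<Longrightarrow> x \<notin> N \<Longrightarrow> \<zeta> x = 0"
  defines "C \<equiv> ennreal ((real DIM('a) + \<alpha>) * unit_ball_vol DIM('a) * (1 / (2 - \<alpha>) + 1 / \<alpha>) * L powr \<alpha>)"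
  shows "sqnorm \<alpha> S (\<lambda>x. \<zeta> x * (f x * indicator N x)) \<le> (2 + 4 * C) * sqnorm \<alpha> N f"
proof -
  have sq1: "(\<zeta> x)\<^sup>2 \<le> 1" for x using \<zeta>(1,2)[of x] by (simp add: power_le_one)
  let ?I = "\<integral>\<^sup>+x\<in>N. ennreal ((f x)\<^sup>2) \<partial>lborel" and ?D = "dint N (\<lambda>x y. sqd f x y * frac_kernel \<alpha> x y)"
  have 1: "(\<integral>\<^sup>+x\<in>S. ennreal ((\<zeta> x * (f x * indicator N x))\<^sup>2) \<partial>lborel) \<le> ?I"
  proof (rule nn_integral_mono)
    fix x
    have "(\<zeta> x)\<^sup>2 * (f x)\<^sup>2 \<le> 1 * (f x)\<^sup>2" by (intro mult_right_mono sq1) auto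
    then show "ennreal ((\<zeta> x * (f x * indicator N x))\<^sup>2) * indicator S x \<le> ennreal ((f x)\<^sup>2) * indicator N x"
      by (auto simp: indicator_def power_mult_distrib intro: ennreal_leI)
  qed
  have "dint S (\<lambda>x y. sqd (\<lambda>x. \<zeta> x * (f x * indicator N x)) x y * frac_kernel \<alpha> x y) \<le>
    2 * (\<integral>\<^sup>+x. \<integral>\<^sup>+y. ennreal ((\<zeta> y)\<^sup>2) * (sqd f x y * frac_kernel \<alpha> x y * (indicator N x * indicator N y)) \<partial>lborel \<partial>lborel) +
    4 * (C * ?I)"
    unfolding C_def by (rule cutoff_energy_le[OF \<alpha> L _ _ _ \<zeta> out]) auto
  also have "(\<integral>\<^sup>+x. \<integral>\<^sup>+y. ennreal ((\<zeta> y)\<^sup>2) * (sqd f x y * frac_kernel \<alpha> x y * (indicator N x * indicator N y)) \<partial>lborel \<partial>lborel) \<le> ?D"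
    unfolding dint_conv
  proof (intro nn_integral_mono)
    fix x y
    have "ennreal ((\<zeta> y)\<^sup>2) \<le> 1" using ennreal_leI[OF sq1[of y]] by simp
    from mult_right_mono[OF this zero_le]
    show "ennreal ((\<zeta> y)\<^sup>2) * (sqd f x y * frac_kernel \<alpha> x y * (indicator N x * indicator N y)) \<le>
      sqd f x y * frac_kernel \<alpha> x y * (indicator N x * indicator N y)" by simp
  qed
  finally have 2: "dint S (\<lambda>x y. sqd (\<lambda>x. \<zeta> x * (f x * indicator N x)) x y * frac_kernel \<alpha> x y) \<le> 2 * ?D + 4 * (C * ?I)"
    by (simp add: add_right_mono mult_left_mono)
  have "sqnorm \<alpha> S (\<lambda>x. \<zeta> x * (f x * indicator N x)) \<le> ?I + (2 * ?D + 4 * (C * ?I))"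
    unfolding sqnorm_def by (rule add_mono[OF 1 2])
  also have "\<dots> \<le> (2 + 4 * C) * (?I + ?D)"
  proof -
    have "(2 + 4 * C) * (i + j) = (i + (2 * j + 4 * (C * i))) + (i + 4 * (C * j))" for i j
      by (simp add: distrib_left distrib_right mult.assoc mult_2 add_ac)
    then show ?thesis by (simp add: add_increasing2)
  qed
  finally show ?thesis by (simp add: sqnorm_def)
qed

section \<open>Truncation at infinity, and density on the whole space\<close>

definition radial_cutoff :: "real \<Rightarrow> 'a::euclidean_space \<Rightarrow> real" where
  "radial_cutoff R x = max 0 (min 1 (2 - norm x / R))"

lemma radial_cutoff:
  assumes R: "R > 0"
  shows "0 \<le> radial_cutoff R x" "radial_cutoff R x \<le> 1"
    "\<bar>radial_cutoff R x - radial_cutoff R y\<bar> \<le> 1 / R * norm (x - y)"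
    "norm x < R \<Longrightarrow> radial_cutoff R x = 1" "2 * R \<le> norm x \<Longrightarrow> radial_cutoff R x = 0"
proof -
  show "0 \<le> radial_cutoff R x" "radial_cutoff R x \<le> 1" by (auto simp: radial_cutoff_def)
  have "\<bar>radial_cutoff R x - radial_cutoff R y\<bar> \<le> \<bar>norm x / R - norm y / R\<bar>" by (auto simp: radial_cutoff_def)
  also have "\<dots> = 1 / R * \<bar>norm x - norm y\<bar>" using R by (simp add: diff_divide_distrib[symmetric])
  also have "\<dots> \<le> 1 / R * norm (x - y)" using R norm_triangle_ineq3[of x y] by (intro mult_left_mono) auto
  finally show "\<bar>radial_cutoff R x - radial_cutoff R y\<bar> \<le> 1 / R * norm (x - y)" .
  show "norm x < R \<Longrightarrow> radial_cutoff R x = 1" using R by (simp add: radial_cutoff_def field_simps)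
  show "2 * R \<le> norm x \<Longrightarrow> radial_cutoff R x = 0" using R by (simp add: radial_cutoff_def field_simps)
qed

lemma radial_cutoff_measurable [measurable]: "radial_cutoff R \<in> borel_measurable borel"
  unfolding radial_cutoff_def by measurable

text \<open>Three errors of size \<open>e / 3\<close>: a tail of the \<open>L2\<close> integral,
  twice a tail of the energy (the weight \<open>\<zeta> y\<close> vanishes for
  \<open>norm y < n\<close>), and four times the cutoff term, which tends to \<open>0\<close>
  because the Lipschitz constant \<open>1 / n\<close> enters with the power
  \<open>\<alpha>\<close>.\<close>

lemma radial_cutoff_converges:
  fixes f :: "'a::euclidean_space \<Rightarrow> real"
  assumes \<alpha>: "0 < \<alpha>" "\<alpha> < 2" and f [measurable]: "f \<in> borel_measurable borel" and fin: "sqnorm \<alpha> UNIV f < top" and e: "0 < (e::real)"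
  obtains n :: nat where "0 < n" "sqnorm \<alpha> UNIV (\<lambda>x. (1 - radial_cutoff (real n) x) * f x) \<le> ennreal e"
proof -
  define c0 where "c0 = (real DIM('a) + \<alpha>) * unit_ball_vol DIM('a) * (1 / (2 - \<alpha>) + 1 / \<alpha>)"
  have c0: "c0 > 0" using \<alpha> by (simp add: c0_def add_pos_pos)
  let ?I = "\<integral>\<^sup>+x. ennreal ((f x)\<^sup>2) \<partial>lborel"
  define \<Phi> where "\<Phi> = (\<lambda>z :: 'a \<times> 'a. sqd f (fst z) (snd z) * frac_kernel \<alpha> (fst z) (snd z))"
  have [measurable]: "\<Phi> \<in> borel_measurable borel" unfolding \<Phi>_def by measurable
  have I: "?I < top" and D: "dint UNIV (\<lambda>x y. sqd f x y * frac_kernel \<alpha> x y) < top"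
    using fin by (auto simp: sqnorm_def)
  have "dint UNIV (\<lambda>x y. sqd f x y * frac_kernel \<alpha> x y) = (\<integral>\<^sup>+z. \<Phi> z \<partial>lborel)"
    by (subst dint_eq_product) (auto simp: \<Phi>_def case_prod_unfold)
  then have P: "(\<integral>\<^sup>+z. \<Phi> z \<partial>lborel) < top" using D by simp
  obtain i where i: "?I = ennreal i" "0 \<le> i" using I by (cases ?I) auto
  have "((\<lambda>n. c0 * i * (1 / real n) powr \<alpha>) \<longlonglongrightarrow> c0 * i * 0)"
  proof (intro tendsto_mult tendsto_const)
    have "((\<lambda>n. real n powr (- \<alpha>)) \<longlonglongrightarrow> 0)"
      using \<alpha> by (intro tendsto_neg_powr filterlim_real_sequentially) auto
    moreover have "\<forall>\<^sub>F n in sequentially. real n powr (- \<alpha>) = (1 / real n) powr \<alpha>"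
      using eventually_gt_at_top[of 0] by eventually_elim (simp add: powr_divide powr_minus_divide)
    ultimately show "((\<lambda>n. (1 / real n) powr \<alpha>) \<longlonglongrightarrow> 0)" by (rule Lim_transform_eventually)
  qed
  then have E1: "\<forall>\<^sub>F n in sequentially. c0 * i * (1 / real n) powr \<alpha> < e / 12"
    using e by (intro order_tendstoD) auto
  have E2: "\<forall>\<^sub>F n in sequentially. (\<integral>\<^sup>+x\<in>{x. real n \<le> norm x}. ennreal ((f x)\<^sup>2) \<partial>lborel) \<le> ennreal (e / 3)"
  proof (rule nn_integral_tail_small)
    show "(\<Inter>n. {x::'a. real n \<le> norm x}) = {}"
    proof (rule equals0I)
      fix x assume "x \<in> (\<Inter>n. {x::'a. real n \<le> norm x})"
      then have "real n \<le> norm x" for n by simp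
      moreover obtain n where "norm x < real n" using reals_Archimedean2 by blast
      ultimately show False by (meson not_le)
    qed
    show "decseq (\<lambda>n. {x::'a. real n \<le> norm x})" by (auto simp: decseq_def)
  qed (use I e in auto)
  have E3: "\<forall>\<^sub>F n in sequentially. (\<integral>\<^sup>+z\<in>{z. real n \<le> norm (snd z)}. \<Phi> z \<partial>lborel) \<le> ennreal (e / 6)"
  proof (rule nn_integral_tail_small)
    show "(\<Inter>n. {z::'a \<times> 'a. real n \<le> norm (snd z)}) = {}"
    proof (rule equals0I)
      fix z assume "z \<in> (\<Inter>n. {z::'a \<times> 'a. real n \<le> norm (snd z)})"
      then have "real n \<le> norm (snd z)" for n by simp
      moreover obtain n where "norm (snd z) < real n" using reals_Archimedean2 by blast
      ultimately show False by (meson not_le)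
    qed
    show "decseq (\<lambda>n. {z::'a \<times> 'a. real n \<le> norm (snd z)})" by (auto simp: decseq_def)
  qed (use P e in auto)
  obtain n :: nat where n: "0 < n" "c0 * i * (1 / real n) powr \<alpha> < e / 12"
    "(\<integral>\<^sup>+x\<in>{x. real n \<le> norm x}. ennreal ((f x)\<^sup>2) \<partial>lborel) \<le> ennreal (e / 3)"
    "(\<integral>\<^sup>+z\<in>{z. real n \<le> norm (snd z)}. \<Phi> z \<partial>lborel) \<le> ennreal (e / 6)"
    using eventually_happens'[OF _ eventually_conj[OF eventually_gt_at_top[of 0] eventually_conj[OF E1 eventually_conj[OF E2 E3]]]] by auto
  define \<zeta> :: "'a \<Rightarrow> real" where "\<zeta> x = 1 - radial_cutoff (real n) x" for x
  have [measurable]: "\<zeta> \<in> borel_measurable borel" unfolding \<zeta>_def by measurable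
  have n0: "real n > 0" using n by simp
  have \<zeta>: "0 \<le> \<zeta> x" "\<zeta> x \<le> 1" "\<bar>\<zeta> x - \<zeta> y\<bar> \<le> 1 / real n * norm (x - y)" "norm x < real n \<Longrightarrow> \<zeta> x = 0" for x y
    using radial_cutoff[OF n0] by (auto simp: \<zeta>_def abs_minus_commute)
  have sq1: "(\<zeta> x)\<^sup>2 \<le> 1" for x using \<zeta>(1,2)[of x] by (simp add: power_le_one)
  have 1: "(\<integral>\<^sup>+x\<in>UNIV. ennreal ((\<zeta> x * f x)\<^sup>2) \<partial>lborel) \<le> ennreal (e / 3)"
  proof (rule order_trans[OF nn_integral_mono n(3)])
    fix x
    show "ennreal ((\<zeta> x * f x)\<^sup>2) * indicator UNIV x \<le> ennreal ((f x)\<^sup>2) * indicator {x. real n \<le> norm x} x"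
    proof (cases "norm x < real n")
      case True then show ?thesis using \<zeta>(4) by simp
    next
      case False
      have "(\<zeta> x)\<^sup>2 * (f x)\<^sup>2 \<le> 1 * (f x)\<^sup>2" by (intro mult_right_mono sq1) auto
      then show ?thesis using False by (simp add: power_mult_distrib ennreal_leI)
    qed
  qed
  have "dint UNIV (\<lambda>x y. sqd (\<lambda>x. \<zeta> x * (f x * indicator UNIV x)) x y * frac_kernel \<alpha> x y) \<le>
    2 * (\<integral>\<^sup>+x. \<integral>\<^sup>+y. ennreal ((\<zeta> y)\<^sup>2) * (sqd f x y * frac_kernel \<alpha> x y * (indicator UNIV x * indicator UNIV y)) \<partial>lborel \<partial>lborel) +
    4 * (ennreal (c0 * (1 / real n) powr \<alpha>) * (\<integral>\<^sup>+x\<in>UNIV. ennreal ((f x)\<^sup>2) \<partial>lborel))"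
    unfolding c0_def by (rule cutoff_energy_le[OF \<alpha>]) (use \<zeta> n0 in auto)
  also have "(\<integral>\<^sup>+x. \<integral>\<^sup>+y. ennreal ((\<zeta> y)\<^sup>2) * (sqd f x y * frac_kernel \<alpha> x y * (indicator UNIV x * indicator UNIV y)) \<partial>lborel \<partial>lborel) =
     (\<integral>\<^sup>+z. ennreal ((\<zeta> (snd z))\<^sup>2) * \<Phi> z \<partial>lborel)"
    by (subst nn_integral_lborel_pair) (auto simp: \<Phi>_def)
  also have "\<dots> \<le> ennreal (e / 6)"
  proof (rule order_trans[OF nn_integral_mono n(4)])
    fix z :: "'a \<times> 'a"
    show "ennreal ((\<zeta> (snd z))\<^sup>2) * \<Phi> z \<le> \<Phi> z * indicator {z. real n \<le> norm (snd z)} z"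
    proof (cases "norm (snd z) < real n")
      case True then show ?thesis using \<zeta>(4) by simp
    next
      case False
      have "ennreal ((\<zeta> (snd z))\<^sup>2) \<le> 1" using ennreal_leI[OF sq1[of "snd z"]] by simp
      from mult_right_mono[OF this zero_le, of "\<Phi> z"] False show ?thesis by simp
    qed
  qed
  also have "(\<integral>\<^sup>+x\<in>UNIV. ennreal ((f x)\<^sup>2) \<partial>lborel) = ennreal i" using i by simp
  also have "ennreal (c0 * (1 / real n) powr \<alpha>) * ennreal i = ennreal (c0 * i * (1 / real n) powr \<alpha>)"
    using c0 i by (subst ennreal_mult'[symmetric]) (auto simp: mult_ac)
  also have "\<dots> \<le> ennreal (e / 12)" using n by (intro ennreal_leI) simp
  finally have "dint UNIV (\<lambda>x y. sqd (\<lambda>x. \<zeta> x * f x) x y * frac_kernel \<alpha> x y) \<le> 2 * ennreal (e / 6) + 4 * ennreal (e / 12)"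
    by (simp add: add_mono mult_left_mono)
  also have "2 * ennreal (e / 6) = ennreal (2 * (e / 6))" by (subst ennreal_mult') auto
  also have "4 * ennreal (e / 12) = ennreal (4 * (e / 12))" by (subst ennreal_mult') auto
  finally have 2: "dint UNIV (\<lambda>x y. sqd (\<lambda>x. \<zeta> x * f x) x y * frac_kernel \<alpha> x y) \<le> ennreal (2 * (e / 6)) + ennreal (4 * (e / 12))" .
  have "sqnorm \<alpha> UNIV (\<lambda>x. \<zeta> x * f x) \<le> ennreal (e / 3) + (ennreal (2 * (e / 6)) + ennreal (4 * (e / 12)))"
    unfolding sqnorm_def by (rule add_mono[OF 1 2])
  also have "\<dots> = ennreal e" using e by (simp add: ennreal_plus[symmetric] del: ennreal_plus)
  finally show ?thesis using that[OF n(1)] by (simp add: \<zeta>_def)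
qed

lemma integrable_bounded_support_L2:
  fixes f :: "'a::euclidean_space \<Rightarrow> real"
  assumes [measurable]: "f \<in> borel_measurable borel" "S \<in> sets borel" and L2: "(\<integral>\<^sup>+x. ennreal ((f x)\<^sup>2) \<partial>lborel) < top"
    and S: "emeasure lborel S < top" "\<And>x. x \<notin> S \<Longrightarrow> f x = 0"
  shows "integrable lborel f"
  unfolding integrable_iff_bounded
proof
  have "(\<integral>\<^sup>+x. ennreal (norm (f x)) \<partial>lborel) \<le> (\<integral>\<^sup>+x. indicator S x + ennreal ((f x)\<^sup>2) \<partial>lborel)"
  proof (rule nn_integral_mono)
    fix x
    show "ennreal (norm (f x)) \<le> indicator S x + ennreal ((f x)\<^sup>2)"
    proof (cases "x \<in> S")
      case True
      have "0 \<le> (\<bar>f x\<bar> - 1)\<^sup>2" by simp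
      then have "2 * \<bar>f x\<bar> \<le> 1 + (f x)\<^sup>2" by (simp add: power2_diff)
      then have "norm (f x) \<le> 1 + (f x)\<^sup>2" using abs_ge_zero[of "f x"] by simp
      then have "ennreal (norm (f x)) \<le> ennreal (1 + (f x)\<^sup>2)" by (rule ennreal_leI)
      also have "\<dots> = indicator S x + ennreal ((f x)\<^sup>2)" using True by (simp add: ennreal_plus)
      finally show ?thesis .
    next
      case False then show ?thesis using S by simp
    qed
  qed
  also have "\<dots> = emeasure lborel S + (\<integral>\<^sup>+x. ennreal ((f x)\<^sup>2) \<partial>lborel)" by (simp add: nn_integral_add)
  also have "\<dots> < top" using L2 S by simp
  finally show "(\<integral>\<^sup>+x. ennreal (norm (f x)) \<partial>lborel) < \<infinity>" by simp
qed simp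

lemma conv_vanishes_outside:
  fixes \<eta> u :: "'a::euclidean_space \<Rightarrow> real"
  assumes "vanishes_outside r \<eta>" "vanishes_outside M u"
  shows "vanishes_outside (M + r) (conv \<eta> u)"
  unfolding vanishes_outside_def
proof (intro allI impI)
  fix x :: 'a assume x: "M + r \<le> norm x"
  have z: "\<eta> (y - x) * u y = 0" for y
  proof (cases "norm y \<ge> M")
    case True then show ?thesis using assms(2) by (simp add: vanishes_outside_def)
  next
    case False
    then have "norm (y - x) \<ge> r" using x norm_triangle_ineq2[of x y] by (simp add: norm_minus_commute)
    then show ?thesis using assms(1) by (simp add: vanishes_outside_def)
  qed
  show "conv \<eta> u x = 0" unfolding conv_def z by simp
qed

lemma smooth_compact_dense_UNIV:
  fixes f :: "'a::euclidean_space \<Rightarrow> real"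
  assumes \<alpha>: "0 < \<alpha>" "\<alpha> < 2" and f [measurable]: "f \<in> borel_measurable borel" and fin: "sqnorm \<alpha> UNIV f < top" and e: "0 < (e::real)"
  shows "\<exists>g r. smooth g \<and> vanishes_outside r g \<and> sqnorm \<alpha> UNIV (\<lambda>x. f x - g x) \<le> ennreal e"
proof -
  \<comment> \<open>\<open>sqnorm_add\<close> doubles both errors, so truncation and mollification
    may cost \<open>e / 4\<close> each; the latter is split into \<open>e / 8\<close> for the
    \<open>L2\<close> part and \<open>e / 8\<close> for the energy.\<close>
  have e4: "e / 4 > 0" "e / 8 > 0" using e by auto
  obtain n where n: "0 < n" "sqnorm \<alpha> UNIV (\<lambda>x. (1 - radial_cutoff (real n) x) * f x) \<le> ennreal (e / 4)"
    using radial_cutoff_converges[OF \<alpha> f fin e4(1)] by blast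
  have n0: "real n > 0" using n by simp
  define u where "u x = radial_cutoff (real n) x * f x" for x
  have u [measurable]: "u \<in> borel_measurable borel" unfolding u_def by measurable
  have "sqnorm \<alpha> UNIV (\<lambda>x. radial_cutoff (real n) x * (f x * indicator UNIV x)) \<le>
      (2 + 4 * ennreal ((real DIM('a) + \<alpha>) * unit_ball_vol DIM('a) * (1 / (2 - \<alpha>) + 1 / \<alpha>) * (1 / real n) powr \<alpha>)) * sqnorm \<alpha> UNIV f"
    by (rule sqnorm_cutoff_finite[OF \<alpha>]) (use n0 radial_cutoff[OF n0] in auto)
  also have "\<dots> < top" using fin by (simp add: ennreal_mult_less_top)
  finally have uf: "sqnorm \<alpha> UNIV u < top" by (simp add: u_def[abs_def])
  then have uL2: "(\<integral>\<^sup>+x. ennreal ((u x)\<^sup>2) \<partial>lborel) < top"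
    and uE: "dint UNIV (\<lambda>x y. sqd u x y * frac_kernel \<alpha> x y) < top" by (auto simp: sqnorm_def)
  have uv: "vanishes_outside (2 * real n) u"
    by (simp add: vanishes_outside_def u_def radial_cutoff(5)[OF n0])
  have ui: "integrable lborel u"
  proof (rule integrable_bounded_support_L2[OF u _ uL2])
    show "emeasure lborel (ball (0::'a) (2 * real n)) < top" by (intro emeasure_lborel_bounded_less_top) simp
    show "u x = 0" if "x \<notin> ball 0 (2 * real n)" for x using that uv by (simp add: vanishes_outside_def)
  qed simp
  obtain \<delta> where \<delta>: "\<delta> > 0"
    "\<And>\<eta> N. continuous_on UNIV \<eta> \<Longrightarrow> vanishes_outside \<delta> \<eta> \<Longrightarrow> (\<And>h. 0 \<le> \<eta> h) \<Longrightarrow>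
      (\<integral>\<^sup>+h. ennreal (\<eta> h) \<partial>lborel) = 1 \<Longrightarrow> N \<in> sets borel \<Longrightarrow> N \<subseteq> UNIV \<Longrightarrow>
      (\<And>x h. x \<in> N \<Longrightarrow> \<eta> h \<noteq> 0 \<Longrightarrow> x + h \<in> UNIV) \<Longrightarrow>
      (\<integral>\<^sup>+x\<in>N. ennreal ((conv \<eta> u x - u x)\<^sup>2) \<partial>lborel) \<le> ennreal (e / 8) \<and>
      dint N (\<lambda>x y. sqd (\<lambda>x. conv \<eta> u x - u x) x y * frac_kernel \<alpha> x y) \<le> ennreal (e / 8)"
    using mollify_small[OF u _ ui uL2 uE e4(2)] by auto
  obtain \<eta> :: "'a \<Rightarrow> real" where \<eta>: "smooth \<eta>" "\<And>x. 0 \<le> \<eta> x" "\<And>x. x \<notin> ball 0 \<delta> \<Longrightarrow> \<eta> x = 0"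
    "(\<integral>\<^sup>+x. ennreal (\<eta> x) \<partial>lborel) = 1"
    using mollifier_exists[OF \<delta>(1), of 0] by blast
  have \<eta>v: "vanishes_outside \<delta> \<eta>" using \<eta>(3) by (simp add: vanishes_outside_def)
  have [measurable]: "\<eta> \<in> borel_measurable borel" by (rule borel_measurable_continuous_onI[OF smooth_continuous[OF \<eta>(1)]])
  have [measurable]: "conv \<eta> u \<in> borel_measurable borel" by (rule conv_measurable) measurable
  have m: "(\<integral>\<^sup>+x\<in>UNIV. ennreal ((conv \<eta> u x - u x)\<^sup>2) \<partial>lborel) \<le> ennreal (e / 8) \<and>
      dint UNIV (\<lambda>x y. sqd (\<lambda>x. conv \<eta> u x - u x) x y * frac_kernel \<alpha> x y) \<le> ennreal (e / 8)"
    by (rule \<delta>(2)[OF smooth_continuous[OF \<eta>(1)] \<eta>v \<eta>(2) \<eta>(4)]) auto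
  have "sqnorm \<alpha> UNIV (\<lambda>x. u x - conv \<eta> u x) = sqnorm \<alpha> UNIV (\<lambda>x. conv \<eta> u x - u x)"
    unfolding sqnorm_def sqd_def by (simp add: power2_commute) (simp add: algebra_simps power2_commute)
  also have "\<dots> \<le> ennreal (e / 8) + ennreal (e / 8)" unfolding sqnorm_def using m by (intro add_mono) auto
  also have "\<dots> = ennreal (e / 4)" using e by (simp add: ennreal_plus[symmetric] del: ennreal_plus)
  finally have 2: "sqnorm \<alpha> UNIV (\<lambda>x. u x - conv \<eta> u x) \<le> ennreal (e / 4)" .
  show ?thesis
  proof (intro exI[of _ "conv \<eta> u"] exI[of _ "2 * real n + \<delta>"] conjI)
    show "smooth (conv \<eta> u)" by (rule smooth_conv[OF \<eta>(1) \<eta>v ui])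
    show "vanishes_outside (2 * real n + \<delta>) (conv \<eta> u)" by (rule conv_vanishes_outside[OF \<eta>v uv])
    have "(\<lambda>x. f x - conv \<eta> u x) = (\<lambda>x. (1 - radial_cutoff (real n) x) * f x + (u x - conv \<eta> u x))"
      by (auto simp: u_def algebra_simps)
    then have "sqnorm \<alpha> UNIV (\<lambda>x. f x - conv \<eta> u x) \<le>
       2 * sqnorm \<alpha> UNIV (\<lambda>x. (1 - radial_cutoff (real n) x) * f x) + 2 * sqnorm \<alpha> UNIV (\<lambda>x. u x - conv \<eta> u x)"
      by (simp only:) (rule sqnorm_add; measurable)
    also have "\<dots> \<le> 2 * ennreal (e / 4) + 2 * ennreal (e / 4)" by (intro add_mono mult_left_mono n 2) auto
    also have "2 * ennreal (e / 4) = ennreal (e / 2)" using e by (subst ennreal_numeral[symmetric], subst ennreal_mult'[symmetric]) auto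
    also have "ennreal (e / 2) + ennreal (e / 2) = ennreal e" using e by (simp add: ennreal_plus[symmetric] del: ennreal_plus)
    finally show "sqnorm \<alpha> UNIV (\<lambda>x. f x - conv \<eta> u x) \<le> ennreal e" .
  qed
qed

section \<open>Density\<close>

text \<open>In the interior a mollifier centred at \<open>0\<close> will do. At a boundary point it
  is centred at \<open>t *\<^sub>R e\<close> with radius \<open>c * t\<close>, so every shift goes
  into the interior cone, however small \<open>\<delta>\<close> is.\<close>

lemma local_mollifier:
  fixes \<Omega> :: "'a::euclidean_space set"
  assumes lip: "lipschitz_domain \<Omega>" and p: "p \<in> closure \<Omega>"
  shows "\<exists>s>0. \<forall>\<delta>>0. \<exists>\<eta>. smooth \<eta> \<and> (\<forall>h. 0 \<le> \<eta> h) \<and> (\<integral>\<^sup>+h. ennreal (\<eta> h) \<partial>lborel) = 1 \<and>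
    vanishes_outside \<delta> \<eta> \<and> (\<forall>x\<in>\<Omega> \<inter> ball p s. \<forall>h. \<eta> h \<noteq> 0 \<longrightarrow> x + h \<in> \<Omega>)"
proof (cases "p \<in> \<Omega>")
  case True
  have "open \<Omega>" using lip by (simp add: lipschitz_domain_def)
  then obtain r where r: "r > 0" "ball p r \<subseteq> \<Omega>" using True open_contains_ball by blast
  show ?thesis
  proof (intro exI[of _ "r / 2"] conjI allI impI)
    fix \<delta> :: real assume \<delta>: "\<delta> > 0"
    obtain \<eta> :: "'a \<Rightarrow> real" where \<eta>: "smooth \<eta>" "\<And>x. 0 \<le> \<eta> x" "\<And>x. x \<notin> ball 0 (min \<delta> (r / 2)) \<Longrightarrow> \<eta> x = 0"
      "(\<integral>\<^sup>+x. ennreal (\<eta> x) \<partial>lborel) = 1"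
      using mollifier_exists[of "min \<delta> (r / 2)" 0] \<delta> r by auto
    have "x + h \<in> \<Omega>" if x: "x \<in> \<Omega> \<inter> ball p (r / 2)" and h: "\<eta> h \<noteq> 0" for x h
    proof -
      have "norm h < r / 2" using \<eta>(3)[of h] h by auto
      moreover have "dist x (x + h) = norm h" by (simp add: dist_norm)
      ultimately have "x + h \<in> ball p r" using x dist_triangle[of p "x + h" x] by simp
      then show ?thesis using r by blast
    qed
    moreover have "vanishes_outside \<delta> \<eta>" using \<eta>(3) by (simp add: vanishes_outside_def)
    ultimately show "\<exists>\<eta>. smooth \<eta> \<and> (\<forall>h. 0 \<le> \<eta> h) \<and> (\<integral>\<^sup>+h. ennreal (\<eta> h) \<partial>lborel) = 1 \<and>
      vanishes_outside \<delta> \<eta> \<and> (\<forall>x\<in>\<Omega> \<inter> ball p (r / 2). \<forall>h. \<eta> h \<noteq> 0 \<longrightarrow> x + h \<in> \<Omega>)"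
      using \<eta> by blast
  qed (use r in simp)
next
  case False
  have "open \<Omega>" using lip by (simp add: lipschitz_domain_def)
  then have "p \<in> frontier \<Omega>" using p False by (simp add: frontier_def interior_open)
  from lipschitz_domain_cone[OF lip this] obtain e r c where e: "norm e = 1" and r: "0 < r" and c: "0 < c" "c < 1"
    and cone: "\<And>x t. x \<in> \<Omega> \<inter> ball p (r / 2) \<Longrightarrow> t \<in> {0<..r / 4} \<Longrightarrow> ball (x + t *\<^sub>R e) (c * t) \<subseteq> \<Omega> \<inter> ball p r"
    by blast
  show ?thesis
  proof (intro exI[of _ "r / 2"] conjI allI impI)
    fix \<delta> :: real assume \<delta>: "\<delta> > 0"
    \<comment> \<open>The bound \<open>r / 4\<close> is the length of the interior cone. The bound
      \<open>\<delta> / 4\<close> confines the support: its points have norm below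
      \<open>t + c * t\<close>, which is less than \<open>\<delta>\<close>.\<close>
    define t where "t = min (r / 4) (\<delta> / 4)"
    have t: "0 < t" "t \<le> r / 4" "4 * t \<le> \<delta>" using r \<delta> by (auto simp: t_def)
    obtain \<eta> :: "'a \<Rightarrow> real" where \<eta>: "smooth \<eta>" "\<And>x. 0 \<le> \<eta> x" "\<And>x. x \<notin> ball (t *\<^sub>R e) (c * t) \<Longrightarrow> \<eta> x = 0"
      "(\<integral>\<^sup>+x. ennreal (\<eta> x) \<partial>lborel) = 1"
      using mollifier_exists[of "c * t" "t *\<^sub>R e"] c t by auto
    have "x + h \<in> \<Omega>" if x: "x \<in> \<Omega> \<inter> ball p (r / 2)" and h: "\<eta> h \<noteq> 0" for x h
    proof -
      have "h \<in> ball (t *\<^sub>R e) (c * t)" using \<eta>(3)[of h] h by blast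
      then have "x + h \<in> ball (x + t *\<^sub>R e) (c * t)" by (simp add: dist_norm)
      then show ?thesis using cone[OF x, of t] t by auto
    qed
    moreover have "vanishes_outside \<delta> \<eta>"
      unfolding vanishes_outside_def
    proof (intro allI impI)
      fix h :: 'a assume h: "\<delta> \<le> norm h"
      have "norm (t *\<^sub>R e) = t" using e t by simp
      then have "dist (t *\<^sub>R e) h \<ge> norm h - t"
        using norm_triangle_ineq2[of h "t *\<^sub>R e"] by (simp add: dist_norm norm_minus_commute)
      moreover have "c * t \<le> t" using c t by (simp add: mult_left_le_one_le)
      ultimately have "c * t \<le> dist (t *\<^sub>R e) h" using h t by linarith
      then have "h \<notin> ball (t *\<^sub>R e) (c * t)" by simp
      then show "\<eta> h = 0" by (rule \<eta>(3))
    qed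
    ultimately show "\<exists>\<eta>. smooth \<eta> \<and> (\<forall>h. 0 \<le> \<eta> h) \<and> (\<integral>\<^sup>+h. ennreal (\<eta> h) \<partial>lborel) = 1 \<and>
      vanishes_outside \<delta> \<eta> \<and> (\<forall>x\<in>\<Omega> \<inter> ball p (r / 2). \<forall>h. \<eta> h \<noteq> 0 \<longrightarrow> x + h \<in> \<Omega>)"
      using \<eta> by blast
  qed (use r in simp)
qed

section \<open>Lipschitz bump functions and a smooth partition of unity\<close>

lemma linear_onorm_le_sum_Basis:
  fixes D :: "'a::euclidean_space \<Rightarrow> real"
  assumes lin: "linear D" and B: "\<And>b. b \<in> Basis \<Longrightarrow> \<bar>D b\<bar> \<le> B b"
  shows "onorm D \<le> (\<Sum>b\<in>Basis. B b)"
proof (rule onorm_le)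
  fix v :: 'a
  have "D v = D (\<Sum>b\<in>Basis. (v \<bullet> b) *\<^sub>R b)" by (simp add: euclidean_representation)
  also have "\<dots> = (\<Sum>b\<in>Basis. (v \<bullet> b) * D b)" by (simp add: linear_sum[OF lin] linear_scale[OF lin])
  finally have "norm (D v) \<le> (\<Sum>b\<in>Basis. norm v * B b)"
    by (simp only:) (rule sum_norm_le, use B Basis_le_norm[of _ v] in \<open>auto simp: abs_mult intro!: mult_mono\<close>)
  then show "norm (D v) \<le> (\<Sum>b\<in>Basis. B b) * norm v" by (simp add: sum_distrib_left mult.commute)
qed

lemma smooth_lipschitz:
  fixes \<zeta> :: "'a::euclidean_space \<Rightarrow> real"
  assumes \<zeta>: "smooth \<zeta>" "vanishes_outside r \<zeta>"
  obtains L where "L > 0" "\<And>x y. \<bar>\<zeta> x - \<zeta> y\<bar> \<le> L * norm (x - y)"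
proof -
  let ?D = "\<lambda>z. frechet_derivative \<zeta> (at z)"
  have "\<exists>B. \<forall>z. \<bar>?D z b\<bar> \<le> B" for b
    using vanishes_outside_bounded[OF smooth_continuous[OF smooth_deriv[OF \<zeta>(1)]] vanishes_outside_deriv[OF \<zeta>(2)], of b] by blast
  then obtain B where B: "\<And>b z. \<bar>?D z b\<bar> \<le> B b" by metis
  define L where "L = \<bar>\<Sum>b\<in>Basis. B b\<bar> + 1"
  have bd: "norm (\<zeta> x - \<zeta> y) \<le> (\<Sum>b\<in>Basis. B b) * norm (x - y)" for x y
  proof (rule differentiable_bound[of UNIV \<zeta> ?D])
    fix z
    show "(\<zeta> has_derivative ?D z) (at z within UNIV)"
      using smooth_differentiable[OF \<zeta>(1), of z] by (simp only: frechet_derivative_works)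
    show "onorm (?D z) \<le> (\<Sum>b\<in>Basis. B b)"
      using smooth_differentiable[OF \<zeta>(1), of z] B by (intro linear_onorm_le_sum_Basis linear_frechet_derivative)
  qed auto
  show ?thesis
  proof (rule that[of L])
    show "L > 0" by (simp add: L_def)
    show "\<bar>\<zeta> x - \<zeta> y\<bar> \<le> L * norm (x - y)" for x y
    proof -
      have "(\<Sum>b\<in>Basis. B b) * norm (x - y) \<le> L * norm (x - y)" by (intro mult_right_mono) (auto simp: L_def)
      then show ?thesis using bd[of x y] by simp
    qed
  qed
qed

text \<open>The indicator of the ball of radius \<open>2 * s / 3\<close> is mollified at scale
  \<open>s / 3\<close>: values within \<open>s / 3\<close> of \<open>p\<close> average only ones,
  values beyond \<open>s\<close> only zeros.\<close>

lemma bump_exists: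
  fixes p :: "'a::euclidean_space"
  assumes s: "s > 0"
  obtains b :: "'a \<Rightarrow> real" where "smooth b" "\<And>x. 0 \<le> b x" "\<And>x. b x \<le> 1" "\<And>x. x \<in> ball p (s / 3) \<Longrightarrow> b x = 1"
    "\<And>x. x \<notin> ball p s \<Longrightarrow> b x = 0"
proof -
  obtain \<eta> :: "'a \<Rightarrow> real" where \<eta>: "smooth \<eta>" "\<And>x. 0 \<le> \<eta> x" "\<And>x. x \<notin> ball 0 (s / 3) \<Longrightarrow> \<eta> x = 0"
    "(\<integral>\<^sup>+x. ennreal (\<eta> x) \<partial>lborel) = 1"
    using mollifier_exists[of "s / 3" 0] s by auto
  have [measurable]: "\<eta> \<in> borel_measurable borel" by (rule borel_measurable_continuous_onI[OF smooth_continuous[OF \<eta>(1)]])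
  have \<eta>v: "vanishes_outside (s / 3) \<eta>" using \<eta>(3) by (simp add: vanishes_outside_def)
  have i\<eta>: "integrable lborel \<eta>" using \<eta>(2,4) by (intro integrableI_nonneg) auto
  have o: "(LINT h|lborel. \<eta> h) = 1" using nn_integral_eq_integral[OF i\<eta>] \<eta>(2,4) by simp
  define u :: "'a \<Rightarrow> real" where "u = indicator (ball p (2 * s / 3))"
  have [measurable]: "u \<in> borel_measurable borel" by (simp add: u_def)
  have ui: "integrable lborel u"
    unfolding u_def using emeasure_lborel_bounded_less_top[of "ball p (2 * s / 3)"]
    by (intro integrable_real_indicator) auto
  have c: "conv \<eta> u x = (LINT h|lborel. \<eta> h * u (x + h))" for x by (rule conv_translate) measurable
  have i: "integrable lborel (\<lambda>h. \<eta> h * u (x + h))" for x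
  proof (rule Bochner_Integration.integrable_bound[OF i\<eta>])
    show "AE h in lborel. norm (\<eta> h * u (x + h)) \<le> norm (\<eta> h)"
      by (rule AE_I2) (simp add: u_def indicator_def)
  qed measurable
  show ?thesis
  proof (rule that)
    show "smooth (conv \<eta> u)" by (rule smooth_conv[OF \<eta>(1) \<eta>v ui])
    show "0 \<le> conv \<eta> u x" for x
      unfolding c using \<eta>(2) by (intro integral_nonneg_AE AE_I2) (simp add: u_def)
    show "conv \<eta> u x \<le> 1" for x
      unfolding c o[symmetric] using \<eta>(2) by (intro integral_mono i i\<eta>) (simp add: u_def indicator_def)
    show "conv \<eta> u x = 1" if x: "x \<in> ball p (s / 3)" for x
    proof -
      have z: "\<eta> h * u (x + h) = \<eta> h" for h
      proof (cases "\<eta> h = 0")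
        case False
        then have "norm h < s / 3" using \<eta>(3)[of h] by auto
        moreover have "dist x (x + h) = norm h" by (simp add: dist_norm)
        ultimately have "x + h \<in> ball p (2 * s / 3)" using x dist_triangle[of p "x + h" x] by simp
        then show ?thesis by (simp add: u_def)
      qed simp
      show ?thesis unfolding c z by (rule o)
    qed
    show "conv \<eta> u x = 0" if x: "x \<notin> ball p s" for x
    proof -
      have z: "\<eta> h * u (x + h) = 0" for h
      proof (cases "\<eta> h = 0")
        case False
        then have "norm h < s / 3" using \<eta>(3)[of h] by auto
        moreover have "dist (x + h) x = norm h" by (simp add: dist_norm)
        ultimately have "x + h \<notin> ball p (2 * s / 3)" using x dist_triangle[of p x "x + h"] by simp
        then show ?thesis by (simp add: u_def)
      qed simp
      show ?thesis unfolding c z by simp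
    qed
  qed
qed

lemma smooth_sum: "(\<And>i. i \<in> I \<Longrightarrow> smooth (f i)) \<Longrightarrow> smooth (\<lambda>x. \<Sum>i\<in>I. f i x)"
  by (auto simp: smooth_def intro: Ck_sum)

text \<open>If \<open>S\<close> is the sum so far and \<open>b\<close> a bump at the new point
  \<open>q\<close>, the new function is \<open>b * (1 - S)\<close>. The new sum satisfies
  \<open>1 - S' = (1 - b) * (1 - S)\<close>, hence it stays at most 1 and equals 1 wherever one of
  the bumps does. No division is involved.\<close>

lemma smooth_partition:
  fixes P :: "'a::euclidean_space set" and s :: "'a \<Rightarrow> real"
  assumes "finite P" "\<And>p. p \<in> P \<Longrightarrow> s p > 0"
  shows "\<exists>\<zeta>. (\<forall>p\<in>P. smooth (\<zeta> p) \<and> (\<forall>x. 0 \<le> \<zeta> p x) \<and> (\<forall>x. \<zeta> p x \<le> 1) \<and> (\<forall>x. x \<notin> ball p (s p) \<longrightarrow> \<zeta> p x = 0)) \<and>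
    (\<forall>x. (\<Sum>p\<in>P. \<zeta> p x) \<le> 1) \<and> (\<forall>x. (\<exists>p\<in>P. x \<in> ball p (s p / 3)) \<longrightarrow> (\<Sum>p\<in>P. \<zeta> p x) = 1)"
  using assms
proof (induction P)
  case empty
  then show ?case by simp
next
  case (insert q P)
  obtain \<zeta> where \<zeta>: "\<forall>p\<in>P. smooth (\<zeta> p) \<and> (\<forall>x. 0 \<le> \<zeta> p x) \<and> (\<forall>x. \<zeta> p x \<le> 1) \<and> (\<forall>x. x \<notin> ball p (s p) \<longrightarrow> \<zeta> p x = 0)"
    "\<forall>x. (\<Sum>p\<in>P. \<zeta> p x) \<le> 1" "\<forall>x. (\<exists>p\<in>P. x \<in> ball p (s p / 3)) \<longrightarrow> (\<Sum>p\<in>P. \<zeta> p x) = 1"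
    using insert.IH insert.prems by auto
  obtain b :: "'a \<Rightarrow> real" where b: "smooth b" "\<And>x. 0 \<le> b x" "\<And>x. b x \<le> 1" "\<And>x. x \<in> ball q (s q / 3) \<Longrightarrow> b x = 1"
    "\<And>x. x \<notin> ball q (s q) \<Longrightarrow> b x = 0"
    using bump_exists[of "s q" q] insert.prems by auto
  define S where "S x = (\<Sum>p\<in>P. \<zeta> p x)" for x
  have S: "0 \<le> S x" "S x \<le> 1" for x using \<zeta> by (auto simp: S_def intro!: sum_nonneg)
  define \<zeta>' where "\<zeta>' p = (if p = q then (\<lambda>x. b x * (1 + - 1 * S x)) else \<zeta> p)" for p
  have sum': "(\<Sum>p\<in>insert q P. \<zeta>' p x) = S x + b x * (1 - S x)" for x
  proof -
    have "(\<Sum>p\<in>P. \<zeta>' p x) = S x"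
      unfolding S_def using insert.hyps by (intro sum.cong) (auto simp: \<zeta>'_def)
    then show ?thesis using insert.hyps by (simp add: \<zeta>'_def)
  qed
  have bS: "0 \<le> b x * (1 - S x)" "b x * (1 - S x) \<le> 1 - S x" for x
    using b(2,3)[of x] S[of x] by (auto simp: mult_left_le_one_le)
  show ?case
  proof (intro exI[of _ \<zeta>'] conjI ballI allI impI)
    fix p assume p: "p \<in> insert q P"
    show "smooth (\<zeta>' p)"
    proof (cases "p = q")
      case True
      have "smooth S" unfolding S_def using \<zeta> by (intro smooth_sum) auto
      then have "smooth (\<lambda>x. b x * (1 + - 1 * S x))" by (intro smooth_mult smooth_add smooth_const b)
      then show ?thesis using True by (simp add: \<zeta>'_def)
    next
      case False then show ?thesis using \<zeta> p by (simp add: \<zeta>'_def)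
    qed
    fix x
    show "0 \<le> \<zeta>' p x" using bS[of x] \<zeta> p by (auto simp: \<zeta>'_def)
    show "\<zeta>' p x \<le> 1" using bS[of x] S[of x] \<zeta> p by (auto simp: \<zeta>'_def)
    show "\<zeta>' p x = 0" if "x \<notin> ball p (s p)" using that b(5) \<zeta> p by (auto simp: \<zeta>'_def)
  next
    fix x
    show "(\<Sum>p\<in>insert q P. \<zeta>' p x) \<le> 1" unfolding sum' using bS[of x] by linarith
    assume "\<exists>p\<in>insert q P. x \<in> ball p (s p / 3)"
    then have "b x = 1 \<or> S x = 1" using b(4) \<zeta>(3) by (auto simp: S_def)
    then show "(\<Sum>p\<in>insert q P. \<zeta>' p x) = 1" unfolding sum' by auto
  qed
qed

lemma sqnorm_cong:
  assumes "\<And>x. x \<in> S \<Longrightarrow> u x = w x"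
  shows "sqnorm \<alpha> S u = sqnorm \<alpha> S w"
proof -
  have "(\<integral>\<^sup>+x\<in>S. ennreal ((u x)\<^sup>2) \<partial>lborel) = (\<integral>\<^sup>+x\<in>S. ennreal ((w x)\<^sup>2) \<partial>lborel)"
    using assms by (intro nn_integral_cong) (auto simp: indicator_def)
  moreover have "dint S (\<lambda>x y. sqd u x y * frac_kernel \<alpha> x y) = dint S (\<lambda>x y. sqd w x y * frac_kernel \<alpha> x y)"
    unfolding dint_conv using assms by (intro nn_integral_cong) (auto simp: indicator_def sqd_def)
  ultimately show ?thesis by (simp add: sqnorm_def)
qed

lemma sqnorm_minus: "sqnorm \<alpha> S (\<lambda>x. - u x) = sqnorm \<alpha> S u"
proof -
  have "sqd (\<lambda>x. - u x) x y = sqd u x y" for x y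
    unfolding sqd_def by (simp add: power2_commute)
  then show ?thesis by (simp add: sqnorm_def)
qed

text \<open>On \<open>\<Omega>\<close> the error \<open>g - f\<close> is the sum of the terms
  \<open>\<zeta> p x * (conv (\<eta> p) f x - f x)\<close>. Each difference is controlled only on
  \<open>N p\<close>, where the shifts of \<open>\<eta> p\<close> stay in the domain; the cutoff
  \<open>\<zeta> p\<close> carries the bound from there to \<open>\<Omega>\<close>.\<close>

lemma smooth_dense_lipschitz_domain:
  fixes f :: "'a::euclidean_space \<Rightarrow> real"
  assumes \<alpha>: "0 < \<alpha>" "\<alpha> < 2" and bdd: "bounded \<Omega>" and lip: "lipschitz_domain \<Omega>"
    and f [measurable]: "f \<in> borel_measurable borel" and f0: "\<And>x. x \<notin> \<Omega> \<Longrightarrow> f x = 0"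
    and fin: "sqnorm \<alpha> \<Omega> f < top" and e: "0 < (e::real)"
  shows "\<exists>g. smooth g \<and> sqnorm \<alpha> \<Omega> (\<lambda>x. f x - g x) \<le> ennreal e"
proof -
  have op: "open \<Omega>" using lip by (simp add: lipschitz_domain_def)
  then have \<Omega> [measurable]: "\<Omega> \<in> sets borel" by simp
  have "\<forall>p\<in>closure \<Omega>. \<exists>s. s > 0 \<and> (\<forall>\<delta>>0. \<exists>\<eta>. smooth \<eta> \<and> (\<forall>h. 0 \<le> \<eta> h) \<and> (\<integral>\<^sup>+h. ennreal (\<eta> h) \<partial>lborel) = 1 \<and>
    vanishes_outside \<delta> \<eta> \<and> (\<forall>x\<in>\<Omega> \<inter> ball p s. \<forall>h. \<eta> h \<noteq> 0 \<longrightarrow> x + h \<in> \<Omega>))"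
    using local_mollifier[OF lip] by blast
  from bchoice[OF this] obtain s where s: "\<forall>p\<in>closure \<Omega>. s p > 0 \<and> (\<forall>\<delta>>0. \<exists>\<eta>. smooth \<eta> \<and> (\<forall>h. 0 \<le> \<eta> h) \<and> (\<integral>\<^sup>+h. ennreal (\<eta> h) \<partial>lborel) = 1 \<and>
    vanishes_outside \<delta> \<eta> \<and> (\<forall>x\<in>\<Omega> \<inter> ball p (s p). \<forall>h. \<eta> h \<noteq> 0 \<longrightarrow> x + h \<in> \<Omega>))" ..
  have comp: "compact (closure \<Omega>)" using bdd by simp
  have cov: "closure \<Omega> \<subseteq> (\<Union>p\<in>closure \<Omega>. ball p (s p / 3))" using s by fastforce
  obtain P where P: "P \<subseteq> closure \<Omega>" "finite P" "closure \<Omega> \<subseteq> (\<Union>p\<in>P. ball p (s p / 3))"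
    by (rule compactE_image[OF comp _ cov]) auto
  have sP: "s p > 0" if "p \<in> P" for p using that P(1) s by blast
  obtain \<zeta> where \<zeta>: "\<forall>p\<in>P. smooth (\<zeta> p) \<and> (\<forall>x. 0 \<le> \<zeta> p x) \<and> (\<forall>x. \<zeta> p x \<le> 1) \<and> (\<forall>x. x \<notin> ball p (s p) \<longrightarrow> \<zeta> p x = 0)"
    "\<forall>x. (\<exists>p\<in>P. x \<in> ball p (s p / 3)) \<longrightarrow> (\<Sum>p\<in>P. \<zeta> p x) = 1"
    using smooth_partition[of P s, OF P(2) sP] by blast
  have "\<forall>p\<in>P. \<exists>L. L > 0 \<and> (\<forall>x y. \<bar>\<zeta> p x - \<zeta> p y\<bar> \<le> L * norm (x - y))"
  proof
    fix p assume p: "p \<in> P"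
    have van: "vanishes_outside (norm p + s p) (\<zeta> p)"
      unfolding vanishes_outside_def
    proof (intro allI impI)
      fix x :: 'a assume "norm p + s p \<le> norm x"
      then have "x \<notin> ball p (s p)" using norm_triangle_ineq2[of x p] by (simp add: dist_norm norm_minus_commute)
      then show "\<zeta> p x = 0" using \<zeta>(1) p by blast
    qed
    have sm: "smooth (\<zeta> p)" using \<zeta>(1) p by blast
    obtain L where "L > 0" "\<And>x y. \<bar>\<zeta> p x - \<zeta> p y\<bar> \<le> L * norm (x - y)"
      by (rule smooth_lipschitz[OF sm van], rule that)
    then show "\<exists>L. L > 0 \<and> (\<forall>x y. \<bar>\<zeta> p x - \<zeta> p y\<bar> \<le> L * norm (x - y))" by auto
  qed
  from bchoice[OF this] obtain L where L: "\<forall>p\<in>P. L p > 0 \<and> (\<forall>x y. \<bar>\<zeta> p x - \<zeta> p y\<bar> \<le> L p * norm (x - y))" ..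
  define C where "C p = 2 + 4 * ennreal ((real DIM('a) + \<alpha>) * unit_ball_vol DIM('a) * (1 / (2 - \<alpha>) + 1 / \<alpha>) * L p powr \<alpha>)" for p
  define K where "K = 2 ^ card P * (\<Sum>p\<in>P. C p)"
  have "K < top" using P(2) by (auto simp: K_def C_def ennreal_mult_less_top power_less_top_ennreal)
  then obtain \<kappa> where \<kappa>: "K = ennreal \<kappa>" "0 \<le> \<kappa>" by (cases K) auto
  \<comment> \<open>The constant \<open>K\<close> comes from the partition alone and is fixed before
    the mollifiers, so the mollification error can be chosen against it. Each piece costs
    \<open>2 * e'\<close>, and \<open>\<kappa> + 1\<close> avoids division by
    \<open>0\<close>.\<close>
  define e' where "e' = e / (2 * (\<kappa> + 1))"
  have e': "e' > 0" using e \<kappa> by (simp add: e'_def)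
  have fL2: "(\<integral>\<^sup>+x. ennreal ((f x)\<^sup>2) \<partial>lborel) < top"
  proof -
    have "(\<integral>\<^sup>+x. ennreal ((f x)\<^sup>2) \<partial>lborel) = (\<integral>\<^sup>+x\<in>\<Omega>. ennreal ((f x)\<^sup>2) \<partial>lborel)"
      using f0 by (intro nn_integral_cong) (auto simp: indicator_def)
    then show ?thesis using fin by (simp add: sqnorm_def)
  qed
  have fE: "dint \<Omega> (\<lambda>x y. sqd f x y * frac_kernel \<alpha> x y) < top" using fin by (simp add: sqnorm_def)
  have fi: "integrable lborel f"
    by (rule integrable_bounded_support_L2[OF f \<Omega> fL2 emeasure_lborel_bounded_less_top[OF bdd] f0])
  obtain \<delta> where \<delta>: "\<delta> > 0"
    "\<And>\<eta> N. continuous_on UNIV \<eta> \<Longrightarrow> vanishes_outside \<delta> \<eta> \<Longrightarrow> (\<And>h. 0 \<le> \<eta> h) \<Longrightarrow>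
      (\<integral>\<^sup>+h. ennreal (\<eta> h) \<partial>lborel) = 1 \<Longrightarrow> N \<in> sets borel \<Longrightarrow> N \<subseteq> \<Omega> \<Longrightarrow>
      (\<And>x h. x \<in> N \<Longrightarrow> \<eta> h \<noteq> 0 \<Longrightarrow> x + h \<in> \<Omega>) \<Longrightarrow>
      (\<integral>\<^sup>+x\<in>N. ennreal ((conv \<eta> f x - f x)\<^sup>2) \<partial>lborel) \<le> ennreal e' \<and>
      dint N (\<lambda>x y. sqd (\<lambda>x. conv \<eta> f x - f x) x y * frac_kernel \<alpha> x y) \<le> ennreal e'"
    by (rule mollify_small[OF f \<Omega> fi fL2 fE e']) auto
  have "\<forall>p\<in>P. \<exists>\<eta>. smooth \<eta> \<and> (\<forall>h. 0 \<le> \<eta> h) \<and> (\<integral>\<^sup>+h. ennreal (\<eta> h) \<partial>lborel) = 1 \<and>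
    vanishes_outside \<delta> \<eta> \<and> (\<forall>x\<in>\<Omega> \<inter> ball p (s p). \<forall>h. \<eta> h \<noteq> 0 \<longrightarrow> x + h \<in> \<Omega>)"
    using s P(1) \<delta>(1) by blast
  from bchoice[OF this] obtain \<eta> where \<eta>: "\<forall>p\<in>P. smooth (\<eta> p) \<and> (\<forall>h. 0 \<le> \<eta> p h) \<and> (\<integral>\<^sup>+h. ennreal (\<eta> p h) \<partial>lborel) = 1 \<and>
    vanishes_outside \<delta> (\<eta> p) \<and> (\<forall>x\<in>\<Omega> \<inter> ball p (s p). \<forall>h. \<eta> p h \<noteq> 0 \<longrightarrow> x + h \<in> \<Omega>)" ..
  define N where "N p = \<Omega> \<inter> ball p (s p)" for p
  define w where "w p x = conv (\<eta> p) f x - f x" for p x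
  define g where "g x = (\<Sum>p\<in>P. \<zeta> p x * conv (\<eta> p) f x)" for x
  have N: "N p \<in> sets borel" for p by (simp add: N_def)
  have cm: "conv (\<eta> p) f \<in> borel_measurable borel" if "p \<in> P" for p
    using \<eta> that by (intro conv_measurable f borel_measurable_continuous_onI smooth_continuous) auto
  have wm: "w p \<in> borel_measurable borel" if "p \<in> P" for p
    unfolding w_def using cm[OF that] by measurable
  have \<zeta>m: "\<zeta> p \<in> borel_measurable borel" if "p \<in> P" for p
    using \<zeta>(1) that by (intro borel_measurable_continuous_onI smooth_continuous) auto
  have w_small: "sqnorm \<alpha> (N p) (w p) \<le> ennreal (2 * e')" if p: "p \<in> P" for p
  proof -
    have h: "smooth (\<eta> p)" "\<And>h. 0 \<le> \<eta> p h" "(\<integral>\<^sup>+h. ennreal (\<eta> p h) \<partial>lborel) = 1" "vanishes_outside \<delta> (\<eta> p)"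
      "\<And>x h. x \<in> N p \<Longrightarrow> \<eta> p h \<noteq> 0 \<Longrightarrow> x + h \<in> \<Omega>"
      using \<eta> p by (auto simp: N_def)
    have "(\<integral>\<^sup>+x\<in>N p. ennreal ((conv (\<eta> p) f x - f x)\<^sup>2) \<partial>lborel) \<le> ennreal e' \<and>
      dint (N p) (\<lambda>x y. sqd (\<lambda>x. conv (\<eta> p) f x - f x) x y * frac_kernel \<alpha> x y) \<le> ennreal e'"
      by (rule \<delta>(2)[OF smooth_continuous[OF h(1)] h(4) h(2) h(3) N _ h(5)]) (auto simp: N_def)
    then have "sqnorm \<alpha> (N p) (w p) \<le> ennreal e' + ennreal e'"
      unfolding sqnorm_def w_def[abs_def] by (intro add_mono) auto
    also have "\<dots> = ennreal (2 * e')" using e' by (simp add: ennreal_plus[symmetric] del: ennreal_plus)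
    finally show ?thesis .
  qed
  have piece: "sqnorm \<alpha> \<Omega> (\<lambda>x. \<zeta> p x * (w p x * indicator (N p) x)) \<le> C p * ennreal (2 * e')" if p: "p \<in> P" for p
  proof -
    have "sqnorm \<alpha> \<Omega> (\<lambda>x. \<zeta> p x * (w p x * indicator (N p) x)) \<le> C p * sqnorm \<alpha> (N p) (w p)"
      unfolding C_def
      by (rule sqnorm_cutoff_finite[OF \<alpha>]) (use L \<zeta>(1) p N wm[OF p] \<zeta>m[OF p] in \<open>auto simp: N_def\<close>)
    also have "\<dots> \<le> C p * ennreal (2 * e')" by (intro mult_left_mono w_small p) simp
    finally show ?thesis .
  qed
  show ?thesis
  proof (intro exI[of _ g] conjI)
    show "smooth g"
      unfolding g_def using \<zeta>(1) \<eta> smooth_conv[OF _ _ fi] by (intro smooth_sum smooth_mult) blast+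
    have "f x - g x = - (\<Sum>p\<in>P. \<zeta> p x * (w p x * indicator (N p) x))" if x: "x \<in> \<Omega>" for x
    proof -
      have "\<zeta> p x * (w p x * indicator (N p) x) = \<zeta> p x * w p x" if "p \<in> P" for p
        using \<zeta>(1) that x by (cases "x \<in> ball p (s p)") (auto simp: N_def)
      then have "(\<Sum>p\<in>P. \<zeta> p x * (w p x * indicator (N p) x)) = (\<Sum>p\<in>P. \<zeta> p x * conv (\<eta> p) f x) - (\<Sum>p\<in>P. \<zeta> p x * f x)"
        by (simp add: w_def right_diff_distrib sum_subtractf)
      also have "(\<Sum>p\<in>P. \<zeta> p x * f x) = (\<Sum>p\<in>P. \<zeta> p x) * f x" by (simp add: sum_distrib_right)
      also have "(\<Sum>p\<in>P. \<zeta> p x) = 1"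
      proof -
        have "x \<in> closure \<Omega>" using x closure_subset[of \<Omega>] by blast
        then have "\<exists>p\<in>P. x \<in> ball p (s p / 3)" using P(3) by blast
        then show ?thesis using \<zeta>(2) by blast
      qed
      finally show ?thesis by (simp add: g_def)
    qed
    then have "sqnorm \<alpha> \<Omega> (\<lambda>x. f x - g x) = sqnorm \<alpha> \<Omega> (\<lambda>x. - (\<Sum>p\<in>P. \<zeta> p x * (w p x * indicator (N p) x)))"
      by (rule sqnorm_cong)
    also have "\<dots> = sqnorm \<alpha> \<Omega> (\<lambda>x. \<Sum>p\<in>P. \<zeta> p x * (w p x * indicator (N p) x))" by (rule sqnorm_minus)
    also have "\<dots> \<le> 2 ^ card P * (\<Sum>p\<in>P. sqnorm \<alpha> \<Omega> (\<lambda>x. \<zeta> p x * (w p x * indicator (N p) x)))"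
      using wm \<zeta>m N by (intro sqnorm_sum P(2) \<Omega> borel_measurable_times) auto
    also have "\<dots> \<le> 2 ^ card P * (\<Sum>p\<in>P. C p * ennreal (2 * e'))"
      by (intro mult_left_mono sum_mono piece) auto
    also have "\<dots> = K * ennreal (2 * e')" by (simp add: K_def sum_distrib_right mult.assoc)
    also have "\<dots> = ennreal (\<kappa> * (2 * e'))" unfolding \<kappa>(1) by (rule ennreal_mult'[symmetric]) (rule \<kappa>(2))
    also have "\<dots> \<le> ennreal e"
    proof (rule ennreal_leI)
      have "e = e' * (2 * (\<kappa> + 1))" using \<kappa>(2) by (simp add: e'_def)
      then have "e = \<kappa> * (2 * e') + 2 * e'" by (simp add: algebra_simps)
      then show "\<kappa> * (2 * e') \<le> e" using e' by linarith
    qed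
    finally show "sqnorm \<alpha> \<Omega> (\<lambda>x. f x - g x) \<le> ennreal e" .
  qed
qed

section \<open>Smooth functions have finite fractional energy\<close>

lemma lipschitz_dint_finite:
  fixes g :: "'a::euclidean_space \<Rightarrow> real"
  assumes \<alpha>: "0 < \<alpha>" "\<alpha> < 2" and [measurable]: "g \<in> borel_measurable borel" "S \<in> sets borel" "T \<in> sets borel"
    and T: "emeasure lborel T < top" and A: "0 \<le> A"
    and le: "\<And>x y. x \<in> S \<Longrightarrow> y \<in> S \<Longrightarrow> (g y - g x)\<^sup>2 \<le> A * (min 1 (norm (x - y)))\<^sup>2"
    and out: "\<And>x y. x \<in> S \<Longrightarrow> y \<in> S \<Longrightarrow> x \<notin> T \<Longrightarrow> y \<notin> T \<Longrightarrow> g x = g y"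
  shows "dint S (\<lambda>x y. sqd g x y * frac_kernel \<alpha> x y) < top"
proof -
  define C where "C = ennreal ((real DIM('a) + \<alpha>) * unit_ball_vol DIM('a) * (1 / (2 - \<alpha>) + 1 / \<alpha>) * 1 powr \<alpha>)"
  have C: "(\<integral>\<^sup>+y. truncated_kernel \<alpha> 1 x y \<partial>lborel) \<le> C" for x :: 'a
    unfolding C_def by (rule truncated_kernel_integral_le[OF \<alpha>]) simp
  \<comment> \<open>A pair with \<open>g x \<noteq> g y\<close> has a member in \<open>T\<close>.
    Charging the pair to that member leaves the integral of the truncated kernel over the other one,
    which is bounded uniformly, times the finite measure of \<open>T\<close>.\<close>
  have pt: "sqd g x y * frac_kernel \<alpha> x y * (indicator S x * indicator S y) \<le>
      ennreal A * (truncated_kernel \<alpha> 1 x y * indicator T x) + ennreal A * (truncated_kernel \<alpha> 1 y x * indicator T y)" for x y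
  proof (cases "x \<in> S \<and> y \<in> S \<and> (x \<in> T \<or> y \<in> T)")
    case True
    have "(min 1 n)\<^sup>2 \<le> min 1 (1\<^sup>2 * n\<^sup>2)" if "n \<ge> 0" for n :: real
      using that by (cases "n \<le> 1") (auto simp: power_le_one)
    from mult_left_mono[OF this[OF norm_ge_zero] A] le[of x y] True
    have "(g y - g x)\<^sup>2 \<le> A * min 1 (1\<^sup>2 * (norm (x - y))\<^sup>2)" by (meson order_trans)
    then have "sqd g x y \<le> ennreal (A * min 1 (1\<^sup>2 * (norm (x - y))\<^sup>2))"
      unfolding sqd_def by (rule ennreal_leI)
    also have "\<dots> = ennreal A * ennreal (min 1 (1\<^sup>2 * (norm (x - y))\<^sup>2))" by (rule ennreal_mult') (rule A)
    finally have "sqd g x y * frac_kernel \<alpha> x y \<le> ennreal A * truncated_kernel \<alpha> 1 x y"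
      unfolding truncated_kernel_def mult.assoc[symmetric] by (rule mult_right_mono) simp
    then show ?thesis using True
      by (auto simp: truncated_kernel_sym[of \<alpha> 1 y x] intro: add_increasing add_increasing2)
  next
    case False
    show ?thesis
    proof (cases "x \<in> S \<and> y \<in> S")
      case True
      then have "g x = g y" using out False by blast
      then show ?thesis by (simp add: sqd_def)
    qed auto
  qed
  have 1: "(\<integral>\<^sup>+x. \<integral>\<^sup>+y. truncated_kernel \<alpha> 1 x y * indicator T x \<partial>lborel \<partial>lborel) \<le> C * emeasure lborel T"
  proof -
    have "(\<integral>\<^sup>+x. \<integral>\<^sup>+y. truncated_kernel \<alpha> 1 x y * indicator T x \<partial>lborel \<partial>lborel) =
        (\<integral>\<^sup>+x. (\<integral>\<^sup>+y. truncated_kernel \<alpha> 1 x y \<partial>lborel) * indicator T x \<partial>lborel)"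
      by (intro nn_integral_cong nn_integral_multc) measurable
    also have "\<dots> \<le> (\<integral>\<^sup>+x. C * indicator T x \<partial>lborel)" by (intro nn_integral_mono mult_right_mono C) auto
    finally show ?thesis by (simp add: nn_integral_cmult_indicator)
  qed
  have 2: "(\<integral>\<^sup>+x. \<integral>\<^sup>+y. truncated_kernel \<alpha> 1 y x * indicator T y \<partial>lborel \<partial>lborel) \<le> C * emeasure lborel T"
    by (subst nn_integral_lborel_swap) (use 1 in auto)
  have "dint S (\<lambda>x y. sqd g x y * frac_kernel \<alpha> x y) \<le> (\<integral>\<^sup>+x. \<integral>\<^sup>+y. ennreal A * (truncated_kernel \<alpha> 1 x y * indicator T x) + ennreal A * (truncated_kernel \<alpha> 1 y x * indicator T y) \<partial>lborel \<partial>lborel)"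
    unfolding dint_conv by (intro nn_integral_mono pt)
  also have "\<dots> = ennreal A * (\<integral>\<^sup>+x. \<integral>\<^sup>+y. truncated_kernel \<alpha> 1 x y * indicator T x \<partial>lborel \<partial>lborel) +
      ennreal A * (\<integral>\<^sup>+x. \<integral>\<^sup>+y. truncated_kernel \<alpha> 1 y x * indicator T y \<partial>lborel \<partial>lborel)"
    by (simp add: nn_integral_add nn_integral_cmult)
  also have "\<dots> \<le> ennreal A * (C * emeasure lborel T) + ennreal A * (C * emeasure lborel T)"
    by (intro add_mono mult_left_mono 1 2) auto
  also have "\<dots> < top" using T by (simp add: C_def ennreal_mult_less_top)
  finally show ?thesis .
qed

lemma sqnorm_smooth_compact_finite:
  fixes g :: "'a::euclidean_space \<Rightarrow> real"
  assumes \<alpha>: "0 < \<alpha>" "\<alpha> < 2" and g: "smooth g" "vanishes_outside r g"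
  shows "sqnorm \<alpha> UNIV g < top"
proof -
  have [measurable]: "g \<in> borel_measurable borel" by (rule borel_measurable_continuous_onI[OF smooth_continuous[OF g(1)]])
  obtain B where B: "B > 0" "\<And>x. \<bar>g x\<bar> \<le> B" using vanishes_outside_bounded[OF smooth_continuous[OF g(1)] g(2)] by blast
  obtain L where L: "L > 0" "\<And>x y. \<bar>g x - g y\<bar> \<le> L * norm (x - y)" using smooth_lipschitz[OF g] by blast
  \<comment> \<open>Covers both regimes of the minimum: the Lipschitz bound for distances up to 1,
    the trivial bound \<open>2 * B\<close> beyond.\<close>
  define M where "M = L + 2 * B"
  have fT: "emeasure lborel (ball (0::'a) r) < top" by (intro emeasure_lborel_bounded_less_top) simp
  have out: "g x = 0" if "x \<notin> ball 0 r" for x using that g(2) by (simp add: vanishes_outside_def)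
  have "dint UNIV (\<lambda>x y. sqd g x y * frac_kernel \<alpha> x y) < top"
  proof (rule lipschitz_dint_finite[OF \<alpha>, of g UNIV "ball 0 r" "M\<^sup>2"])
    fix x y
    have "\<bar>g y - g x\<bar> \<le> M * min 1 (norm (x - y))"
    proof (cases "norm (x - y) \<le> 1")
      case True
      have "L * norm (x - y) \<le> M * norm (x - y)" using B by (intro mult_right_mono) (auto simp: M_def)
      then show ?thesis using L(2)[of y x] True by (simp add: norm_minus_commute)
    next
      case False
      then show ?thesis using B(2)[of x] B(2)[of y] L(1) by (simp add: M_def)
    qed
    then have "\<bar>g y - g x\<bar>\<^sup>2 \<le> (M * min 1 (norm (x - y)))\<^sup>2" by (rule power_mono) simp
    then show "(g y - g x)\<^sup>2 \<le> M\<^sup>2 * (min 1 (norm (x - y)))\<^sup>2" by (simp add: power_mult_distrib)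
  qed (use fT out in auto)
  moreover have "(\<integral>\<^sup>+x\<in>UNIV. ennreal ((g x)\<^sup>2) \<partial>lborel) < top"
  proof -
    have "(\<integral>\<^sup>+x\<in>UNIV. ennreal ((g x)\<^sup>2) \<partial>lborel) \<le> (\<integral>\<^sup>+x. ennreal (B\<^sup>2) * indicator (ball (0::'a) r) x \<partial>lborel)"
    proof (rule nn_integral_mono)
      fix x
      have "\<bar>g x\<bar>\<^sup>2 \<le> B\<^sup>2" using B(2) by (intro power_mono) auto
      then show "ennreal ((g x)\<^sup>2) * indicator UNIV x \<le> ennreal (B\<^sup>2) * indicator (ball 0 r) x"
        using out[of x] by (cases "x \<in> ball 0 r") (auto intro: ennreal_leI)
    qed
    also have "\<dots> < top" using fT by (simp add: nn_integral_cmult_indicator ennreal_mult_less_top)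
    finally show ?thesis .
  qed
  ultimately show ?thesis by (simp add: sqnorm_def)
qed

lemma bounded_deriv_segment:
  fixes f :: "'a::euclidean_space \<Rightarrow> real"
  assumes "\<And>x. x \<in> \<Omega> \<Longrightarrow> f differentiable at x" and "\<And>x. x \<in> \<Omega> \<Longrightarrow> onorm (frechet_derivative f (at x)) \<le> M"
    and "closed_segment x y \<subseteq> \<Omega>"
  shows "\<bar>f x - f y\<bar> \<le> M * norm (x - y)"
proof -
  have "norm (f x - f y) \<le> M * norm (x - y)"
  proof (rule differentiable_bound)
    show "convex (closed_segment x y)" by simp
    fix z assume "z \<in> closed_segment x y"
    then have z: "z \<in> \<Omega>" using assms(3) by blast
    show "(f has_derivative frechet_derivative f (at z)) (at z within closed_segment x y)"
      by (rule has_derivative_at_withinI[OF frechet_derivative_works[THEN iffD1, OF assms(1)[OF z]]])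
    show "onorm (frechet_derivative f (at z)) \<le> M" by (rule assms(2)[OF z])
  next
    show "x \<in> closed_segment x y" "y \<in> closed_segment x y" by simp_all
  qed
  then show ?thesis by (simp only: real_norm_def)
qed

text \<open>Bounded derivatives control \<open>f\<close> only along segments in the domain, and near
  the boundary the segment from \<open>x\<close> to \<open>y\<close> may leave it. The detour over
  \<open>x + t *\<^sub>R e\<close> and \<open>y + t *\<^sub>R e\<close> stays in the interior cones
  and has length comparable to \<open>norm (x - y)\<close>.\<close>

lemma lipschitz_domain_locally_lipschitz:
  fixes f :: "'a::euclidean_space \<Rightarrow> real"
  assumes lip: "lipschitz_domain \<Omega>" and p: "p \<in> closure \<Omega>"
    and diff: "\<And>x. x \<in> \<Omega> \<Longrightarrow> f differentiable at x" and M: "\<And>x. x \<in> \<Omega> \<Longrightarrow> onorm (frechet_derivative f (at x)) \<le> M" "0 \<le> M"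
  shows "\<exists>s>0. \<exists>A\<ge>0. \<forall>x\<in>\<Omega> \<inter> ball p s. \<forall>y\<in>\<Omega> \<inter> ball p s. \<bar>f x - f y\<bar> \<le> A * norm (x - y)"
proof (cases "p \<in> \<Omega>")
  case True
  have "open \<Omega>" using lip by (simp add: lipschitz_domain_def)
  then obtain r where r: "r > 0" "ball p r \<subseteq> \<Omega>" using True open_contains_ball by blast
  have "\<bar>f x - f y\<bar> \<le> M * norm (x - y)" if "x \<in> \<Omega> \<inter> ball p r" "y \<in> \<Omega> \<inter> ball p r" for x y
  proof (rule bounded_deriv_segment[OF diff M(1)])
    have "closed_segment x y \<subseteq> ball p r" using that by (intro closed_segment_subset) auto
    then show "closed_segment x y \<subseteq> \<Omega>" using r by blast
  qed auto
  then show ?thesis using r M(2) by blast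
next
  case False
  have "open \<Omega>" using lip by (simp add: lipschitz_domain_def)
  then have "p \<in> frontier \<Omega>" using p False by (simp add: frontier_def interior_open)
  from lipschitz_domain_cone[OF lip this] obtain e r c where e: "norm e = 1" and r: "0 < r" and c: "0 < c" "c < 1"
    and cone: "\<And>x t. x \<in> \<Omega> \<inter> ball p (r / 2) \<Longrightarrow> t \<in> {0<..r / 4} \<Longrightarrow> ball (x + t *\<^sub>R e) (c * t) \<subseteq> \<Omega> \<inter> ball p r"
    by blast
  \<comment> \<open>Points of \<open>ball p s\<close> have distance below \<open>2 * s\<close>, and
    \<open>2 / c * (2 * s) = r / 4\<close> is the length of the interior cone.\<close>
  define s where "s = c * r / 16"
  have s: "0 < s" "s \<le> r / 2" using c r by (auto simp: s_def)
  have "\<bar>f x - f y\<bar> \<le> M * (1 + 4 / c) * norm (x - y)" if x: "x \<in> \<Omega> \<inter> ball p s" and y: "y \<in> \<Omega> \<inter> ball p s" for x y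
  proof (cases "x = y")
    case False
    \<comment> \<open>Then \<open>c * t = 2 * norm (x - y)\<close>, so the middle segment lies in
      the ball of radius \<open>c * t\<close> around \<open>x + t *\<^sub>R e\<close>.\<close>
    define t where "t = 2 / c * norm (x - y)"
    have xy: "norm (x - y) < 2 * s" using x y dist_triangle[of x y p] by (simp add: dist_commute dist_norm)
    then have "t < 2 / c * (2 * s)" using c unfolding t_def by (intro mult_strict_left_mono) auto
    then have t: "t \<in> {0<..r / 4}" using False c by (auto simp: t_def s_def)
    have sub: "x \<in> \<Omega> \<inter> ball p (r / 2)" "y \<in> \<Omega> \<inter> ball p (r / 2)" using x y s by auto
    have up: "\<bar>f z - f (z + t *\<^sub>R e)\<bar> \<le> M * t" if z: "z \<in> \<Omega> \<inter> ball p (r / 2)" for z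
    proof -
      have "closed_segment z (z + t *\<^sub>R e) \<subseteq> \<Omega>"
      proof
        fix u assume "u \<in> closed_segment z (z + t *\<^sub>R e)"
        then obtain a where a: "0 \<le> a" "a \<le> 1" "u = (1 - a) *\<^sub>R z + a *\<^sub>R (z + t *\<^sub>R e)" by (auto simp: in_segment)
        then have u: "u = z + (a * t) *\<^sub>R e" by (simp add: algebra_simps)
        show "u \<in> \<Omega>"
        proof (cases "a = 0")
          case True then show ?thesis using z u by simp
        next
          case False
          have "a * t \<le> t" using a t by (intro mult_left_le_one_le) auto
          moreover have "0 < a * t" using a t False by simp
          moreover have "t \<le> r / 4" using t by simp
          ultimately have at: "a * t \<in> {0<..r / 4}" unfolding greaterThanAtMost_iff by linarith
          have "u \<in> ball (z + (a * t) *\<^sub>R e) (c * (a * t))" using u c at by auto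
          then show ?thesis using cone[OF z at] by blast
        qed
      qed
      from bounded_deriv_segment[OF diff M(1) this] show ?thesis using e t by simp
    qed
    have mid: "\<bar>f (x + t *\<^sub>R e) - f (y + t *\<^sub>R e)\<bar> \<le> M * norm (x - y)"
    proof -
      have "closed_segment (x + t *\<^sub>R e) (y + t *\<^sub>R e) \<subseteq> ball (x + t *\<^sub>R e) (c * t)"
      proof (rule closed_segment_subset)
        show "x + t *\<^sub>R e \<in> ball (x + t *\<^sub>R e) (c * t)" using c t by simp
        have "c * t = 2 * norm (x - y)" using c by (simp add: t_def)
        then show "y + t *\<^sub>R e \<in> ball (x + t *\<^sub>R e) (c * t)" using False by (simp add: dist_norm)
      qed simp
      then have "closed_segment (x + t *\<^sub>R e) (y + t *\<^sub>R e) \<subseteq> \<Omega>" using cone[OF sub(1) t] by blast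
      from bounded_deriv_segment[OF diff M(1) this] show ?thesis by simp
    qed
    have "\<bar>f x - f y\<bar> \<le> \<bar>f x - f (x + t *\<^sub>R e)\<bar> + \<bar>f (x + t *\<^sub>R e) - f (y + t *\<^sub>R e)\<bar> + \<bar>f y - f (y + t *\<^sub>R e)\<bar>" by linarith
    also have "\<dots> \<le> M * t + M * norm (x - y) + M * t" using up[OF sub(1)] up[OF sub(2)] mid by linarith
    also have "\<dots> = M * (1 + 4 / c) * norm (x - y)" by (simp add: t_def algebra_simps)
    finally show ?thesis .
  qed simp
  moreover have "0 \<le> M * (1 + 4 / c)" using M(2) c by simp
  ultimately show ?thesis using s by blast
qed

text \<open>The continuous extensions to the compact closure bound \<open>f\<close> and its first
  derivatives, which makes \<open>f\<close> Lipschitz near each point of the closure. The factor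
  \<open>indicator \<Omega> x\<close> gives a Borel function, since the values of \<open>f\<close>
  outside \<open>\<Omega>\<close> are arbitrary.\<close>

lemma C_infinity_closure_sqnorm_finite:
  fixes f :: "'a::euclidean_space \<Rightarrow> real"
  assumes \<alpha>: "0 < \<alpha>" "\<alpha> < 2" and bdd: "bounded \<Omega>" and lip: "lipschitz_domain \<Omega>" and f: "f \<in> C_infinity_closure \<Omega>"
  shows "continuous_on \<Omega> f" and "(\<lambda>x. f x * indicator \<Omega> x) \<in> borel_measurable borel"
    and "sqnorm \<alpha> \<Omega> (\<lambda>x. f x * indicator \<Omega> x) < top"
proof -
  have op: "open \<Omega>" and con: "connected \<Omega>" using lip by (auto simp: lipschitz_domain_def)
  then have \<Omega> [measurable]: "\<Omega> \<in> sets borel" by simp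
  have em: "emeasure lborel \<Omega> < top" by (rule emeasure_lborel_bounded_less_top[OF bdd])
  have "iterated_deriv [] f differentiable at x" if "x \<in> \<Omega>" for x
    using f that unfolding C_infinity_closure_def C_infinity_def by blast
  then have diff: "f differentiable at x" if "x \<in> \<Omega>" for x using that by simp
  show cont: "continuous_on \<Omega> f"
    by (intro continuous_at_imp_continuous_on ballI differentiable_imp_continuous_within diff)
  define g where "g x = f x * indicator \<Omega> x" for x
  show "(\<lambda>x. f x * indicator \<Omega> x) \<in> borel_measurable borel"
    using borel_measurable_continuous_on_indicator[OF \<Omega> cont] by (simp add: mult.commute)
  then have [measurable]: "g \<in> borel_measurable borel" by (simp add: g_def[abs_def])
  have bd: "\<exists>B\<ge>0. \<forall>x\<in>\<Omega>. \<bar>iterated_deriv vs f x\<bar> \<le> B" for vs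
  proof -
    obtain h where h: "continuous_on (closure \<Omega>) h" "\<And>x. x \<in> \<Omega> \<Longrightarrow> h x = iterated_deriv vs f x"
      using f unfolding C_infinity_closure_def by blast
    have "compact (h ` closure \<Omega>)" using h(1) bdd by (intro compact_continuous_image) auto
    then have "bounded (h ` closure \<Omega>)" by (rule compact_imp_bounded)
    then obtain B where B: "B > 0" "\<And>y. y \<in> h ` closure \<Omega> \<Longrightarrow> norm y \<le> B" unfolding bounded_pos by blast
    have "\<bar>iterated_deriv vs f x\<bar> \<le> B" if "x \<in> \<Omega>" for x
    proof -
      have "h x \<in> h ` closure \<Omega>" using that closure_subset[of \<Omega>] by blast
      from B(2)[OF this] show ?thesis by (simp add: h(2)[OF that])
    qed
    then show ?thesis using B(1) by (intro exI[of _ B]) auto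
  qed
  obtain B where B: "B \<ge> 0" "\<And>x. x \<in> \<Omega> \<Longrightarrow> \<bar>f x\<bar> \<le> B" using bd[of "[]"] by auto
  have "\<forall>b. \<exists>B\<ge>0. \<forall>x\<in>\<Omega>. \<bar>frechet_derivative f (at x) b\<bar> \<le> B" using bd[of "[_]"] by simp
  then obtain D where D: "\<And>b. D b \<ge> 0" "\<And>b x. x \<in> \<Omega> \<Longrightarrow> \<bar>frechet_derivative f (at x) b\<bar> \<le> D b" by metis
  define M where "M = (\<Sum>b\<in>(Basis::'a set). D b)"
  have M0: "M \<ge> 0" unfolding M_def using D(1) by (intro sum_nonneg) auto
  have M: "onorm (frechet_derivative f (at x)) \<le> M" if "x \<in> \<Omega>" for x
    unfolding M_def using D(2)[OF that] diff[OF that] by (intro linear_onorm_le_sum_Basis linear_frechet_derivative)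
  \<comment> \<open>\<open>frac_energy_globalise\<close> is reused with a single function and the
    constant 1 in place of the cone energy: locally finite energy up to the boundary is globally
    finite.\<close>
  have "\<exists>C<top. \<forall>f\<in>{g}. dint \<Omega> (\<lambda>x y. sqd f x y * frac_kernel \<alpha> x y) \<le> C * 1"
  proof (rule frac_energy_globalise[OF op con bdd \<alpha>(1)])
    fix p assume "p \<in> closure \<Omega>"
    from lipschitz_domain_locally_lipschitz[OF lip this diff M M0]
    obtain s A where s: "s > 0" "A \<ge> 0" "\<And>x y. x \<in> \<Omega> \<inter> ball p s \<Longrightarrow> y \<in> \<Omega> \<inter> ball p s \<Longrightarrow> \<bar>f x - f y\<bar> \<le> A * norm (x - y)"
      by blast
    \<comment> \<open>The radius is at most \<open>1 / 2\<close>, so points of \<open>W\<close> have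
      distance below 1 and the minimum in \<open>lipschitz_dint_finite\<close> is the distance
      itself.\<close>
    define W where "W = ball p (min s (1 / 2))"
    have "dint (W \<inter> \<Omega>) (\<lambda>x y. sqd g x y * frac_kernel \<alpha> x y) < top"
    proof (rule lipschitz_dint_finite[OF \<alpha>, of g "W \<inter> \<Omega>" \<Omega> "A\<^sup>2"])
      fix x y assume xy: "x \<in> W \<inter> \<Omega>" "y \<in> W \<inter> \<Omega>"
      have "norm (x - y) < 1 / 2 + 1 / 2"
        using xy dist_triangle[of x y p] by (simp add: W_def dist_commute dist_norm)
      then have m: "min 1 (norm (x - y)) = norm (x - y)" by simp
      have "\<bar>g y - g x\<bar> \<le> A * norm (x - y)"
        using s(3)[of x y] xy by (simp add: g_def W_def abs_minus_commute)
      then have "\<bar>g y - g x\<bar>\<^sup>2 \<le> (A * norm (x - y))\<^sup>2" by (rule power_mono) simp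
      then show "(g y - g x)\<^sup>2 \<le> A\<^sup>2 * (min 1 (norm (x - y)))\<^sup>2" unfolding m by (simp add: power_mult_distrib)
    qed (use op em in \<open>auto simp: W_def\<close>)
    then show "\<exists>W. open W \<and> p \<in> W \<and> (\<exists>C<top. \<forall>f\<in>{g}. dint (W \<inter> \<Omega>) (\<lambda>x y. sqd f x y * frac_kernel \<alpha> x y) \<le> C * 1)"
      using s(1) by (intro exI[of _ W] conjI exI[of _ "dint (W \<inter> \<Omega>) (\<lambda>x y. sqd g x y * frac_kernel \<alpha> x y)"]) (auto simp: W_def)
  qed auto
  then have "dint \<Omega> (\<lambda>x y. sqd g x y * frac_kernel \<alpha> x y) < top" by (auto intro: le_less_trans)
  moreover have "(\<integral>\<^sup>+x\<in>\<Omega>. ennreal ((g x)\<^sup>2) \<partial>lborel) < top"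
  proof -
    have "(\<integral>\<^sup>+x\<in>\<Omega>. ennreal ((g x)\<^sup>2) \<partial>lborel) \<le> (\<integral>\<^sup>+x. ennreal (B\<^sup>2) * indicator \<Omega> x \<partial>lborel)"
    proof (rule nn_integral_mono)
      fix x
      show "ennreal ((g x)\<^sup>2) * indicator \<Omega> x \<le> ennreal (B\<^sup>2) * indicator \<Omega> x"
      proof (cases "x \<in> \<Omega>")
        case True
        have "\<bar>f x\<bar>\<^sup>2 \<le> B\<^sup>2" using B(2)[OF True] by (intro power_mono) auto
        then show ?thesis using True by (simp add: g_def ennreal_leI)
      qed simp
    qed
    also have "\<dots> < top" using em by (simp add: nn_integral_cmult_indicator ennreal_mult_less_top)
    finally show ?thesis .
  qed
  ultimately show "sqnorm \<alpha> \<Omega> (\<lambda>x. f x * indicator \<Omega> x) < top" by (simp add: sqnorm_def g_def[abs_def])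
qed

lemma smooth_imp_C_infinity_closure:
  assumes "smooth g"
  shows "g \<in> C_infinity_closure \<Omega>"
  unfolding C_infinity_closure_def
proof (intro CollectI conjI allI)
  show "g \<in> C_infinity \<Omega>" by (rule smooth_imp_C_infinity[OF assms])
  fix vs
  have "iterated_deriv vs g differentiable at x" for x
    using smooth_imp_C_infinity[OF assms, of UNIV] unfolding C_infinity_def by blast
  then have "continuous_on (closure \<Omega>) (iterated_deriv vs g)"
    by (intro continuous_at_imp_continuous_on ballI differentiable_imp_continuous_within)
  then show "\<exists>h. continuous_on (closure \<Omega>) h \<and> (\<forall>x\<in>\<Omega>. h x = iterated_deriv vs g x)" by blast
qed

lemma vanishes_outside_imp_C_infinity_compact:
  assumes "smooth g" "vanishes_outside r g"
  shows "g \<in> C_infinity_compact"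
proof -
  have "{x. g x \<noteq> 0} \<subseteq> ball 0 r" using assms(2) by (auto simp: vanishes_outside_def not_le[symmetric])
  then have "bounded {x. g x \<noteq> 0}" using bounded_ball bounded_subset by blast
  then have "compact (closure {x. g x \<noteq> 0})" by simp
  then show ?thesis using smooth_imp_C_infinity[OF assms(1)] by (simp add: C_infinity_compact_def)
qed

lemma C_infinity_compact_imp_vanishes_outside:
  assumes "g \<in> C_infinity_compact"
  shows "smooth g" "\<exists>r. vanishes_outside r g"
proof -
  show "smooth g" using assms by (intro C_infinity_imp_smooth) (simp add: C_infinity_compact_def)
  have "compact (closure {x. g x \<noteq> 0})" using assms by (simp add: C_infinity_compact_def)
  then have "bounded (closure {x. g x \<noteq> 0})" by (rule compact_imp_bounded)
  then obtain r where r: "closure {x. g x \<noteq> 0} \<subseteq> ball 0 r" using bounded_subset_ballD by blast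
  have "g x = 0" if "r \<le> norm x" for x
  proof (rule ccontr)
    assume "g x \<noteq> 0"
    then have "x \<in> ball 0 r" using r closure_subset[of "{x. g x \<noteq> 0}"] by blast
    then show False using that by simp
  qed
  then show "\<exists>r. vanishes_outside r g" by (auto simp: vanishes_outside_def)
qed

section \<open>Transfer of the results to the spaces of the theorem\<close>

lemma sqnorm_finite_imp_Hk_space:
  fixes g :: "'a::euclidean_space \<Rightarrow> real"
  assumes \<Omega>: "\<Omega> \<in> sets borel" and f: "f \<in> borel_measurable (lebesgue_on \<Omega>)"
    and g: "g \<in> borel_measurable borel" "\<And>x. x \<in> \<Omega> \<Longrightarrow> f x = g x" and fin: "sqnorm \<alpha> \<Omega> g < top"
  shows "f \<in> frac_space \<Omega> \<alpha>"
proof -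
  have ae: "AE x in lborel. x \<in> \<Omega> \<longrightarrow> f x = g x" using g(2) by simp
  have "Hk_energy \<Omega> (frac_kernel \<alpha>) f < top"
    using fin by (simp add: Hk_energy_cong_AE[OF \<Omega> ae] Hk_energy_frac_eq_dint[OF \<Omega> g(1)] sqnorm_def)
  moreover have "(\<integral>\<^sup>+x. ennreal ((f x)\<^sup>2) \<partial>lebesgue_on \<Omega>) < top"
    using fin by (simp add: L2_integral_cong_AE[OF \<Omega> ae] sqnorm_def)
  ultimately show ?thesis using f by (simp add: Hk_space_def L2_space_def)
qed

text \<open>Approximation of Borel functions that vanish outside \<open>\<Omega>\<close>, in the
  fractional norm, is enough: representatives handle the measurability, and the upper bound on
  \<open>k\<close> turns fractional smallness into smallness for \<open>k\<close>, at the price of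
  the factor \<open>\<Lambda>\<close>.\<close>

lemma dense_in_HkI:
  fixes \<Omega> :: "'a::euclidean_space set" and k :: "'a \<Rightarrow> 'a \<Rightarrow> ennreal"
  assumes \<Omega>: "\<Omega> \<in> sets borel" and eq: "Hk_space \<Omega> k = frac_space \<Omega> \<alpha>"
    and \<Lambda>: "\<Lambda> \<ge> 1" and k: "\<And>x y. k x y \<le> ennreal \<Lambda> * frac_kernel \<alpha> x y"
    and sub: "D \<subseteq> frac_space \<Omega> \<alpha>"
    and dense: "\<And>f e. f \<in> borel_measurable borel \<Longrightarrow> (\<And>x. x \<notin> \<Omega> \<Longrightarrow> f x = 0) \<Longrightarrow> sqnorm \<alpha> \<Omega> f < top \<Longrightarrow> 0 < (e::real) \<Longrightarrow>
      \<exists>g\<in>D. g \<in> borel_measurable borel \<and> sqnorm \<alpha> \<Omega> (\<lambda>x. f x - g x) \<le> ennreal e"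
  shows "dense_in_Hk \<Omega> k D"
  unfolding dense_in_Hk_def
proof (intro conjI ballI allI impI)
  show "D \<subseteq> Hk_space \<Omega> k" using sub eq by simp
  fix f and \<epsilon> :: real assume f: "f \<in> Hk_space \<Omega> k" and \<epsilon>: "\<epsilon> > 0"
  have f': "f \<in> frac_space \<Omega> \<alpha>" using f eq by simp
  then have "f \<in> borel_measurable (lebesgue_on \<Omega>)" by (simp add: Hk_space_def L2_space_def)
  from lebesgue_on_borel_representative[OF \<Omega> this] obtain u
    where u: "u \<in> borel_measurable borel" "AE x in lborel. x \<in> \<Omega> \<longrightarrow> f x = u x" "\<And>x. x \<notin> \<Omega> \<Longrightarrow> u x = 0" by blast
  have "sqnorm \<alpha> \<Omega> u < top"
    using f' by (simp add: Hk_space_def L2_space_def sqnorm_def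
        Hk_energy_cong_AE[OF \<Omega> u(2)] Hk_energy_frac_eq_dint[OF \<Omega> u(1)] L2_integral_cong_AE[OF \<Omega> u(2)])
  \<comment> \<open>Chosen so that \<open>\<Lambda> * e\<close> is half of the square of
    \<open>\<epsilon>\<close>; the half makes the final inequality strict.\<close>
  define e where "e = \<epsilon>\<^sup>2 / (2 * \<Lambda>)"
  have e: "e > 0" using \<epsilon> \<Lambda> by (simp add: e_def)
  obtain g where g: "g \<in> D" "g \<in> borel_measurable borel" "sqnorm \<alpha> \<Omega> (\<lambda>x. u x - g x) \<le> ennreal e"
    using dense[OF u(1) u(3) \<open>sqnorm \<alpha> \<Omega> u < top\<close> e] by blast
  show "\<exists>g\<in>D. Hk_norm \<Omega> k (\<lambda>x. f x - g x) < \<epsilon>"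
  proof (intro bexI[OF _ g(1)])
    let ?w = "\<lambda>x. u x - g x"
    have w: "?w \<in> borel_measurable borel" using u(1) g(2) by measurable
    have ae: "AE x in lborel. x \<in> \<Omega> \<longrightarrow> f x - g x = ?w x" using u(2) by eventually_elim auto
    have "Hk_energy \<Omega> k ?w \<le> ennreal \<Lambda> * dint \<Omega> (\<lambda>x y. sqd ?w x y * frac_kernel \<alpha> x y)"
      using Hk_energy_le_frac_energy[OF \<Omega> w k] by (simp add: Hk_energy_frac_eq_dint[OF \<Omega> w])
    moreover have "(\<integral>\<^sup>+x\<in>\<Omega>. ennreal ((?w x)\<^sup>2) \<partial>lborel) \<le> ennreal \<Lambda> * (\<integral>\<^sup>+x\<in>\<Omega>. ennreal ((?w x)\<^sup>2) \<partial>lborel)"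
    proof -
      have "1 \<le> ennreal \<Lambda>" using ennreal_leI[OF \<Lambda>] by simp
      from mult_right_mono[OF this zero_le] show ?thesis by simp
    qed
    ultimately have "(\<integral>\<^sup>+x\<in>\<Omega>. ennreal ((?w x)\<^sup>2) \<partial>lborel) + Hk_energy \<Omega> k ?w \<le> ennreal \<Lambda> * sqnorm \<alpha> \<Omega> ?w"
      unfolding sqnorm_def distrib_left by (intro add_mono)
    also have "\<dots> \<le> ennreal \<Lambda> * ennreal e" by (intro mult_left_mono g) simp
    also have "\<dots> = ennreal (\<Lambda> * e)" using \<Lambda> by (intro ennreal_mult'[symmetric]) simp
    finally have "enn2real ((\<integral>\<^sup>+x\<in>\<Omega>. ennreal ((?w x)\<^sup>2) \<partial>lborel) + Hk_energy \<Omega> k ?w) \<le> \<Lambda> * e"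
      using \<Lambda> e by (intro enn2real_leI) auto
    also have "\<Lambda> * e = \<epsilon>\<^sup>2 / 2" using \<Lambda> by (simp add: e_def)
    also have "\<dots> < \<epsilon>\<^sup>2" using \<epsilon> by simp
    finally have "sqrt (enn2real ((\<integral>\<^sup>+x\<in>\<Omega>. ennreal ((?w x)\<^sup>2) \<partial>lborel) + Hk_energy \<Omega> k ?w)) < \<epsilon>"
      using \<epsilon> by (intro real_less_lsqrt) auto
    then show "Hk_norm \<Omega> k (\<lambda>x. f x - g x) < \<epsilon>"
      by (simp add: Hk_norm_def L2_integral_cong_AE[OF \<Omega> ae] Hk_energy_cong_AE[OF \<Omega> ae])
  qed
qed

lemma C_infinity_closure_subset_frac_space:
  fixes \<Omega> :: "'a::euclidean_space set"
  assumes \<alpha>: "0 < \<alpha>" "\<alpha> < 2" and bdd: "bounded \<Omega>" and lip: "lipschitz_domain \<Omega>"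
  shows "C_infinity_closure \<Omega> \<subseteq> frac_space \<Omega> \<alpha>"
proof
  have \<Omega>: "\<Omega> \<in> sets borel" using lip by (simp add: lipschitz_domain_def)
  fix f assume f: "f \<in> C_infinity_closure \<Omega>"
  note fin = C_infinity_closure_sqnorm_finite[OF \<alpha> bdd lip f]
  show "f \<in> frac_space \<Omega> \<alpha>"
  proof (rule sqnorm_finite_imp_Hk_space[OF \<Omega> _ fin(2) _ fin(3)])
    show "f \<in> borel_measurable (lebesgue_on \<Omega>)"
      using fin(1) \<Omega> by (intro continuous_imp_measurable_on_sets_lebesgue) auto
  qed simp
qed

lemma dense_C_infinity_closure:
  fixes \<Omega> :: "'a::euclidean_space set" and k :: "'a \<Rightarrow> 'a \<Rightarrow> ennreal"
  assumes \<alpha>: "0 < \<alpha>" "\<alpha> < 2" and bdd: "bounded \<Omega>" and lip: "lipschitz_domain \<Omega>"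
    and eq: "Hk_space \<Omega> k = frac_space \<Omega> \<alpha>"
    and \<Lambda>: "\<Lambda> \<ge> 1" and k: "\<And>x y. k x y \<le> ennreal \<Lambda> * frac_kernel \<alpha> x y"
  shows "dense_in_Hk \<Omega> k (C_infinity_closure \<Omega>)"
proof (rule dense_in_HkI[OF _ eq \<Lambda> k C_infinity_closure_subset_frac_space[OF \<alpha> bdd lip]])
  show "\<Omega> \<in> sets borel" using lip by (simp add: lipschitz_domain_def)
  fix f :: "'a \<Rightarrow> real" and e :: real
  assume f: "f \<in> borel_measurable borel" "\<And>x. x \<notin> \<Omega> \<Longrightarrow> f x = 0" "sqnorm \<alpha> \<Omega> f < top" "0 < e"
  have "\<exists>g. smooth g \<and> sqnorm \<alpha> \<Omega> (\<lambda>x. f x - g x) \<le> ennreal e"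
    by (rule smooth_dense_lipschitz_domain[OF \<alpha> bdd lip f(1) _ f(3,4)]) (rule f(2))
  then obtain g where g: "smooth g" "sqnorm \<alpha> \<Omega> (\<lambda>x. f x - g x) \<le> ennreal e"
    by (elim exE conjE)
  show "\<exists>g\<in>C_infinity_closure \<Omega>. g \<in> borel_measurable borel \<and> sqnorm \<alpha> \<Omega> (\<lambda>x. f x - g x) \<le> ennreal e"
    using smooth_imp_C_infinity_closure[OF g(1)] borel_measurable_continuous_onI[OF smooth_continuous[OF g(1)]] g(2)
    by (intro bexI[of _ g] conjI)
qed

lemma C_infinity_compact_subset_frac_space:
  assumes \<alpha>: "0 < \<alpha>" "\<alpha> < 2"
  shows "(C_infinity_compact :: ('a::euclidean_space \<Rightarrow> real) set) \<subseteq> frac_space UNIV \<alpha>"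
proof
  fix f :: "'a \<Rightarrow> real" assume f: "f \<in> C_infinity_compact"
  have sm: "smooth f" by (rule C_infinity_compact_imp_vanishes_outside(1)[OF f])
  obtain r where r: "vanishes_outside r f"
    using C_infinity_compact_imp_vanishes_outside(2)[OF f] by (elim exE)
  have b: "f \<in> borel_measurable borel" by (rule borel_measurable_continuous_onI[OF smooth_continuous[OF sm]])
  have "f \<in> borel_measurable (lebesgue_on UNIV)"
    by (intro continuous_imp_measurable_on_sets_lebesgue smooth_continuous sm) simp
  then show "f \<in> frac_space UNIV \<alpha>"
    by (rule sqnorm_finite_imp_Hk_space[OF space_in_borel _ b refl sqnorm_smooth_compact_finite[OF \<alpha> sm r]])
qed

lemma dense_C_infinity_compact:
  fixes k :: "'a::euclidean_space \<Rightarrow> 'a \<Rightarrow> ennreal"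
  assumes \<alpha>: "0 < \<alpha>" "\<alpha> < 2" and eq: "Hk_space UNIV k = frac_space UNIV \<alpha>"
    and \<Lambda>: "\<Lambda> \<ge> 1" and k: "\<And>x y. k x y \<le> ennreal \<Lambda> * frac_kernel \<alpha> x y"
  shows "dense_in_Hk UNIV k C_infinity_compact"
proof (rule dense_in_HkI[OF _ eq \<Lambda> k C_infinity_compact_subset_frac_space[OF \<alpha>]])
  show "UNIV \<in> sets (borel :: 'a measure)" by simp
  fix f :: "'a \<Rightarrow> real" and e :: real
  assume f: "f \<in> borel_measurable borel" "\<And>x. x \<notin> UNIV \<Longrightarrow> f x = 0" "sqnorm \<alpha> UNIV f < top" "0 < e"
  obtain g r where g: "smooth g" "vanishes_outside r g" "sqnorm \<alpha> UNIV (\<lambda>x. f x - g x) \<le> ennreal e"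
    using smooth_compact_dense_UNIV[OF \<alpha> f(1,3,4)] by (elim exE conjE)
  show "\<exists>g\<in>C_infinity_compact. g \<in> borel_measurable borel \<and> sqnorm \<alpha> UNIV (\<lambda>x. f x - g x) \<le> ennreal e"
    using vanishes_outside_imp_C_infinity_compact[OF g(1,2)]
      borel_measurable_continuous_onI[OF smooth_continuous[OF g(1)]] g(3)
    by (intro bexI[of _ g] conjI)
qed

theorem theorem1p4:
  fixes \<Gamma> :: "'a::euclidean_space \<Rightarrow> 'a set"
    and k :: "'a \<Rightarrow> 'a \<Rightarrow> ennreal"
    and \<alpha> \<theta> \<Lambda> :: real
  assumes "0 < \<alpha>" and "\<alpha> < 2"
    and "admissible_configuration \<theta> \<Gamma>"
    and "\<Lambda> \<ge> 1"
    and "(\<lambda>(x, y). k x y) \<in> borel_measurable lebesgue"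
    and "\<And>x y. k x y = k y x"
    and "\<And>x y. ennreal (1 / \<Lambda>) *
           (indicator (shifted_cone \<Gamma> x) y + indicator (shifted_cone \<Gamma> y) x) *
           frac_kernel \<alpha> x y \<le> k x y"
    and "\<And>x y. k x y \<le> ennreal \<Lambda> * frac_kernel \<alpha> x y"
  shows "(\<forall>\<Omega>. bounded \<Omega> \<and> lipschitz_domain \<Omega> \<longrightarrow>
            Hk_space \<Omega> k = frac_space \<Omega> \<alpha> \<and>
            comparable_on (Hk_space \<Omega> k) (Hk_seminorm \<Omega> k) (frac_seminorm \<Omega> \<alpha>) \<and>
            comparable_on (Hk_space \<Omega> k) (Hk_norm \<Omega> k) (frac_norm \<Omega> \<alpha>) \<and>
            dense_in_Hk \<Omega> k (C_infinity_closure \<Omega>)) \<and>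
         Hk_space UNIV k = frac_space UNIV \<alpha> \<and>
         comparable_on (Hk_space UNIV k) (Hk_seminorm UNIV k) (frac_seminorm UNIV \<alpha>) \<and>
         comparable_on (Hk_space UNIV k) (Hk_norm UNIV k) (frac_norm UNIV \<alpha>) \<and>
         dense_in_Hk UNIV k C_infinity_compact"
proof -
  note \<alpha> = assms(1,2) and \<Lambda> = assms(4) and upper = assms(8)
  obtain \<kappa> \<tau> where "thick_relation {(x, y). y - x \<in> \<Gamma> x} \<kappa> \<tau>"
    using admissible_configuration_thick[OF assms(3)] by blast
  then interpret thick_relation "{(x, y). y - x \<in> \<Gamma> x}" \<kappa> \<tau> .
  \<comment> \<open>Keeping only the indicator of the cone at \<open>x\<close> leaves a kernel bound
    for the one-sided relation to which thickness refers.\<close>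
  have lower: "ennreal (1 / \<Lambda>) * indicator {(x, y). y - x \<in> \<Gamma> x} (x, y) * frac_kernel \<alpha> x y \<le> k x y" for x y
  proof -
    have "y \<in> shifted_cone \<Gamma> x" if "y - x \<in> \<Gamma> x"
      using that by (auto simp: shifted_cone_def image_iff intro!: bexI[of _ "y - x"])
    then have "(indicator {(x, y). y - x \<in> \<Gamma> x} (x, y) :: ennreal) \<le> indicator (shifted_cone \<Gamma> x) y + indicator (shifted_cone \<Gamma> y) x"
      by (auto simp: indicator_def)
    then have "ennreal (1 / \<Lambda>) * indicator {(x, y). y - x \<in> \<Gamma> x} (x, y) * frac_kernel \<alpha> x y \<le>
        ennreal (1 / \<Lambda>) * (indicator (shifted_cone \<Gamma> x) y + indicator (shifted_cone \<Gamma> y) x) * frac_kernel \<alpha> x y"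
      by (intro mult_right_mono mult_left_mono) auto
    also have "\<dots> \<le> k x y" by (rule assms(7))
    finally show ?thesis .
  qed
  have comparable: "Hk_space \<Omega> k = frac_space \<Omega> \<alpha> \<and>
      comparable_on (Hk_space \<Omega> k) (Hk_seminorm \<Omega> k) (frac_seminorm \<Omega> \<alpha>) \<and>
      comparable_on (Hk_space \<Omega> k) (Hk_norm \<Omega> k) (frac_norm \<Omega> \<alpha>)"
    if \<Omega>: "\<Omega> \<in> sets borel" and
      le: "\<exists>C<top. \<forall>f. f \<in> borel_measurable borel \<longrightarrow> (\<integral>\<^sup>+y\<in>\<Omega>. ennreal ((f y)\<^sup>2) \<partial>lborel) < top \<longrightarrow>
        dint \<Omega> (\<lambda>x y. sqd f x y * frac_kernel \<alpha> x y) \<le> C * dint \<Omega> (\<lambda>x y. Gsq f x y * frac_kernel \<alpha> x y)" for \<Omega>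
  proof -
    have "\<Lambda> > 0" using \<Lambda> by simp
    from frac_energy_le_Hk_energy[OF \<Omega> this lower le] obtain M
      where M: "\<And>f. f \<in> L2_space \<Omega> \<Longrightarrow> Hk_energy \<Omega> (frac_kernel \<alpha>) f \<le> ennreal M * Hk_energy \<Omega> k f" by blast
    \<comment> \<open>One constant for both directions; the maximum with \<open>\<Lambda>\<close>
      also ensures that it is at least 1, whatever the sign of \<open>M\<close>.\<close>
    define M' where "M' = max M \<Lambda>"
    have M': "M' \<ge> 1" using \<Lambda> by (simp add: M'_def)
    have up: "Hk_energy \<Omega> k f \<le> ennreal M' * Hk_energy \<Omega> (frac_kernel \<alpha>) f" if "f \<in> L2_space \<Omega>" for f
      using Hk_energy_le_frac_energy_L2[OF \<Omega> that upper]
      by (rule order_trans) (auto simp: M'_def intro!: mult_right_mono ennreal_leI)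
    have lo: "Hk_energy \<Omega> (frac_kernel \<alpha>) f \<le> ennreal M' * Hk_energy \<Omega> k f" if "f \<in> L2_space \<Omega>" for f
      using M[OF that] by (rule order_trans) (auto simp: M'_def intro!: mult_right_mono ennreal_leI)
    show ?thesis using Hk_comparability[OF M' up lo] by blast
  qed
  have dom: "Hk_space \<Omega> k = frac_space \<Omega> \<alpha> \<and>
            comparable_on (Hk_space \<Omega> k) (Hk_seminorm \<Omega> k) (frac_seminorm \<Omega> \<alpha>) \<and>
            comparable_on (Hk_space \<Omega> k) (Hk_norm \<Omega> k) (frac_norm \<Omega> \<alpha>) \<and>
            dense_in_Hk \<Omega> k (C_infinity_closure \<Omega>)" if bdd: "bounded \<Omega>" and lip: "lipschitz_domain \<Omega>" for \<Omega>
  proof -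
    have \<Omega>: "\<Omega> \<in> sets borel" using lip by (simp add: lipschitz_domain_def)
    note cmp = comparable[OF \<Omega> frac_energy_lipschitz_domain_le[OF \<alpha>(1) bdd lip]]
    have eq: "Hk_space \<Omega> k = frac_space \<Omega> \<alpha>" using cmp by (elim conjE)
    show ?thesis using cmp dense_C_infinity_closure[OF \<alpha> bdd lip eq \<Lambda> upper] by (elim conjE) (intro conjI; assumption)
  qed
  have U: "UNIV \<in> sets (borel :: 'a measure)" by simp
  obtain C where C: "C < top" and le: "\<forall>f. f \<in> borel_measurable borel \<longrightarrow>
        dint UNIV (\<lambda>x y. sqd f x y * frac_kernel \<alpha> x y) \<le> C * dint UNIV (\<lambda>x y. Gsq f x y * frac_kernel \<alpha> x y)"
    using frac_energy_UNIV_le[OF \<alpha>(1)] by (elim exE conjE)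
  have "\<exists>C<top. \<forall>f. f \<in> borel_measurable borel \<longrightarrow> (\<integral>\<^sup>+y\<in>UNIV. ennreal ((f y)\<^sup>2) \<partial>lborel) < top \<longrightarrow>
        dint UNIV (\<lambda>x y. sqd f x y * frac_kernel \<alpha> x y) \<le> C * dint UNIV (\<lambda>x y. Gsq f x y * frac_kernel \<alpha> x y)"
    by (intro exI[of _ C] conjI C allI impI) (rule le[rule_format])
  note cmp = comparable[OF U this]
  have eq: "Hk_space UNIV k = frac_space UNIV \<alpha>" using cmp by (elim conjE)
  note dense = dense_C_infinity_compact[OF \<alpha> eq \<Lambda> upper]
  show ?thesis
  proof (intro conjI allI impI)
    fix \<Omega> :: "'a set" assume "bounded \<Omega> \<and> lipschitz_domain \<Omega>"
    note d = dom[OF conjunct1[OF this] conjunct2[OF this]]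
    show "Hk_space \<Omega> k = frac_space \<Omega> \<alpha>" using d by (elim conjE)
    show "comparable_on (Hk_space \<Omega> k) (Hk_seminorm \<Omega> k) (frac_seminorm \<Omega> \<alpha>)" using d by (elim conjE)
    show "comparable_on (Hk_space \<Omega> k) (Hk_norm \<Omega> k) (frac_norm \<Omega> \<alpha>)" using d by (elim conjE)
    show "dense_in_Hk \<Omega> k (C_infinity_closure \<Omega>)" using d by (elim conjE)
  next
    show "Hk_space UNIV k = frac_space UNIV \<alpha>" by (rule eq)
    show "comparable_on (Hk_space UNIV k) (Hk_seminorm UNIV k) (frac_seminorm UNIV \<alpha>)" using cmp by (elim conjE)
    show "comparable_on (Hk_space UNIV k) (Hk_norm UNIV k) (frac_norm UNIV \<alpha>)" using cmp by (elim conjE)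
    show "dense_in_Hk UNIV k C_infinity_compact" by (rule dense)
  qed
qed

end
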